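(* Suppose $\Pi$ is the preprojective algebra of type $A_n$ over a field $k$, and let $\overline\Pi:=\Pi/I_{\mathrm{cyc}}$, where $I_{\mathrm{cyc}}$ is the ideal of $\Pi$ generated by all 2-cycles. (a) The layer modules for $\Pi$ are exactly the indecomposable $\overline\Pi$-modules (which are exactly the string modules). (b) The doubleton extension order on layer modules is the opposite of the subfactor order: for layer modules $A,B$, $A\ge B$ in the doubleton extension order if and only if $A$ is isomorphic to a subfactor of $B$.
   Context: Let $Q$ be an orientation of the Dynkin diagram $A_n$ and $\overline Q$ the quiver obtained by adding an opposite arrow $a^*$ for each arrow $a$ of $Q$; $\Pi=k\overline Q/\langle\sum_a(aa^*-a^*a)\rangle$. Modules are finite-dimensional left modules; $e_i$ is the idempotent at vertex $i$. A 2-cycle is a path of length two of the form $i\to i\pm1\to i$. String modules: a non-revisiting walk on $\overline Q$ is a walk (possibly of length $0$) following a sequence of arrows with or against their direction and not visiting any vertex more than once; a walk and its reverse are identified. For such a walk $p$ the string module $X_p$ is the $\overline\Pi$-module with one basis vector for each vertex visited by $p$ (lying at that vertex), on which each arrow of $p$ sends the basis vector at its source to the basis vector at its target, and all other arrows act by zero. Let $W$ be the Weyl group of type $A_n$ with simple reflections $s_i$ and length $\ell$. Let $I_i=\Pi(1-e_i)\Pi$ and, for a reduced word $w=s_{i_1}\cdots s_{i_m}$, let $I(w)=I_{i_1}\cdots I_{i_m}$ (independent of the reduced word; $I(e)=\Pi$). A layer module is a $\Pi$-module isomorphic to $I(w)/I(ws_i)$ for some $w\in W$ and $i$ with $\ell(ws_i)=\ell(w)+1$.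 Doubleton extension order: a pair of layer modules $X,Y$ forms a doubleton if $\mathrm{Ext}^1_\Pi(Y,X)$ and $\mathrm{Ext}^1_\Pi(X,Y)$ are both one-dimensional over $k$ and the corresponding extensions (middle terms of the non-split short exact sequences $0\to X\to E\to Y\to0$ and $0\to Y\to F\to X\to0$) are again layer modules. The doubleton extension order on (isomorphism classes of) layer modules is the (reflexive and) transitive closure of the relation with $A>B$ whenever there is a doubleton $A,C$ such that $B$ is the (non-split) extension of $A$ by $C$ or of $C$ by $A$. A subfactor of a module is a quotient of a submodule. *)

theory Defs
  imports
    "HOL-Algebra.Module"
    "HOL-Algebra.QuotRing"
    "HOL-Algebra.Ideal_Product"
    "HOL-Algebra.Sym_Groups"
    "Graph_Theory.Arc_Walk"
begin

section \<open>Left modules over noncommutative algebras\<close>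

text \<open>
  The ground field \<open>k\<close> is a type of class \<^class>\<open>field\<close>.  A \<open>k\<close>-algebra is a ring in the sense of
  HOL-Algebra, carried by a \<^type>\<open>module\<close> record whose scalars have type \<open>k\<close>.  A left module over such
  an algebra is again a \<^type>\<open>module\<close> record, with scalars in the algebra; its multiplication and its unit
  are irrelevant.  The library locale \<^locale>\<open>module\<close> cannot be used because it assumes a
  commutative ring of scalars.
\<close>

locale left_module = R?: ring R + M?: abelian_group M
  for R (structure) and M (structure) +
  assumes smult_closed [simp, intro]:
      "\<lbrakk>a \<in> carrier R; x \<in> carrier M\<rbrakk> \<Longrightarrow> a \<odot>\<^bsub>M\<^esub> x \<in> carrier M"
    and smult_l_distr:
      "\<lbrakk>a \<in> carrier R; b \<in> carrier R; x \<in> carrier M\<rbrakk> \<Longrightarrow>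
        (a \<oplus> b) \<odot>\<^bsub>M\<^esub> x = a \<odot>\<^bsub>M\<^esub> x \<oplus>\<^bsub>M\<^esub> b \<odot>\<^bsub>M\<^esub> x"
    and smult_r_distr:
      "\<lbrakk>a \<in> carrier R; x \<in> carrier M; y \<in> carrier M\<rbrakk> \<Longrightarrow>
        a \<odot>\<^bsub>M\<^esub> (x \<oplus>\<^bsub>M\<^esub> y) = a \<odot>\<^bsub>M\<^esub> x \<oplus>\<^bsub>M\<^esub> a \<odot>\<^bsub>M\<^esub> y"
    and smult_assoc1:
      "\<lbrakk>a \<in> carrier R; b \<in> carrier R; x \<in> carrier M\<rbrakk> \<Longrightarrow>
        (a \<otimes> b) \<odot>\<^bsub>M\<^esub> x = a \<odot>\<^bsub>M\<^esub> (b \<odot>\<^bsub>M\<^esub> x)"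
    and smult_one [simp]:
      "x \<in> carrier M \<Longrightarrow> \<one> \<odot>\<^bsub>M\<^esub> x = x"

definition with_smult :: "('m, 'z) ring_scheme \<Rightarrow> ('r \<Rightarrow> 'm \<Rightarrow> 'm) \<Rightarrow> ('r, 'm) module" where
  "with_smult M s =
    \<lparr>carrier = carrier M, monoid.mult = monoid.mult M, one = one M, zero = zero M, add = add M, smult = s\<rparr>"

definition field_smult ::
    "('k, 'r, 'y) module_scheme \<Rightarrow> ('r, 'm, 'z) module_scheme \<Rightarrow> 'k \<Rightarrow> 'm \<Rightarrow> 'm" where
  "field_smult A M c x = (c \<odot>\<^bsub>A\<^esub> \<one>\<^bsub>A\<^esub>) \<odot>\<^bsub>M\<^esub> x"

definition fd_module :: "('k::field, 'r, 'y) module_scheme \<Rightarrow> ('r, 'm, 'z) module_scheme \<Rightarrow> bool" where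
  "fd_module A M \<longleftrightarrow> left_module A M \<and>
    (\<exists>S. finite S \<and> S \<subseteq> carrier M \<and>
      (\<forall>x\<in>carrier M. \<exists>c. x = (\<Oplus>\<^bsub>M\<^esub>s\<in>S. field_smult A M (c s) s)))"

definition regular_module :: "('k, 'r, 'y) module_scheme \<Rightarrow> ('r, 'r) module" where
  "regular_module A = with_smult A (monoid.mult A)"

text \<open>
  This one construction gives the quotient of a module by a submodule, and also the quotient of a
  \<open>k\<close>-algebra by a two-sided ideal.
\<close>

definition quot_module :: "('r, 'm, 'z) module_scheme \<Rightarrow> 'm set \<Rightarrow> ('r, 'm set) module" where
  "quot_module M N = with_smult (M Quot N) (\<lambda>r C. \<Union>x\<in>C. N +>\<^bsub>M\<^esub> (r \<odot>\<^bsub>M\<^esub> x))"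

definition mod_hom ::
    "('k, 'r, 'y) module_scheme \<Rightarrow> ('r, 'm, 'z) module_scheme \<Rightarrow> ('r, 'n, 'w) module_scheme \<Rightarrow>
      ('m \<Rightarrow> 'n) set" where
  "mod_hom A M N = {f \<in> carrier M \<rightarrow> carrier N.
    (\<forall>x\<in>carrier M. \<forall>y\<in>carrier M. f (x \<oplus>\<^bsub>M\<^esub> y) = f x \<oplus>\<^bsub>N\<^esub> f y) \<and>
    (\<forall>a\<in>carrier A. \<forall>x\<in>carrier M. f (a \<odot>\<^bsub>M\<^esub> x) = a \<odot>\<^bsub>N\<^esub> f x)}"

definition mod_iso ::
    "('k, 'r, 'y) module_scheme \<Rightarrow> ('r, 'm, 'z) module_scheme \<Rightarrow> ('r, 'n, 'w) module_scheme \<Rightarrow> bool"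
  where
  "mod_iso A M N \<longleftrightarrow> (\<exists>f \<in> mod_hom A M N. bij_betw f (carrier M) (carrier N))"

definition indecomposable ::
    "('k, 'r, 'y) module_scheme \<Rightarrow> ('r, 'm, 'z) module_scheme \<Rightarrow> bool" where
  "indecomposable A M \<longleftrightarrow> carrier M \<noteq> {\<zero>\<^bsub>M\<^esub>} \<and>
    (\<forall>U V. submodule U A M \<and> submodule V A M \<and> U \<inter> V = {\<zero>\<^bsub>M\<^esub>} \<and> U <+>\<^bsub>M\<^esub> V = carrier M \<longrightarrow>
      U = {\<zero>\<^bsub>M\<^esub>} \<or> V = {\<zero>\<^bsub>M\<^esub>})"

definition iso_to_subfactor ::
    "('k, 'r, 'y) module_scheme \<Rightarrow> ('r, 'm, 'z) module_scheme \<Rightarrow> ('r, 'n, 'w) module_scheme \<Rightarrow> bool"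
  where
  "iso_to_subfactor A X M \<longleftrightarrow>
    (\<exists>U V. submodule U A M \<and> submodule V A (M\<lparr>carrier := U\<rparr>) \<and>
      mod_iso A X (quot_module (M\<lparr>carrier := U\<rparr>) V))"

text \<open>
  Change of rings along \<open>A \<rightarrow> A/I\<close>: \<open>inflate\<close> regards an \<open>A/I\<close>-module as an \<open>A\<close>-module, and
  \<open>deflate\<close> regards an \<open>A\<close>-module annihilated by \<open>I\<close> as an \<open>A/I\<close>-module (every representative of
  a coset then acts in the same way).
\<close>

definition inflate ::
    "('k, 'r, 'y) module_scheme \<Rightarrow> 'r set \<Rightarrow> ('r set, 'm, 'z) module_scheme \<Rightarrow> ('r, 'm) module" where
  "inflate A I N = with_smult N (\<lambda>a. smult N (I +>\<^bsub>A\<^esub> a))"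

definition deflate :: "('r, 'm, 'z) module_scheme \<Rightarrow> ('r set, 'm) module" where
  "deflate M = with_smult M (\<lambda>C. smult M (SOME a. a \<in> C))"


section \<open>Extensions\<close>

definition nonsplit_extension ::
    "('k, 'r, 'y) module_scheme \<Rightarrow> ('r, 'l, 'u) module_scheme \<Rightarrow> ('r, 'm, 'v) module_scheme \<Rightarrow>
      ('r, 'n, 'w) module_scheme \<Rightarrow> bool" where
  "nonsplit_extension A X E Y \<longleftrightarrow>
    (\<exists>f\<in>mod_hom A X E. \<exists>g\<in>mod_hom A E Y.
      inj_on f (carrier X) \<and> g ` carrier E = carrier Y \<and>
      f ` carrier X = {e \<in> carrier E. g e = \<zero>\<^bsub>Y\<^esub>} \<and>
      \<not> (\<exists>s\<in>mod_hom A Y E. \<forall>y\<in>carrier Y. g (s y) = y))"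

definition hom_space ::
    "('k, 'r, 'y) module_scheme \<Rightarrow> ('r, 'm, 'z) module_scheme \<Rightarrow> ('r, 'n, 'w) module_scheme \<Rightarrow>
      ('k, 'm \<Rightarrow> 'n) module" where
  "hom_space A M N =
    \<lparr>carrier = mod_hom A M N \<inter> extensional (carrier M), monoid.mult = undefined, one = undefined,
     zero = (\<lambda>x\<in>carrier M. \<zero>\<^bsub>N\<^esub>), add = (\<lambda>f g. \<lambda>x\<in>carrier M. f x \<oplus>\<^bsub>N\<^esub> g x),
     smult = (\<lambda>c f. \<lambda>x\<in>carrier M. field_smult A N c (f x))\<rparr>"

definition free_module :: "('k, 'r, 'y) module_scheme \<Rightarrow> 's set \<Rightarrow> ('r, 's \<Rightarrow> 'r) module" where
  "free_module A S =
    \<lparr>carrier = {g. g ` S \<subseteq> carrier A \<and> (\<forall>s. s \<notin> S \<longrightarrow> g s = \<zero>\<^bsub>A\<^esub>) \<and> finite {s. g s \<noteq> \<zero>\<^bsub>A\<^esub>}},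
     monoid.mult = undefined, one = undefined,
     zero = (\<lambda>_. \<zero>\<^bsub>A\<^esub>), add = (\<lambda>g h s. g s \<oplus>\<^bsub>A\<^esub> h s), smult = (\<lambda>a g s. a \<otimes>\<^bsub>A\<^esub> g s)\<rparr>"

text \<open>
  For the canonical presentation \<open>0 \<rightarrow> K \<rightarrow> F \<rightarrow> Y \<rightarrow> 0\<close> with \<open>F\<close> free on the set \<open>carrier Y\<close>, the long
  exact sequence identifies \<open>Ext\<^sup>1(Y, X)\<close>, as a \<open>k\<close>-space, with the cokernel of the restriction map
  \<open>Hom(F, X) \<rightarrow> Hom(K, X)\<close>.
\<close>

definition free_cover_kernel ::
    "('k, 'r, 'y) module_scheme \<Rightarrow> ('r, 'n, 'w) module_scheme \<Rightarrow> ('n \<Rightarrow> 'r) set" where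
  "free_cover_kernel A Y =
    {g \<in> carrier (free_module A (carrier Y)).
      (\<Oplus>\<^bsub>Y\<^esub>y\<in>{y. g y \<noteq> \<zero>\<^bsub>A\<^esub>}. g y \<odot>\<^bsub>Y\<^esub> y) = \<zero>\<^bsub>Y\<^esub>}"

definition Ext1 ::
    "('k, 'r, 'y) module_scheme \<Rightarrow> ('r, 'n, 'w) module_scheme \<Rightarrow> ('r, 'm, 'z) module_scheme \<Rightarrow>
      ('k, (('n \<Rightarrow> 'r) \<Rightarrow> 'm) set) module" where
  "Ext1 A Y X =
    (let F = free_module A (carrier Y); K = free_cover_kernel A Y
     in quot_module (hom_space A (F\<lparr>carrier := K\<rparr>) X) ((\<lambda>f. restrict f K) ` mod_hom A F X))"

definition one_dimensional :: "('k::field, 'm, 'z) module_scheme \<Rightarrow> bool" where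
  "one_dimensional V \<longleftrightarrow>
    (\<exists>x\<in>carrier V. x \<noteq> \<zero>\<^bsub>V\<^esub> \<and> (\<forall>y\<in>carrier V. \<exists>c. y = c \<odot>\<^bsub>V\<^esub> x))"


section \<open>Path algebras and string modules\<close>

text \<open>
  Quivers are \<^type>\<open>pre_digraph\<close>s.  In the double of \<open>Q\<close>, the arrow \<open>a\<close> is \<open>Inl a\<close> and the opposite
  arrow \<open>a\<^sup>*\<close> is \<open>Inr a\<close>.
\<close>

definition double_quiver :: "('v, 'b) pre_digraph \<Rightarrow> ('v, 'b + 'b) pre_digraph" where
  "double_quiver Q =
    \<lparr>verts = verts Q, arcs = arcs Q <+> arcs Q,
     tail = case_sum (tail Q) (head Q), head = case_sum (head Q) (tail Q)\<rparr>"

text \<open>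
  A path is given by its first vertex and the list of its arrows in the order of traversal.
\<close>

definition paths :: "('v, 'b) pre_digraph \<Rightarrow> ('v \<times> 'b list) set" where
  "paths G = {(u, p). \<exists>v. pre_digraph.awalk G u p v}"

text \<open>
  As modules are left modules on which an arrow maps its source to its target, the product
  \<open>x \<otimes> y\<close> of two paths is the path that traverses first \<open>y\<close> and then \<open>x\<close>.
\<close>

definition path_algebra :: "('v, 'b) pre_digraph \<Rightarrow> ('k::field, 'v \<times> 'b list \<Rightarrow> 'k) module" where
  "path_algebra G =
    \<lparr>carrier = {f. finite {x. f x \<noteq> 0} \<and> {x. f x \<noteq> 0} \<subseteq> paths G},
     monoid.mult = (\<lambda>f g (u, p). \<Sum>j\<le>length p.
       f (pre_digraph.awlast G u (take j p), drop j p) * g (u, take j p)),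
     one = (\<lambda>(u, p). if u \<in> verts G \<and> p = [] then 1 else 0),
     zero = (\<lambda>_. 0), add = (\<lambda>f g x. f x + g x), smult = (\<lambda>c f x. c * f x)\<rparr>"

definition basis_path :: "'v \<times> 'b list \<Rightarrow> 'v \<times> 'b list \<Rightarrow> 'k::field" where
  "basis_path x = (\<lambda>y. if y = x then 1 else 0)"

definition basis_arrow :: "('v, 'b) pre_digraph \<Rightarrow> 'b \<Rightarrow> 'v \<times> 'b list \<Rightarrow> 'k::field" where
  "basis_arrow G b = basis_path (tail G b, [b])"

text \<open>
  A walk on \<open>G\<close> that may follow arrows with (\<open>Inl\<close>) or against (\<open>Inr\<close>) their direction is a directed
  walk on the double of \<open>G\<close>; it is non-revisiting iff it is an \<open>apath\<close>.
\<close>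

definition nonrevisiting_walk :: "('v, 'b) pre_digraph \<Rightarrow> 'v \<times> ('b + 'b) list \<Rightarrow> bool" where
  "nonrevisiting_walk G = (\<lambda>(u, p). \<exists>v. pre_digraph.apath (double_quiver G) u p v)"

definition walk_verts :: "('v, 'b) pre_digraph \<Rightarrow> 'v \<times> ('b + 'b) list \<Rightarrow> 'v set" where
  "walk_verts G = (\<lambda>(u, p). set (pre_digraph.awalk_verts (double_quiver G) u p))"

definition walk_arrows :: "'v \<times> ('b + 'b) list \<Rightarrow> 'b set" where
  "walk_arrows = (\<lambda>(u, p). case_sum id id ` set p)"

definition string_arrow ::
    "('v, 'b) pre_digraph \<Rightarrow> 'v \<times> ('b + 'b) list \<Rightarrow> 'b \<Rightarrow> ('v \<Rightarrow> 'k::field) \<Rightarrow> 'v \<Rightarrow> 'k" where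
  "string_arrow G w b x =
    (\<lambda>v. if b \<in> walk_arrows w \<and> v = head G b then x (tail G b) else 0)"

definition string_path ::
    "('v, 'b) pre_digraph \<Rightarrow> 'v \<times> ('b + 'b) list \<Rightarrow> 'v \<times> 'b list \<Rightarrow> ('v \<Rightarrow> 'k::field) \<Rightarrow> 'v \<Rightarrow> 'k" where
  "string_path G w = (\<lambda>(u, p) x. fold (string_arrow G w) p (\<lambda>v. if v = u then x v else 0))"

text \<open>
  The vector \<open>x\<close> has coordinate \<open>x v\<close> at the basis vector belonging to the vertex \<open>v\<close> of the walk.
\<close>

definition path_algebra_string_module ::
    "('v, 'b) pre_digraph \<Rightarrow> 'v \<times> ('b + 'b) list \<Rightarrow> ('v \<times> 'b list \<Rightarrow> 'k::field, 'v \<Rightarrow> 'k) module" where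
  "path_algebra_string_module G w =
    \<lparr>carrier = {x. {v. x v \<noteq> 0} \<subseteq> walk_verts G w}, monoid.mult = undefined, one = undefined,
     zero = (\<lambda>_. 0), add = (\<lambda>x y v. x v + y v),
     smult = (\<lambda>f x v. \<Sum>q\<in>{q. f q \<noteq> 0}. f q * string_path G w q x v)\<rparr>"


section \<open>The preprojective algebra\<close>

type_synonym ('b, 'k) path_elt = "nat \<times> ('b + 'b) list \<Rightarrow> 'k"
type_synonym ('b, 'k) preproj_elt = "('b, 'k) path_elt set"
type_synonym ('b, 'k) preproj_bar_elt = "('b, 'k) preproj_elt set"

definition A_orientation :: "nat \<Rightarrow> (nat, 'b) pre_digraph \<Rightarrow> bool" where
  "A_orientation n Q \<longleftrightarrow> verts Q = {1..n} \<and>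
    bij_betw (\<lambda>a. {tail Q a, head Q a}) (arcs Q) {{i, Suc i} | i. 1 \<le> i \<and> i < n}"

definition preproj_relation :: "(nat, 'b) pre_digraph \<Rightarrow> ('b, 'k::field) path_elt" where
  "preproj_relation Q =
    (let D = double_quiver Q; P = path_algebra D
     in \<Oplus>\<^bsub>P\<^esub>a\<in>arcs Q.
          (basis_arrow D (Inl a) \<otimes>\<^bsub>P\<^esub> basis_arrow D (Inr a)) \<ominus>\<^bsub>P\<^esub>
          (basis_arrow D (Inr a) \<otimes>\<^bsub>P\<^esub> basis_arrow D (Inl a)))"

definition preproj_ideal :: "(nat, 'b) pre_digraph \<Rightarrow> ('b, 'k::field) path_elt set" where
  "preproj_ideal Q = Idl\<^bsub>path_algebra (double_quiver Q)\<^esub> {preproj_relation Q}"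

definition preproj :: "(nat, 'b) pre_digraph \<Rightarrow> ('k::field, ('b, 'k) preproj_elt) module" where
  "preproj Q = quot_module (path_algebra (double_quiver Q)) (preproj_ideal Q)"

definition preproj_path ::
    "(nat, 'b) pre_digraph \<Rightarrow> nat \<times> ('b + 'b) list \<Rightarrow> ('b, 'k::field) preproj_elt" where
  "preproj_path Q q = preproj_ideal Q +>\<^bsub>path_algebra (double_quiver Q)\<^esub> basis_path q"

definition cyc_ideal :: "(nat, 'b) pre_digraph \<Rightarrow> ('b, 'k::field) preproj_elt set" where
  "cyc_ideal Q = Idl\<^bsub>preproj Q\<^esub>
    {preproj_path Q (u, p) | u p. pre_digraph.awalk (double_quiver Q) u p u \<and> length p = 2}"

definition preproj_bar :: "(nat, 'b) pre_digraph \<Rightarrow> ('k::field, ('b, 'k) preproj_bar_elt) module" where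
  "preproj_bar Q = quot_module (preproj Q) (cyc_ideal Q)"

text \<open>
  On the string module of a non-revisiting walk every 2-cycle acts by zero, hence so do the
  preprojective relation and \<open>cyc_ideal\<close>, and both uses of \<^const>\<open>deflate\<close> are legitimate.
\<close>

definition string_module ::
    "(nat, 'b) pre_digraph \<Rightarrow> nat \<times> (('b + 'b) + ('b + 'b)) list \<Rightarrow>
      (('b, 'k::field) preproj_bar_elt, nat \<Rightarrow> 'k) module" where
  "string_module Q w = deflate (deflate (path_algebra_string_module (double_quiver Q) w))"


section \<open>Layer modules\<close>

text \<open>The Weyl group of type \<open>A\<^sub>n\<close> is the symmetric group on \<open>{1..n+1}\<close>.\<close>

definition simple_refl :: "nat \<Rightarrow> nat \<Rightarrow> nat" where
  "simple_refl i = transpose i (Suc i)"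

definition word_prod :: "nat \<Rightarrow> nat list \<Rightarrow> nat \<Rightarrow> nat" where
  "word_prod n is = foldr (monoid.mult (sym_group (Suc n))) (map simple_refl is) \<one>\<^bsub>sym_group (Suc n)\<^esub>"

definition weyl_length :: "nat \<Rightarrow> (nat \<Rightarrow> nat) \<Rightarrow> nat" where
  "weyl_length n w = (LEAST m. \<exists>is. set is \<subseteq> {1..n} \<and> length is = m \<and> word_prod n is = w)"

definition reduced_word :: "nat \<Rightarrow> nat list \<Rightarrow> (nat \<Rightarrow> nat) \<Rightarrow> bool" where
  "reduced_word n is w \<longleftrightarrow> set is \<subseteq> {1..n} \<and> word_prod n is = w \<and> length is = weyl_length n w"

definition vertex_ideal :: "(nat, 'b) pre_digraph \<Rightarrow> nat \<Rightarrow> ('b, 'k::field) preproj_elt set" where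
  "vertex_ideal Q i = Idl\<^bsub>preproj Q\<^esub> {\<one>\<^bsub>preproj Q\<^esub> \<ominus>\<^bsub>preproj Q\<^esub> preproj_path Q (i, [])}"

text \<open>The choice of the reduced word is immaterial.\<close>

definition weyl_ideal ::
    "nat \<Rightarrow> (nat, 'b) pre_digraph \<Rightarrow> (nat \<Rightarrow> nat) \<Rightarrow> ('b, 'k::field) preproj_elt set" where
  "weyl_ideal n Q w =
    foldr (ideal_prod (preproj Q)) (map (vertex_ideal Q) (SOME is. reduced_word n is w))
      (carrier (preproj Q))"

definition layer ::
    "nat \<Rightarrow> (nat, 'b) pre_digraph \<Rightarrow> (nat \<Rightarrow> nat) \<Rightarrow> nat \<Rightarrow>
      (('b, 'k::field) preproj_elt, ('b, 'k) preproj_elt set) module" where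
  "layer n Q w i =
    quot_module ((regular_module (preproj Q))\<lparr>carrier := weyl_ideal n Q w\<rparr>)
      (weyl_ideal n Q (w \<otimes>\<^bsub>sym_group (Suc n)\<^esub> simple_refl i))"

definition layer_module ::
    "nat \<Rightarrow> (nat, 'b) pre_digraph \<Rightarrow> (('b, 'k::field) preproj_elt, 'm, 'z) module_scheme \<Rightarrow> bool" where
  "layer_module n Q M \<longleftrightarrow> fd_module (preproj Q) M \<and>
    (\<exists>w\<in>carrier (sym_group (Suc n)). \<exists>i\<in>{1..n}.
      weyl_length n (w \<otimes>\<^bsub>sym_group (Suc n)\<^esub> simple_refl i) = weyl_length n w + 1 \<and>
      mod_iso (preproj Q) M (layer n Q w i))"


section \<open>The doubleton extension order\<close>

text \<open>
  To quantify over isomorphism classes of finite-dimensional modules, we let modules range over the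
  type below: every finite-dimensional module has an isomorphic copy whose underlying
  set consists of coordinate sequences.
\<close>

type_synonym ('b, 'k) coord_module = "(('b, 'k) preproj_elt, nat \<Rightarrow> 'k) module"

definition doubleton ::
    "nat \<Rightarrow> (nat, 'b) pre_digraph \<Rightarrow> ('b, 'k::field) coord_module \<Rightarrow> ('b, 'k) coord_module \<Rightarrow> bool" where
  "doubleton n Q X Y \<longleftrightarrow> layer_module n Q X \<and> layer_module n Q Y \<and>
    one_dimensional (Ext1 (preproj Q) Y X) \<and> one_dimensional (Ext1 (preproj Q) X Y) \<and>
    (\<forall>E :: ('b, 'k) coord_module. fd_module (preproj Q) E \<and>
      (nonsplit_extension (preproj Q) X E Y \<or> nonsplit_extension (preproj Q) Y E X) \<longrightarrow>
      layer_module n Q E)"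

definition doubleton_gt ::
    "nat \<Rightarrow> (nat, 'b) pre_digraph \<Rightarrow> ('b, 'k::field) coord_module \<Rightarrow> ('b, 'k) coord_module \<Rightarrow> bool" where
  "doubleton_gt n Q A B \<longleftrightarrow> fd_module (preproj Q) B \<and>
    (\<exists>C. doubleton n Q A C \<and>
      (nonsplit_extension (preproj Q) A B C \<or> nonsplit_extension (preproj Q) C B A))"

definition doubleton_ge ::
    "nat \<Rightarrow> (nat, 'b) pre_digraph \<Rightarrow> (('b, 'k::field) preproj_elt, 'm, 'z) module_scheme \<Rightarrow>
      (('b, 'k) preproj_elt, 'n, 'w) module_scheme \<Rightarrow> bool" where
  "doubleton_ge n Q A B \<longleftrightarrow>
    (\<exists>A' B'. fd_module (preproj Q) A' \<and> fd_module (preproj Q) B' \<and>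
      mod_iso (preproj Q) A A' \<and> mod_iso (preproj Q) B B' \<and> (doubleton_gt n Q)\<^sup>*\<^sup>* A' B')"

end

theory Submission
  imports Defs
begin

text \<open>
  The double quiver has, for each \<open>1 \<le> i < n\<close>, an arrow \<open>up i\<close> from \<open>i\<close> to \<open>i + 1\<close> and an arrow \<open>dn i\<close> back.
  Up to sign, the preprojective relation lets ascents and descents of a path commute and kills a path
  as soon as such an exchange would leave the diagram.  So a path counts, up to sign, only through its start \<open>u\<close>,
  its end \<open>v\<close> and its number \<open>p\<close> of descents, and it survives iff \<open>p < u\<close> and \<open>p + v \<le> n\<close>.  The signed sums of
  coefficients \<open>coord f u p v\<close> are therefore coordinates on \<open>\<Pi>\<close> (\<open>preproj_ideal_eq_kernel\<close>).

  In these coordinates every \<open>I(w)\<close> is a monomial ideal: it consists of the elements whose coordinates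
  with \<open>p < #{r \<le> u. v < w r}\<close> vanish (\<open>weyl_ideal_depth\<close>, by induction on a reduced word; the induction
  step multiplies by \<open>I\<^sub>i\<close> from the left and is \<open>ideal_prod_depth_ideal\<close>).
  Passing from \<open>w\<close> to \<open>w s\<^sub>i\<close> changes these bounds only for \<open>u = i\<close> and
  \<open>w i \<le> v < w (i + 1)\<close>, where they grow by one.  Hence the layer has one basis vector for each of these
  vertices \<open>v\<close>, neighbouring ones being joined by \<open>dn\<close> or \<open>up\<close> according to whether \<open>v + 1\<close> occurs among
  \<open>w 1, \<dots>, w (i - 1)\<close>.  This is a string module, and since that set can be prescribed at will, every
  string module arises (\<open>layer_module_iff\<close>).

  A module over the quotient by the two-cycles is a representation in which any two opposite arrows
  compose to zero in both orders.
  To see that an indecomposable one is a string module, consider its last nonzero vertex space, and in it the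
  chain of subspaces obtained from the vertices further left by taking images under \<open>up\<close> and preimages under
  \<open>dn\<close>.  Between two neighbours of this chain that differ, a vector and a linear form vanishing on the
  smaller space extend to the left to a string in the module and to a retraction onto it
  (\<open>good_interval_exists\<close>, \<open>indecomposable_string\<close>).  The converse is a direct check on the basis vectors.

  For the order, let \<open>Y\<close> and \<open>X\<close> be strings on disjoint sets of vertices with exactly one arrow from \<open>Y\<close> to
  \<open>X\<close>.  Then \<open>Ext\<^sup>1(Y, X)\<close> is a line, and every non-split extension is obtained by adding that arrow
  (\<open>Ext1_one_dimensional\<close>, \<open>extension_unique\<close>).  So a string and the simple module at a vertex next to one of
  its ends form a doubleton, and a string lies above each string that extends it by one vertex.
  Since a subfactor of a string that is itself a string is its restriction to a subinterval
  (\<open>string_data_mono\<close>), iterating this gives one half of the comparison of the orders.  The other half is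
  formal: in any short exact sequence the outer terms are subfactors of the middle one.
\<close>

section \<open>Algebras, modules and quotients\<close>

locale kalg = ring A for A :: "('k::field, 'r, 'y) module_scheme" (structure) +
  assumes scal_closed [simp, intro]: "a \<in> carrier A ==> c \<odot> a \<in> carrier A"
    and scal_l_distr: "a \<in> carrier A ==> (c + d) \<odot> a = c \<odot> a \<oplus> d \<odot> a"
    and scal_r_distr: "a \<in> carrier A ==> b \<in> carrier A ==> c \<odot> (a \<oplus> b) = c \<odot> a \<oplus> c \<odot> b"
    and scal_assoc: "a \<in> carrier A ==> (c * d) \<odot> a = c \<odot> (d \<odot> a)"
    and scal_one [simp]: "a \<in> carrier A ==> 1 \<odot> a = a"
    and scal_mult_l: "a \<in> carrier A ==> b \<in> carrier A ==> (c \<odot> a) \<otimes> b = c \<odot> (a \<otimes> b)"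
    and scal_mult_r: "a \<in> carrier A ==> b \<in> carrier A ==> a \<otimes> (c \<odot> b) = c \<odot> (a \<otimes> b)"
begin

lemma ideal_scal: "ideal I A ==> x \<in> I ==> c \<odot> x \<in> I"
proof -
  assume a: "ideal I A" "x \<in> I"
  then have x: "x \<in> carrier A" by (rule ideal.Icarr)
  then have "c \<odot> x = (c \<odot> \<one>) \<otimes> x" by (simp add: scal_mult_l)
  then show ?thesis using a x by (simp add: ideal.I_l_closed)
qed

end

lemma ring_cong:
  assumes "ring R" "carrier S = carrier R" "monoid.mult S = monoid.mult R" "one S = one R"
    "zero S = zero R" "add S = add R"
  shows "ring S"
proof -
  interpret ring R by fact
  show ?thesis
    by (rule ringI; (rule abelian_groupI | rule monoidI)?)
      (simp_all add: assms(2-) m_assoc a_ac l_distr r_distr add.l_inv_ex)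
qed

lemma quot_module_simps:
  "carrier (quot_module M N) = (\<lambda>x. N +>\<^bsub>M\<^esub> x) ` carrier M"
  "zero (quot_module M N) = N"
  "one (quot_module M N) = N +>\<^bsub>M\<^esub> one M"
  "add (quot_module M N) = set_add M"
  "monoid.mult (quot_module M N) = rcoset_mult M N"
  by (auto simp: quot_module_def with_smult_def FactRing_def A_RCOSETS_def')

lemma (in abelian_group) minus_eq_zero_iff:
  assumes "x \<in> carrier G" "y \<in> carrier G"
  shows "x \<ominus> y = \<zero> \<longleftrightarrow> x = y"
  using assms by (metis a_minus_def a_inv_closed r_neg minus_equality minus_minus)

context abelian_subgroup
begin

lemma a_rcos_eq_iff:
  assumes "x \<in> carrier G" "y \<in> carrier G"
  shows "H +> x = H +> y \<longleftrightarrow> x \<ominus> y \<in> H"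
  by (metis a_coset_add_inv1 a_coset_add_inv2 a_coset_join1 a_coset_join2 a_inv_closed a_minus_def
      a_subgroup a_subset assms minus_closed)

lemma a_rcos_eq_zero_iff:
  "x \<in> carrier G ==> H +> x = H \<longleftrightarrow> x \<in> H"
  using a_coset_join1 a_coset_join2 a_subgroup by blast

lemma a_rcos_memE:
  assumes "y \<in> H +> x" "x \<in> carrier G"
  shows "y \<in> carrier G" "H +> y = H +> x" "\<exists>h\<in>H. y = h \<oplus> x"
  using assms a_repr_independence[OF _ _ a_subgroup] a_r_coset_subset_G[OF a_subset]
  by (auto simp: a_r_coset_def')

end

lemma quot_module_smult:
  fixes M :: "('r, 'm, 'z) module_scheme" (structure)
  assumes "abelian_subgroup N M" "x \<in> carrier M"
    and cl: "\<And>y. y \<in> carrier M ==> r \<odot> y \<in> carrier M"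
    and ad: "\<And>y z. y \<in> carrier M ==> z \<in> carrier M ==> r \<odot> (y \<oplus> z) = r \<odot> y \<oplus> r \<odot> z"
    and N: "\<And>y. y \<in> N ==> r \<odot> y \<in> N"
  shows "r \<odot>\<^bsub>quot_module M N\<^esub> (N +> x) = N +> (r \<odot> x)"
proof -
  interpret abelian_subgroup N M by fact
  have "N +> (r \<odot> y) = N +> (r \<odot> x)" if y: "y \<in> N +> x" for y
  proof -
    from a_rcos_memE(3)[OF y assms(2)] obtain h where h: "h \<in> N" "y = h \<oplus> x" by auto
    then have "r \<odot> y = r \<odot> h \<oplus> r \<odot> x" using ad a_Hcarr assms(2) by auto
    moreover have "r \<odot> h \<oplus> r \<odot> x \<in> N +> (r \<odot> x)"
      using N[OF h(1)] by (auto simp: a_r_coset_def')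
    ultimately show ?thesis using a_rcos_memE(2) cl assms(2) by auto
  qed
  moreover have "x \<in> N +> x" using assms(2) by (rule a_rcos_self)
  ultimately have "(\<Union>y\<in>N +> x. N +> (r \<odot> y)) = N +> (r \<odot> x)" by blast
  then show ?thesis by (simp add: quot_module_def with_smult_def)
qed

context kalg
begin

lemma quot_smult:
  assumes "ideal I A" "a \<in> carrier A"
  shows "c \<odot>\<^bsub>quot_module A I\<^esub> (I +> a) = I +> (c \<odot> a)"
proof -
  interpret ideal I A by fact
  show ?thesis
    by (rule quot_module_smult) (use assms ideal_scal in \<open>auto simp: scal_r_distr abelian_subgroup_axioms\<close>)
qed

lemma quot_mult:
  assumes "ideal I A" "a \<in> carrier A" "b \<in> carrier A"
  shows "(I +> a) \<otimes>\<^bsub>quot_module A I\<^esub> (I +> b) = I +> (a \<otimes> b)"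
    and "(I +> a) \<oplus>\<^bsub>quot_module A I\<^esub> (I +> b) = I +> (a \<oplus> b)"
proof -
  interpret ideal I A by fact
  show "(I +> a) \<otimes>\<^bsub>quot_module A I\<^esub> (I +> b) = I +> (a \<otimes> b)"
    "(I +> a) \<oplus>\<^bsub>quot_module A I\<^esub> (I +> b) = I +> (a \<oplus> b)"
    using assms by (simp_all add: quot_module_simps rcoset_mult_add a_rcos_sum)
qed

lemma quot_kalg:
  assumes "ideal I A"
  shows "kalg (quot_module A I)"
proof -
  interpret ideal I A by fact
  interpret q: ring "quot_module A I"
    by (rule ring_cong[OF quotient_is_ring])
      (simp_all add: quot_module_def with_smult_def FactRing_def)
  show ?thesis
    by unfold_locales
      (auto simp: quot_module_simps(1) quot_smult[OF assms] quot_mult[OF assms] scal_l_distr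
        scal_r_distr scal_assoc scal_mult_l scal_mult_r)
qed

end

context left_module
begin

lemma act_zero [simp]: "r \<in> carrier R ==> r \<odot>\<^bsub>M\<^esub> \<zero>\<^bsub>M\<^esub> = \<zero>\<^bsub>M\<^esub>"
  using smult_r_distr[of r "\<zero>\<^bsub>M\<^esub>" "\<zero>\<^bsub>M\<^esub>"] smult_closed[of r "\<zero>\<^bsub>M\<^esub>"]
  by (simp add: M.add.r_cancel_one')

lemma zero_act [simp]: "x \<in> carrier M ==> \<zero>\<^bsub>R\<^esub> \<odot>\<^bsub>M\<^esub> x = \<zero>\<^bsub>M\<^esub>"
  using smult_l_distr[of "\<zero>\<^bsub>R\<^esub>" "\<zero>\<^bsub>R\<^esub>" x] smult_closed[of "\<zero>\<^bsub>R\<^esub>" x]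
  by (simp add: M.add.r_cancel_one')

end

lemma submoduleD:
  assumes "submodule U A M"
  shows "U \<subseteq> carrier M" "\<zero>\<^bsub>M\<^esub> \<in> U" "x \<in> U ==> x \<in> carrier M"
    "x \<in> U ==> y \<in> U ==> x \<oplus>\<^bsub>M\<^esub> y \<in> U"
    "a \<in> carrier A ==> x \<in> U ==> a \<odot>\<^bsub>M\<^esub> x \<in> U"
proof -
  interpret submodule U A M by fact
  show "U \<subseteq> carrier M" "\<zero>\<^bsub>M\<^esub> \<in> U" "x \<in> U ==> x \<in> carrier M"
    "x \<in> U ==> y \<in> U ==> x \<oplus>\<^bsub>M\<^esub> y \<in> U" "a \<in> carrier A ==> x \<in> U ==> a \<odot>\<^bsub>M\<^esub> x \<in> U"
    using subset one_closed m_closed[of x y] smult_closed[of a x] by auto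
qed

locale kmod = kalg A + left_module A M
  for A :: "('k::field, 'r, 'y) module_scheme" (structure) and M :: "('r, 'm, 'z) module_scheme" (structure)
begin

abbreviation sm :: "'k => 'm => 'm" where "sm \<equiv> field_smult A M"

lemma sm_closed [simp, intro]: "x \<in> carrier M ==> sm c x \<in> carrier M"
  by (simp add: field_smult_def)

lemma scal_act: "a \<in> carrier A ==> x \<in> carrier M ==> (c \<odot>\<^bsub>A\<^esub> a) \<odot>\<^bsub>M\<^esub> x = sm c (a \<odot>\<^bsub>M\<^esub> x)"
  by (simp add: field_smult_def scal_mult_l flip: smult_assoc1)

lemma sm_comm: "a \<in> carrier A ==> x \<in> carrier M ==> a \<odot>\<^bsub>M\<^esub> (sm c x) = sm c (a \<odot>\<^bsub>M\<^esub> x)"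
  by (simp add: field_smult_def scal_mult_l scal_mult_r flip: smult_assoc1)

lemma sm_l_distr: "x \<in> carrier M ==> sm (c + d) x = sm c x \<oplus>\<^bsub>M\<^esub> sm d x"
  by (simp add: field_smult_def scal_l_distr smult_l_distr)

lemma sm_r_distr: "x \<in> carrier M ==> y \<in> carrier M ==> sm c (x \<oplus>\<^bsub>M\<^esub> y) = sm c x \<oplus>\<^bsub>M\<^esub> sm c y"
  by (simp add: field_smult_def smult_r_distr)

lemma sm_sm: "x \<in> carrier M ==> sm c (sm d x) = sm (c * d) x"
  by (simp add: field_smult_def scal_mult_l scal_assoc flip: smult_assoc1)

lemma sm_one [simp]: "x \<in> carrier M ==> sm 1 x = x"
  by (simp add: field_smult_def)

lemma sm_zero [simp]: "sm c \<zero>\<^bsub>M\<^esub> = \<zero>\<^bsub>M\<^esub>"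
  by (simp add: field_smult_def)

lemma zero_sm [simp]: "x \<in> carrier M ==> sm 0 x = \<zero>\<^bsub>M\<^esub>"
  using sm_l_distr[of x 0 0] by (metis add_0 M.add.r_cancel_one' sm_closed)

lemma sm_minus: "x \<in> carrier M ==> \<ominus>\<^bsub>M\<^esub> x = sm (-1) x"
  using sm_l_distr[of x "-1" 1] by (simp add: M.minus_equality)

end

lemma mod_homD:
  assumes "f \<in> mod_hom A M N"
  shows "x \<in> carrier M ==> f x \<in> carrier N"
    "x \<in> carrier M ==> y \<in> carrier M ==> f (x \<oplus>\<^bsub>M\<^esub> y) = f x \<oplus>\<^bsub>N\<^esub> f y"
    "a \<in> carrier A ==> x \<in> carrier M ==> f (a \<odot>\<^bsub>M\<^esub> x) = a \<odot>\<^bsub>N\<^esub> f x"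
  using assms by (auto simp: mod_hom_def)

lemma mod_hom_sm:
  assumes "kalg A" "f \<in> mod_hom A M N" "x \<in> carrier M"
  shows "f (field_smult A M c x) = field_smult A N c (f x)"
proof -
  interpret kalg A by fact
  show ?thesis using assms mod_homD(3)[OF assms(2)] by (simp add: field_smult_def)
qed

lemma mod_hom_zero:
  assumes "f \<in> mod_hom A M N" "abelian_group M" "abelian_group N"
  shows "f \<zero>\<^bsub>M\<^esub> = \<zero>\<^bsub>N\<^esub>"
proof -
  interpret M: abelian_group M by fact
  interpret N: abelian_group N by fact
  have "f \<zero>\<^bsub>M\<^esub> \<oplus>\<^bsub>N\<^esub> f \<zero>\<^bsub>M\<^esub> = f \<zero>\<^bsub>M\<^esub>" "f \<zero>\<^bsub>M\<^esub> \<in> carrier N"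
    using mod_homD(1,2)[OF assms(1)] M.zero_closed by (metis M.l_zero)+
  then show ?thesis by (simp add: N.add.r_cancel_one')
qed

lemma mod_hom_comp:
  "f \<in> mod_hom A L M ==> g \<in> mod_hom A M N ==> (\<lambda>x. g (f x)) \<in> mod_hom A L N"
  by (auto simp: mod_hom_def Pi_def)

lemma mod_iso_refl: "mod_iso A M M"
  unfolding mod_iso_def
  by (rule bexI[of _ "\<lambda>x. x"]) (auto simp: mod_hom_def bij_betw_def)

lemma mod_iso_trans: "mod_iso A L M ==> mod_iso A M N ==> mod_iso A L N"
  unfolding mod_iso_def
proof (elim bexE)
  fix f g assume "f \<in> mod_hom A L M" "bij_betw f (carrier L) (carrier M)"
    "g \<in> mod_hom A M N" "bij_betw g (carrier M) (carrier N)"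
  then show "\<exists>h\<in>mod_hom A L N. bij_betw h (carrier L) (carrier N)"
    using bij_betw_trans[of f "carrier L" "carrier M" g "carrier N"]
    by (intro bexI[of _ "\<lambda>x. g (f x)"]) (simp_all add: comp_def mod_hom_comp)
qed

lemma inv_mod_hom:
  assumes "left_module A M" "f \<in> mod_hom A M N" "bij_betw f (carrier M) (carrier N)"
  shows "inv_into (carrier M) f \<in> mod_hom A N M"
proof -
  interpret left_module A M by fact
  let ?g = "inv_into (carrier M) f"
  have g: "y \<in> carrier N ==> ?g y \<in> carrier M" "y \<in> carrier N ==> f (?g y) = y"
    "x \<in> carrier M ==> ?g (f x) = x" for x y
    using assms(3) by (auto simp: bij_betw_def inv_into_into f_inv_into_f inv_into_f_f)
  have "?g (x \<oplus>\<^bsub>N\<^esub> y) = ?g x \<oplus>\<^bsub>M\<^esub> ?g y" if "x \<in> carrier N" "y \<in> carrier N" for x y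
    using mod_homD(2)[OF assms(2), of "?g x" "?g y"] g that by (metis M.a_closed)
  moreover have "?g (a \<odot>\<^bsub>N\<^esub> x) = a \<odot>\<^bsub>M\<^esub> ?g x" if "x \<in> carrier N" "a \<in> carrier A" for x a
    using mod_homD(3)[OF assms(2), of a "?g x"] g that by (metis smult_closed)
  ultimately show ?thesis using g by (auto simp: mod_hom_def)
qed

lemma mod_iso_sym:
  assumes "left_module A M" "mod_iso A M N"
  shows "mod_iso A N M"
  using assms inv_mod_hom bij_betw_inv_into unfolding mod_iso_def by blast

lemma abelian_group_restrict:
  assumes "abelian_group M" "subgroup U (add_monoid M)"
  shows "abelian_group (M\<lparr>carrier := U\<rparr>)"
proof -
  interpret M: abelian_group M by fact
  interpret U: additive_subgroup U M by (rule additive_subgroupI) fact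
  show ?thesis
  proof (rule abelian_groupI)
    fix x assume "x \<in> carrier (M\<lparr>carrier := U\<rparr>)"
    then show "\<exists>y\<in>carrier (M\<lparr>carrier := U\<rparr>). y \<oplus>\<^bsub>M\<lparr>carrier := U\<rparr>\<^esub> x = \<zero>\<^bsub>M\<lparr>carrier := U\<rparr>\<^esub>"
      using M.l_neg U.a_Hcarr by (intro bexI[of _ "\<ominus>\<^bsub>M\<^esub> x"]) auto
  qed (simp_all add: M.a_ac U.a_Hcarr)
qed

lemma submodule_left_module:
  assumes "left_module A M" "submodule U A M"
  shows "left_module A (M\<lparr>carrier := U\<rparr>)"
proof -
  interpret left_module A M by fact
  interpret U: submodule U A M by fact
  interpret additive_subgroup U M by (rule additive_subgroupI) (rule U.subgroup_axioms)
  interpret abelian_group "M\<lparr>carrier := U\<rparr>"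
    by (rule abelian_group_restrict) (rule M.abelian_group_axioms U.subgroup_axioms)+
  show ?thesis
    by unfold_locales
      (auto simp: smult_l_distr smult_r_distr smult_assoc1 a_Hcarr)
qed

text \<open>A surjection identifies its target with the quotient by its kernel: \<open>y\<close> corresponds to its fibre.\<close>

lemma first_isomorphism:
  assumes M: "left_module A M" and N: "left_module A N" and f: "f \<in> mod_hom A M N"
    and surj: "f ` carrier M = carrier N" and K: "K = {x \<in> carrier M. f x = \<zero>\<^bsub>N\<^esub>}"
  shows "mod_iso A N (quot_module M K)"
proof -
  interpret M: left_module A M by fact
  interpret N: left_module A N by fact
  have f0: "f \<zero>\<^bsub>M\<^esub> = \<zero>\<^bsub>N\<^esub>"
    by (rule mod_hom_zero[OF f M.abelian_group_axioms N.abelian_group_axioms])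
  have fneg: "f (\<ominus>\<^bsub>M\<^esub> x) = \<ominus>\<^bsub>N\<^esub> f x" if "x \<in> carrier M" for x
    using mod_homD(1,2)[OF f] that f0 by (metis M.M.l_neg M.M.a_inv_closed N.M.minus_equality)
  have "subgroup K (add_monoid M)"
    by (rule M.M.add.subgroupI)
      (use mod_homD[OF f] f0 fneg in \<open>auto simp: K a_inv_def[symmetric]\<close>)
  then interpret K: abelian_subgroup K M
    by (intro abelian_subgroupI3 additive_subgroupI M.M.abelian_group_axioms)
  have eq: "K +>\<^bsub>M\<^esub> x = K +>\<^bsub>M\<^esub> y \<longleftrightarrow> f x = f y" if "x \<in> carrier M" "y \<in> carrier M" for x y
  proof -
    have "x \<ominus>\<^bsub>M\<^esub> y \<in> K \<longleftrightarrow> f x \<ominus>\<^bsub>N\<^esub> f y = \<zero>\<^bsub>N\<^esub>"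
    proof -
      have "f (x \<ominus>\<^bsub>M\<^esub> y) = f x \<ominus>\<^bsub>N\<^esub> f y"
        unfolding a_minus_def mod_homD(2)[OF f that(1) M.M.a_inv_closed[OF that(2)]] fneg[OF that(2)] ..
      then show ?thesis using that by (simp only: K mem_Collect_eq M.M.minus_closed simp_thms)
    qed
    also have "\<dots> \<longleftrightarrow> f x = f y" by (rule N.M.minus_eq_zero_iff) (use that mod_homD(1)[OF f] in auto)
    finally show ?thesis using that by (simp only: K.a_rcos_eq_iff)
  qed
  have sm: "r \<odot>\<^bsub>quot_module M K\<^esub> (K +>\<^bsub>M\<^esub> x) = K +>\<^bsub>M\<^esub> (r \<odot>\<^bsub>M\<^esub> x)"
    if "x \<in> carrier M" "r \<in> carrier A" for r x
  proof (rule quot_module_smult[OF K.abelian_subgroup_axioms that(1)])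
    show "r \<odot>\<^bsub>M\<^esub> y \<in> K" if "y \<in> K" for y
    proof -
      have y: "y \<in> carrier M" "f y = \<zero>\<^bsub>N\<^esub>" using that unfolding K by auto
      have "f (r \<odot>\<^bsub>M\<^esub> y) = \<zero>\<^bsub>N\<^esub>"
        unfolding mod_homD(3)[OF f \<open>r \<in> carrier A\<close> y(1)] y(2) by (rule N.act_zero[OF \<open>r \<in> carrier A\<close>])
      then show ?thesis unfolding K using M.smult_closed[OF \<open>r \<in> carrier A\<close> y(1)] by simp
    qed
  qed (use that(2) M.smult_r_distr in auto)
  define g where "g y = K +>\<^bsub>M\<^esub> (SOME x. x \<in> carrier M \<and> f x = y)" for y
  have g: "g (f x) = K +>\<^bsub>M\<^esub> x" if "x \<in> carrier M" for x
  proof -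
    have "\<exists>x'. x' \<in> carrier M \<and> f x' = f x" using that by auto
    from someI_ex[OF this] show ?thesis using eq that by (simp add: g_def)
  qed
  have "g \<in> mod_hom A N (quot_module M K)"
  proof -
    have "g (f x \<oplus>\<^bsub>N\<^esub> f y) = g (f x) \<oplus>\<^bsub>quot_module M K\<^esub> g (f y)" if "x \<in> carrier M" "y \<in> carrier M" for x y
      using g[of "x \<oplus>\<^bsub>M\<^esub> y"] that mod_homD(2)[OF f] by (simp add: g quot_module_simps K.a_rcos_sum)
    moreover have "g (a \<odot>\<^bsub>N\<^esub> f x) = a \<odot>\<^bsub>quot_module M K\<^esub> g (f x)" if "x \<in> carrier M" "a \<in> carrier A" for a x
      using g[of "a \<odot>\<^bsub>M\<^esub> x"] that mod_homD(3)[OF f] by (simp add: g sm)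
    ultimately show ?thesis
      by (auto simp: mod_hom_def quot_module_simps g simp flip: surj)
  qed
  moreover have "bij_betw g (carrier N) (carrier (quot_module M K))"
    by (auto simp: bij_betw_def inj_on_def quot_module_simps g eq image_image simp flip: surj)
  ultimately show ?thesis by (auto simp: mod_iso_def)
qed

text \<open>
  Subfactors without cosets: \<open>X\<close> is a subfactor of \<open>M\<close> iff some submodule of \<open>M\<close> maps onto \<open>X\<close>.
\<close>

definition subfactor ::
    "('k, 'r, 'y) module_scheme => ('r, 'm, 'z) module_scheme => ('r, 'n, 'w) module_scheme => bool" where
  "subfactor A X M \<longleftrightarrow>
    (\<exists>U f. submodule U A M \<and> f \<in> mod_hom A (M\<lparr>carrier := U\<rparr>) X \<and> f ` U = carrier X)"

lemma submodule_preimage: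
  assumes M: "left_module A M" and N: "left_module A N" and U: "submodule U A M"
    and f: "f \<in> mod_hom A (M\<lparr>carrier := U\<rparr>) N" and W: "submodule W A N"
  shows "submodule {x \<in> U. f x \<in> W} A M"
proof -
  interpret M: left_module A M by fact
  interpret N: left_module A N by fact
  interpret U: submodule U A M by fact
  interpret W: submodule W A N by fact
  interpret UM: left_module A "M\<lparr>carrier := U\<rparr>" by (rule submodule_left_module[OF M U])
  interpret Ug: additive_subgroup U M by (rule additive_subgroupI) (rule U.subgroup_axioms)
  interpret Wg: additive_subgroup W N by (rule additive_subgroupI) (rule W.subgroup_axioms)
  have f0: "f \<zero>\<^bsub>M\<^esub> = \<zero>\<^bsub>N\<^esub>"
    using mod_hom_zero[OF f UM.abelian_group_axioms N.abelian_group_axioms] by simp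
  have fneg: "f (\<ominus>\<^bsub>M\<^esub> x) = \<ominus>\<^bsub>N\<^esub> f x" if "x \<in> U" for x
  proof -
    have "f (\<ominus>\<^bsub>M\<^esub> x) \<oplus>\<^bsub>N\<^esub> f x = f (\<ominus>\<^bsub>M\<^esub> x \<oplus>\<^bsub>M\<^esub> x)"
      using mod_homD(2)[OF f, of "\<ominus>\<^bsub>M\<^esub> x" x] that by simp
    then show ?thesis using mod_homD(1)[OF f, of x] mod_homD(1)[OF f, of "\<ominus>\<^bsub>M\<^esub> x"] that f0
      by (simp add: M.M.l_neg Ug.a_Hcarr N.M.minus_equality)
  qed
  show ?thesis
  proof (rule submodule.intro)
    show "subgroup {x \<in> U. f x \<in> W} (add_monoid M)"
      by (rule M.M.add.subgroupI)
        (use mod_homD(2)[OF f] f0 fneg Ug.zero_closed in \<open>auto simp: a_inv_def[symmetric] Ug.a_Hcarr simp del: Ug.zero_closed\<close>)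
    show "submodule_axioms {x \<in> U. f x \<in> W} A M"
      using mod_homD(3)[OF f] by unfold_locales (auto simp: W.smult_closed)
  qed
qed

lemma subfactor_trans:
  assumes "left_module A M" "left_module A N" "subfactor A X N" "subfactor A N M"
  shows "subfactor A X M"
proof -
  from assms obtain W g U f where
    W: "submodule W A N" "g \<in> mod_hom A (N\<lparr>carrier := W\<rparr>) X" "g ` W = carrier X" and
    U: "submodule U A M" "f \<in> mod_hom A (M\<lparr>carrier := U\<rparr>) N" "f ` U = carrier N"
    unfolding subfactor_def by auto
  have "W \<subseteq> carrier N" by (rule submoduleD[OF W(1)])
  then have "(\<lambda>x. g (f x)) ` {x \<in> U. f x \<in> W} = carrier X"
    using U(3) W(3) by (auto simp: image_iff) (metis (no_types, lifting) imageE in_mono)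
  moreover have "(\<lambda>x. g (f x)) \<in> mod_hom A (M\<lparr>carrier := {x \<in> U. f x \<in> W}\<rparr>) X"
    using U(2) W(2) by (auto simp: mod_hom_def Pi_def)
  ultimately show ?thesis
    using submodule_preimage[OF assms(1,2) U(1,2) W(1)] unfolding subfactor_def by blast
qed

lemma submodule_carrier: "left_module A M ==> submodule (carrier M) A M"
proof -
  assume "left_module A M"
  then interpret left_module A M .
  show ?thesis
    by (rule submodule.intro, rule M.add.subgroup_self[simplified]) (unfold_locales, auto)
qed

lemma subfactor_iso: "left_module A M ==> mod_iso A M N ==> subfactor A N M"
  unfolding subfactor_def mod_iso_def
  by (rule exI[of _ "carrier M"]) (auto simp: submodule_carrier bij_betw_def)

lemma subfactor_quotient:
  "left_module A M ==> f \<in> mod_hom A M N ==> f ` carrier M = carrier N ==> subfactor A N M"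
  unfolding subfactor_def by (rule exI[of _ "carrier M"]) (auto simp: submodule_carrier)

lemma iso_to_subfactor_iff:
  assumes M: "left_module A M" and X: "left_module A X"
  shows "iso_to_subfactor A X M \<longleftrightarrow> subfactor A X M"
proof
  assume "subfactor A X M"
  then obtain U f where U: "submodule U A M" "f \<in> mod_hom A (M\<lparr>carrier := U\<rparr>) X" "f ` U = carrier X"
    unfolding subfactor_def by auto
  have UM: "left_module A (M\<lparr>carrier := U\<rparr>)" by (rule submodule_left_module[OF M U(1)])
  interpret X: left_module A X by fact
  have "submodule {\<zero>\<^bsub>X\<^esub>} A X"
  proof (rule submodule.intro)
    show "subgroup {\<zero>\<^bsub>X\<^esub>} (add_monoid X)" by (rule X.M.add.subgroupI) (auto simp: a_inv_def[symmetric])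
    have "a \<odot>\<^bsub>X\<^esub> \<zero>\<^bsub>X\<^esub> = \<zero>\<^bsub>X\<^esub>" if "a \<in> carrier A" for a
using that by simp
    then show "submodule_axioms {\<zero>\<^bsub>X\<^esub>} A X" by unfold_locales auto
  qed
  then have "submodule {x \<in> U. f x = \<zero>\<^bsub>X\<^esub>} A (M\<lparr>carrier := U\<rparr>)"
    using submodule_preimage[OF UM X, of U f "{\<zero>\<^bsub>X\<^esub>}"] submodule_carrier[OF UM] U(2) by auto
  moreover have "mod_iso A X (quot_module (M\<lparr>carrier := U\<rparr>) {x \<in> U. f x = \<zero>\<^bsub>X\<^esub>})"
    by (rule first_isomorphism[OF UM X U(2)]) (auto simp: U(3))
  ultimately show "iso_to_subfactor A X M" using U(1) unfolding iso_to_subfactor_def by blast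
next
  assume "iso_to_subfactor A X M"
  then obtain U V where U: "submodule U A M" and V: "submodule V A (M\<lparr>carrier := U\<rparr>)"
    and iso: "mod_iso A X (quot_module (M\<lparr>carrier := U\<rparr>) V)"
    unfolding iso_to_subfactor_def by auto
  let ?U = "M\<lparr>carrier := U\<rparr>" and ?q = "quot_module (M\<lparr>carrier := U\<rparr>) V"
  interpret UM: left_module A ?U by (rule submodule_left_module[OF M U])
  interpret V: submodule V A ?U by fact
  interpret V: abelian_subgroup V ?U
    by (intro abelian_subgroupI3 additive_subgroupI V.subgroup_axioms UM.M.abelian_group_axioms)
  have "(\<lambda>x. V +>\<^bsub>?U\<^esub> x) \<in> mod_hom A ?U ?q"
    using quot_module_smult[of V ?U] UM.smult_closed UM.smult_r_distr V.smult_closed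
      V.abelian_subgroup_axioms V.a_rcos_sum
    by (auto simp: mod_hom_def quot_module_simps)
  then have 1: "subfactor A ?q ?U"
    by (intro subfactor_quotient UM.left_module_axioms) (auto simp: quot_module_simps)
  obtain g where g: "g \<in> mod_hom A X ?q" "bij_betw g (carrier X) (carrier ?q)"
    using iso unfolding mod_iso_def by auto
  let ?h = "inv_into (carrier X) g"
  have h: "?h \<in> mod_hom A ?q X" by (rule inv_mod_hom[OF X g])
  have "(\<lambda>x. ?h (V +>\<^bsub>?U\<^esub> x)) \<in> mod_hom A ?U X"
    using \<open>(\<lambda>x. V +>\<^bsub>?U\<^esub> x) \<in> mod_hom A ?U ?q\<close> h by (rule mod_hom_comp)
  moreover have "(\<lambda>x. ?h (V +>\<^bsub>?U\<^esub> x)) ` U = carrier X"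
    using bij_betw_inv_into[OF g(2)] by (auto simp: bij_betw_def quot_module_simps image_image)
  ultimately show "subfactor A X M" using U unfolding subfactor_def by blast
qed

subsection \<open>Change of rings\<close>

lemma inflate_simps [simp]:
  "carrier (inflate A I N) = carrier N" "zero (inflate A I N) = zero N" "add (inflate A I N) = add N"
  "smult (inflate A I N) a = smult N (I +>\<^bsub>A\<^esub> a)"
  by (auto simp: inflate_def with_smult_def)

lemma deflate_simps [simp]:
  "carrier (deflate N) = carrier N" "zero (deflate N) = zero N" "add (deflate N) = add N"
  by (auto simp: deflate_def with_smult_def)

lemma abelian_group_cong:
  assumes "abelian_group R" "carrier S = carrier R" "zero S = zero R" "add S = add R"
  shows "abelian_group S"
proof -
  interpret abelian_group R by fact
  show ?thesis
    by (rule abelian_groupI) (simp_all add: assms(2-) a_ac add.l_inv_ex)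
qed

lemma left_module_inflate:
  assumes "kalg A" "ideal I A" "left_module (quot_module A I) N"
  shows "left_module A (inflate A I N)"
proof -
  interpret kalg A by fact
  interpret N: left_module "quot_module A I" N by fact
  interpret I: abelian_group "inflate A I N"
    by (rule abelian_group_cong[OF N.abelian_group_axioms]) auto
  have c: "a \<in> carrier A ==> I +>\<^bsub>A\<^esub> a \<in> carrier (quot_module A I)" for a
    by (auto simp: quot_module_simps)
  show ?thesis
    by unfold_locales
      (use N.smult_l_distr N.smult_assoc1 in \<open>auto simp: c N.smult_r_distr
        simp flip: quot_mult[OF assms(2)] quot_module_simps(3)\<close>)
qed

lemma deflate_smult:
  assumes "kalg A" "ideal I A" "left_module A M"
    and kill: "\<And>a x. a \<in> I ==> x \<in> carrier M ==> a \<odot>\<^bsub>M\<^esub> x = \<zero>\<^bsub>M\<^esub>"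
    and a: "a \<in> carrier A" "x \<in> carrier M"
  shows "(I +>\<^bsub>A\<^esub> a) \<odot>\<^bsub>deflate M\<^esub> x = a \<odot>\<^bsub>M\<^esub> x"
proof -
  interpret kalg A by fact
  interpret I: ideal I A by fact
  interpret M: left_module A M by fact
  let ?b = "SOME b. b \<in> I +>\<^bsub>A\<^esub> a"
  have "?b \<in> I +>\<^bsub>A\<^esub> a" using I.a_rcos_self[OF a(1)] by (rule someI)
  then obtain h where "h \<in> I" "?b = h \<oplus>\<^bsub>A\<^esub> a" using I.a_rcos_memE(3) a by blast
  then have "?b \<odot>\<^bsub>M\<^esub> x = a \<odot>\<^bsub>M\<^esub> x" using a kill by (simp add: M.smult_l_distr I.Icarr)
  then show ?thesis by (simp add: deflate_def with_smult_def)
qed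

lemma left_module_deflate:
  assumes "kalg A" "ideal I A" "left_module A M"
    and kill: "\<And>a x. a \<in> I ==> x \<in> carrier M ==> a \<odot>\<^bsub>M\<^esub> x = \<zero>\<^bsub>M\<^esub>"
  shows "left_module (quot_module A I) (deflate M)"
proof -
  interpret kalg A by fact
  interpret Q: kalg "quot_module A I" by (rule quot_kalg[OF assms(2)])
  interpret M: left_module A M by fact
  interpret D: abelian_group "deflate M"
    by (rule abelian_group_cong[OF M.abelian_group_axioms]) auto
  note [simp] = deflate_smult[OF assms]
  show ?thesis
    by unfold_locales
      (auto simp: quot_module_simps(1,3) quot_mult[OF assms(2)] M.smult_l_distr M.smult_r_distr M.smult_assoc1)
qed

section \<open>Path algebras\<close>

text \<open>Linear extension of a function on the basis of paths.\<close>

definition lin :: "('p => 'k) => ('p => 'k::field) => 'k" where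
  "lin h f = (\<Sum>x\<in>{x. f x \<noteq> 0}. f x * h x)"

lemma lin_superset: "finite S ==> {x. f x \<noteq> 0} \<subseteq> S ==> lin h f = (\<Sum>x\<in>S. f x * h x)"
  unfolding lin_def by (rule sum.mono_neutral_left) auto

lemma lin_add:
  assumes "finite {x. f x \<noteq> 0}" "finite {x. g x \<noteq> 0}"
  shows "lin h (\<lambda>x. f x + g x) = lin h f + lin h g"
proof -
  let ?S = "{x. f x \<noteq> 0} \<union> {x. g x \<noteq> 0}"
  have "lin h (\<lambda>x. f x + g x) = (\<Sum>x\<in>?S. (f x + g x) * h x)"
    by (rule lin_superset) (use assms in auto)
  also have "\<dots> = lin h f + lin h g"
    using assms by (simp add: lin_superset[of ?S f] lin_superset[of ?S g] distrib_right sum.distrib)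
  finally show ?thesis .
qed

lemma lin_scal: "lin h (\<lambda>x. c * f x) = c * lin h f"
proof (cases "c = 0")
  case False
  then have "{x. c * f x \<noteq> 0} = {x. f x \<noteq> 0}" by auto
  then show ?thesis by (simp add: lin_def sum_distrib_left mult.assoc)
qed (simp add: lin_def)

lemma lin_basis [simp]: "lin h (basis_path x) = h x"
proof -
  have "lin h (basis_path x) = (\<Sum>y\<in>{x}. basis_path x y * h y)"
    by (rule lin_superset) (auto simp: basis_path_def)
  then show ?thesis by (simp add: basis_path_def)
qed

lemma lin_zero [simp]: "lin h (\<lambda>_. 0) = 0"
  by (simp add: lin_def)

lemma lin_fun_add: "lin (\<lambda>x. h x + h' x) f = lin h f + lin h' f"
  by (simp add: lin_def distrib_left sum.distrib)

lemma lin_fun_scal: "lin (\<lambda>x. c * h x) f = c * lin h f"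
  by (simp add: lin_def sum_distrib_left mult_ac)

lemma path_algebra_simps:
  "carrier (path_algebra G) = {f. finite {x. f x \<noteq> 0} \<and> {x. f x \<noteq> 0} \<subseteq> paths G}"
  "zero (path_algebra G) = (\<lambda>_. 0)"
  "add (path_algebra G) = (\<lambda>f g x. f x + g x)"
  "smult (path_algebra G) = (\<lambda>c f x. c * f x)"
  by (simp_all add: path_algebra_def)

definition path_end :: "('v, 'b) pre_digraph => 'v \<times> 'b list => 'v" where
  "path_end G x = (if snd x = [] then fst x else head G (last (snd x)))"

lemma path_end_Nil [simp]: "path_end G (u, []) = u"
  and path_end_snoc [simp]: "path_end G (u, p @ [b]) = head G b"
  and path_end_Cons [simp]: "path_end G (u, b # p) = path_end G (head G b, p)"
  by (simp_all add: path_end_def)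

lemma awlast_eq_path_end: "pre_digraph.awlast G u p = path_end G (u, p)"
  by (simp add: pre_digraph.awalk_verts_conv path_end_def)

lemma path_end_append: "path_end G (u, p @ q) = path_end G (path_end G (u, p), q)"
  by (auto simp: path_end_def)

locale quiver = wf_digraph G for G :: "('v, 'b) pre_digraph" +
  assumes finite_verts: "finite (verts G)"
begin

abbreviation PA :: "('k::field, 'v \<times> 'b list => 'k) module" where "PA \<equiv> path_algebra G"

lemma paths_iff: "(u, p) \<in> paths G \<longleftrightarrow> awalk u p (path_end G (u, p))"
  by (auto simp: paths_def awlast_eq_path_end[symmetric] elim: awalkE)

lemma paths_append: "(u, p @ q) \<in> paths G \<longleftrightarrow> (u, p) \<in> paths G \<and> (path_end G (u, p), q) \<in> paths G"
  by (simp add: paths_iff awalk_append_iff awlast_eq_path_end path_end_append)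

lemma paths_Nil [simp]: "(u, []) \<in> paths G \<longleftrightarrow> u \<in> verts G"
  by (auto simp: paths_def awalk_Nil_iff)

lemma paths_single: "(u, [b]) \<in> paths G \<longleftrightarrow> b \<in> arcs G \<and> u = tail G b"
  by (auto simp: paths_def awalk_simps)

lemma paths_Cons [simp]:
  "(u, b # p) \<in> paths G \<longleftrightarrow> b \<in> arcs G \<and> u = tail G b \<and> (head G b, p) \<in> paths G"
  by (auto simp: paths_iff awalk_Cons_iff)

lemma paths_snoc:
  "(u, p @ [b]) \<in> paths G \<longleftrightarrow> (u, p) \<in> paths G \<and> b \<in> arcs G \<and> path_end G (u, p) = tail G b"
  by (auto simp: paths_append)

lemma path_start_in_verts: "(u, p) \<in> paths G ==> u \<in> verts G"
  by (auto simp: paths_def)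

lemma path_end_in_verts: "(u, p) \<in> paths G ==> path_end G (u, p) \<in> verts G"
  by (auto simp: paths_def simp flip: awlast_eq_path_end)

lemma PA_finite: "f \<in> carrier PA ==> finite {x. f x \<noteq> 0}"
  and PA_paths: "f \<in> carrier PA ==> f x \<noteq> 0 ==> x \<in> paths G"
  by (auto simp: path_algebra_simps)

lemma basis_in_PA: "x \<in> paths G ==> (basis_path x :: _ => 'k::field) \<in> carrier PA"
proof -
  have "{y. basis_path x y \<noteq> (0::'k)} = {x}" by (auto simp: basis_path_def)
  then show "x \<in> paths G ==> (basis_path x :: _ => 'k) \<in> carrier PA" by (simp add: path_algebra_simps)
qed

lemma arrow_in_PA [simp]: "b \<in> arcs G ==> basis_arrow G b \<in> carrier PA"
  by (simp add: basis_arrow_def basis_in_PA paths_single)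

lemma add_in_PA: "f \<in> carrier PA ==> g \<in> carrier PA ==> (\<lambda>x. f x + g x) \<in> carrier PA"
proof -
  assume "f \<in> carrier PA" "g \<in> carrier PA"
  moreover have "{x. f x + g x \<noteq> 0} \<subseteq> {x. f x \<noteq> 0} \<union> {x. g x \<noteq> 0}" by auto
  ultimately show ?thesis by (auto simp: path_algebra_simps intro: finite_subset)
qed

lemma scal_in_PA: "f \<in> carrier PA ==> (\<lambda>x. c * f x) \<in> carrier PA"
proof -
  assume "f \<in> carrier PA"
  moreover have "{x. c * f x \<noteq> 0} \<subseteq> {x. f x \<noteq> 0}" by auto
  ultimately show ?thesis by (auto simp: path_algebra_simps intro: finite_subset)
qed

lemma zero_in_PA: "(\<lambda>_. 0) \<in> carrier PA"
  by (simp add: path_algebra_simps)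

lemma PA_induct [consumes 1, case_names zero basis add]:
  fixes f :: "'v \<times> 'b list => 'k::field"
  assumes "f \<in> carrier PA"
    and zero: "P (\<lambda>_. 0)"
    and basis: "\<And>c x. x \<in> paths G ==> P (\<lambda>y. c * basis_path x y)"
    and add: "\<And>f g. f \<in> carrier PA ==> g \<in> carrier PA ==> P f ==> P g ==> P (\<lambda>x. f x + g x)"
  shows "P f"
proof -
  have "\<forall>f. f \<in> carrier PA \<longrightarrow> {x. f x \<noteq> 0} \<subseteq> S \<longrightarrow> P f" if "finite S" for S :: "('v \<times> 'b list) set"
    using that
  proof (induction S rule: finite_induct)
    case empty
    have "f = (\<lambda>_. 0)" if "{x. f x \<noteq> 0} \<subseteq> {}" for f :: "'v \<times> 'b list => 'k" using that by auto
    then show ?case using zero by blast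
  next
    case (insert x S)
    show ?case
    proof (intro allI impI)
      fix f :: "'v \<times> 'b list => 'k" assume f: "f \<in> carrier PA" "{x. f x \<noteq> 0} \<subseteq> insert x S"
      show "P f"
      proof (cases "f x = 0")
        case True
        then have "{x. f x \<noteq> 0} \<subseteq> S" using f(2) by auto
        then show ?thesis using insert f by blast
      next
        case False
        let ?g = "f(x := 0)" and ?b = "\<lambda>y. f x * basis_path x y"
        have x: "x \<in> paths G" using False f(1) by (rule PA_paths[rotated])
        have "{y. ?g y \<noteq> 0} \<subseteq> {y. f y \<noteq> 0}" by auto
        then have g: "?g \<in> carrier PA" using f(1) by (auto simp: path_algebra_simps intro: finite_subset)
        have "{x. ?g x \<noteq> 0} \<subseteq> S" using f(2) by auto
        then have "P ?g" using insert g by blast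
        moreover have "?b \<in> carrier PA" by (rule scal_in_PA[OF basis_in_PA[OF x]])
        ultimately have "P (\<lambda>y. ?g y + ?b y)" using add g basis[OF x] by blast
        moreover have "(\<lambda>y. ?g y + ?b y) = f" by (auto simp: basis_path_def)
        ultimately show ?thesis by simp
      qed
    qed
  qed
  then show ?thesis using assms(1) PA_finite by blast
qed

lemma mult_PA:
  "(f \<otimes>\<^bsub>PA\<^esub> g) (u, p) = (\<Sum>j\<le>length p. f (path_end G (u, take j p), drop j p) * g (u, take j p))"
  by (simp add: path_algebra_def awlast_eq_path_end)

lemma mult_basis:
  "basis_path x \<otimes>\<^bsub>PA\<^esub> basis_path y =
    (if fst x = path_end G y then basis_path (fst y, snd y @ snd x) else (\<lambda>_. 0 :: 'k::field))"
proof (rule ext, clarify)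
  fix u p
  let ?t = "\<lambda>j. basis_path x (path_end G (u, take j p), drop j p) * (basis_path y (u, take j p) :: 'k)"
  have t: "?t j = (if (path_end G (u, take j p), drop j p) = x \<and> (u, take j p) = y then 1 else 0)" for j
    by (auto simp: basis_path_def)
  show "(basis_path x \<otimes>\<^bsub>PA\<^esub> basis_path y) (u, p) =
    (if fst x = path_end G y then basis_path (fst y, snd y @ snd x) else (\<lambda>_. 0 :: 'k)) (u, p)"
  proof (cases "fst x = path_end G y \<and> (u, p) = (fst y, snd y @ snd x)")
    case True
    then have "?t j = (if j = length (snd y) then 1 else 0)" if "j \<le> length p" for j
    proof (cases "j = length (snd y)")
      case False
      then have "length (take j p) \<noteq> length (snd y)" using that by simp
      then show ?thesis unfolding t using False by auto
    next
      case j: True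
      then have "take j p = snd y" "drop j p = snd x" using True by auto
      then show ?thesis unfolding t using True j by (cases x; cases y) auto
    qed
    then have "(\<Sum>j\<le>length p. ?t j) = (\<Sum>j\<le>length p. if j = length (snd y) then 1 else 0)"
      by (intro sum.cong) auto
    also have "\<dots> = 1" using True by (simp add: sum.delta)
    finally show ?thesis using True by (simp add: mult_PA basis_path_def)
  next
    case False
    have "?t j = 0" for j
    proof -
      have "\<not> ((path_end G (u, take j p), drop j p) = x \<and> (u, take j p) = y)"
        using False by (cases x; cases y) auto
      then show ?thesis unfolding t by simp
    qed
    then have "(\<Sum>j\<le>length p. ?t j) = 0" by (intro sum.neutral) blast
    then show ?thesis using False by (auto simp: mult_PA basis_path_def)
  qed
qed

lemma mult_l_distr: "(\<lambda>x. f x + g x) \<otimes>\<^bsub>PA\<^esub> h = (\<lambda>x. (f \<otimes>\<^bsub>PA\<^esub> h) x + (g \<otimes>\<^bsub>PA\<^esub> h) x)"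
  and mult_r_distr: "h \<otimes>\<^bsub>PA\<^esub> (\<lambda>x. f x + g x) = (\<lambda>x. (h \<otimes>\<^bsub>PA\<^esub> f) x + (h \<otimes>\<^bsub>PA\<^esub> g) x)"
  and mult_l_scal: "(\<lambda>x. c * f x) \<otimes>\<^bsub>PA\<^esub> h = (\<lambda>x. c * (f \<otimes>\<^bsub>PA\<^esub> h) x)"
  and mult_r_scal: "h \<otimes>\<^bsub>PA\<^esub> (\<lambda>x. c * f x) = (\<lambda>x. c * (h \<otimes>\<^bsub>PA\<^esub> f) x)"
  and mult_l_zero: "(\<lambda>_. 0) \<otimes>\<^bsub>PA\<^esub> h = (\<lambda>_. 0)"
  and mult_r_zero: "h \<otimes>\<^bsub>PA\<^esub> (\<lambda>_. 0) = (\<lambda>_. 0)"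
  by (auto simp: fun_eq_iff mult_PA distrib_left distrib_right sum.distrib sum_distrib_left mult_ac)

lemmas mult_lin = mult_l_distr mult_r_distr mult_l_scal mult_r_scal mult_l_zero mult_r_zero

lemma mult_basis_in_PA:
  assumes "x \<in> paths G" "y \<in> paths G"
  shows "basis_path x \<otimes>\<^bsub>PA\<^esub> basis_path y \<in> carrier PA"
  using assms by (cases x; cases y) (auto simp: mult_basis basis_in_PA zero_in_PA paths_append)

lemma mult_in_PA:
  assumes "f \<in> carrier PA" "g \<in> carrier PA"
  shows "f \<otimes>\<^bsub>PA\<^esub> g \<in> carrier PA"
  using assms(1)
proof (induction f rule: PA_induct)
  case (basis c x)
  show ?case using assms(2)
  proof (induction g rule: PA_induct)
    case (basis d y)
    show ?case unfolding mult_lin by (intro scal_in_PA mult_basis_in_PA basis \<open>x \<in> paths G\<close>)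
  qed (simp_all add: mult_lin zero_in_PA add_in_PA)
qed (simp_all add: mult_lin zero_in_PA add_in_PA)

lemma mult_assoc_PA:
  assumes "f \<in> carrier PA" "g \<in> carrier PA" "h \<in> carrier PA"
  shows "(f \<otimes>\<^bsub>PA\<^esub> g) \<otimes>\<^bsub>PA\<^esub> h = f \<otimes>\<^bsub>PA\<^esub> (g \<otimes>\<^bsub>PA\<^esub> h)"
  using assms(1)
proof (induction f rule: PA_induct)
  case (basis c x)
  show ?case using assms(2)
  proof (induction g rule: PA_induct)
    case (basis d y)
    show ?case using assms(3)
    proof (induction h rule: PA_induct)
      case (basis e z)
      have "path_end G (fst z, snd z @ snd y) = path_end G y" if "fst y = path_end G z"
        using that by (cases y; cases z) (simp add: path_end_append)
      then show ?case by (auto simp: mult_lin mult_basis)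
    qed (simp_all add: mult_lin)
  qed (simp_all add: mult_lin)
qed (simp_all add: mult_lin)

lemma one_PA: "\<one>\<^bsub>PA\<^esub> (u, p) = (if u \<in> verts G \<and> p = [] then 1 else 0)"
  by (simp add: path_algebra_def)

lemma one_in_PA: "\<one>\<^bsub>PA\<^esub> \<in> carrier (PA :: ('k::field, _) module)"
proof -
  have "{x. \<one>\<^bsub>PA\<^esub> x \<noteq> (0::'k)} = (\<lambda>u. (u, [])) ` verts G"
    by (auto simp: one_PA split: if_splits)
  then show ?thesis using finite_verts by (auto simp: path_algebra_simps(1))
qed

lemma one_mult_PA: "f \<in> carrier PA ==> \<one>\<^bsub>PA\<^esub> \<otimes>\<^bsub>PA\<^esub> f = (f :: _ => 'k::field)"
proof (rule ext, clarify)
  fix u p assume f: "f \<in> carrier PA"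
  have "(\<one>\<^bsub>PA\<^esub> \<otimes>\<^bsub>PA\<^esub> f) (u, p) =
      (\<Sum>j\<le>length p. if j = length p then (if path_end G (u, p) \<in> verts G then f (u, p) else 0) else 0)"
    unfolding mult_PA by (rule sum.cong) (auto simp: one_PA)
  also have "\<dots> = f (u, p)" using PA_paths[OF f] path_end_in_verts by (auto simp: sum.delta)
  finally show "(\<one>\<^bsub>PA\<^esub> \<otimes>\<^bsub>PA\<^esub> f) (u, p) = f (u, p)" .
qed

lemma mult_one_PA: "f \<in> carrier PA ==> f \<otimes>\<^bsub>PA\<^esub> \<one>\<^bsub>PA\<^esub> = (f :: _ => 'k::field)"
proof (rule ext, clarify)
  fix u p assume f: "f \<in> carrier PA"
  have "(f \<otimes>\<^bsub>PA\<^esub> \<one>\<^bsub>PA\<^esub>) (u, p) =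
      (\<Sum>j\<le>length p. if j = 0 then (if u \<in> verts G then f (u, p) else 0) else 0)"
    unfolding mult_PA by (rule sum.cong) (auto simp: one_PA)
  also have "\<dots> = f (u, p)" using PA_paths[OF f] path_start_in_verts by (auto simp: sum.delta)
  finally show "(f \<otimes>\<^bsub>PA\<^esub> \<one>\<^bsub>PA\<^esub>) (u, p) = f (u, p)" .
qed

lemma kalg_PA: "kalg (PA :: ('k::field, _) module)"
proof -
  have "abelian_group (PA :: ('k, _) module)"
  proof (rule abelian_groupI)
    fix f :: "_ => 'k" assume "f \<in> carrier PA"
    then show "\<exists>g\<in>carrier PA. g \<oplus>\<^bsub>PA\<^esub> f = \<zero>\<^bsub>PA\<^esub>"
      by (intro bexI[of _ "\<lambda>x. (-1) * f x"] scal_in_PA) (simp_all add: path_algebra_simps(2-3))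
  qed (auto simp: path_algebra_simps(2-4) add_in_PA zero_in_PA add_ac)
  then have "ring (PA :: ('k, _) module)"
    by (rule ringI)
      (auto intro!: monoidI simp: mult_in_PA one_in_PA one_mult_PA mult_one_PA mult_assoc_PA
        path_algebra_simps(2-4) mult_lin)
  then interpret ring "PA :: ('k, _) module" .
  show ?thesis
    by unfold_locales
      (auto simp: scal_in_PA path_algebra_simps(3-4) distrib_left distrib_right mult_lin mult.assoc)
qed

lemma arrow_mult_basis:
  assumes "(u, p @ [b]) \<in> paths G"
  shows "basis_path (u, p @ [b]) = basis_arrow G b \<otimes>\<^bsub>PA\<^esub> basis_path (u, p)"
  using assms by (auto simp: basis_arrow_def mult_basis paths_snoc)

subsection \<open>Thin modules\<close>

text \<open>
  A set \<open>W\<close> of vertices and a set \<open>S\<close> of arrows give a module with one basis vector at each vertex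
  of \<open>W\<close>, on which the arrows in \<open>S\<close> act as in a string module.
\<close>

definition thin_arrow :: "'b set => 'b => ('v => 'k::field) => 'v => 'k" where
  "thin_arrow S b x = (\<lambda>v. if b \<in> S \<and> v = head G b then x (tail G b) else 0)"

definition thin_path :: "'b set => 'v \<times> 'b list => ('v => 'k::field) => 'v => 'k" where
  "thin_path S = (\<lambda>(u, p) x. fold (thin_arrow S) p (\<lambda>v. if v = u then x v else 0))"

definition thin_module :: "'v set => 'b set => ('v \<times> 'b list => 'k::field, 'v => 'k) module" where
  "thin_module W S =
    \<lparr>carrier = {x. {v. x v \<noteq> 0} \<subseteq> W}, monoid.mult = undefined, one = undefined,
     zero = (\<lambda>_. 0), add = (\<lambda>x y v. x v + y v),
     smult = (\<lambda>f x v. lin (\<lambda>q. thin_path S q x v) f)\<rparr>"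

lemma string_module_thin:
  "path_algebra_string_module G w =
    (thin_module (walk_verts G w) (walk_arrows w) :: ('v \<times> 'b list => 'k::field, 'v => 'k) module)"
proof -
  have "(string_arrow G w :: 'b => ('v => 'k) => _) = thin_arrow (walk_arrows w)"
    by (simp add: string_arrow_def thin_arrow_def fun_eq_iff)
  then have "(string_path G w :: _ => ('v => 'k) => _) = thin_path (walk_arrows w)"
    unfolding string_path_def thin_path_def by simp
  then show ?thesis
    unfolding path_algebra_string_module_def thin_module_def lin_def by simp
qed

lemma thin_module_simps:
  "carrier (thin_module W S) = {x. {v. x v \<noteq> 0} \<subseteq> W}"
  "zero (thin_module W S) = (\<lambda>_. 0)"
  "add (thin_module W S) = (\<lambda>x y v. x v + y v)"
  "smult (thin_module W S) f x = (\<lambda>v. lin (\<lambda>q. thin_path S q x v) f)"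
  by (simp_all add: thin_module_def)

lemma thin_path_Nil [simp]: "thin_path S (u, []) x = (\<lambda>v. if v = u then x v else 0)"
  and thin_path_snoc [simp]: "thin_path S (u, p @ [b]) x = thin_arrow S b (thin_path S (u, p) x)"
  by (simp_all add: thin_path_def)

lemma thin_path_support: "v \<noteq> path_end G (u, p) ==> thin_path S (u, p) x v = 0"
  by (induction p rule: rev_induct) (auto simp: thin_arrow_def)

lemma thin_path_lin:
  "thin_path S q (\<lambda>v. x v + y v) = (\<lambda>v. thin_path S q x v + thin_path S q y v)"
  "thin_path S q (\<lambda>v. c * x v) = (\<lambda>v. c * thin_path S q x v)"
proof -
  obtain u p where q: "q = (u, p)" by (cases q)
  show "thin_path S q (\<lambda>v. x v + y v) = (\<lambda>v. thin_path S q x v + thin_path S q y v)"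
    "thin_path S q (\<lambda>v. c * x v) = (\<lambda>v. c * thin_path S q x v)"
    unfolding q by (induction p rule: rev_induct) (auto simp: thin_arrow_def fun_eq_iff)
qed

lemma thin_path_append:
  "thin_path S (u, p @ q) x = thin_path S (path_end G (u, p), q) (thin_path S (u, p) x)"
proof (induction q rule: rev_induct)
  case Nil
  then show ?case using thin_path_support[of _ u p] by (auto simp: fun_eq_iff)
next
  case (snoc b q)
  then show ?case by (simp flip: append_assoc)
qed

lemma thin_path_wrong_start: "u \<noteq> path_end G (u', p') ==> thin_path S (u, p) (thin_path S (u', p') x) = (\<lambda>_. 0)"
proof (induction p rule: rev_induct)
  case Nil
  then show ?case using thin_path_support[of u u' p'] by (auto simp: fun_eq_iff)
qed (simp add: thin_arrow_def)

lemma thin_act_add: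
  "f \<in> carrier PA ==> g \<in> carrier PA ==> (\<lambda>x. f x + g x) \<odot>\<^bsub>thin_module W S\<^esub> x =
      (\<lambda>v. (f \<odot>\<^bsub>thin_module W S\<^esub> x) v + (g \<odot>\<^bsub>thin_module W S\<^esub> x) v)"
  by (simp add: thin_module_simps lin_add PA_finite)

lemma thin_act_lin:
  "(\<lambda>x. c * f x) \<odot>\<^bsub>thin_module W S\<^esub> x = (\<lambda>v. c * (f \<odot>\<^bsub>thin_module W S\<^esub> x) v)"
  "f \<odot>\<^bsub>thin_module W S\<^esub> (\<lambda>v. y v + z v) =
      (\<lambda>v. (f \<odot>\<^bsub>thin_module W S\<^esub> y) v + (f \<odot>\<^bsub>thin_module W S\<^esub> z) v)"
  "f \<odot>\<^bsub>thin_module W S\<^esub> (\<lambda>v. d * y v) = (\<lambda>v. d * (f \<odot>\<^bsub>thin_module W S\<^esub> y) v)"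
  "(\<lambda>_. 0) \<odot>\<^bsub>thin_module W S\<^esub> y = (\<lambda>_. 0)"
  by (simp_all add: thin_module_simps lin_scal thin_path_lin lin_fun_add lin_fun_scal)

lemma thin_act_basis: "basis_path q \<odot>\<^bsub>thin_module W S\<^esub> x = thin_path S q x"
  by (simp add: thin_module_simps)

lemma thin_act_mult:
  assumes "f \<in> carrier PA" "g \<in> carrier PA"
  shows "(f \<otimes>\<^bsub>PA\<^esub> g) \<odot>\<^bsub>thin_module W S\<^esub> x = f \<odot>\<^bsub>thin_module W S\<^esub> (g \<odot>\<^bsub>thin_module W S\<^esub> x)"
proof -
  have z: "f \<odot>\<^bsub>thin_module W S\<^esub> (\<lambda>_. 0) = (\<lambda>_. 0)" for f
    using thin_act_lin(3)[of W S f 0 "\<lambda>_. 0"] by simp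
  show ?thesis using assms(1)
  proof (induction f rule: PA_induct)
    case (basis c p)
    show ?case using assms(2)
    proof (induction g rule: PA_induct)
      case (basis d q)
      have "(basis_path p \<otimes>\<^bsub>PA\<^esub> basis_path q) \<odot>\<^bsub>thin_module W S\<^esub> x = thin_path S p (thin_path S q x)"
        by (cases p; cases q)
          (auto simp: mult_basis thin_act_basis thin_act_lin(4) thin_path_append thin_path_wrong_start)
      then show ?case by (simp only: mult_lin thin_act_lin thin_act_basis)
    next
      case zero
      then show ?case by (simp only: mult_lin thin_act_lin z)
    next
      case (add f g)
      have cp: "(\<lambda>y. c * basis_path p y) \<in> carrier PA" by (rule scal_in_PA[OF basis_in_PA[OF \<open>p \<in> paths G\<close>]])
      show ?case using add(3,4)
        by (simp only: mult_r_distr thin_act_add[OF mult_in_PA[OF cp add(1)] mult_in_PA[OF cp add(2)]]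
            thin_act_add[OF add(1,2)] thin_act_lin(2))
    qed
  next
    case zero
    then show ?case by (simp only: mult_lin thin_act_lin)
  next
    case (add f f')
    then show ?case
      by (simp only: mult_l_distr thin_act_add[OF add(1,2)]
          thin_act_add[OF mult_in_PA[OF add(1) assms(2)] mult_in_PA[OF add(2) assms(2)]])
  qed
qed

lemma left_module_thin:
  assumes "W \<subseteq> verts G" "\<And>b. b \<in> S ==> head G b \<in> W"
  shows "left_module PA (thin_module W S :: ('v \<times> 'b list => 'k::field, _) module)"
proof -
  interpret PA: kalg "PA :: ('k, _) module" by (rule kalg_PA)
  let ?M = "thin_module W S :: ('v \<times> 'b list => 'k::field, _) module"
  interpret M: abelian_group ?M
  proof (rule abelian_groupI)
    fix x assume "x \<in> carrier ?M"
    then show "\<exists>y\<in>carrier ?M. y \<oplus>\<^bsub>?M\<^esub> x = \<zero>\<^bsub>?M\<^esub>"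
      by (intro bexI[of _ "\<lambda>v. - x v"]) (auto simp: thin_module_simps)
  next
    fix x y assume "x \<in> carrier ?M" "y \<in> carrier ?M"
    then show "x \<oplus>\<^bsub>?M\<^esub> y \<in> carrier ?M"
      by (simp add: thin_module_simps subset_iff) (metis add.right_neutral)
  qed (auto simp: thin_module_simps add_ac)
  have path: "thin_path S q x v = 0" if "x \<in> carrier ?M" "v \<notin> W" for q x v
  proof -
    obtain u p where "q = (u, p)" by (cases q)
    then show ?thesis
      using that assms(2) by (induction p arbitrary: q rule: rev_induct) (auto simp: thin_arrow_def thin_module_simps)
  qed
  show ?thesis
  proof unfold_locales
    fix f x assume "f \<in> carrier (PA :: ('k, _) module)" "x \<in> carrier ?M"
    show "f \<odot>\<^bsub>?M\<^esub> x \<in> carrier ?M"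
    proof -
      have "(f \<odot>\<^bsub>?M\<^esub> x) v = 0" if "v \<notin> W" for v
        unfolding thin_module_simps(4) lin_def
        by (rule sum.neutral) (simp add: path[OF \<open>x \<in> carrier ?M\<close> that])
      then show ?thesis by (auto simp: thin_module_simps(1))
    qed
  next
    fix x assume x: "x \<in> carrier ?M"
    show "\<one>\<^bsub>PA\<^esub> \<odot>\<^bsub>?M\<^esub> x = x"
    proof
      fix v
      have "(\<one>\<^bsub>PA\<^esub> \<odot>\<^bsub>?M\<^esub> x) v = (\<Sum>q\<in>(\<lambda>u. (u, [])) ` verts G. \<one>\<^bsub>PA\<^esub> q * thin_path S q x v)"
        unfolding thin_module_simps
        by (rule lin_superset) (use finite_verts in \<open>auto simp: one_PA split: if_splits\<close>)
      also have "\<dots> = (\<Sum>u\<in>verts G. if v = u then x u else 0)"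
        by (subst sum.reindex) (auto simp: inj_on_def one_PA intro!: sum.cong)
      also have "\<dots> = x v" using x assms(1) finite_verts by (auto simp: thin_module_simps)
      finally show "(\<one>\<^bsub>PA\<^esub> \<odot>\<^bsub>?M\<^esub> x) v = x v" .
    qed
  qed (simp_all only: thin_act_mult path_algebra_simps(3) thin_module_simps(3) thin_act_lin thin_act_add)
qed

lemma thin_act_arrow:
  "basis_arrow G b \<odot>\<^bsub>thin_module W S\<^esub> x = thin_arrow S b x"
  using thin_path_snoc[of S "tail G b" "[]" b x]
  by (auto simp: basis_arrow_def thin_act_basis thin_arrow_def)

end

section \<open>The preprojective algebra in coordinates\<close>

locale type_A =
  fixes n :: nat and Q :: "(nat, 'b) pre_digraph"
  assumes n_pos: "n \<ge> 1" and orientation: "A_orientation n Q"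
begin

abbreviation D :: "(nat, 'b + 'b) pre_digraph" where "D \<equiv> double_quiver Q"

definition edge :: "nat => 'b" where
  "edge i = (THE a. a \<in> arcs Q \<and> {tail Q a, head Q a} = {i, Suc i})"

lemma edge_bij: "bij_betw edge {1..<n} (arcs Q)"
  and edge_ends: "1 \<le> i ==> i < n ==> {tail Q (edge i), head Q (edge i)} = {i, Suc i}"
proof -
  let ?f = "\<lambda>a. {tail Q a, head Q a}" and ?g = "\<lambda>i. {i, Suc i}"
  have "{{i, Suc i} | i. 1 \<le> i \<and> i < n} = ?g ` {1..<n}" by auto
  then have f: "inj_on ?f (arcs Q)" "?f ` arcs Q = ?g ` {1..<n}"
    using orientation by (simp_all add: A_orientation_def bij_betw_def)
  have uniq: "\<exists>!a. a \<in> arcs Q \<and> ?f a = ?g i" if "1 \<le> i" "i < n" for i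
  proof -
    have "?g i \<in> ?f ` arcs Q" unfolding f(2) using that by auto
    then obtain a where "a \<in> arcs Q" "?f a = ?g i" by auto
    then show ?thesis
      by (intro ex1I[of _ a]) (simp, metis (no_types, lifting) inj_onD[OF f(1)])
  qed
  have e: "edge i \<in> arcs Q" "?f (edge i) = ?g i" if "1 \<le> i" "i < n" for i
    using theI'[OF uniq[OF that]] by (auto simp: edge_def)
  show "1 \<le> i ==> i < n ==> ?f (edge i) = ?g i" by (rule e)
  have g: "i = j" if "?g i = ?g j" for i j
    using that by (auto simp: doubleton_eq_iff)
  have "inj_on edge {1..<n}"
    by (rule inj_onI) (metis e(2) g atLeastLessThan_iff)
  moreover have "a \<in> edge ` {1..<n}" if "a \<in> arcs Q" for a
  proof -
    have "?f a \<in> ?g ` {1..<n}" unfolding f(2)[symmetric] using that by (rule imageI)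
    then obtain i where i: "1 \<le> i" "i < n" "?f a = ?g i" by auto
    then have "a = edge i" using uniq[of i] e[of i] that by blast
    then show ?thesis using i by auto
  qed
  ultimately show "bij_betw edge {1..<n} (arcs Q)" using e(1) by (auto simp: bij_betw_def)
qed

lemma finite_arcs_Q: "finite (arcs Q)"
  using edge_bij bij_betw_finite by blast

lemma verts_D [simp]: "verts D = {1..n}"
  using orientation by (simp add: A_orientation_def double_quiver_def)

lemma double_ends: "tail D (Inl a) = tail Q a" "tail D (Inr a) = head Q a"
    "head D (Inl a) = head Q a" "head D (Inr a) = tail Q a"
  by (simp_all add: double_quiver_def)

text \<open>The arrows of the double: \<open>up i\<close> goes from \<open>i\<close> to \<open>i + 1\<close> and \<open>dn i\<close> goes back.\<close>

definition up :: "nat => 'b + 'b" where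
  "up i = (if tail Q (edge i) = i then Inl (edge i) else Inr (edge i))"

definition dn :: "nat => 'b + 'b" where
  "dn i = (if tail Q (edge i) = i then Inr (edge i) else Inl (edge i))"

definition eps :: "nat => 'k::field" where
  "eps i = (if tail Q (edge i) = i then 1 else - 1)"

lemma eps_square [simp]: "eps i * eps i = (1 :: 'k::field)" "eps i * (eps i * x) = (x :: 'k)"
  by (simp_all add: eps_def)

lemma edge_cases:
  assumes "1 \<le> i" "i < n"
  shows "tail Q (edge i) = i \<and> head Q (edge i) = Suc i \<or> tail Q (edge i) = Suc i \<and> head Q (edge i) = i"
  using edge_ends[OF assms] by (auto simp: doubleton_eq_iff)

lemma tail_head [simp]:
  assumes "1 \<le> i" "i < n"
  shows "tail D (up i) = i" "head D (up i) = Suc i" "tail D (dn i) = Suc i" "head D (dn i) = i"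
  using edge_cases[OF assms] by (auto simp: up_def dn_def double_quiver_def)

lemma arcs_D: "arcs D = up ` {1..<n} \<union> dn ` {1..<n}"
proof -
  have "arcs D = (\<Union>a\<in>arcs Q. {Inl a, Inr a})" by (auto simp: double_quiver_def)
  also have "\<dots> = (\<Union>i\<in>{1..<n}. {Inl (edge i), Inr (edge i)})"
  proof -
    have e: "arcs Q = edge ` {1..<n}" using edge_bij by (simp add: bij_betw_def)
    show ?thesis unfolding e by simp
  qed
  also have "\<dots> = (\<Union>i\<in>{1..<n}. {up i, dn i})"
    by (intro SUP_cong refl) (auto simp: up_def dn_def)
  finally show ?thesis by auto
qed

lemma arcs_DE:
  assumes "b \<in> arcs D"
  obtains (up) i where "1 \<le> i" "i < n" "b = up i" | (dn) i where "1 \<le> i" "i < n" "b = dn i"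
  using assms by (auto simp: arcs_D)

lemma up_in_arcs [simp]: "1 \<le> i ==> i < n ==> up i \<in> arcs D"
  and dn_in_arcs [simp]: "1 \<le> i ==> i < n ==> dn i \<in> arcs D"
  by (auto simp: arcs_D)

lemma arc_eqI:
  assumes "b \<in> arcs D" "c \<in> arcs D" "tail D b = tail D c" "head D b = head D c"
  shows "b = c"
  using assms(1)
proof (cases rule: arcs_DE)
  case (up i)
  show ?thesis using assms(2) by (cases rule: arcs_DE) (use up assms(3,4) in auto)
next
  case (dn i)
  show ?thesis using assms(2) by (cases rule: arcs_DE) (use dn assms(3,4) in auto)
qed

end

sublocale type_A \<subseteq> D: quiver "double_quiver Q"
  by unfold_locales (auto elim: arcs_DE)

context type_A
begin

abbreviation PA :: "('k::field, ('b, 'k) path_elt) module" where "PA \<equiv> path_algebra D"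

subsection \<open>Counting descents along paths\<close>

definition descents :: "('b + 'b) list => nat" where
  "descents q = length (filter (\<lambda>b. head D b < tail D b) q)"

definition path_sign :: "('b + 'b) list => 'k::field" where
  "path_sign q = prod_list (map (\<lambda>b. if head D b < tail D b then eps (head D b) else 1) q)"

lemma descents_simps [simp]:
  "descents [] = 0" "descents (p @ q) = descents p + descents q"
  "1 \<le> i ==> i < n ==> descents (up i # q) = descents q"
  "1 \<le> i ==> i < n ==> descents (dn i # q) = Suc (descents q)"
  by (simp_all add: descents_def)

lemma path_sign_simps [simp]:
  "path_sign [] = 1" "path_sign (p @ q) = path_sign p * path_sign q"
  "1 \<le> i ==> i < n ==> path_sign (up i # q) = path_sign q"
  "1 \<le> i ==> i < n ==> path_sign (dn i # q) = eps i * path_sign q"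
  by (simp_all add: path_sign_def)

lemma path_sign_square [simp]: "path_sign q * path_sign q = (1 :: 'k::field)"
proof (induction q)
  case (Cons b q)
  have b: "path_sign [b] * path_sign [b] = (1 :: 'k)" by (simp add: path_sign_def)
  have "path_sign (b # q) * path_sign (b # q) = (path_sign [b] * path_sign [b]) * (path_sign q * path_sign q :: 'k)"
    by (simp add: path_sign_def mult_ac)
  then show ?case unfolding b Cons by simp
qed simp

lemma path_bounds:
  "(u, q) \<in> paths D ==> u \<le> path_end D (u, q) + descents q"
proof (induction q rule: rev_induct)
  case (snoc b q)
  then have b: "b \<in> arcs D" "path_end D (u, q) = tail D b" "(u, q) \<in> paths D" by (auto simp: D.paths_snoc)
  from b(1) show ?case by (cases rule: arcs_DE) (use snoc b in auto)
qed simp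

text \<open>
  \<open>coord f u p v\<close> adds up, with signs, the coefficients in \<open>f\<close> of the paths from \<open>u\<close> to \<open>v\<close> with \<open>p\<close>
  descents.  The preprojective relation says that such paths agree up to sign, and that they vanish
  unless \<open>p < u\<close> and \<open>p + v \<le> n\<close>.
\<close>

definition coord :: "('b, 'k::field) path_elt => nat => nat => nat => 'k" where
  "coord f u p v =
    lin (\<lambda>(u', q). if u' = u \<and> descents q = p \<and> path_end D (u', q) = v then path_sign q else 0) f"

definition cell :: "nat => nat => nat => bool" where
  "cell u p v \<longleftrightarrow> 1 \<le> u \<and> u \<le> n \<and> 1 \<le> v \<and> v \<le> n \<and> p < u \<and> p + v \<le> n \<and> u \<le> p + v"

lemma coord_add: "f \<in> carrier PA ==> g \<in> carrier PA ==>
    coord (\<lambda>x. f x + g x) u p v = coord f u p v + coord g u p v"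
  by (simp add: coord_def lin_add D.PA_finite)

lemma coord_scal: "coord (\<lambda>x. c * f x) u p v = c * coord f u p v"
  by (simp add: coord_def lin_scal)

lemma coord_zero [simp]: "coord (\<lambda>_. 0) u p v = 0"
  by (simp add: coord_def)

lemma coord_basis:
  "coord (basis_path (u', q)) u p v =
    (if u' = u \<and> descents q = p \<and> path_end D (u', q) = v then path_sign q else 0)"
  by (simp add: coord_def)

lemma coord_eq_0:
  assumes "f \<in> carrier PA" "\<not> (u \<le> p + v \<and> 1 \<le> u \<and> u \<le> n \<and> 1 \<le> v \<and> v \<le> n)"
  shows "coord f u p v = 0"
  using assms(1)
proof (induction f rule: D.PA_induct)
  case (basis c x)
  obtain u' q where x: "x = (u', q)" by (cases x)
  then show ?case using basis path_bounds[of u' q] D.path_start_in_verts[of u' q] D.path_end_in_verts[of u' q] assms(2)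
    by (auto simp: coord_scal coord_basis)
qed (simp_all add: coord_add)

lemma coord_up_mult:
  assumes "f \<in> carrier PA" "1 \<le> i" "i < n"
  shows "coord (basis_arrow D (up i) \<otimes>\<^bsub>PA\<^esub> f) u p v = (if v = Suc i then coord f u p i else 0)"
  using assms(1)
proof (induction f rule: D.PA_induct)
  case (basis c x)
  then show ?case using assms(2,3)
    by (cases x) (auto simp: D.mult_lin coord_scal coord_basis basis_arrow_def D.mult_basis path_end_append)
qed (use assms(2,3) in \<open>simp_all add: D.mult_lin coord_add D.mult_in_PA\<close>)

lemma coord_dn_mult:
  assumes "f \<in> carrier PA" "1 \<le> i" "i < n"
  shows "coord (basis_arrow D (dn i) \<otimes>\<^bsub>PA\<^esub> f) u p v =
    (if v = i \<and> 0 < p then eps i * coord f u (p - 1) (Suc i) else 0)"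
  using assms(1)
proof (induction f rule: D.PA_induct)
  case (basis c x)
  then show ?case using assms(2,3)
    by (cases x) (auto simp: D.mult_lin coord_scal coord_basis basis_arrow_def D.mult_basis path_end_append)
qed (use assms(2,3) in \<open>simp_all add: D.mult_lin coord_add D.mult_in_PA distrib_left\<close>)

lemma coord_mult_up:
  assumes "f \<in> carrier PA" "1 \<le> i" "i < n"
  shows "coord (f \<otimes>\<^bsub>PA\<^esub> basis_arrow D (up i)) u p v = (if u = i then coord f (Suc i) p v else 0)"
  using assms(1)
proof (induction f rule: D.PA_induct)
  case (basis c x)
  then show ?case using assms(2,3)
    by (cases x) (auto simp: D.mult_lin coord_scal coord_basis basis_arrow_def D.mult_basis)
qed (use assms(2,3) in \<open>simp_all add: D.mult_lin coord_add D.mult_in_PA\<close>)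

lemma coord_mult_dn:
  assumes "f \<in> carrier PA" "1 \<le> i" "i < n"
  shows "coord (f \<otimes>\<^bsub>PA\<^esub> basis_arrow D (dn i)) u p v =
    (if u = Suc i \<and> 0 < p then eps i * coord f i (p - 1) v else 0)"
  using assms(1)
proof (induction f rule: D.PA_induct)
  case (basis c x)
  then show ?case using assms(2,3)
    by (cases x) (auto simp: D.mult_lin coord_scal coord_basis basis_arrow_def D.mult_basis)
qed (use assms(2,3) in \<open>simp_all add: D.mult_lin coord_add D.mult_in_PA distrib_left\<close>)

lemma coord_vertex_mult:
  assumes "f \<in> carrier PA" "w \<in> {1..n}"
  shows "coord (basis_path (w, []) \<otimes>\<^bsub>PA\<^esub> f) u p v = (if v = w then coord f u p v else 0)"
    and "coord (f \<otimes>\<^bsub>PA\<^esub> basis_path (w, [])) u p v = (if u = w then coord f u p v else 0)"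
  using assms(1)
proof (induction f rule: D.PA_induct)
  case (basis c x)
  {
    case 1
    then show ?case by (cases x) (auto simp: D.mult_lin coord_scal coord_basis D.mult_basis)
  next
    case 2
    then show ?case by (cases x) (auto simp: D.mult_lin coord_scal coord_basis D.mult_basis)
  }
qed (use assms(2) in \<open>simp_all add: D.mult_lin coord_add D.mult_in_PA D.basis_in_PA\<close>)

text \<open>
  A path is a product of arrows, so a subspace stable under vertices and arrows is stable under all paths.
\<close>

lemma left_mult_induct:
  assumes f: "f \<in> carrier PA" and g: "g \<in> carrier PA" "P (g :: ('b, 'k::field) path_elt)"
    and add: "\<And>g h. g \<in> carrier PA ==> h \<in> carrier PA ==> P g ==> P h ==> P (\<lambda>x. g x + h x)"
    and scal: "\<And>c g. g \<in> carrier PA ==> P g ==> P (\<lambda>x. c * g x)"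
    and vertex: "\<And>g v. g \<in> carrier PA ==> P g ==> v \<in> {1..n} ==> P (basis_path (v, []) \<otimes>\<^bsub>PA\<^esub> g)"
    and arrow: "\<And>g b. g \<in> carrier PA ==> P g ==> b \<in> arcs D ==> P (basis_arrow D b \<otimes>\<^bsub>PA\<^esub> g)"
  shows "P (f \<otimes>\<^bsub>PA\<^esub> g)"
  using f
proof (induction f rule: D.PA_induct)
  case zero
  then show ?case using scal[OF g, of 0] by (simp add: D.mult_lin)
next
  case (add f f')
  then show ?case using assms(4) by (simp add: D.mult_lin D.mult_in_PA g)
next
  case (basis c x)
  obtain u q where x: "x = (u, q)" by (cases x)
  have "P (basis_path (u, q) \<otimes>\<^bsub>PA\<^esub> g)" using basis unfolding x
  proof (induction q rule: rev_induct)
    case Nil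
    then show ?case using vertex[OF g] by simp
  next
    case (snoc b q)
    then have q: "(u, q) \<in> paths D" and b: "b \<in> arcs D" by (auto simp: D.paths_snoc)
    have "P (basis_arrow D b \<otimes>\<^bsub>PA\<^esub> (basis_path (u, q) \<otimes>\<^bsub>PA\<^esub> g))"
      by (rule arrow) (use snoc q b g in \<open>auto intro: D.mult_in_PA D.basis_in_PA\<close>)
    then show ?case
      using snoc(2) q g(1) b by (simp add: D.arrow_mult_basis D.mult_assoc_PA D.basis_in_PA)
  qed
  then show ?case using scal basis x g(1) by (simp add: D.mult_lin D.mult_in_PA D.basis_in_PA)
qed

lemma right_mult_induct:
  assumes f: "f \<in> carrier PA" and g: "g \<in> carrier PA" "P (g :: ('b, 'k::field) path_elt)"
    and add: "\<And>g h. g \<in> carrier PA ==> h \<in> carrier PA ==> P g ==> P h ==> P (\<lambda>x. g x + h x)"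
    and scal: "\<And>c g. g \<in> carrier PA ==> P g ==> P (\<lambda>x. c * g x)"
    and vertex: "\<And>g v. g \<in> carrier PA ==> P g ==> v \<in> {1..n} ==> P (g \<otimes>\<^bsub>PA\<^esub> basis_path (v, []))"
    and arrow: "\<And>g b. g \<in> carrier PA ==> P g ==> b \<in> arcs D ==> P (g \<otimes>\<^bsub>PA\<^esub> basis_arrow D b)"
  shows "P (g \<otimes>\<^bsub>PA\<^esub> f)"
  using f
proof (induction f rule: D.PA_induct)
  case zero
  then show ?case using scal[OF g, of 0] by (simp add: D.mult_lin)
next
  case (add f f')
  then show ?case using assms(4) by (simp add: D.mult_lin D.mult_in_PA g)
next
  case (basis c x)
  obtain u q where x: "x = (u, q)" by (cases x)
  have "P (g \<otimes>\<^bsub>PA\<^esub> basis_path (u, q))" using basis unfolding x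
  proof (induction q arbitrary: u)
    case Nil
    then show ?case using vertex[OF g] by simp
  next
    case (Cons b q)
    from Cons.prems have q: "(head D b, q) \<in> paths D" and b: "b \<in> arcs D" and u: "u = tail D b"
      using D.paths_append[of u "[b]" q] by (auto simp: D.paths_single path_end_def)
    have eq: "basis_path (u, b # q) = basis_path (head D b, q) \<otimes>\<^bsub>PA\<^esub> (basis_arrow D b :: ('b, 'k) path_elt)"
      by (simp add: basis_arrow_def D.mult_basis path_end_def u)
    have "P ((g \<otimes>\<^bsub>PA\<^esub> basis_path (head D b, q)) \<otimes>\<^bsub>PA\<^esub> basis_arrow D b)"
      by (rule arrow) (use Cons.IH q b g in \<open>auto intro: D.mult_in_PA D.basis_in_PA\<close>)
    then show ?case
      using q g(1) b by (simp add: eq D.mult_assoc_PA D.basis_in_PA)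
  qed
  then show ?case using scal basis x g(1) by (simp add: D.mult_lin D.mult_in_PA D.basis_in_PA)
qed

lemma PA_minus:
  assumes "f \<in> carrier PA" "g \<in> carrier PA"
  shows "f \<ominus>\<^bsub>PA\<^esub> g = (\<lambda>x. f x - g x :: 'k::field)"
proof -
  interpret kalg "PA :: ('k, _) module" by (rule D.kalg_PA)
  have "\<ominus>\<^bsub>PA\<^esub> g = (\<lambda>x. (-1) * g x)"
    by (rule minus_equality) (use assms D.scal_in_PA[OF assms(2), of "-1"] in \<open>auto simp: path_algebra_simps(2,3)\<close>)
  then show ?thesis by (simp add: a_minus_def path_algebra_simps(3))
qed

text \<open>
  A left ideal spanned by paths is cut out by a depth function \<open>c\<close>: it contains the paths from \<open>u\<close> to
  \<open>v\<close> with at least \<open>c u v\<close> descents.  Depth at least \<open>n\<close> is out of reach, hence the constant \<open>n\<close>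
  stands for the zero ideal of the preprojective algebra.
\<close>

definition depth_ideal :: "(nat => nat => nat) => ('b, 'k::field) path_elt set" where
  "depth_ideal c = {f \<in> carrier PA. \<forall>u p v. cell u p v \<longrightarrow> p < c u v \<longrightarrow> coord f u p v = 0}"

lemma depth_idealD:
  assumes "f \<in> depth_ideal c"
  shows "f \<in> carrier PA" "p < u ==> p + v \<le> n ==> (cell u p v ==> p < c u v) ==> coord f u p v = 0"
proof -
  show f: "f \<in> carrier PA" using assms by (simp add: depth_ideal_def)
  assume "p < u" "p + v \<le> n" "cell u p v ==> p < c u v"
  then show "coord f u p v = 0"
    using assms coord_eq_0[OF f, of u p v] by (cases "cell u p v") (auto simp: depth_ideal_def cell_def)
qed

lemma depth_ideal_add: "f \<in> depth_ideal c ==> g \<in> depth_ideal c ==> (\<lambda>x. f x + g x) \<in> depth_ideal c"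
  and depth_ideal_scal: "f \<in> depth_ideal c ==> (\<lambda>x. a * f x) \<in> depth_ideal c"
  and depth_ideal_zero: "(\<lambda>_. 0) \<in> depth_ideal c"
  by (auto simp: depth_ideal_def coord_add coord_scal D.add_in_PA D.scal_in_PA D.zero_in_PA)

text \<open>
  Multiplication by an arrow on the left changes the end \<open>v\<close> by one, and the number of descents by one if the
  arrow descends.  The condition says that this never leaves the depth ideal.  On the right, the start \<open>u\<close> changes.
\<close>

definition left_stable :: "(nat => nat => nat) => bool" where
  "left_stable c \<longleftrightarrow> (\<forall>u p v. 1 \<le> v \<longrightarrow> v < n \<longrightarrow>
    (cell u p v \<longrightarrow> p < c u (Suc v) \<longrightarrow> p < c u v) \<and>
    (cell u p (Suc v) \<longrightarrow> Suc p < c u v \<longrightarrow> p < c u (Suc v)))"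

definition right_stable :: "(nat => nat => nat) => bool" where
  "right_stable c \<longleftrightarrow> (\<forall>u p v. 1 \<le> u \<longrightarrow> u < n \<longrightarrow>
    (cell (Suc u) p v \<longrightarrow> p < c u v \<longrightarrow> p < c (Suc u) v) \<and>
    (cell u p v \<longrightarrow> Suc p < c (Suc u) v \<longrightarrow> p < c u v))"

lemma depth_ideal_left_mult:
  assumes c: "left_stable c" and f: "f \<in> carrier PA" and g: "g \<in> depth_ideal c"
  shows "f \<otimes>\<^bsub>PA\<^esub> g \<in> depth_ideal c"
proof (rule left_mult_induct[where P = "\<lambda>g. g \<in> depth_ideal c", OF f depth_idealD(1)[OF g] g])
  fix g b assume g: "g \<in> depth_ideal c" and b: "b \<in> arcs D"
  note gc = depth_idealD(1)[OF g]
  have m: "basis_arrow D b \<otimes>\<^bsub>PA\<^esub> g \<in> carrier PA" using b gc by (simp add: D.mult_in_PA)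
  from b show "basis_arrow D b \<otimes>\<^bsub>PA\<^esub> g \<in> depth_ideal c"
  proof (cases rule: arcs_DE)
    case (up i)
    have "coord g u p i = 0" if "cell u p (Suc i)" "p < c u (Suc i)" for u p
      by (rule depth_idealD(2)[OF g]) (use that c up in \<open>auto simp: cell_def left_stable_def\<close>)
    then show ?thesis using m up by (auto simp: depth_ideal_def coord_up_mult[OF gc])
  next
    case (dn i)
    have "coord g u (p - 1) (Suc i) = 0" if "cell u p i" "p < c u i" "0 < p" for u p
    proof (rule depth_idealD(2)[OF g])
      assume "cell u (p - 1) (Suc i)"
      then have "Suc (p - 1) < c u i \<longrightarrow> p - 1 < c u (Suc i)" using c dn unfolding left_stable_def by blast
      then show "p - 1 < c u (Suc i)" using that by simp
    qed (use that dn in \<open>auto simp: cell_def\<close>)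
    then show ?thesis using m dn by (auto simp: depth_ideal_def coord_dn_mult[OF gc])
  qed
next
  fix g v assume g: "g \<in> depth_ideal c" and v: "v \<in> {1..n}"
  note gc = depth_idealD(1)[OF g]
  show "basis_path (v, []) \<otimes>\<^bsub>PA\<^esub> g \<in> depth_ideal c"
    using g v by (auto simp: depth_ideal_def D.mult_in_PA D.basis_in_PA coord_vertex_mult)
qed (simp_all add: depth_ideal_add depth_ideal_scal)

lemma depth_ideal_right_mult:
  assumes c: "right_stable c" and f: "f \<in> carrier PA" and g: "g \<in> depth_ideal c"
  shows "g \<otimes>\<^bsub>PA\<^esub> f \<in> depth_ideal c"
proof (rule right_mult_induct[where P = "\<lambda>g. g \<in> depth_ideal c", OF f depth_idealD(1)[OF g] g])
  fix g b assume g: "g \<in> depth_ideal c" and b: "b \<in> arcs D"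
  note gc = depth_idealD(1)[OF g]
  have m: "g \<otimes>\<^bsub>PA\<^esub> basis_arrow D b \<in> carrier PA" using b gc by (simp add: D.mult_in_PA)
  from b show "g \<otimes>\<^bsub>PA\<^esub> basis_arrow D b \<in> depth_ideal c"
  proof (cases rule: arcs_DE)
    case (up i)
    have "coord g (Suc i) p v = 0" if "cell i p v" "p < c i v" for p v
      by (rule depth_idealD(2)[OF g]) (use that c up in \<open>auto simp: cell_def right_stable_def\<close>)
    then show ?thesis using m up by (auto simp: depth_ideal_def coord_mult_up[OF gc])
  next
    case (dn i)
    have "coord g i (p - 1) v = 0" if "cell (Suc i) p v" "p < c (Suc i) v" "0 < p" for p v
    proof (rule depth_idealD(2)[OF g])
      assume "cell i (p - 1) v"
      then have "Suc (p - 1) < c (Suc i) v \<longrightarrow> p - 1 < c i v" using c dn unfolding right_stable_def by blast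
      then show "p - 1 < c i v" using that by simp
    qed (use that dn in \<open>auto simp: cell_def\<close>)
    then show ?thesis using m dn by (auto simp: depth_ideal_def coord_mult_dn[OF gc])
  qed
next
  fix g v assume g: "g \<in> depth_ideal c" and v: "v \<in> {1..n}"
  note gc = depth_idealD(1)[OF g]
  show "g \<otimes>\<^bsub>PA\<^esub> basis_path (v, []) \<in> depth_ideal c"
    using g v by (auto simp: depth_ideal_def D.mult_in_PA D.basis_in_PA coord_vertex_mult)
qed (simp_all add: depth_ideal_add depth_ideal_scal)

lemma depth_ideal_ideal:
  assumes "left_stable c" "right_stable c"
  shows "ideal (depth_ideal c) (PA :: ('k::field, _) module)"
proof -
  interpret kalg "PA :: ('k, _) module" by (rule D.kalg_PA)
  have "subgroup (depth_ideal c) (add_monoid (PA :: ('k, _) module))"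
  proof (rule add.subgroupI)
    show "depth_ideal c \<noteq> ({} :: ('b, 'k) path_elt set)" using depth_ideal_zero by blast
    show "depth_ideal c \<subseteq> carrier (PA :: ('k, _) module)" by (auto simp: depth_ideal_def)
    fix f :: "('b, 'k) path_elt" assume f: "f \<in> depth_ideal c"
    have "\<ominus>\<^bsub>PA\<^esub> f = (\<lambda>x. (-1) * f x)"
      by (rule minus_equality)
        (use depth_idealD(1)[OF f] D.scal_in_PA[OF depth_idealD(1)[OF f], of "-1"] in
          \<open>auto simp: path_algebra_simps(2,3)\<close>)
    then show "\<ominus>\<^bsub>PA\<^esub> f \<in> depth_ideal c"
      using depth_ideal_scal[OF f, of "-1"] by simp
    fix g :: "('b, 'k) path_elt" assume "g \<in> depth_ideal c"
    then show "f \<oplus>\<^bsub>PA\<^esub> g \<in> depth_ideal c" using f by (simp add: path_algebra_simps(3) depth_ideal_add)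
  qed
  then show ?thesis
    by (intro idealI ring_axioms) (use depth_ideal_left_mult depth_ideal_right_mult assms in auto)
qed

abbreviation coord_kernel :: "('b, 'k::field) path_elt set" where
  "coord_kernel \<equiv> depth_ideal (\<lambda>_ _. n)"

lemma coord_kernel_ideal: "ideal coord_kernel (PA :: ('k::field, _) module)"
  by (rule depth_ideal_ideal) (auto simp: left_stable_def right_stable_def)

lemma coord_kernel_iff: "f \<in> coord_kernel \<longleftrightarrow> f \<in> carrier PA \<and> (\<forall>u p v. cell u p v \<longrightarrow> coord f u p v = 0)"
  by (auto simp: depth_ideal_def cell_def)

lemma PA_finsum:
  assumes "finite A" "\<And>a. a \<in> A ==> g a \<in> carrier PA"
  shows "(\<Oplus>\<^bsub>PA\<^esub>a\<in>A. g a) = (\<lambda>x. \<Sum>a\<in>A. g a x :: 'k::field)"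
proof -
  interpret kalg "PA :: ('k, _) module" by (rule D.kalg_PA)
  show ?thesis using assms
    by (induction A rule: finite_induct) (simp_all add: path_algebra_simps(2,3) Pi_def)
qed

lemma relation_in_PA: "preproj_relation Q \<in> carrier (PA :: ('k::field, _) module)"
  and relation_eq: "preproj_relation Q = (\<lambda>x. \<Sum>i\<in>{1..<n}. eps i *
    (basis_path (Suc i, [dn i, up i]) x - basis_path (i, [up i, dn i]) x) :: 'k::field)"
proof -
  interpret kalg "PA :: ('k, _) module" by (rule D.kalg_PA)
  let ?t = "\<lambda>a. (basis_arrow D (Inl a) \<otimes>\<^bsub>PA\<^esub> basis_arrow D (Inr a)) \<ominus>\<^bsub>PA\<^esub>
          (basis_arrow D (Inr a) \<otimes>\<^bsub>PA\<^esub> basis_arrow D (Inl a)) :: ('b, 'k) path_elt"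
  have t: "?t a = (\<lambda>x. basis_path (head Q a, [Inr a, Inl a]) x - basis_path (tail Q a, [Inl a, Inr a]) x)"
    "?t a \<in> carrier PA" if a: "a \<in> arcs Q" for a
  proof -
    have "Inl a \<in> arcs D" "Inr a \<in> arcs D" using a by (auto simp: double_quiver_def)
    then have c: "basis_arrow D (Inl a) \<in> carrier (PA :: ('k, _) module)"
      "basis_arrow D (Inr a) \<in> carrier (PA :: ('k, _) module)"
      by auto
    then show "?t a \<in> carrier PA" by (simp add: D.mult_in_PA)
    have "basis_arrow D (Inl a) \<otimes>\<^bsub>PA\<^esub> basis_arrow D (Inr a) = (basis_path (head Q a, [Inr a, Inl a]) :: ('b, 'k) path_elt)"
      "basis_arrow D (Inr a) \<otimes>\<^bsub>PA\<^esub> basis_arrow D (Inl a) = (basis_path (tail Q a, [Inl a, Inr a]) :: ('b, 'k) path_elt)"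
      by (auto simp: basis_arrow_def D.mult_basis path_end_def double_ends)
    then show "?t a = (\<lambda>x. basis_path (head Q a, [Inr a, Inl a]) x - basis_path (tail Q a, [Inl a, Inr a]) x)"
      using PA_minus[OF D.mult_in_PA[OF c] D.mult_in_PA[OF c(2,1)]] by simp
  qed
  have rel: "preproj_relation Q = (\<Oplus>\<^bsub>PA\<^esub>a\<in>arcs Q. ?t a)"
    by (simp add: preproj_relation_def Let_def)
  show "preproj_relation Q \<in> carrier (PA :: ('k, _) module)"
    unfolding rel by (rule finsum_closed) (use t(2) in auto)
  have "preproj_relation Q = (\<lambda>x. \<Sum>a\<in>arcs Q. ?t a x)"
    unfolding rel by (rule PA_finsum) (use t(2) finite_arcs_Q in auto)
  also have "\<dots> = (\<lambda>x. \<Sum>a\<in>arcs Q. basis_path (head Q a, [Inr a, Inl a]) x - basis_path (tail Q a, [Inl a, Inr a]) x)"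
    using t(1) by (intro ext sum.cong) auto
  also have "\<dots> = (\<lambda>x. \<Sum>i\<in>{1..<n}. basis_path (head Q (edge i), [Inr (edge i), Inl (edge i)]) x
      - basis_path (tail Q (edge i), [Inl (edge i), Inr (edge i)]) x)"
    using sum.reindex_bij_betw[OF edge_bij] by (intro ext) (rule sym)
  also have "\<dots> = (\<lambda>x. \<Sum>i\<in>{1..<n}. eps i *
    (basis_path (Suc i, [dn i, up i]) x - basis_path (i, [up i, dn i]) x))"
  proof (intro ext sum.cong refl)
    fix x i assume "i \<in> {1..<n}"
    then show "basis_path (head Q (edge i), [Inr (edge i), Inl (edge i)]) x
      - basis_path (tail Q (edge i), [Inl (edge i), Inr (edge i)]) x =
      eps i * (basis_path (Suc i, [dn i, up i]) x - basis_path (i, [up i, dn i]) x)"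
      using edge_cases[of i] by (auto simp: eps_def up_def dn_def)
  qed
  finally show "preproj_relation Q = (\<lambda>x. \<Sum>i\<in>{1..<n}. eps i *
    (basis_path (Suc i, [dn i, up i]) x - basis_path (i, [up i, dn i]) x) :: 'k)" .
qed

lemma paths_two_cycle [simp]:
  assumes "1 \<le> i" "i < n"
  shows "(i, [up i, dn i]) \<in> paths D" "(Suc i, [dn i, up i]) \<in> paths D"
  using assms D.paths_snoc[of i "[up i]" "dn i"] D.paths_snoc[of "Suc i" "[dn i]" "up i"]
  by (auto simp: D.paths_single path_end_def)

lemma lin_sum:
  assumes "finite A" "\<And>a. a \<in> A ==> g a \<in> carrier PA"
  shows "lin h (\<lambda>x. \<Sum>a\<in>A. g a x) = (\<Sum>a\<in>A. lin h (g a) :: 'k::field)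
    \<and> (\<lambda>x. \<Sum>a\<in>A. g a x) \<in> carrier PA"
  using assms
  by (induction A rule: finite_induct) (auto simp: D.zero_in_PA lin_add D.PA_finite D.add_in_PA)

lemma relation_in_kernel: "preproj_relation Q \<in> (coord_kernel :: ('b, 'k::field) path_elt set)"
proof -
  let ?g = "\<lambda>i x. eps i * (basis_path (Suc i, [dn i, up i]) x + (-1) * basis_path (i, [up i, dn i]) x) :: 'k"
  have g: "?g i \<in> carrier PA" if "i \<in> {1..<n}" for i
    by (intro D.scal_in_PA D.add_in_PA D.basis_in_PA) (use that in auto)
  have "coord (preproj_relation Q) u p v = (0 :: 'k)" if c: "cell u p v" for u p v
  proof -
    have "coord (preproj_relation Q) u p v = (\<Sum>i\<in>{1..<n}. coord (?g i) u p v)"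
      using lin_sum[of "{1..<n}" ?g] g by (simp add: relation_eq coord_def)
    also have "\<dots> = (\<Sum>i\<in>{1..<n}. (if i = u - 1 then (if p = 1 \<and> v = u then 1 else 0) else 0) -
        (if i = u then (if p = 1 \<and> v = u then 1 else 0) else 0))"
    proof (rule sum.cong)
      fix i assume i: "i \<in> {1..<n}"
      have "coord (?g i) u p v = eps i * (coord (basis_path (Suc i, [dn i, up i])) u p v
          + (-1) * coord (basis_path (i, [up i, dn i])) u p v :: 'k)"
        unfolding coord_scal using i by (subst coord_add) (auto simp: D.basis_in_PA D.scal_in_PA[of _ "-1", simplified] coord_scal[of "-1", simplified])
      then show "coord (?g i) u p v = (if i = u - 1 then (if p = 1 \<and> v = u then 1 else 0) else 0) -
          (if i = u then (if p = 1 \<and> v = u then 1 else 0) else 0)"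
        using i c
        by (auto simp: coord_basis path_end_def cell_def)
    qed simp
    also have "\<dots> = 0" using c by (auto simp: sum_subtractf sum.delta cell_def)
    finally show ?thesis .
  qed
  then show ?thesis using relation_in_PA by (auto simp: coord_kernel_iff)
qed

end

subsection \<open>Normal forms of paths\<close>

context type_A
begin

lemma preproj_ideal_ideal: "ideal (preproj_ideal Q) (PA :: ('k::field, _) module)"
proof -
  interpret kalg "PA :: ('k, _) module" by (rule D.kalg_PA)
  show ?thesis unfolding preproj_ideal_def by (rule genideal_ideal) (simp add: relation_in_PA)
qed

lemma preproj_ideal_closed:
  fixes f :: "('b, 'k::field) path_elt"
  assumes f: "f \<in> preproj_ideal Q"
  shows "f \<in> carrier PA" "g \<in> preproj_ideal Q ==> (\<lambda>x. f x + g x) \<in> preproj_ideal Q"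
    "(\<lambda>x. c * f x) \<in> preproj_ideal Q" "g \<in> carrier PA ==> g \<otimes>\<^bsub>PA\<^esub> f \<in> preproj_ideal Q"
    "g \<in> carrier PA ==> f \<otimes>\<^bsub>PA\<^esub> g \<in> preproj_ideal Q"
proof -
  interpret kalg "PA :: ('k, _) module" by (rule D.kalg_PA)
  interpret I: ideal "preproj_ideal Q" "PA :: ('k, _) module" by (rule preproj_ideal_ideal)
  show "f \<in> carrier PA" using f by (rule I.Icarr)
  show "g \<in> preproj_ideal Q ==> (\<lambda>x. f x + g x) \<in> preproj_ideal Q"
    using I.a_closed[OF f] by (simp add: path_algebra_simps(3))
  show "(\<lambda>x. c * f x) \<in> preproj_ideal Q"
    using ideal_scal[OF preproj_ideal_ideal f, of c] by (simp add: path_algebra_simps(4))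
  show "g \<in> carrier PA ==> g \<otimes>\<^bsub>PA\<^esub> f \<in> preproj_ideal Q" by (rule I.I_l_closed[OF f])
  show "g \<in> carrier PA ==> f \<otimes>\<^bsub>PA\<^esub> g \<in> preproj_ideal Q" by (rule I.I_r_closed[OF f])
qed

lemma relation_in_ideal: "preproj_relation Q \<in> (preproj_ideal Q :: ('b, 'k::field) path_elt set)"
proof -
  interpret kalg "PA :: ('k, _) module" by (rule D.kalg_PA)
  show ?thesis unfolding preproj_ideal_def by (rule genideal_self') (rule relation_in_PA)
qed

lemma preproj_ideal_zero: "(\<lambda>_. 0) \<in> preproj_ideal Q"
  using preproj_ideal_closed(3)[OF relation_in_ideal, of 0] by simp

lemma preproj_ideal_subset_kernel: "preproj_ideal Q \<subseteq> (coord_kernel :: ('b, 'k::field) path_elt set)"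
proof -
  interpret kalg "PA :: ('k, _) module" by (rule D.kalg_PA)
  show ?thesis
    unfolding preproj_ideal_def
    by (rule genideal_minimal[OF coord_kernel_ideal]) (simp add: relation_in_kernel)
qed

text \<open>Basis paths with the sign that makes them agree in the preprojective algebra.\<close>

definition signed :: "nat => ('b + 'b) list => ('b, 'k::field) path_elt" where
  "signed u q = (\<lambda>y. path_sign q * basis_path (u, q) y)"

definition equal_mod :: "('b, 'k::field) path_elt => ('b, 'k) path_elt => bool" (infix \<open>\<approx>\<close> 50) where
  "f \<approx> g \<longleftrightarrow> (\<lambda>y. f y - g y) \<in> preproj_ideal Q"

lemma equal_mod_refl [simp]: "f \<approx> f"
  using preproj_ideal_zero by (simp add: equal_mod_def)

lemma equal_mod_trans [trans]: "f \<approx> g ==> g \<approx> h ==> f \<approx> h"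
  using preproj_ideal_closed(2)[of "\<lambda>y. f y - g y" "\<lambda>y. g y - h y"] by (simp add: equal_mod_def)

lemma equal_mod_sym: "f \<approx> g ==> g \<approx> f"
  using preproj_ideal_closed(3)[of "\<lambda>y. f y - g y" "-1"] by (simp add: equal_mod_def)

lemma equal_mod_zero: "f \<approx> (\<lambda>_. 0) \<longleftrightarrow> f \<in> preproj_ideal Q"
  by (simp add: equal_mod_def)

lemma signed_in_PA: "(u, q) \<in> paths D ==> signed u q \<in> carrier PA"
  unfolding signed_def by (rule D.scal_in_PA[OF D.basis_in_PA])

lemma mult_diff:
  "(\<lambda>x. f x - g x) \<otimes>\<^bsub>PA\<^esub> h = (\<lambda>x. (f \<otimes>\<^bsub>PA\<^esub> h) x - (g \<otimes>\<^bsub>PA\<^esub> h) x :: 'k::field)"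
  "h \<otimes>\<^bsub>PA\<^esub> (\<lambda>x. f x - g x) = (\<lambda>x. (h \<otimes>\<^bsub>PA\<^esub> f) x - (h \<otimes>\<^bsub>PA\<^esub> g) x :: 'k)"
  by (auto simp: fun_eq_iff D.mult_PA left_diff_distrib right_diff_distrib sum_subtractf)

lemma signed_sandwich:
  "signed u (A @ X @ B) = (\<lambda>y. (path_sign A * path_sign B) *
    (basis_path (path_end D (u, A @ X), B) \<otimes>\<^bsub>PA\<^esub> (signed (path_end D (u, A)) X \<otimes>\<^bsub>PA\<^esub> basis_path (u, A))) y :: 'k::field)"
proof -
  have "basis_path (path_end D (u, A), X) \<otimes>\<^bsub>PA\<^esub> basis_path (u, A) = (basis_path (u, A @ X) :: ('b, 'k) path_elt)"
    "basis_path (path_end D (u, A @ X), B) \<otimes>\<^bsub>PA\<^esub> basis_path (u, A @ X) = (basis_path (u, A @ X @ B) :: ('b, 'k) path_elt)"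
    by (simp_all add: D.mult_basis)
  then show ?thesis by (simp add: signed_def D.mult_lin mult_ac)
qed

lemma signed_context:
  fixes r :: "('b, 'k::field) path_elt"
  assumes "(u, A @ X @ B) \<in> paths D" "(u, A @ Y @ B) \<in> paths D"
    and eq: "(signed (path_end D (u, A)) X :: ('b, 'k) path_elt) \<approx> signed (path_end D (u, A)) Y"
    and e: "path_end D (u, A @ X) = path_end D (u, A @ Y)"
  shows "(signed u (A @ X @ B) :: ('b, 'k) path_elt) \<approx> signed u (A @ Y @ B)"
proof -
  let ?w = "path_end D (u, A)"
  let ?d = "\<lambda>y. signed ?w X y - signed ?w Y y :: 'k"
  have A: "basis_path (u, A) \<in> carrier (PA :: ('k, _) module)"
    and B: "basis_path (path_end D (u, A @ X), B) \<in> carrier (PA :: ('k, _) module)"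
    using assms(1) by (auto simp: D.paths_append path_end_append intro: D.basis_in_PA)
  have "(\<lambda>y. (path_sign A * path_sign B) * (basis_path (path_end D (u, A @ X), B) \<otimes>\<^bsub>PA\<^esub>
      (?d \<otimes>\<^bsub>PA\<^esub> basis_path (u, A))) y) \<in> preproj_ideal Q"
    by (rule preproj_ideal_closed(3)[OF preproj_ideal_closed(4)[OF preproj_ideal_closed(5)[OF eq[unfolded equal_mod_def] A] B]])
  then show ?thesis
    unfolding equal_mod_def signed_sandwich mult_diff e by (simp add: algebra_simps)
qed

lemma signed_context_zero:
  assumes "(u, A @ X @ B) \<in> paths D"
    and "(signed (path_end D (u, A)) X :: ('b, 'k::field) path_elt) \<in> preproj_ideal Q"
  shows "(signed u (A @ X @ B) :: ('b, 'k) path_elt) \<in> preproj_ideal Q"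
  unfolding signed_sandwich using assms
  by (intro preproj_ideal_closed D.basis_in_PA) (auto simp: D.paths_append path_end_append)

lemma corner:
  assumes "1 \<le> s" "s \<le> n"
  shows "(basis_path (s, []) \<otimes>\<^bsub>PA\<^esub> (f \<otimes>\<^bsub>PA\<^esub> basis_path (s, []))) (u, q) =
    (if u = s \<and> path_end D (u, q) = s then f (u, q) else 0 :: 'k::field)"
proof -
  have 1: "(f \<otimes>\<^bsub>PA\<^esub> basis_path (s, [])) (u, q) = (if u = s then f (u, q) else 0)" for u q
  proof -
    have "(f \<otimes>\<^bsub>PA\<^esub> basis_path (s, [])) (u, q) =
        (\<Sum>j\<le>length q. if j = 0 then (if u = s then f (u, q) else 0) else 0)"
      unfolding D.mult_PA by (rule sum.cong) (auto simp: basis_path_def)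
    then show ?thesis by (simp add: sum.delta)
  qed
  have "(basis_path (s, []) \<otimes>\<^bsub>PA\<^esub> g) (u, q) = (if path_end D (u, q) = s then g (u, q) else 0)" for g :: "('b, 'k) path_elt"
  proof -
    have "(basis_path (s, []) \<otimes>\<^bsub>PA\<^esub> g) (u, q) =
        (\<Sum>j\<le>length q. if j = length q then (if path_end D (u, q) = s then g (u, q) else 0) else 0)"
      unfolding D.mult_PA by (rule sum.cong) (auto simp: basis_path_def)
    then show ?thesis by (simp add: sum.delta)
  qed
  then show ?thesis by (simp add: 1)
qed

lemma relation_at:
  assumes s: "1 \<le> s" "s \<le> n"
  shows "preproj_relation Q (s, q) = (if 1 < s then signed s [dn (s - 1), up (s - 1)] (s, q) else 0)
    - (if s < n then signed s [up s, dn s] (s, q) else 0 :: 'k::field)"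
proof -
  have "preproj_relation Q (s, q) = (\<Sum>i\<in>{1..<n}. (if i = s - 1 then eps i * basis_path (Suc i, [dn i, up i]) (s, q) else 0)
    - (if i = s then eps i * basis_path (i, [up i, dn i]) (s, q) else 0 :: 'k))"
    unfolding relation_eq by (rule sum.cong) (auto simp: basis_path_def algebra_simps)
  also have "\<dots> = (if s - 1 \<in> {1..<n} then eps (s - 1) * basis_path (Suc (s - 1), [dn (s - 1), up (s - 1)]) (s, q) else 0)
    - (if s \<in> {1..<n} then eps s * basis_path (s, [up s, dn s]) (s, q) else 0)"
    by (simp add: sum_subtractf sum.delta)
  also have "\<dots> = (if 1 < s then signed s [dn (s - 1), up (s - 1)] (s, q) else 0)
    - (if s < n then signed s [up s, dn s] (s, q) else 0)"
    using s by (auto simp: signed_def)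
  finally show ?thesis .
qed

text \<open>
  Multiplying the preprojective relation by the idempotent at \<open>s\<close> on both sides isolates its part at \<open>s\<close>.
\<close>

lemma two_cycles_in_ideal:
  assumes s: "1 \<le> s" "s \<le> n"
  shows "(\<lambda>y. (if 1 < s then signed s [dn (s - 1), up (s - 1)] y else 0)
    - (if s < n then signed s [up s, dn s] y else 0) :: 'k::field) \<in> preproj_ideal Q"
proof -
  let ?e = "basis_path (s, []) :: ('b, 'k) path_elt"
  have "?e \<in> carrier PA" using s by (intro D.basis_in_PA) auto
  then have "?e \<otimes>\<^bsub>PA\<^esub> (preproj_relation Q \<otimes>\<^bsub>PA\<^esub> ?e) \<in> preproj_ideal Q"
    by (intro preproj_ideal_closed(4) preproj_ideal_closed(5) relation_in_ideal)
  moreover have "?e \<otimes>\<^bsub>PA\<^esub> (preproj_relation Q \<otimes>\<^bsub>PA\<^esub> ?e) =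
    (\<lambda>y. (if 1 < s then signed s [dn (s - 1), up (s - 1)] y else 0)
    - (if s < n then signed s [up s, dn s] y else 0) :: 'k)" (is "_ = ?r")
  proof (rule ext, clarify)
    fix u q
    have pe: "path_end D (s, q) = s" if "?r (s, q) \<noteq> 0"
    proof -
      have "path_end D (s, [dn (s - 1), up (s - 1)]) = s" if "1 < s"
        using tail_head(2)[of "s - 1"] that s by simp
      moreover have "path_end D (s, [up s, dn s]) = s" if "s < n" using that s by simp
      moreover have "q = [dn (s - 1), up (s - 1)] \<and> 1 < s \<or> q = [up s, dn s] \<and> s < n"
        using that by (auto simp: signed_def basis_path_def split: if_splits)
      ultimately show ?thesis by blast
    qed
    show "(?e \<otimes>\<^bsub>PA\<^esub> (preproj_relation Q \<otimes>\<^bsub>PA\<^esub> ?e)) (u, q) = ?r (u, q)"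
    proof (cases "u = s \<and> path_end D (s, q) = s")
      case True
      then show ?thesis unfolding corner[OF s] using relation_at[OF s, of q, where ?'k = 'k] by simp
    next
      case False
      then have "?r (u, q) = 0" using pe
        by (cases "u = s") (blast, auto simp: signed_def basis_path_def)
      then show ?thesis unfolding corner[OF s] using False by auto
    qed
  qed
  ultimately show ?thesis by simp
qed

lemma commute_at:
  assumes "1 < s" "s < n"
  shows "(signed s [up s, dn s] :: ('b, 'k::field) path_elt) \<approx> signed s [dn (s - 1), up (s - 1)]"
  by (rule equal_mod_sym) (use two_cycles_in_ideal[of s] assms in \<open>simp add: equal_mod_def\<close>)

lemma vanish_at_bottom: "1 < n ==> (signed 1 [up 1, dn 1] :: ('b, 'k::field) path_elt) \<in> preproj_ideal Q"
  using two_cycles_in_ideal[of 1, where ?'k = 'k] preproj_ideal_closed(3)[of "\<lambda>y. - signed 1 [up 1, dn 1] y" "- 1"]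
  by simp

lemma vanish_at_top: "1 < n ==> (signed n [dn (n - 1), up (n - 1)] :: ('b, 'k::field) path_elt) \<in> preproj_ideal Q"
  using two_cycles_in_ideal[of n, where ?'k = 'k] by simp

definition ups :: "nat => nat => ('b + 'b) list" where
  "ups a b = map up [a..<b]"

definition dns :: "nat => nat => ('b + 'b) list" where
  "dns a b = map dn (rev [a..<b])"

lemma ups_self [simp]: "ups a a = []" and ups_Suc: "a \<le> b ==> ups a (Suc b) = ups a b @ [up b]"
  and dns_self [simp]: "dns a a = []" and dns_Suc: "a < b ==> dns a b = dns (Suc a) b @ [dn a]"
  by (simp_all add: ups_def dns_def upt_conv_Cons)

lemma ups_path:
  assumes "1 \<le> a" "a \<le> b" "b \<le> n"
  shows "(a, ups a b) \<in> paths D \<and> path_end D (a, ups a b) = b \<and> descents (ups a b) = 0"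
  using assms(2,3)
proof (induction b rule: dec_induct)
  case (step b)
  then show ?case using assms(1) by (simp add: ups_Suc D.paths_append path_end_append D.paths_single)
qed (use assms(1) in auto)

lemma dns_path:
  assumes "1 \<le> a" "a \<le> b" "b \<le> n"
  shows "(b, dns a b) \<in> paths D \<and> path_end D (b, dns a b) = a \<and> descents (dns a b) = b - a"
  using assms(2,1)
proof (induction a rule: inc_induct)
  case (step a)
  then show ?case using assms(3)
    by (simp add: dns_Suc D.paths_append path_end_append D.paths_single)
qed (use assms in auto)

text \<open>
  At each peak the descent commutes with the ascent before it.  If it arrives at the vertex \<open>1\<close>, it meets the
  relation there, which consists of a single two-cycle.
\<close>

lemma ups_dn:
  assumes A: "(u, A) \<in> paths D" "path_end D (u, A) = s" and sv: "1 \<le> s" "s < v" "v \<le> n"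
  shows "(1 < s \<longrightarrow> (signed u (A @ ups s v @ [dn (v - 1)]) :: ('b, 'k::field) path_elt) \<approx>
      signed u (A @ [dn (s - 1)] @ ups (s - 1) (v - 1))) \<and>
    (s = 1 \<longrightarrow> (signed u (A @ ups s v @ [dn (v - 1)]) :: ('b, 'k) path_elt) \<in> preproj_ideal Q)"
proof -
  have "Suc s \<le> v" using sv by simp
  then show ?thesis using sv(3)
  proof (induction v rule: dec_induct)
    case base
    have p: "(u, A @ [up s, dn s] @ []) \<in> paths D"
      using A sv base D.paths_append[of u A "[up s, dn s]"] by simp
    have "(signed u (A @ [up s, dn s] @ []) :: ('b, 'k) path_elt) \<approx> signed u (A @ [dn (s - 1), up (s - 1)] @ [])"
      if "1 < s"
    proof (rule signed_context[OF p])
      show "(u, A @ [dn (s - 1), up (s - 1)] @ []) \<in> paths D"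
        using A that base D.paths_append[of u A "[dn (s - 1), up (s - 1)]"] paths_two_cycle(2)[of "s - 1"] by simp
      show "signed (path_end D (u, A)) [up s, dn s] \<approx> (signed (path_end D (u, A)) [dn (s - 1), up (s - 1)] :: ('b, 'k) path_elt)"
        using A commute_at[of s] that base by simp
      show "path_end D (u, A @ [up s, dn s]) = path_end D (u, A @ [dn (s - 1), up (s - 1)])"
        using that base by (simp add: path_end_def)
    qed
    moreover have "(signed u (A @ [up s, dn s] @ []) :: ('b, 'k) path_elt) \<in> preproj_ideal Q" if "s = 1"
      by (rule signed_context_zero[OF p]) (use A that base vanish_at_bottom in simp)
    moreover have "ups (s - 1) s = [up (s - 1)]" if "1 < s" using that ups_Suc[of "s - 1" "s - 1"] by simp
    moreover have e: "A @ ups s (Suc s) @ [dn (Suc s - 1)] = A @ [up s, dn s] @ []"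
      using ups_Suc[of s s] by simp
    ultimately show ?case unfolding e by auto
  next
    case (step v)
    let ?L = "A @ ups s v @ [dn (v - 1)]" and ?R = "A @ [dn (s - 1)] @ ups (s - 1) (v - 1)"
    have v: "1 < v" "v < n" "s < v" using step sv by auto
    have U: "(u, A @ ups s v) \<in> paths D" "path_end D (u, A @ ups s v) = v"
      using ups_path[of s v] A v sv(1) by (auto simp: D.paths_append path_end_append)
    have 1: "(signed u ((A @ ups s v) @ [up v, dn v] @ []) :: ('b, 'k) path_elt) \<approx>
        signed u ((A @ ups s v) @ [dn (v - 1), up (v - 1)] @ [])"
    proof (rule signed_context)
      show "(u, (A @ ups s v) @ [up v, dn v] @ []) \<in> paths D"
        using U v D.paths_append[of u "A @ ups s v" "[up v, dn v]"] by simp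
      show "(u, (A @ ups s v) @ [dn (v - 1), up (v - 1)] @ []) \<in> paths D"
        using U v D.paths_append[of u "A @ ups s v" "[dn (v - 1), up (v - 1)]"] paths_two_cycle(2)[of "v - 1"] by simp
      show "signed (path_end D (u, A @ ups s v)) [up v, dn v] \<approx>
          (signed (path_end D (u, A @ ups s v)) [dn (v - 1), up (v - 1)] :: ('b, 'k) path_elt)"
        using U commute_at[of v] v by simp
      show "path_end D (u, (A @ ups s v) @ [up v, dn v]) = path_end D (u, (A @ ups s v) @ [dn (v - 1), up (v - 1)])"
        using v by (simp add: path_end_def)
    qed
    have Lp: "(u, ?L @ [up (v - 1)]) \<in> paths D"
      using U v D.paths_append[of u "A @ ups s v" "[dn (v - 1), up (v - 1)]"] paths_two_cycle(2)[of "v - 1"] by simp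
    have IH: "1 < s ==> (signed u ?L :: ('b, 'k) path_elt) \<approx> signed u ?R"
      "s = 1 ==> (signed u ?L :: ('b, 'k) path_elt) \<in> preproj_ideal Q"
      using step by auto
    have "(signed u (?L @ [up (v - 1)]) :: ('b, 'k) path_elt) \<approx> signed u (A @ [dn (s - 1)] @ ups (s - 1) v)" if s: "1 < s"
    proof -
      have e: "A @ [dn (s - 1)] @ ups (s - 1) v = ?R @ [up (v - 1)]"
        using ups_Suc[of "s - 1" "v - 1"] s v by simp
      have Rp: "(u, A @ [dn (s - 1)] @ ups (s - 1) v) \<in> paths D"
        using A s v sv ups_path[of "s - 1" v] by (simp add: D.paths_append D.paths_single path_end_append)
      have "(signed u ([] @ ?L @ [up (v - 1)]) :: ('b, 'k) path_elt) \<approx> signed u ([] @ ?R @ [up (v - 1)])"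
      proof (rule signed_context)
        show "path_end D (u, [] @ ?L) = path_end D (u, [] @ ?R)"
          using A v s sv ups_path[of "s - 1" "v - 1"] by (simp add: path_end_append)
      qed (use Lp Rp e IH(1)[OF s] in auto)
      then show ?thesis unfolding e by simp
    qed
    moreover have "(signed u (?L @ [up (v - 1)]) :: ('b, 'k) path_elt) \<in> preproj_ideal Q" if "s = 1"
    proof -
      have "(signed u ([] @ ?L @ [up (v - 1)]) :: ('b, 'k) path_elt) \<in> preproj_ideal Q"
        by (rule signed_context_zero) (use Lp IH(2)[OF that] in auto)
      then show ?thesis by (simp only: append_Nil)
    qed
    moreover have e: "A @ ups s (Suc v) @ [dn (Suc v - 1)] = (A @ ups s v) @ [up v, dn v] @ []"
      using ups_Suc[of s v] v by simp
    moreover have e': "(A @ ups s v) @ [dn (v - 1), up (v - 1)] @ [] = ?L @ [up (v - 1)]" by simp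
    note 1 = 1[unfolded e']
    moreover have "f \<in> preproj_ideal Q" if "f \<approx> g" "g \<in> preproj_ideal Q" for f g :: "('b, 'k) path_elt"
      using that equal_mod_trans[of f g "\<lambda>_. 0"] by (simp add: equal_mod_zero)
    note tr = this[OF 1]
    ultimately show ?case unfolding e using equal_mod_trans[OF 1] tr
      by (auto simp del: append_assoc append_Cons append_Nil)
  qed
qed

lemma dn_ups_top:
  assumes A: "(u, A) \<in> paths D" "path_end D (u, A) = Suc s" and s: "1 \<le> s" "s < n"
  shows "(signed u (A @ [dn s] @ ups s n) :: ('b, 'k::field) path_elt) \<in> preproj_ideal Q"
proof (cases "Suc s = n")
  case True
  have "(signed (Suc s) [dn s, up s] :: ('b, 'k) path_elt) \<in> preproj_ideal Q"
    using vanish_at_top[where ?'k = 'k] s unfolding True[symmetric] by simp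
  then have "(signed u (A @ [dn s, up s] @ []) :: ('b, 'k) path_elt) \<in> preproj_ideal Q"
    by (intro signed_context_zero) (use A s in \<open>simp_all add: D.paths_append\<close>)
  then show ?thesis using True ups_Suc[of s s] by simp
next
  case False
  then have s': "Suc s < n" using s by simp
  have U: "(u, A @ ups (Suc s) n) \<in> paths D" "path_end D (u, A @ ups (Suc s) n) = n"
    using ups_path[of "Suc s" n] A s' by (auto simp: D.paths_append path_end_append)
  let ?X = "A @ ups (Suc s) n @ [dn (n - 1)]" and ?Y = "A @ [dn s] @ ups s (n - 1)"
  have XY: "(signed u ?X :: ('b, 'k) path_elt) \<approx> signed u ?Y"
    using ups_dn[OF A, of n, where ?'k = 'k] s s' by simp
  have Xp: "(u, (A @ ups (Suc s) n) @ [dn (n - 1), up (n - 1)] @ []) \<in> paths D"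
    using U s' D.paths_append[of u "A @ ups (Suc s) n" "[dn (n - 1), up (n - 1)]"] paths_two_cycle(2)[of "n - 1"] by simp
  have e: "ups s n = ups s (n - 1) @ [up (n - 1)]" using ups_Suc[of s "n - 1"] s' by simp
  have Yp: "(u, A @ [dn s] @ ups s n) \<in> paths D"
    using A s ups_path[of s n] by (simp add: D.paths_append D.paths_single path_end_append)
  have "(signed u ([] @ ?X @ [up (n - 1)]) :: ('b, 'k) path_elt) \<approx> signed u ([] @ ?Y @ [up (n - 1)])"
  proof (rule signed_context)
    show "path_end D (u, [] @ ?X) = path_end D (u, [] @ ?Y)"
      using A s s' ups_path[of s "n - 1"] by (simp add: path_end_append)
  qed (use Xp Yp XY e in auto)
  moreover have "(signed u ((A @ ups (Suc s) n) @ [dn (n - 1), up (n - 1)] @ []) :: ('b, 'k) path_elt) \<in> preproj_ideal Q"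
    by (rule signed_context_zero[OF Xp]) (use U s' vanish_at_top in auto)
  ultimately show ?thesis
    using equal_mod_trans[OF equal_mod_sym, of "signed u (?X @ [up (n - 1)])" "signed u (?Y @ [up (n - 1)])" "\<lambda>_. 0 :: 'k"]
    by (simp add: equal_mod_zero e)
qed

definition normal_path :: "nat => nat => nat => ('b + 'b) list" where
  "normal_path u p v = dns (u - p) u @ ups (u - p) v"

lemma normal_path_path:
  assumes "p < u" "u \<le> n" "v \<le> n" "u \<le> p + v"
  shows "(u, normal_path u p v) \<in> paths D \<and> path_end D (u, normal_path u p v) = v \<and> descents (normal_path u p v) = p"
  using dns_path[of "u - p" u] ups_path[of "u - p" v] assms
  by (simp add: normal_path_def D.paths_append path_end_append)

lemma normal_path_vanishes:
  assumes "p < u" "u \<le> n" "v \<le> n" "p + v > n"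
  shows "(signed u (normal_path u p v) :: ('b, 'k::field) path_elt) \<in> preproj_ideal Q"
  using assms
proof (induction p arbitrary: v)
  case (Suc p)
  let ?s = "u - Suc p"
  have s: "1 \<le> ?s" "?s < v" "?s < n" "u - p = Suc ?s" using Suc.prems by auto
  let ?A = "dns (Suc ?s) u"
  have A: "(u, ?A) \<in> paths D" "path_end D (u, ?A) = Suc ?s"
    using dns_path[of "Suc ?s" u] s Suc.prems by auto
  have e: "normal_path u (Suc p) v = ?A @ [dn ?s] @ ups ?s v"
    using dns_Suc[of ?s u] Suc.prems by (simp add: normal_path_def)
  show ?case
  proof (cases "v = n")
    case True
    then show ?thesis using dn_ups_top[OF A s(1,3)] e by simp
  next
    case False
    let ?U = "?A @ ups (Suc ?s) (Suc v)"
    have U: "(u, ?U) \<in> paths D" "path_end D (u, ?U) = Suc v"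
      using A ups_path[of "Suc ?s" "Suc v"] s Suc.prems False by (auto simp: D.paths_append path_end_append)
    have "(signed u (?A @ ups (Suc ?s) (Suc v) @ [dn v]) :: ('b, 'k) path_elt) \<approx> signed u (normal_path u (Suc p) v)"
      using ups_dn[OF A, of "Suc v", where ?'k = 'k] s Suc.prems False e by simp
    moreover have "(signed u (normal_path u p (Suc v)) :: ('b, 'k) path_elt) \<in> preproj_ideal Q"
      by (rule Suc.IH) (use Suc.prems False in auto)
    then have "(signed u ([] @ ?U @ [dn v]) :: ('b, 'k) path_elt) \<in> preproj_ideal Q"
      by (intro signed_context_zero)
        (use s U Suc.prems False in \<open>auto simp: normal_path_def D.paths_append D.paths_single path_end_append\<close>)
    ultimately show ?thesis
      using equal_mod_trans[OF equal_mod_sym, of "signed u (?U @ [dn v])" "signed u (normal_path u (Suc p) v)" "\<lambda>_. 0 :: 'k"]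
      by (simp add: equal_mod_zero)
  qed
qed simp

text \<open>
  By induction along the path: a further ascent prolongs the final run of ascents, a further descent
  moves to the left through that run.  The path vanishes when the run would leave the diagram at the top,
  or the descents at the bottom.
\<close>

lemma path_normal_form:
  assumes "(u, q) \<in> paths D"
  shows "(cell u (descents q) (path_end D (u, q)) \<longrightarrow>
      (signed u q :: ('b, 'k::field) path_elt) \<approx> signed u (normal_path u (descents q) (path_end D (u, q)))) \<and>
    (\<not> cell u (descents q) (path_end D (u, q)) \<longrightarrow> (signed u q :: ('b, 'k) path_elt) \<in> preproj_ideal Q)"
  using assms
proof (induction q rule: rev_induct)
  case Nil
  then show ?case by (auto simp: cell_def normal_path_def)
next
  case (snoc b q)
  let ?p = "descents q" and ?v = "path_end D (u, q)"
  have q: "(u, q) \<in> paths D" and b: "b \<in> arcs D" "?v = tail D b" using snoc.prems by (auto simp: D.paths_snoc)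
  have u: "1 \<le> u" "u \<le> n" using D.path_start_in_verts[OF q] by auto
  have v: "1 \<le> ?v" "?v \<le> n" using D.path_end_in_verts[OF q] by auto
  have hv: "1 \<le> head D b" "head D b \<le> n" using D.head_in_verts[OF b(1)] by auto
  have ub: "u \<le> ?p + ?v" using path_bounds[OF q] by simp
  have tr: "f \<in> preproj_ideal Q" if "f \<approx> g" "g \<in> preproj_ideal Q" for f g :: "('b, 'k) path_elt"
    using that equal_mod_trans[of f g "\<lambda>_. 0"] by (simp add: equal_mod_zero)
  show ?case
  proof (cases "cell u ?p ?v")
    case False
    then have "(signed u ([] @ q @ [b]) :: ('b, 'k) path_elt) \<in> preproj_ideal Q"
      by (intro signed_context_zero) (use snoc q in auto)
    moreover have "\<not> cell u (descents (q @ [b])) (head D b)"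
      using b(1) by (cases rule: arcs_DE) (use False b u v ub in \<open>auto simp: cell_def\<close>)
    ultimately show ?thesis by simp
  next
    case True
    let ?N = "normal_path u ?p ?v"
    have N: "(u, ?N) \<in> paths D" "path_end D (u, ?N) = ?v"
      using normal_path_path[of ?p u ?v] True by (auto simp: cell_def)
    have Np: "(u, ?N @ [b]) \<in> paths D" using N b by (simp add: D.paths_snoc)
    have qN: "(signed u (q @ [b]) :: ('b, 'k) path_elt) \<approx> signed u (?N @ [b])"
      using signed_context[of u "[]" q "[b]" ?N, where ?'k = 'k] snoc q True N Np by simp
    from b(1) show ?thesis
    proof (cases rule: arcs_DE)
      case (up i)
      then have vi: "?v = i" using b by simp
      have d: "descents (q @ [b]) = ?p" "path_end D (u, q @ [b]) = Suc i" using up by simp_all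
      have N': "?N @ [b] = normal_path u ?p (Suc i)"
        using True up vi ups_Suc[of "u - ?p" i] by (auto simp: normal_path_def cell_def)
      show ?thesis
      proof (cases "?p + Suc i \<le> n")
        case le: True
        then have "cell u ?p (Suc i)" using True vi up by (auto simp: cell_def)
        then show ?thesis unfolding d using qN N' by simp
      next
        case le: False
        then have "(signed u (normal_path u ?p (Suc i)) :: ('b, 'k) path_elt) \<in> preproj_ideal Q"
          using normal_path_vanishes[of ?p u "Suc i"] True up by (auto simp: cell_def)
        moreover have "\<not> cell u ?p (Suc i)" using le by (auto simp: cell_def)
        ultimately show ?thesis unfolding d using tr[OF qN] N' by simp
      qed
    next
      case (dn i)
      then have vi: "?v = Suc i" using b by simp
      let ?s = "u - ?p" and ?A = "dns (u - ?p) u"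
      have A: "(u, ?A) \<in> paths D" "path_end D (u, ?A) = ?s" and s: "1 \<le> ?s" "?s \<le> Suc i"
        using dns_path[of ?s u] True vi by (auto simp: cell_def)
      have c: "cell u (Suc ?p) i \<longleftrightarrow> 1 < ?s" using True vi dn by (auto simp: cell_def)
      have s': "u - Suc ?p = ?s - 1" by simp
      have eN: "?A @ [dn (?s - 1)] @ ups (?s - 1) i = normal_path u (Suc ?p) i" if "1 < ?s"
      proof -
        have e: "?s - 1 < u" "Suc (?s - 1) = ?s" using that by auto
        show ?thesis by (simp only: normal_path_def s' dns_Suc[OF e(1)] e(2) append_assoc)
      qed
      show ?thesis
      proof (cases "?s = Suc i")
        case True
        then have "?N @ [b] = normal_path u (Suc ?p) i"
          using eN vi dn by (simp add: normal_path_def)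
        moreover have "1 < ?s" using True dn by simp
        ultimately show ?thesis using qN c dn by simp
      next
        case False
        then have "?s < Suc i" using s by simp
        note U = ups_dn[OF A s(1) this, where ?'k = 'k]
        have N': "?N @ [b] = ?A @ ups ?s (Suc i) @ [dn (Suc i - 1)]" using vi dn by (simp add: normal_path_def)
        have d: "descents (q @ [b]) = Suc ?p" "path_end D (u, q @ [b]) = i" using dn by simp_all
        have vn: "Suc i \<le> n" using v vi by simp
        show ?thesis
        proof (cases "?s = 1")
          case True
          then have "(signed u (?N @ [b]) :: ('b, 'k) path_elt) \<in> preproj_ideal Q" unfolding N' using U vn by blast
          then show ?thesis unfolding d c using tr[OF qN] True by simp
        next
          case False
          then have s1: "1 < ?s" using s by simp
          have "(signed u (?N @ [b]) :: ('b, 'k) path_elt) \<approx> signed u (?A @ [dn (?s - 1)] @ ups (?s - 1) (Suc i - 1))"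
            unfolding N' using U vn s1 by blast
          then have "(signed u (?N @ [b]) :: ('b, 'k) path_elt) \<approx> signed u (normal_path u (Suc ?p) i)"
            using eN[OF s1] by simp
          then show ?thesis unfolding d c using equal_mod_trans[OF qN] s1 by blast
        qed
      qed
    qed
  qed
qed

definition cells :: "(nat \<times> nat \<times> nat) set" where
  "cells = {(u, p, v). cell u p v}"

lemma finite_cells: "finite cells"
proof (rule finite_subset)
  show "cells \<subseteq> {..n} \<times> {..n} \<times> {..n}" by (auto simp: cells_def cell_def)
qed simp

definition normal_elt :: "nat \<times> nat \<times> nat => ('b, 'k::field) path_elt" where
  "normal_elt = (\<lambda>(u, p, v). signed u (normal_path u p v))"

lemma normal_elt_in_PA: "cell u p v ==> (normal_elt (u, p, v) :: ('b, 'k::field) path_elt) \<in> carrier PA"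
  using normal_path_path[of p u v] by (auto simp: normal_elt_def cell_def intro: signed_in_PA)

lemma coord_normal_elt:
  assumes "cell u p v"
  shows "coord (normal_elt (u, p, v)) u' p' v' = (if (u', p', v') = (u, p, v) then 1 else 0 :: 'k::field)"
  using normal_path_path[of p u v] assms
  by (auto simp: normal_elt_def signed_def coord_scal coord_basis cell_def)

text \<open>
  By linearity from the normal form of a path: a coordinate collects the signed coefficients of all
  paths with the same normal form.
\<close>

lemma normal_expansion:
  assumes "f \<in> carrier PA"
  shows "f \<approx> (\<lambda>y. \<Sum>t\<in>cells. (case t of (u, p, v) => coord f u p v) * normal_elt t y :: 'k::field)"
  using assms
proof (induction f rule: D.PA_induct)
  case (basis c x)
  obtain u q where x: "x = (u, q)" by (cases x)
  let ?p = "descents q" and ?v = "path_end D (u, q)"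
  let ?t = "(u, ?p, ?v)"
  have f: "(\<lambda>y. c * basis_path x y) = (\<lambda>y. (c * path_sign q) * signed u q y :: 'k)"
    by (simp add: signed_def x mult_ac fun_eq_iff)
  have co: "(case t of (u', p', v') => coord (\<lambda>y. c * basis_path x y) u' p' v') * normal_elt t y
      = (if t = ?t then (c * path_sign q) * normal_elt ?t y else 0 :: 'k)" for t y
    by (cases t) (auto simp: coord_scal coord_basis x)
  have sum: "(\<Sum>t\<in>cells. (case t of (u', p', v') => coord (\<lambda>y. c * basis_path x y) u' p' v') * normal_elt t y)
      = (if cell u ?p ?v then (c * path_sign q) * normal_elt ?t y else 0 :: 'k)" for y
    unfolding co using finite_cells by (simp add: sum.delta) (simp add: cells_def)
  have nf: "cell u ?p ?v ==> signed u q \<approx> (normal_elt ?t :: ('b, 'k) path_elt)"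
    "\<not> cell u ?p ?v ==> (signed u q :: ('b, 'k) path_elt) \<in> preproj_ideal Q"
    using path_normal_form[of u q, where ?'k = 'k] basis x by (auto simp: normal_elt_def)
  show ?case
  proof (cases "cell u ?p ?v")
    case True
    then show ?thesis unfolding sum unfolding f
      using preproj_ideal_closed(3)[OF nf(1)[OF True, unfolded equal_mod_def], of "c * path_sign q"]
      by (simp add: equal_mod_def algebra_simps)
  next
    case False
    then show ?thesis unfolding sum unfolding f
      using preproj_ideal_closed(3)[OF nf(2)[OF False], of "c * path_sign q"]
      by (simp add: equal_mod_def)
  qed
next
  case (add f g)
  have "(\<Sum>t\<in>cells. (case t of (u, p, v) => coord (\<lambda>x. f x + g x) u p v) * normal_elt t y) =
    (\<Sum>t\<in>cells. (case t of (u, p, v) => coord f u p v) * normal_elt t y) +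
    (\<Sum>t\<in>cells. (case t of (u, p, v) => coord g u p v) * normal_elt t y :: 'k)" for y
    by (simp add: coord_add[OF add(1,2)] case_prod_unfold distrib_right sum.distrib)
  then show ?case
    using preproj_ideal_closed(2)[OF add(3,4)[unfolded equal_mod_def]]
    by (simp add: equal_mod_def algebra_simps)
qed simp

text \<open>
  The relation has zero coordinates, which gives one inclusion.  For the other one, an element without
  nonzero coordinates is congruent to zero by its normal expansion.
\<close>

theorem preproj_ideal_eq_kernel: "preproj_ideal Q = (coord_kernel :: ('b, 'k::field) path_elt set)"
proof
  show "coord_kernel \<subseteq> (preproj_ideal Q :: ('b, 'k) path_elt set)"
  proof
    fix f :: "('b, 'k) path_elt" assume f: "f \<in> coord_kernel"
    then have "(\<Sum>t\<in>cells. (case t of (u, p, v) => coord f u p v) * normal_elt t y) = 0" for y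
      by (intro sum.neutral) (auto simp: coord_kernel_iff cells_def)
    then show "f \<in> preproj_ideal Q" using normal_expansion[of f] f
      by (simp add: coord_kernel_iff equal_mod_def)
  qed
qed (rule preproj_ideal_subset_kernel)

end

section \<open>Reduced words and inversions\<close>

definition inversions :: "nat => (nat => nat) => (nat \<times> nat) set" where
  "inversions N w = {(r, s). 1 \<le> r \<and> r < s \<and> s \<le> N \<and> w s < w r}"

lemma finite_inversions: "finite (inversions N w)"
  by (rule finite_subset[of _ "{..N} \<times> {..N}"]) (auto simp: inversions_def)

lemma simple_refl_less_iff:
  "simple_refl i x < simple_refl i y \<longleftrightarrow>
    (if x = i \<and> y = Suc i then False else if x = Suc i \<and> y = i then True else x < y)"
  by (auto simp: simple_refl_def transpose_def)

lemma simple_refl_simps [simp]: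
  "simple_refl i i = Suc i" "simple_refl i (Suc i) = i" "simple_refl i (simple_refl i x) = x"
  "simple_refl i \<circ> (simple_refl i \<circ> w) = w" "inv' (simple_refl i) = simple_refl i"
  by (auto simp: simple_refl_def fun_eq_iff)

lemma simple_refl_permutes: "1 \<le> i ==> i \<le> n ==> simple_refl i permutes {1..Suc n}"
  unfolding simple_refl_def by (rule permutes_swap_id) auto

lemma permutes_cases:
  assumes "w permutes {1..N}" "v \<in> {1..N}"
  shows "inv' w v \<in> {1..N}" "w r = v \<longleftrightarrow> r = inv' w v" "w (inv' w v) = v"
  using permutes_in_image[OF permutes_inv[OF assms(1)]] permutes_inverses[OF assms(1)] assms(2) by auto

text \<open>
  Only the pair of positions of \<open>i\<close> and \<open>i + 1\<close> changes its order.
\<close>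

lemma inversions_simple_refl:
  assumes w: "w permutes {1..N}" and i: "1 \<le> i" "i < N" and less: "inv' w i < inv' w (Suc i)"
  shows "card (inversions N (simple_refl i \<circ> w)) = Suc (card (inversions N w))"
proof -
  let ?a = "inv' w i" and ?b = "inv' w (Suc i)"
  have ab: "1 \<le> ?a" "?b \<le> N" "w ?a = i" "w ?b = Suc i"
    and iff: "w r = i \<longleftrightarrow> r = ?a" "w r = Suc i \<longleftrightarrow> r = ?b" for r
    using permutes_cases[OF w, of i] permutes_cases[OF w, of "Suc i"] i by auto
  have "inversions N (simple_refl i \<circ> w) = insert (?a, ?b) (inversions N w)"
    using ab less by (auto simp: inversions_def simple_refl_less_iff iff)
  moreover have "(?a, ?b) \<notin> inversions N w" using ab by (simp add: inversions_def)
  ultimately show ?thesis by (simp add: finite_inversions)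
qed

lemma inv_simple_refl_comp:
  assumes "w permutes {1..Suc n}" "1 \<le> i" "i \<le> n"
  shows "inv' (simple_refl i \<circ> w) v = inv' w (simple_refl i v)"
  using o_inv_distrib[OF permutes_bij[OF simple_refl_permutes[OF assms(2,3)]] permutes_bij[OF assms(1)]]
  by simp

lemma inversions_simple_refl_cases:
  assumes w: "w permutes {1..Suc n}" and i: "1 \<le> i" "i \<le> n"
  shows "inv' w i < inv' w (Suc i) \<and> card (inversions (Suc n) (simple_refl i \<circ> w)) = Suc (card (inversions (Suc n) w)) \<or>
    inv' w (Suc i) < inv' w i \<and> card (inversions (Suc n) w) = Suc (card (inversions (Suc n) (simple_refl i \<circ> w)))"
proof -
  have "inv' w i \<noteq> inv' w (Suc i)" using permutes_inverses(1)[OF w] by (metis n_not_Suc_n)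
  then consider "inv' w i < inv' w (Suc i)" | "inv' w (Suc i) < inv' w i" by linarith
  then show ?thesis
  proof cases
    case 1
    then show ?thesis using inversions_simple_refl[OF w, of i] i by simp
  next
    case 2
    have "(simple_refl i \<circ> w) permutes {1..Suc n}"
      using permutes_compose[OF w simple_refl_permutes[OF i]] .
    from inversions_simple_refl[OF this, of i] show ?thesis
      using 2 i by (simp add: inv_simple_refl_comp[OF w i])
  qed
qed

lemma word_prod_Nil [simp]: "word_prod n [] = id"
  and word_prod_Cons [simp]: "word_prod n (i # is) = simple_refl i \<circ> word_prod n is"
  by (simp_all add: word_prod_def sym_group_def)

lemma word_prod_permutes: "set is \<subseteq> {1..n} ==> word_prod n is permutes {1..Suc n}"
proof (induction "is")
  case (Cons i "is")
  then show ?case using permutes_compose[OF Cons.IH simple_refl_permutes[of i n]] by (simp add: o_def)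
qed (simp add: permutes_id)

lemma inversions_le_length: "set is \<subseteq> {1..n} ==> card (inversions (Suc n) (word_prod n is)) \<le> length is"
proof (induction "is")
  case Nil
  have "inversions (Suc n) id = {}" by (auto simp: inversions_def)
  then show ?case by (simp add: id_def)
next
  case (Cons i "is")
  then have "word_prod n is permutes {1..Suc n}" by (intro word_prod_permutes) auto
  from inversions_simple_refl_cases[OF this, of i] show ?case using Cons by (auto simp: o_def)
qed

lemma monotone_permutation_id:
  assumes w: "w permutes {1..N}" and mono: "\<And>i. 1 \<le> i ==> i < N ==> w i < w (Suc i)"
  shows "w = id"
proof
  fix x
  have lower: "1 \<le> i ==> i \<le> N ==> i \<le> w i" for i
  proof (induction i)
    case (Suc i)
    show ?case
    proof (cases "i = 0")
      case True
      then show ?thesis using permutes_in_image[OF w, of 1] Suc.prems by auto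
    next
      case False
      then show ?thesis using mono[of i] Suc by fastforce
    qed
  qed simp
  have upper: "w (N - k) \<le> N - k" if "k < N" for k
    using that
  proof (induction k)
    case 0
    then show ?case using permutes_in_image[OF w, of N] by auto
  next
    case (Suc k)
    then have "w (N - Suc k) < w (N - k)" using mono[of "N - Suc k"] by (simp add: Suc_diff_Suc)
    then show ?case using Suc by simp
  qed
  show "w x = id x"
  proof (cases "1 \<le> x \<and> x \<le> N")
    case True
    then show ?thesis using lower[of x] upper[of "N - x"] by simp
  next
    case False
    then have "x \<notin> {1..N}" by auto
    then show ?thesis using permutes_not_in[OF w] by simp
  qed
qed

text \<open>
  If \<open>w\<close> is not the identity, some \<open>i + 1\<close> stands before \<open>i\<close> in its one-line notation, and then
  \<open>s\<^sub>i w\<close> has one inversion less.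
\<close>

lemma word_of_inversions:
  assumes "w permutes {1..Suc n}"
  shows "\<exists>is. set is \<subseteq> {1..n} \<and> word_prod n is = w \<and> length is = card (inversions (Suc n) w)"
  using assms
proof (induction "card (inversions (Suc n) w)" arbitrary: w rule: less_induct)
  case (less w)
  show ?case
  proof (cases "\<exists>i\<in>{1..n}. inv' w (Suc i) < inv' w i")
    case True
    then obtain i where i: "1 \<le> i" "i \<le> n" "inv' w (Suc i) < inv' w i" by auto
    let ?w = "simple_refl i \<circ> w"
    have c: "card (inversions (Suc n) w) = Suc (card (inversions (Suc n) ?w))"
      using inversions_simple_refl_cases[OF less.prems i(1,2)] i(3) by auto
    have "?w permutes {1..Suc n}" by (rule permutes_compose[OF less.prems simple_refl_permutes[OF i(1,2)]])
    from less.hyps[OF _ this] c obtain "is" where "set is \<subseteq> {1..n}" "word_prod n is = ?w"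
      "length is = card (inversions (Suc n) ?w)" by auto
    then show ?thesis using i c by (intro exI[of _ "i # is"]) simp
  next
    case False
    have "inv' w i < inv' w (Suc i)" if "1 \<le> i" "i < Suc n" for i
      using False that inversions_simple_refl_cases[OF less.prems, of i] by fastforce
    then have "inv' w = id" by (intro monotone_permutation_id[of _ "Suc n"] permutes_inv less.prems) auto
    then have "w = id" by (metis permutes_inv_inv[OF less.prems] inv_id)
    moreover have "inversions (Suc n) id = {}" by (auto simp: inversions_def)
    ultimately show ?thesis by (intro exI[of _ "[]"]) simp
  qed
qed

text \<open>A simple reflection changes the number of inversions by at most one, so no word is shorter.\<close>

lemma weyl_length_inversions:
  assumes "w permutes {1..Suc n}"
  shows "weyl_length n w = card (inversions (Suc n) w)"
  unfolding weyl_length_def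
proof (rule Least_equality)
  show "\<exists>is. set is \<subseteq> {1..n} \<and> length is = card (inversions (Suc n) w) \<and> word_prod n is = w"
    using word_of_inversions[OF assms] by blast
qed (use inversions_le_length in auto)

lemma reduced_word_exists: "w permutes {1..Suc n} ==> \<exists>is. reduced_word n is w"
  using word_of_inversions[of w n] by (auto simp: reduced_word_def weyl_length_inversions)

lemma reduced_word_ConsD:
  assumes "reduced_word n (i # is) w"
  shows "reduced_word n is (word_prod n is)" "1 \<le> i" "i \<le> n" "w = simple_refl i \<circ> word_prod n is"
    "word_prod n is permutes {1..Suc n}" "inv' (word_prod n is) i < inv' (word_prod n is) (Suc i)"
proof -
  have i: "1 \<le> i" "i \<le> n" "set is \<subseteq> {1..n}" and w: "w = simple_refl i \<circ> word_prod n is"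
    using assms by (auto simp: reduced_word_def)
  show "1 \<le> i" "i \<le> n" "w = simple_refl i \<circ> word_prod n is" by fact+
  show p: "word_prod n is permutes {1..Suc n}" by (rule word_prod_permutes[OF i(3)])
  have "w permutes {1..Suc n}" unfolding w by (rule permutes_compose[OF p simple_refl_permutes[OF i(1,2)]])
  then have "Suc (length is) = card (inversions (Suc n) w)"
    using assms by (simp add: reduced_word_def weyl_length_inversions)
  then show "inv' (word_prod n is) i < inv' (word_prod n is) (Suc i)" "reduced_word n is (word_prod n is)"
    using inversions_simple_refl_cases[OF p i(1,2)] inversions_le_length[OF i(3)] w i(3)
    by (auto simp: reduced_word_def weyl_length_inversions[OF p])
qed

lemma inversions_inv:
  assumes w: "w permutes {1..N}"
  shows "card (inversions N (inv' w)) = card (inversions N w)"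
proof -
  have b: "w permutes {1..N} ==> (\<lambda>(r, s). (w s, w r)) ` inversions N w \<subseteq> inversions N (inv' w)" for w
  proof clarify
    fix r s assume w: "w permutes {1..N}" and "(r, s) \<in> inversions N w"
    then show "(w s, w r) \<in> inversions N (inv' w)"
      using permutes_in_image[OF w, of s] permutes_in_image[OF w, of r]
      by (auto simp: inversions_def permutes_inverses[OF w])
  qed
  have inj: "w permutes {1..N} ==> inj_on (\<lambda>(r, s). (w s, w r)) (inversions N w)" for w
    by (rule inj_onI) (auto dest: permutes_inj injD)
  have le: "w permutes {1..N} ==> card (inversions N w) \<le> card (inversions N (inv' w))" for w
    using card_inj_on_le[OF inj b] finite_inversions by blast
  show ?thesis using le[OF w] le[OF permutes_inv[OF w]] by (simp add: permutes_inv_inv[OF w])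
qed

text \<open>
  Passing to inverses preserves the number of inversions and exchanges left and right multiplication.
\<close>

lemma weyl_length_right:
  assumes w: "w permutes {1..Suc n}" and i: "1 \<le> i" "i \<le> n"
  shows "weyl_length n (w \<circ> simple_refl i) = weyl_length n w + 1 \<longleftrightarrow> w i < w (Suc i)"
proof -
  have w': "inv' w permutes {1..Suc n}" by (rule permutes_inv[OF w])
  have p: "(w \<circ> simple_refl i) permutes {1..Suc n}" by (rule permutes_compose[OF simple_refl_permutes[OF i] w])
  have "inv' (w \<circ> simple_refl i) = simple_refl i \<circ> inv' w"
    using o_inv_distrib[OF permutes_bij[OF w] permutes_bij[OF simple_refl_permutes[OF i]]] by simp
  then have "weyl_length n (w \<circ> simple_refl i) = card (inversions (Suc n) (simple_refl i \<circ> inv' w))"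
    using inversions_inv[OF p] by (simp add: weyl_length_inversions[OF p])
  moreover have "weyl_length n w = card (inversions (Suc n) (inv' w))"
    using inversions_inv[OF w] by (simp add: weyl_length_inversions[OF w])
  ultimately show ?thesis
    using inversions_simple_refl_cases[OF w' i] unfolding permutes_inv_inv[OF w] by linarith
qed

section \<open>The ideals of Weyl group elements\<close>

context type_A
begin

definition cls :: "('b, 'k::field) path_elt => ('b, 'k) preproj_elt" where
  "cls f = preproj_ideal Q +>\<^bsub>PA\<^esub> f"

lemma kalg_preproj: "kalg (preproj Q :: ('k::field, ('b, 'k) preproj_elt) module)"
proof -
  interpret kalg "PA :: ('k, _) module" by (rule D.kalg_PA)
  show ?thesis unfolding preproj_def by (rule quot_kalg[OF preproj_ideal_ideal])
qed

lemma preproj_path_eq: "preproj_path Q x = cls (basis_path x)"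
  by (simp add: preproj_path_def cls_def)

lemma carrier_preproj: "carrier (preproj Q) = cls ` carrier PA"
  by (simp add: preproj_def quot_module_simps cls_def)

lemma cls_closed [simp]: "f \<in> carrier PA ==> cls f \<in> carrier (preproj Q)"
  by (simp add: carrier_preproj)

lemma cls_hom:
  fixes f :: "('b, 'k::field) path_elt"
  assumes "f \<in> carrier PA" "g \<in> carrier PA"
  shows "cls f \<otimes>\<^bsub>preproj Q\<^esub> cls g = cls (f \<otimes>\<^bsub>PA\<^esub> g)"
    "cls f \<oplus>\<^bsub>preproj Q\<^esub> cls g = cls (\<lambda>x. f x + g x)"
    "c \<odot>\<^bsub>preproj Q\<^esub> cls f = cls (\<lambda>x. c * f x)"
proof -
  interpret kalg "PA :: ('k, _) module" by (rule D.kalg_PA)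
  show "cls f \<otimes>\<^bsub>preproj Q\<^esub> cls g = cls (f \<otimes>\<^bsub>PA\<^esub> g)" "cls f \<oplus>\<^bsub>preproj Q\<^esub> cls g = cls (\<lambda>x. f x + g x)"
    using quot_mult[OF preproj_ideal_ideal assms] by (simp_all add: preproj_def cls_def path_algebra_simps(3))
  show "c \<odot>\<^bsub>preproj Q\<^esub> cls f = cls (\<lambda>x. c * f x)"
    using quot_smult[OF preproj_ideal_ideal assms(1), of c] by (simp add: preproj_def cls_def path_algebra_simps(4))
qed

lemma cls_zero_one: "\<zero>\<^bsub>preproj Q\<^esub> = (cls (\<lambda>_. 0) :: ('b, 'k::field) preproj_elt)"
    "\<one>\<^bsub>preproj Q\<^esub> = (cls \<one>\<^bsub>PA\<^esub> :: ('b, 'k) preproj_elt)"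
proof -
  interpret kalg "PA :: ('k, _) module" by (rule D.kalg_PA)
  interpret ideal "preproj_ideal Q" "PA :: ('k, _) module" by (rule preproj_ideal_ideal)
  show "\<zero>\<^bsub>preproj Q\<^esub> = (cls (\<lambda>_. 0) :: ('b, 'k) preproj_elt)"
  proof -
    have "preproj_ideal Q +>\<^bsub>PA\<^esub> (\<lambda>_. 0) = (preproj_ideal Q :: ('b, 'k) path_elt set)"
      using a_rcos_eq_zero_iff[OF D.zero_in_PA] preproj_ideal_zero by blast
    then show ?thesis unfolding cls_def by (simp add: preproj_def quot_module_simps)
  qed
qed (simp add: preproj_def cls_def quot_module_simps)

lemma cls_eq_iff:
  fixes f :: "('b, 'k::field) path_elt"
  assumes "f \<in> carrier PA" "g \<in> carrier PA"
  shows "cls f = cls g \<longleftrightarrow> f \<approx> g"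
    and "cls f = cls g \<longleftrightarrow> (\<forall>u p v. cell u p v \<longrightarrow> coord f u p v = coord g u p v)"
proof -
  interpret kalg "PA :: ('k, _) module" by (rule D.kalg_PA)
  interpret ideal "preproj_ideal Q" "PA :: ('k, _) module" by (rule preproj_ideal_ideal)
  show 1: "cls f = cls g \<longleftrightarrow> f \<approx> g"
    using a_rcos_eq_iff[OF assms] PA_minus[OF assms] by (simp add: cls_def equal_mod_def)
  have d: "(\<lambda>x. f x - g x) = (\<lambda>x. f x + (-1) * g x)" by simp
  have "coord (\<lambda>x. f x - g x) u p v = coord f u p v - coord g u p v" for u p v
    unfolding d by (subst coord_add[OF assms(1) D.scal_in_PA[OF assms(2)]]) (simp add: coord_scal[of "-1", simplified])
  moreover have "(\<lambda>x. f x - g x) \<in> carrier PA"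
    unfolding d by (intro D.add_in_PA D.scal_in_PA assms)
  ultimately show "cls f = cls g \<longleftrightarrow> (\<forall>u p v. cell u p v \<longrightarrow> coord f u p v = coord g u p v)"
    unfolding 1 equal_mod_def preproj_ideal_eq_kernel by (simp add: coord_kernel_iff)
qed

lemma cls_in_depth_ideal:
  assumes "f \<in> carrier PA"
  shows "cls f \<in> cls ` depth_ideal c \<longleftrightarrow> f \<in> depth_ideal c"
  using assms by (auto simp: cls_eq_iff(2) depth_ideal_def)

lemma depth_subgroup:
  "subgroup (cls ` depth_ideal c) (add_monoid (preproj Q :: ('k::field, ('b, 'k) preproj_elt) module))"
proof -
  interpret kalg "preproj Q :: ('k, ('b, 'k) preproj_elt) module" by (rule kalg_preproj)
  show ?thesis
  proof (rule add.subgroupI)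
    show "cls ` depth_ideal c \<subseteq> carrier (preproj Q :: ('k, ('b, 'k) preproj_elt) module)"
      by (auto dest: depth_idealD(1))
    show "cls ` depth_ideal c \<noteq> ({} :: ('b, 'k) preproj_elt set)" using depth_ideal_zero by blast
    fix a :: "('b, 'k) preproj_elt" assume "a \<in> cls ` depth_ideal c"
    then obtain f where f: "a = cls f" "f \<in> depth_ideal c" by auto
    note fc = depth_idealD(1)[OF f(2)]
    have "\<ominus>\<^bsub>preproj Q\<^esub> a = cls (\<lambda>x. (-1) * f x)"
      by (rule minus_equality)
        (use fc D.scal_in_PA[OF fc, of "-1"] in \<open>auto simp: f(1) cls_hom(2) cls_zero_one\<close>)
    then show "\<ominus>\<^bsub>preproj Q\<^esub> a \<in> cls ` depth_ideal c"
      using depth_ideal_scal[OF f(2), of "-1"] by simp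
    fix b :: "('b, 'k) preproj_elt" assume "b \<in> cls ` depth_ideal c"
    then obtain g where g: "b = cls g" "g \<in> depth_ideal c" by auto
    show "a \<oplus>\<^bsub>preproj Q\<^esub> b \<in> cls ` depth_ideal c"
      using depth_ideal_add[OF f(2) g(2)] by (simp add: f g cls_hom(2)[OF fc depth_idealD(1)[OF g(2)]])
  qed
qed

lemma cls_depth_ideal_ideal:
  assumes "left_stable c" "right_stable c"
  shows "ideal (cls ` depth_ideal c) (preproj Q :: ('k::field, ('b, 'k) preproj_elt) module)"
proof -
  interpret kalg "preproj Q :: ('k, ('b, 'k) preproj_elt) module" by (rule kalg_preproj)
  have "subgroup (cls ` depth_ideal c) (add_monoid (preproj Q :: ('k, ('b, 'k) preproj_elt) module))"
    by (rule depth_subgroup)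
  then show ?thesis
  proof (rule idealI[OF ring_axioms])
    fix a x :: "('b, 'k) preproj_elt" assume "a \<in> cls ` depth_ideal c" "x \<in> carrier (preproj Q)"
    then obtain f g where f: "a = cls f" "f \<in> depth_ideal c" and g: "x = cls g" "g \<in> carrier PA"
      by (auto simp: carrier_preproj)
    note fc = depth_idealD(1)[OF f(2)]
    show "x \<otimes>\<^bsub>preproj Q\<^esub> a \<in> cls ` depth_ideal c" "a \<otimes>\<^bsub>preproj Q\<^esub> x \<in> cls ` depth_ideal c"
      using depth_ideal_left_mult[OF assms(1) g(2) f(2)] depth_ideal_right_mult[OF assms(2) g(2) f(2)]
      by (simp_all add: f g cls_hom[OF g(2) fc] cls_hom[OF fc g(2)])
  qed
qed

lemma path_length:
  "(u, q) \<in> paths D ==> path_end D (u, q) + 2 * descents q = u + length q"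
proof (induction q rule: rev_induct)
  case (snoc b q)
  then have b: "b \<in> arcs D" "path_end D (u, q) = tail D b" "(u, q) \<in> paths D" by (auto simp: D.paths_snoc)
  from b(1) show ?case by (cases rule: arcs_DE) (use snoc b in auto)
qed simp

lemma coord_vertex:
  assumes "f \<in> carrier PA"
  shows "coord f i 0 i = (f (i, []) :: 'k::field)"
  using assms
proof (induction f rule: D.PA_induct)
  case (basis c x)
  obtain u q where x: "x = (u, q)" by (cases x)
  have "coord (basis_path (u, q)) i 0 i = (basis_path (u, q) (i, []) :: 'k)"
    using path_length[of u q] basis x unfolding coord_basis by (auto simp: basis_path_def)
  then show ?case by (simp add: x coord_scal)
qed (simp_all add: coord_add)

text \<open>
  The classes with coordinate zero at the trivial path of \<open>i\<close> form an ideal that contains \<open>1 - e\<^sub>i\<close>.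
\<close>

lemma vertex_ideal_subset:
  fixes x :: "('b, 'k::field) preproj_elt"
  assumes i: "1 \<le> i" "i \<le> n" and x: "x \<in> vertex_ideal Q i"
  obtains f where "f \<in> carrier PA" "f (i, []) = 0" "x = cls f"
proof -
  interpret kalg "preproj Q :: ('k, ('b, 'k) preproj_elt) module" by (rule kalg_preproj)
  let ?c = "\<lambda>u v. if u = i \<and> v = i then 1 else 0 :: nat"
  let ?e = "basis_path (i, []) :: ('b, 'k) path_elt"
  have e: "?e \<in> carrier PA" using i by (intro D.basis_in_PA) simp
  let ?f = "\<lambda>x. \<one>\<^bsub>PA\<^esub> x - ?e x"
  have f: "?f \<in> carrier PA" using D.add_in_PA[OF D.one_in_PA D.scal_in_PA[OF e, of "-1"]] by simp
  have one: "\<one>\<^bsub>preproj Q\<^esub> = cls ?f \<oplus>\<^bsub>preproj Q\<^esub> cls ?e"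
    by (simp add: cls_hom(2)[OF f e] cls_zero_one)
  have "\<one>\<^bsub>preproj Q\<^esub> \<ominus>\<^bsub>preproj Q\<^esub> cls ?e = cls ?f"
    unfolding one a_minus_def a_assoc[OF cls_closed[OF f] cls_closed[OF e] a_inv_closed[OF cls_closed[OF e]]]
      r_neg[OF cls_closed[OF e]] by (rule r_zero[OF cls_closed[OF f]])
  moreover have "?f \<in> depth_ideal ?c"
    using coord_vertex[OF f, of i] f i by (auto simp: depth_ideal_def D.one_PA basis_path_def split: if_splits)
  ultimately have gen: "\<one>\<^bsub>preproj Q\<^esub> \<ominus>\<^bsub>preproj Q\<^esub> cls ?e \<in> cls ` depth_ideal ?c" by simp
  have "ideal (cls ` depth_ideal ?c) (preproj Q :: ('k, ('b, 'k) preproj_elt) module)"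
    by (rule cls_depth_ideal_ideal)
      (auto simp: left_stable_def right_stable_def cell_def split: if_splits)
  then have "(vertex_ideal Q i :: ('b, 'k) preproj_elt set) \<subseteq> cls ` depth_ideal ?c"
    unfolding vertex_ideal_def preproj_path_eq by (rule genideal_minimal) (use gen in simp)
  then obtain f where f: "f \<in> depth_ideal ?c" "x = cls f" using x by auto
  have "cell i 0 i" using i by (simp add: cell_def)
  then have "f (i, []) = 0" using f(1) coord_vertex[of f i] by (auto simp: depth_ideal_def)
  then show ?thesis using that f depth_idealD(1) by blast
qed

lemma vertex_ideal_mem:
  fixes f :: "('b, 'k::field) path_elt"
  assumes i: "1 \<le> i" "i \<le> n" and f: "f \<in> carrier PA" "f \<otimes>\<^bsub>PA\<^esub> basis_path (i, []) = (\<lambda>_. 0)"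
  shows "cls f \<in> vertex_ideal Q i"
proof -
  interpret kalg "preproj Q :: ('k, ('b, 'k) preproj_elt) module" by (rule kalg_preproj)
  let ?e = "cls (basis_path (i, [])) :: ('b, 'k) preproj_elt"
  have e: "basis_path (i, []) \<in> carrier (PA :: ('k, _) module)" using i by (intro D.basis_in_PA) simp
  have gen: "\<one>\<^bsub>preproj Q\<^esub> \<ominus>\<^bsub>preproj Q\<^esub> ?e \<in> vertex_ideal Q i"
    unfolding vertex_ideal_def preproj_path_eq using e by (intro genideal_self') simp
  have "ideal (vertex_ideal Q i) (preproj Q :: ('k, ('b, 'k) preproj_elt) module)"
    unfolding vertex_ideal_def preproj_path_eq using e by (intro genideal_ideal) simp
  then have "cls f \<otimes>\<^bsub>preproj Q\<^esub> (\<one>\<^bsub>preproj Q\<^esub> \<ominus>\<^bsub>preproj Q\<^esub> ?e) \<in> vertex_ideal Q i"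
    using gen f(1) by (intro ideal.I_l_closed) auto
  moreover have "cls f \<otimes>\<^bsub>preproj Q\<^esub> ?e = \<zero>\<^bsub>preproj Q\<^esub>"
    by (simp add: cls_hom(1)[OF f(1) e] f(2) cls_zero_one)
  then have "cls f \<otimes>\<^bsub>preproj Q\<^esub> (\<one>\<^bsub>preproj Q\<^esub> \<ominus>\<^bsub>preproj Q\<^esub> ?e) = cls f"
    using f(1) e by (simp add: a_minus_def r_distr r_minus)
  ultimately show ?thesis by simp
qed

text \<open>
  Multiplying by \<open>I\<^sub>i\<close> on the left changes a left ideal only at the vertex \<open>i\<close>, where it leaves what
  arrives from the neighbours.
\<close>

definition lower :: "nat => (nat => nat => nat) => nat => nat => nat" where
  "lower i c u v = (if v = i then min (c u (i - 1)) (Suc (c u (Suc i))) else c u v)"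

lemma coord_path_mult:
  assumes "(w, q) \<in> paths D" "g \<in> carrier PA" "v \<noteq> path_end D (w, q)"
  shows "coord (basis_path (w, q) \<otimes>\<^bsub>PA\<^esub> g) u p v = (0 :: 'k::field)"
  using assms(2)
proof (induction g rule: D.PA_induct)
  case (basis c x)
  then show ?case using assms(1,3)
    by (cases x) (auto simp: D.mult_lin coord_scal coord_basis D.mult_basis path_end_append)
qed (use assms(1) in \<open>simp_all add: D.mult_lin coord_add D.mult_in_PA D.basis_in_PA\<close>)

text \<open>
  A path that is not trivial and ends at \<open>i\<close> arrives there from \<open>i - 1\<close>, or by a descent from \<open>i + 1\<close>.
\<close>

lemma path_mult_lower:
  assumes c: "left_stable c" and i: "1 \<le> i" "i \<le> n" and x: "(w, q) \<in> paths D" "(w, q) \<noteq> (i, [])"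
    and g: "g \<in> depth_ideal c"
  shows "basis_path (w, q) \<otimes>\<^bsub>PA\<^esub> g \<in> (depth_ideal (lower i c) :: ('b, 'k::field) path_elt set)"
proof -
  note gc = depth_idealD(1)[OF g]
  have h: "basis_path (w, q) \<otimes>\<^bsub>PA\<^esub> g \<in> depth_ideal c"
    by (rule depth_ideal_left_mult[OF c D.basis_in_PA[OF x(1)] g])
  have "coord (basis_path (w, q) \<otimes>\<^bsub>PA\<^esub> g) u p v = 0" if uv: "cell u p v" "p < lower i c u v" for u p v
  proof (cases "v = i \<and> path_end D (w, q) = i")
    case False
    then consider "v \<noteq> path_end D (w, q)" | "v \<noteq> i" by auto
    then show ?thesis
    proof cases
      case 1
      then show ?thesis by (rule coord_path_mult[OF x(1) gc])
    next
      case 2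
      then show ?thesis using uv h by (simp add: lower_def depth_ideal_def)
    qed
  next
    case True
    with x(2) have "q \<noteq> []" by auto
    then obtain q' b where q: "q = q' @ [b]" by (metis append_butlast_last_id)
    then have q': "(w, q') \<in> paths D" and b: "b \<in> arcs D" "head D b = i" using x(1) True by (auto simp: D.paths_snoc)
    let ?h = "basis_path (w, q') \<otimes>\<^bsub>PA\<^esub> g"
    have h': "?h \<in> depth_ideal c" by (rule depth_ideal_left_mult[OF c D.basis_in_PA[OF q'] g])
    note hc = depth_idealD(1)[OF h']
    have eq: "basis_path (w, q) \<otimes>\<^bsub>PA\<^esub> g = basis_arrow D b \<otimes>\<^bsub>PA\<^esub> ?h"
      unfolding q using x(1) q by (simp add: D.arrow_mult_basis D.mult_assoc_PA D.basis_in_PA q' b gc)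
    from b(1) show ?thesis
    proof (cases rule: arcs_DE)
      case (up j)
      then have ij: "i = Suc j" using b by simp
      have "coord ?h u p j = 0"
        by (rule depth_idealD(2)[OF h']) (use uv True ij in \<open>auto simp: cell_def lower_def\<close>)
      then show ?thesis unfolding eq using up by (simp add: coord_up_mult[OF hc])
    next
      case (dn j)
      then have ij: "i = j" using b by simp
      have "coord ?h u (p - 1) (Suc j) = 0" if "0 < p"
        by (rule depth_idealD(2)[OF h']) (use uv True ij that in \<open>auto simp: cell_def lower_def\<close>)
      then show ?thesis unfolding eq using dn by (simp add: coord_dn_mult[OF hc])
    qed
  qed
  then show ?thesis using depth_idealD(1)[OF h] by (auto simp: depth_ideal_def)
qed

lemma vertex_ideal_mult_lower:
  assumes c: "left_stable c" and i: "1 \<le> i" "i \<le> n" and f: "f \<in> carrier PA" "f (i, []) = 0"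
    and g: "g \<in> depth_ideal c"
  shows "f \<otimes>\<^bsub>PA\<^esub> g \<in> (depth_ideal (lower i c) :: ('b, 'k::field) path_elt set)"
proof -
  let ?e = "basis_path (i, []) \<otimes>\<^bsub>PA\<^esub> g"
  have "(\<lambda>x. (f \<otimes>\<^bsub>PA\<^esub> g) x - f (i, []) * ?e x) \<in> depth_ideal (lower i c)"
    using f(1)
  proof (induction f rule: D.PA_induct)
    case (basis a x)
    show ?case
    proof (cases "x = (i, [])")
      case True
      then show ?thesis using depth_ideal_zero by (simp add: D.mult_lin basis_path_def)
    next
      case False
      then show ?thesis using path_mult_lower[OF c i _ _ g, of "fst x" "snd x"] basis
        by (simp add: D.mult_lin depth_ideal_scal) (simp add: basis_path_def depth_ideal_scal)
    qed
  next
    case (add f f')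
    then show ?case using depth_ideal_add[OF add(3,4)] by (simp add: D.mult_lin algebra_simps)
  qed (simp add: D.mult_lin depth_ideal_zero)
  then show ?thesis using f(2) by simp
qed

text \<open>
  A normal form is the product of its last arrow and a shorter one if it ends at \<open>i\<close>; otherwise the
  trivial path at its end already lies in \<open>I\<^sub>i\<close>.
\<close>

lemma normal_elt_in_prod:
  fixes c :: "nat => nat => nat"
  assumes i: "1 \<le> i" "i \<le> n" and c: "\<And>u v. u \<le> n ==> v \<le> n ==> u \<le> c u v + v"
    and t: "cell u p v" "lower i c u v \<le> p"
  shows "cls (normal_elt (u, p, v) :: ('b, 'k::field) path_elt) \<in>
    ideal_prod (preproj Q) (vertex_ideal Q i) (cls ` depth_ideal c)"
proof -
  have prod: "cls (normal_elt (u, p, v) :: ('b, 'k) path_elt) \<in> ideal_prod (preproj Q) (vertex_ideal Q i) (cls ` depth_ideal c)"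
    if f: "f \<in> carrier PA" "f \<otimes>\<^bsub>PA\<^esub> basis_path (i, []) = (\<lambda>_. 0)"
      and cl: "cell u p' v'" "c u v' \<le> p'"
      and co: "\<And>u2 p2 v2. cell u2 p2 v2 ==> coord (f \<otimes>\<^bsub>PA\<^esub> normal_elt (u, p', v')) u2 p2 v2 = (if (u2, p2, v2) = (u, p, v) then a else 0)"
      and a: "a \<noteq> 0"
    for f :: "('b, 'k) path_elt" and p' v' a
  proof -
    let ?g = "\<lambda>x. inverse a * normal_elt (u, p', v') x :: 'k"
    note N = normal_elt_in_PA[OF cl(1), where ?'k = 'k]
    have g: "?g \<in> depth_ideal c"
      using N cl by (auto simp: depth_ideal_def coord_scal coord_normal_elt[OF cl(1)] D.scal_in_PA)
    have "cls f \<otimes>\<^bsub>preproj Q\<^esub> cls ?g \<in> ideal_prod (preproj Q) (vertex_ideal Q i) (cls ` depth_ideal c)"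
      using vertex_ideal_mem[OF i f] g by (intro ideal_prod.prod) auto
    moreover have "cls f \<otimes>\<^bsub>preproj Q\<^esub> cls ?g = cls (normal_elt (u, p, v))"
      using co a by (simp add: cls_hom(1)[OF f(1) D.scal_in_PA[OF N]] D.mult_lin cls_eq_iff(2) D.scal_in_PA
          D.mult_in_PA[OF f(1) N] normal_elt_in_PA[OF t(1)] coord_scal coord_normal_elt[OF t(1)])
    ultimately show ?thesis by simp
  qed
  show ?thesis
  proof (cases "v = i")
    case False
    show ?thesis
      by (rule prod[of "basis_path (v, [])" p v 1])
        (use t False in \<open>auto simp: cell_def lower_def D.basis_in_PA D.mult_basis coord_vertex_mult
          normal_elt_in_PA coord_normal_elt\<close>)
  next
    case True
    then consider "c u (i - 1) \<le> p" | "Suc (c u (Suc i)) \<le> p" using t(2) by (auto simp: lower_def min_def split: if_splits)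
    then show ?thesis
    proof cases
      case 1
      have ui: "u \<le> n" "i - 1 \<le> n" using t(1) i by (auto simp: cell_def)
      have b: "u \<le> p + (i - 1)" using c[OF ui] 1 by linarith
      then have i1: "1 < i" using t(1) by (cases "i = 1") (auto simp: cell_def)
      then have cl: "cell u p (i - 1)" using t(1) True b by (auto simp: cell_def)
      have s: "Suc (i - 1) = i" "1 \<le> i - 1" "i - 1 < n" using i i1 by auto
      have N: "normal_elt (u, p, i - 1) \<in> carrier (PA :: ('k, _) module)" by (rule normal_elt_in_PA[OF cl])
      show ?thesis
      proof (rule prod[OF _ _ cl 1, of "basis_arrow D (up (i - 1))" 1])
        have up: "up (i - 1) \<in> arcs D" "tail D (up (i - 1)) = i - 1" using s by simp_all
        then show "basis_arrow D (up (i - 1)) \<in> carrier PA" by simp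
        show "basis_arrow D (up (i - 1)) \<otimes>\<^bsub>PA\<^esub> basis_path (i, []) = (\<lambda>_. 0 :: 'k)"
          using up i1 by (auto simp: basis_arrow_def D.mult_basis)
      qed (use s True in \<open>auto simp: coord_up_mult[OF N s(2,3)] coord_normal_elt[OF cl] simp del: One_nat_def\<close>)
    next
      case 2
      then have cl: "cell u (p - 1) (Suc i)" and s: "1 \<le> i" "i < n" "0 < p" using t(1) True by (auto simp: cell_def)
      have N: "normal_elt (u, p - 1, Suc i) \<in> carrier (PA :: ('k, _) module)" by (rule normal_elt_in_PA[OF cl])
      show ?thesis
      proof (rule prod[OF _ _ cl, of "basis_arrow D (dn i)" "eps i"])
        have dn: "dn i \<in> arcs D" "tail D (dn i) = Suc i" using s by simp_all
        then show "basis_arrow D (dn i) \<in> carrier PA" by simp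
        show "basis_arrow D (dn i) \<otimes>\<^bsub>PA\<^esub> basis_path (i, []) = (\<lambda>_. 0 :: 'k)"
          using dn by (simp add: basis_arrow_def D.mult_basis)
        show "(eps i :: 'k) \<noteq> 0" by (simp add: eps_def)
      qed (use s 2 True in \<open>auto simp: coord_dn_mult[OF N s(1,2)] coord_normal_elt[OF cl] simp del: One_nat_def\<close>)
    qed
  qed
qed

lemma ideal_prod_depth_ideal:
  fixes c :: "nat => nat => nat"
  assumes c: "left_stable c" "\<And>u v. u \<le> n ==> v \<le> n ==> u \<le> c u v + v" and i: "1 \<le> i" "i \<le> n"
  shows "ideal_prod (preproj Q) (vertex_ideal Q i) (cls ` depth_ideal c) =
    (cls ` depth_ideal (lower i c) :: ('b, 'k::field) preproj_elt set)"
proof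
  show "ideal_prod (preproj Q) (vertex_ideal Q i) (cls ` depth_ideal c) \<subseteq>
    (cls ` depth_ideal (lower i c) :: ('b, 'k) preproj_elt set)"
  proof
    fix x :: "('b, 'k) preproj_elt" assume "x \<in> ideal_prod (preproj Q) (vertex_ideal Q i) (cls ` depth_ideal c)"
    then show "x \<in> cls ` depth_ideal (lower i c)"
    proof (induction rule: ideal_prod.induct)
      case (prod x y)
      obtain f where f: "f \<in> carrier PA" "f (i, []) = 0" "x = cls f" by (rule vertex_ideal_subset[OF i prod(1)])
      obtain g where g: "g \<in> depth_ideal c" "y = cls g" using prod(2) by auto
      show ?case using vertex_ideal_mult_lower[OF c(1) i f(1,2) g(1)]
        by (simp add: f(3) g(2) cls_hom(1)[OF f(1) depth_idealD(1)[OF g(1)]])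
    next
      case (sum x y)
      then obtain f g where f: "f \<in> depth_ideal (lower i c)" "x = cls f" and g: "g \<in> depth_ideal (lower i c)" "y = cls g"
        by auto
      then show ?case using depth_ideal_add[OF f(1) g(1)]
        by (simp add: cls_hom(2)[OF depth_idealD(1)[OF f(1)] depth_idealD(1)[OF g(1)]])
    qed
  qed
  show "(cls ` depth_ideal (lower i c) :: ('b, 'k) preproj_elt set) \<subseteq>
    ideal_prod (preproj Q) (vertex_ideal Q i) (cls ` depth_ideal c)" (is "_ \<subseteq> ?P")
  proof clarify
    fix f :: "('b, 'k) path_elt" assume f: "f \<in> depth_ideal (lower i c)"
    note fc = depth_idealD(1)[OF f]
    \<comment> \<open>A product of ideals is only closed under sums by definition; scalars move into the second factor.\<close>
    have scal: "cls (\<lambda>y. a * h y) \<in> ?P" if "cls h \<in> ?P" "h \<in> carrier PA" for a and h :: "('b, 'k) path_elt"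
    proof -
      have "\<exists>h'\<in>carrier PA. x = cls h' \<and> cls (\<lambda>y. a * h' y) \<in> ?P" if "x \<in> ?P" for x
        using that
      proof (induction rule: ideal_prod.induct)
        case (prod x y)
        obtain f where f: "f \<in> carrier PA" "f (i, []) = 0" "x = cls f" by (rule vertex_ideal_subset[OF i prod(1)])
        obtain g where g: "g \<in> depth_ideal c" "y = cls g" using prod(2) by auto
        note gc = depth_idealD(1)[OF g(1)]
        have "cls f \<otimes>\<^bsub>preproj Q\<^esub> cls (\<lambda>y. a * g y) \<in> ?P"
          using prod(1) depth_ideal_scal[OF g(1)] f(3) by (intro ideal_prod.prod) auto
        then show ?case using f g gc
          by (intro bexI[of _ "f \<otimes>\<^bsub>PA\<^esub> g"])
            (auto simp: cls_hom(1)[OF f(1) gc] cls_hom(1)[OF f(1) D.scal_in_PA[OF gc]] D.mult_lin D.mult_in_PA)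
      next
        case (sum x y)
        then obtain h h' where h: "h \<in> carrier PA" "x = cls h" "cls (\<lambda>y. a * h y) \<in> ?P"
          and h': "h' \<in> carrier PA" "y = cls h'" "cls (\<lambda>y. a * h' y) \<in> ?P" by auto
        have "cls (\<lambda>y. a * h y) \<oplus>\<^bsub>preproj Q\<^esub> cls (\<lambda>y. a * h' y) \<in> ?P" using h(3) h'(3) by (rule ideal_prod.sum)
        then show ?case using h h'
          by (intro bexI[of _ "\<lambda>x. h x + h' x"])
            (auto simp: cls_hom(2)[OF h(1) h'(1)] cls_hom(2)[OF D.scal_in_PA[OF h(1)] D.scal_in_PA[OF h'(1)]] D.add_in_PA distrib_left)
      qed
      from this[OF that(1)] obtain h' where h': "h' \<in> carrier PA" "cls h = cls h'" "cls (\<lambda>y. a * h' y) \<in> ?P" by auto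
      moreover have "cls (\<lambda>y. a * h y) = cls (\<lambda>y. a * h' y)"
        using h' cls_hom(3)[OF that(2) that(2)] cls_hom(3)[OF h'(1) h'(1)] by metis
      ultimately show ?thesis by simp
    qed
    let ?t = "\<lambda>t y. (case t of (u, p, v) => coord f u p v) * normal_elt t y"
    have t: "cls (?t t) \<in> ?P \<and> ?t t \<in> carrier PA" if tc: "t \<in> cells" for t
    proof -
      obtain u p v where t: "t = (u, p, v)" "cell u p v" using tc by (auto simp: cells_def)
      show ?thesis
      proof (cases "p < lower i c u v")
        case True
        have "coord f u p v = 0" using f True t(2) by (auto simp: depth_ideal_def)
        then have e: "?t t = (\<lambda>_. 0)" by (simp add: t)
        have "cls (\<lambda>_. 0 :: 'k) \<otimes>\<^bsub>preproj Q\<^esub> cls (\<lambda>_. 0) \<in> ?P"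
          using vertex_ideal_mem[OF i D.zero_in_PA] depth_ideal_zero
          by (intro ideal_prod.prod) (auto simp: D.mult_lin)
        then show ?thesis using e by (simp add: cls_hom(1)[OF D.zero_in_PA D.zero_in_PA] D.mult_lin D.zero_in_PA)
      next
        case False
        then show ?thesis using normal_elt_in_prod[OF i c(2) t(2), where ?'k = 'k] normal_elt_in_PA[OF t(2), where ?'k = 'k]
          by (simp add: t scal D.scal_in_PA)
      qed
    qed
    have fs: "cls f = cls (\<lambda>y. \<Sum>t\<in>cells. ?t t y)"
      using cls_eq_iff(1)[OF fc] normal_expansion[OF fc] lin_sum[OF finite_cells, of ?t] t by auto
    have "cls (\<lambda>y. \<Sum>t\<in>S. ?t t y) \<in> ?P" if "finite S" "S \<noteq> {}" "S \<subseteq> cells" for S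
      using that
    proof (induction S rule: finite_ne_induct)
      case (singleton t)
      then show ?case using t by simp
    next
      case (insert t S)
      have "?t s \<in> carrier PA" if "s \<in> S" for s using t[of s] insert(5) that by blast
      then have "(\<lambda>y. \<Sum>t\<in>S. ?t t y) \<in> carrier PA" using lin_sum[OF insert(1), of ?t] by blast
      moreover have "cls (?t t) \<oplus>\<^bsub>preproj Q\<^esub> cls (\<lambda>y. \<Sum>t\<in>S. ?t t y) \<in> ?P"
        using insert t by (intro ideal_prod.sum) auto
      ultimately show ?case using insert t by (simp add: cls_hom(2))
    qed
    moreover have "(1, 0, 1) \<in> cells" using n_pos by (simp add: cells_def cell_def)
    ultimately show "cls f \<in> ?P" using finite_cells unfolding fs by blast
  qed
qed

end

context type_A
begin

text \<open>
  The least number of descents of a path from \<open>u\<close> to \<open>v\<close> that lies in \<open>I(w)\<close>.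
\<close>

definition depth_of :: "(nat => nat) => nat => nat => nat" where
  "depth_of w u v = card {r \<in> {1..u}. v < w r}"

lemma depth_of_step:
  assumes w: "w permutes {1..Suc n}"
  shows "depth_of w u (Suc v) \<le> depth_of w u v" "depth_of w u v \<le> Suc (depth_of w u (Suc v))"
proof -
  show "depth_of w u (Suc v) \<le> depth_of w u v" unfolding depth_of_def by (rule card_mono) auto
  have "{r \<in> {1..u}. v < w r} \<subseteq> insert (inv' w (Suc v)) {r \<in> {1..u}. Suc v < w r}"
  proof
    fix r assume r: "r \<in> {r \<in> {1..u}. v < w r}"
    show "r \<in> insert (inv' w (Suc v)) {r \<in> {1..u}. Suc v < w r}"
    proof (cases "w r = Suc v")
      case True
      then show ?thesis using permutes_inverses(2)[OF w, of r] by simp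
    qed (use r in auto)
  qed
  then have "card {r \<in> {1..u}. v < w r} \<le> card (insert (inv' w (Suc v)) {r \<in> {1..u}. Suc v < w r})"
    by (rule card_mono[rotated]) simp
  also have "\<dots> \<le> Suc (card {r \<in> {1..u}. Suc v < w r})" by (rule card_insert_le_m1) auto
  finally show "depth_of w u v \<le> Suc (depth_of w u (Suc v))" by (simp add: depth_of_def)
qed

lemma depth_of_left_stable:
  assumes "w permutes {1..Suc n}"
  shows "left_stable (depth_of w)"
proof -
  have "p < depth_of w u v" if "p < depth_of w u (Suc v)" for u p v
    using depth_of_step(1)[OF assms, of u v] that by linarith
  moreover have "p < depth_of w u (Suc v)" if "Suc p < depth_of w u v" for u p v
    using depth_of_step(2)[OF assms, of u v] that by linarith
  ultimately show ?thesis unfolding left_stable_def by blast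
qed

lemma depth_of_reaches:
  assumes w: "w permutes {1..Suc n}" and u: "u \<le> n"
  shows "u \<le> depth_of w u v + v"
proof -
  have "card {r \<in> {1..u}. \<not> v < w r} \<le> card {1..v}"
  proof (rule card_inj_on_le[of w])
    show "inj_on w {r \<in> {1..u}. \<not> v < w r}" using permutes_inj[OF w] by (rule inj_on_subset) simp
    show "w ` {r \<in> {1..u}. \<not> v < w r} \<subseteq> {1..v}"
      using permutes_in_image[OF w] u by (fastforce simp: not_less)
  qed simp
  moreover have "card {1..u} = depth_of w u v + card {r \<in> {1..u}. \<not> v < w r}"
  proof -
    have "{1..u} = {r \<in> {1..u}. v < w r} \<union> {r \<in> {1..u}. \<not> v < w r}" by auto
    moreover have "card ({r \<in> {1..u}. v < w r} \<union> {r \<in> {1..u}. \<not> v < w r}) =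
        card {r \<in> {1..u}. v < w r} + card {r \<in> {1..u}. \<not> v < w r}"
      by (rule card_Un_disjoint) auto
    ultimately show ?thesis unfolding depth_of_def by metis
  qed
  ultimately show ?thesis by simp
qed

lemma depth_of_id: "depth_of id u v = u - v"
proof -
  have "{r \<in> {1..u}. v < id r} = {Suc v..u}" by auto
  then show ?thesis by (simp add: depth_of_def)
qed

text \<open>
  The sets counted for the bounds \<open>i - 1\<close>, \<open>i\<close> and \<open>i + 1\<close> differ by the positions of \<open>i\<close> and \<open>i + 1\<close> in \<open>w\<close>.
\<close>

lemma depth_of_simple_refl:
  assumes w: "w permutes {1..Suc n}" and i: "1 \<le> i" "i \<le> n" and less: "inv' w i < inv' w (Suc i)"
  shows "depth_of (simple_refl i \<circ> w) u v = lower i (depth_of w) u v"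
proof (cases "v = i")
  case False
  have "v < simple_refl i x \<longleftrightarrow> v < x" for x using False by (auto simp: simple_refl_def transpose_def)
  then show ?thesis using False by (simp add: depth_of_def lower_def)
next
  case True
  let ?a = "inv' w i" and ?b = "inv' w (Suc i)" and ?S = "{r \<in> {1..u}. Suc i < w r}"
  have ab: "1 \<le> ?a" "w r = i \<longleftrightarrow> r = ?a" "w r = Suc i \<longleftrightarrow> r = ?b" for r
    using permutes_cases[OF w, of i] permutes_cases[OF w, of "Suc i"] i by auto
  have n: "?a \<notin> ?S" "?b \<notin> ?S" "?a \<noteq> ?b" "finite ?S" using ab(2)[of ?a] ab(3)[of ?b] less by auto
  have "i < simple_refl i y \<longleftrightarrow> Suc i < y \<or> y = i" for y by (auto simp: simple_refl_def transpose_def)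
  then have "{r \<in> {1..u}. i < simple_refl i (w r)} = {r \<in> {1..u}. Suc i < w r \<or> r = ?a}" by (simp add: ab)
  also have "\<dots> = ?S \<union> (if ?a \<le> u then {?a} else {})" using ab(1) by auto
  finally have 1: "depth_of (simple_refl i \<circ> w) u v = card ?S + (if ?a \<le> u then 1 else 0)"
    using n True by (simp add: depth_of_def)
  have "i - 1 < x \<longleftrightarrow> x = i \<or> x = Suc i \<or> Suc i < x" for x using i by auto
  then have "{r \<in> {1..u}. i - 1 < w r} = {r \<in> {1..u}. r = ?a \<or> r = ?b \<or> Suc i < w r}" by (simp add: ab)
  also have "\<dots> = ?S \<union> (if ?a \<le> u then {?a} else {}) \<union> (if ?b \<le> u then {?b} else {})"
    using ab(1) less by auto
  finally have 2: "depth_of w u (i - 1) = card ?S + (if ?a \<le> u then 1 else 0) + (if ?b \<le> u then 1 else 0)"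
    using n by (simp add: depth_of_def)
  have 3: "depth_of w u (Suc i) = card ?S" by (simp add: depth_of_def)
  have "lower i (depth_of w) u v = min (depth_of w u (i - 1)) (Suc (depth_of w u (Suc i)))"
    using True by (simp add: lower_def)
  then show ?thesis unfolding 1 2 3 using less by auto
qed

theorem weyl_ideal_depth:
  assumes w: "w permutes {1..Suc n}"
  shows "weyl_ideal n Q w = (cls ` depth_ideal (depth_of w) :: ('b, 'k::field) preproj_elt set)"
proof -
  have "reduced_word n is w ==> foldr (ideal_prod (preproj Q)) (map (vertex_ideal Q) is) (carrier (preproj Q)) =
      (cls ` depth_ideal (depth_of w) :: ('b, 'k) preproj_elt set)" for "is" w
  proof (induction "is" arbitrary: w)
    case Nil
    then have "w = id" by (simp add: reduced_word_def)
    moreover have "depth_ideal (depth_of id) = (carrier PA :: ('b, 'k) path_elt set)"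
      by (auto simp: depth_ideal_def depth_of_id cell_def)
    ultimately have "cls ` depth_ideal (depth_of w) = (carrier (preproj Q) :: ('b, 'k) preproj_elt set)"
      by (simp only: carrier_preproj)
    then show ?case by (simp only: list.map(1) foldr_Nil id_apply)
  next
    case (Cons i "is")
    note r = reduced_word_ConsD[OF Cons.prems]
    have "ideal_prod (preproj Q) (vertex_ideal Q i) (cls ` depth_ideal (depth_of (word_prod n is))) =
        (cls ` depth_ideal (lower i (depth_of (word_prod n is))) :: ('b, 'k) preproj_elt set)"
      by (rule ideal_prod_depth_ideal[OF depth_of_left_stable[OF r(5)] depth_of_reaches[OF r(5)] r(2,3)])
    also have "lower i (depth_of (word_prod n is)) = depth_of w"
      using depth_of_simple_refl[OF r(5,2,3,6)] r(4) by (intro ext) simp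
    finally show ?case using Cons.IH[OF r(1)] by simp
  qed
  from this[OF someI_ex[OF reduced_word_exists[OF w]]] show ?thesis
    by (simp add: weyl_ideal_def)
qed

section \<open>Modules over the preprojective algebra\<close>


definition vertex_act :: "(('b, 'k::field) preproj_elt, 'm, 'z) module_scheme => nat => 'm => 'm" where
  "vertex_act M v x = cls (basis_path (v, [])) \<odot>\<^bsub>M\<^esub> x"

definition arrow_act :: "(('b, 'k::field) preproj_elt, 'm, 'z) module_scheme => 'b + 'b => 'm => 'm" where
  "arrow_act M b x = cls (basis_arrow D b) \<odot>\<^bsub>M\<^esub> x"

abbreviation pmod :: "(('b, 'k::field) preproj_elt, 'm, 'z) module_scheme => bool" where
  "pmod M \<equiv> left_module (preproj Q) M"

abbreviation psm :: "(('b, 'k::field) preproj_elt, 'm, 'z) module_scheme => 'k => 'm => 'm" where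
  "psm M \<equiv> field_smult (preproj Q) M"

lemma pmod_kmod: "pmod M ==> kmod (preproj Q) M"
  by (intro kmod.intro kalg_preproj)

lemma basis_vertex_in_PA [simp]: "v \<in> {1..n} ==> basis_path (v, []) \<in> carrier PA"
  by (rule D.basis_in_PA) simp


lemma act_induct:
  fixes M :: "(('b, 'k::field) preproj_elt, 'm, 'z) module_scheme"
  assumes M: "pmod M" and x: "x \<in> carrier M" and a: "a \<in> carrier (preproj Q)"
    and zero: "P \<zero>\<^bsub>preproj Q\<^esub> \<zero>\<^bsub>M\<^esub>"
    and add: "\<And>a b y z. y \<in> carrier M ==> z \<in> carrier M ==> a \<in> carrier (preproj Q) ==> b \<in> carrier (preproj Q) ==>
      P a y ==> P b z ==> P (a \<oplus>\<^bsub>preproj Q\<^esub> b) (y \<oplus>\<^bsub>M\<^esub> z)"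
    and scal: "\<And>a y c. y \<in> carrier M ==> a \<in> carrier (preproj Q) ==> P a y ==> P (c \<odot>\<^bsub>preproj Q\<^esub> a) (psm M c y)"
    and vertex: "\<And>v. v \<in> {1..n} ==> P (cls (basis_path (v, []))) (vertex_act M v x)"
    and arrow: "\<And>a y b. y \<in> carrier M ==> a \<in> carrier (preproj Q) ==> b \<in> arcs D ==> P a y ==>
      P (cls (basis_arrow D b) \<otimes>\<^bsub>preproj Q\<^esub> a) (arrow_act M b y)"
  shows "P a (a \<odot>\<^bsub>M\<^esub> x)"
proof -
  interpret kmod "preproj Q" M by (rule pmod_kmod[OF M])
  obtain f where f: "a = cls f" "f \<in> carrier PA" using a by (auto simp: carrier_preproj)
  have "P (cls f) (cls f \<odot>\<^bsub>M\<^esub> x)" using f(2)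
  proof (induction f rule: D.PA_induct)
    case zero
    have "cls (\<lambda>_. 0) \<odot>\<^bsub>M\<^esub> x = \<zero>\<^bsub>M\<^esub>" using x zero_act by (simp add: cls_zero_one[symmetric])
    then show ?case using assms(4) by (simp add: cls_zero_one)
  next
    case (basis c p)
    obtain u q where p: "p = (u, q)" by (cases p)
    have "P (cls (basis_path (u, q))) (cls (basis_path (u, q)) \<odot>\<^bsub>M\<^esub> x)" using basis unfolding p
    proof (induction q rule: rev_induct)
      case Nil
      then show ?case using vertex[of u] by (simp add: vertex_act_def)
    next
      case (snoc b q)
      then have q: "(u, q) \<in> paths D" and b: "b \<in> arcs D" by (auto simp: D.paths_snoc)
      have qc: "basis_path (u, q) \<in> carrier (PA :: ('k, _) module)" by (rule D.basis_in_PA[OF q])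
      have e: "cls (basis_path (u, q @ [b])) = cls (basis_arrow D b) \<otimes>\<^bsub>preproj Q\<^esub> (cls (basis_path (u, q)) :: ('b, 'k) preproj_elt)"
        unfolding D.arrow_mult_basis[OF snoc.prems] by (rule cls_hom(1)[symmetric]) (use b qc in simp_all)
      show ?case
        using arrow[OF _ _ b snoc.IH[OF q]] x b qc by (simp add: e smult_assoc1 arrow_act_def)
    qed
    then have P: "P (cls (basis_path p)) (cls (basis_path p) \<odot>\<^bsub>M\<^esub> x)" by (simp only: p)
    have bc: "basis_path p \<in> carrier (PA :: ('k, _) module)" by (rule D.basis_in_PA[OF basis])
    have e: "cls (\<lambda>x. c * basis_path p x) = c \<odot>\<^bsub>preproj Q\<^esub> (cls (basis_path p) :: ('b, 'k) preproj_elt)"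
      by (rule cls_hom(3)[OF bc bc, symmetric])
    show ?case unfolding e scal_act[OF cls_closed[OF bc] x] by (rule scal[OF _ _ P]) (use x bc in simp_all)
  next
    case (add f g)
    then show ?case
      using assms(5)[of "cls f \<odot>\<^bsub>M\<^esub> x" "cls g \<odot>\<^bsub>M\<^esub> x" "cls f" "cls g"] x smult_l_distr[of "cls f" "cls g" x]
      by (simp add: cls_hom(2)[OF add(1,2)])
  qed
  then show ?thesis by (simp add: f)
qed

lemma mod_homI:
  fixes M :: "(('b, 'k::field) preproj_elt, 'm, 'z) module_scheme"
    and N :: "(('b, 'k) preproj_elt, 'n, 'w) module_scheme"
  assumes M: "pmod M" and N: "pmod N" and cl: "\<And>x. x \<in> carrier M ==> f x \<in> carrier N"
    and add: "\<And>x y. x \<in> carrier M ==> y \<in> carrier M ==> f (x \<oplus>\<^bsub>M\<^esub> y) = f x \<oplus>\<^bsub>N\<^esub> f y"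
    and scal: "\<And>c x. x \<in> carrier M ==> f (psm M c x) = psm N c (f x)"
    and vertex: "\<And>v x. v \<in> {1..n} ==> x \<in> carrier M ==> f (vertex_act M v x) = vertex_act N v (f x)"
    and arrow: "\<And>b x. b \<in> arcs D ==> x \<in> carrier M ==> f (arrow_act M b x) = arrow_act N b (f x)"
  shows "f \<in> mod_hom (preproj Q) M N"
proof -
  interpret M: kmod "preproj Q" M by (rule pmod_kmod[OF M])
  interpret N: kmod "preproj Q" N by (rule pmod_kmod[OF N])
  have f0: "f \<zero>\<^bsub>M\<^esub> = \<zero>\<^bsub>N\<^esub>" using scal[of "\<zero>\<^bsub>M\<^esub>" 0] cl[of "\<zero>\<^bsub>M\<^esub>"] by simp
  have "f (a \<odot>\<^bsub>M\<^esub> x) = a \<odot>\<^bsub>N\<^esub> f x" if a: "a \<in> carrier (preproj Q)" and x: "x \<in> carrier M" for a x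
  proof (rule act_induct[OF M x a])
    fix a b y z
    assume "y \<in> carrier M" "z \<in> carrier M" "a \<in> carrier (preproj Q)" "b \<in> carrier (preproj Q)"
      "f y = a \<odot>\<^bsub>N\<^esub> f x" "f z = b \<odot>\<^bsub>N\<^esub> f x"
    then show "f (y \<oplus>\<^bsub>M\<^esub> z) = (a \<oplus>\<^bsub>preproj Q\<^esub> b) \<odot>\<^bsub>N\<^esub> f x"
      using cl[OF x] by (simp add: add N.smult_l_distr)
  next
    fix a y b
    assume "y \<in> carrier M" "a \<in> carrier (preproj Q)" "b \<in> arcs D" "f y = a \<odot>\<^bsub>N\<^esub> f x"
    then show "f (arrow_act M b y) = (cls (basis_arrow D b) \<otimes>\<^bsub>preproj Q\<^esub> a) \<odot>\<^bsub>N\<^esub> f x"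
      using cl[OF x] by (simp add: arrow N.smult_assoc1) (simp add: arrow_act_def)
  qed (use f0 cl[OF x] x in \<open>simp_all add: scal N.scal_act vertex[unfolded vertex_act_def] vertex_act_def\<close>)
  then show ?thesis using cl add by (auto simp: mod_hom_def)
qed

lemma submoduleI:
  fixes M :: "(('b, 'k::field) preproj_elt, 'm, 'z) module_scheme"
  assumes M: "pmod M" and U: "U \<subseteq> carrier M" "\<zero>\<^bsub>M\<^esub> \<in> U"
    and add: "\<And>x y. x \<in> U ==> y \<in> U ==> x \<oplus>\<^bsub>M\<^esub> y \<in> U"
    and scal: "\<And>c x. x \<in> U ==> psm M c x \<in> U"
    and vertex: "\<And>v x. v \<in> {1..n} ==> x \<in> U ==> vertex_act M v x \<in> U"
    and arrow: "\<And>b x. b \<in> arcs D ==> x \<in> U ==> arrow_act M b x \<in> U"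
  shows "submodule U (preproj Q) M"
proof -
  interpret M: kmod "preproj Q" M by (rule pmod_kmod[OF M])
  have neg: "\<ominus>\<^bsub>M\<^esub> x \<in> U" if "x \<in> U" for x
    using scal[OF that, of "-1"] M.sm_minus[of x] U(1) that by auto
  have act: "a \<odot>\<^bsub>M\<^esub> x \<in> U" if "a \<in> carrier (preproj Q)" "x \<in> U" for a x
    by (rule act_induct[of M x a "\<lambda>_ y. y \<in> U", OF M]) (use that U assms in auto)
  show ?thesis
  proof (rule submodule.intro)
    show "subgroup U (add_monoid M)"
      by (rule M.add.subgroupI) (use U add neg in auto)
    show "submodule_axioms U (preproj Q) M" by unfold_locales (rule act)
  qed
qed

lemma annihilator_ideal:
  assumes "left_module R M"
  shows "ideal {a \<in> carrier R. \<forall>x\<in>carrier M. a \<odot>\<^bsub>M\<^esub> x = \<zero>\<^bsub>M\<^esub>} R"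
proof -
  interpret left_module R M by fact
  have neg: "(\<ominus>\<^bsub>R\<^esub> a) \<odot>\<^bsub>M\<^esub> x = \<zero>\<^bsub>M\<^esub>" if "a \<in> carrier R" "x \<in> carrier M" "a \<odot>\<^bsub>M\<^esub> x = \<zero>\<^bsub>M\<^esub>" for a x
    using smult_l_distr[of "\<ominus>\<^bsub>R\<^esub> a" a x] that by (simp add: R.l_neg)
  have "subgroup {a \<in> carrier R. \<forall>x\<in>carrier M. a \<odot>\<^bsub>M\<^esub> x = \<zero>\<^bsub>M\<^esub>} (add_monoid R)"
    by (rule R.add.subgroupI) (use neg in \<open>auto simp: smult_l_distr\<close>)
  then show ?thesis
    by (intro idealI R.ring_axioms) (auto simp: smult_assoc1)
qed

subsection \<open>String modules\<close>

text \<open>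
  The string modules, with the string given by its set of vertices and its set of arrows.
\<close>

definition thin_data :: "nat set => ('b + 'b) set => bool" where
  "thin_data W S \<longleftrightarrow> W \<subseteq> {1..n} \<and> S \<subseteq> arcs D \<and> (\<forall>b\<in>S. tail D b \<in> W \<and> head D b \<in> W) \<and>
    (\<forall>l. 1 \<le> l \<longrightarrow> l < n \<longrightarrow> \<not> (up l \<in> S \<and> dn l \<in> S))"

definition Str :: "nat set => ('b + 'b) set => ('b, 'k::field) coord_module" where
  "Str W S = deflate (D.thin_module W S)"

lemma thin_data_module:
  assumes "thin_data W S"
  shows "left_module PA (D.thin_module W S :: (('b, 'k::field) path_elt, _) module)"
  using assms by (intro D.left_module_thin) (auto simp: thin_data_def)

text \<open>
  Two opposite arrows are never both in \<open>S\<close>, so each of the two-cycles in the relation acts as zero.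
\<close>

lemma thin_killed:
  fixes f :: "('b, 'k::field) path_elt"
  assumes W: "thin_data W S" and f: "f \<in> preproj_ideal Q" and x: "x \<in> carrier (D.thin_module W S)"
  shows "f \<odot>\<^bsub>D.thin_module W S\<^esub> x = \<zero>\<^bsub>D.thin_module W S\<^esub>"
proof -
  interpret kalg "PA :: ('k, _) module" by (rule D.kalg_PA)
  let ?M = "D.thin_module W S :: (('b, 'k) path_elt, _) module"
  let ?J = "{a \<in> carrier PA. \<forall>x\<in>carrier ?M. a \<odot>\<^bsub>?M\<^esub> x = \<zero>\<^bsub>?M\<^esub>}"
  have J: "ideal ?J PA" by (rule annihilator_ideal[OF thin_data_module[OF W]])
  have "preproj_relation Q \<odot>\<^bsub>?M\<^esub> x = \<zero>\<^bsub>?M\<^esub>" for x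
  proof
    fix v
    let ?g = "\<lambda>i x. eps i * (basis_path (Suc i, [dn i, up i]) x + (-1) * basis_path (i, [up i, dn i]) x) :: 'k"
    have g: "?g i \<in> carrier PA" if "i \<in> {1..<n}" for i
      by (intro D.scal_in_PA D.add_in_PA D.basis_in_PA) (use that in auto)
    have "(preproj_relation Q \<odot>\<^bsub>?M\<^esub> x) v = (\<Sum>i\<in>{1..<n}. lin (\<lambda>q. D.thin_path S q x v) (?g i))"
      using lin_sum[of "{1..<n}" ?g] g by (simp add: D.thin_module_simps relation_eq)
    also have "\<dots> = 0"
    proof (rule sum.neutral, rule ballI)
      fix i assume i: "i \<in> {1..<n}"
      have c: "D.thin_path S (Suc i, [dn i, up i]) x v = 0" "D.thin_path S (i, [up i, dn i]) x v = 0"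
        using i W D.thin_path_snoc[of S "Suc i" "[dn i]" "up i" x] D.thin_path_snoc[of S "Suc i" "[]" "dn i" x]
          D.thin_path_snoc[of S i "[up i]" "dn i" x] D.thin_path_snoc[of S i "[]" "up i" x]
        by (auto simp: thin_data_def D.thin_arrow_def)
      have A: "basis_path (Suc i, [dn i, up i]) \<in> carrier (PA :: ('k, _) module)"
        and B: "basis_path (i, [up i, dn i]) \<in> carrier (PA :: ('k, _) module)"
        using i by (auto intro!: D.basis_in_PA)
      show "lin (\<lambda>q. D.thin_path S q x v) (?g i) = 0"
        unfolding lin_scal lin_add[OF D.PA_finite[OF A] D.PA_finite[OF D.scal_in_PA[OF B, of "-1"]]] by (simp add: c)
    qed
    finally show "(preproj_relation Q \<odot>\<^bsub>?M\<^esub> x) v = \<zero>\<^bsub>?M\<^esub> v" by (simp add: D.thin_module_simps)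
  qed
  then have "preproj_ideal Q \<subseteq> ?J"
    unfolding preproj_ideal_def by (intro genideal_minimal J) (simp add: relation_in_PA)
  then show ?thesis using f x by auto
qed

lemma Str_module:
  assumes "thin_data W S"
  shows "pmod (Str W S :: ('b, 'k::field) coord_module)"
  unfolding Str_def preproj_def
  by (rule left_module_deflate[OF D.kalg_PA preproj_ideal_ideal thin_data_module[OF assms] thin_killed[OF assms]])

lemma Str_simps:
  "carrier (Str W S) = {x. {v. x v \<noteq> 0} \<subseteq> W}"
  "\<zero>\<^bsub>Str W S\<^esub> = (\<lambda>_. 0)"
  "x \<oplus>\<^bsub>Str W S\<^esub> y = (\<lambda>v. x v + y v)"
  by (simp_all add: Str_def D.thin_module_simps)

lemma Str_act:
  assumes "thin_data W S" "f \<in> carrier PA" "x \<in> carrier (Str W S)"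
  shows "cls f \<odot>\<^bsub>Str W S\<^esub> x = f \<odot>\<^bsub>D.thin_module W S\<^esub> x"
  unfolding Str_def cls_def
  by (rule deflate_smult[OF D.kalg_PA preproj_ideal_ideal thin_data_module[OF assms(1)] thin_killed[OF assms(1)] assms(2)])
    (use assms(3) in \<open>simp_all add: Str_def\<close>)

lemma Str_gens:
  fixes x :: "nat => 'k::field"
  assumes W: "thin_data W S" and x: "x \<in> carrier (Str W S)"
  shows "psm (Str W S) c x = (\<lambda>v. c * x v)"
    "u \<in> {1..n} ==> vertex_act (Str W S) u x = (\<lambda>v. if v = u then x v else 0)"
    "b \<in> arcs D ==> arrow_act (Str W S) b x = (\<lambda>v. if b \<in> S \<and> v = head D b then x (tail D b) else 0)"
proof -
  interpret M: left_module PA "D.thin_module W S :: (('b, 'k) path_elt, _) module" by (rule thin_data_module[OF W])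
  have "\<one>\<^bsub>PA\<^esub> \<odot>\<^bsub>D.thin_module W S\<^esub> x = x" using M.smult_one[of x] x by (simp add: Str_def)
  then show "psm (Str W S) c x = (\<lambda>v. c * x v)"
    unfolding field_smult_def cls_zero_one cls_hom(3)[OF D.one_in_PA D.one_in_PA]
    by (simp add: Str_act[OF W D.scal_in_PA[OF D.one_in_PA] x] D.thin_act_lin)
  show "u \<in> {1..n} ==> vertex_act (Str W S) u x = (\<lambda>v. if v = u then x v else 0)"
    by (simp add: vertex_act_def Str_act[OF W _ x] D.thin_act_basis)
  show "b \<in> arcs D ==> arrow_act (Str W S) b x = (\<lambda>v. if b \<in> S \<and> v = head D b then x (tail D b) else 0)"
    by (simp add: arrow_act_def Str_act[OF W _ x] D.thin_act_arrow D.thin_arrow_def)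
qed

lemma up_dn_inj:
  assumes "1 \<le> l" "l < n" "1 \<le> k" "k < n"
  shows "up l = up k \<longleftrightarrow> l = k" "dn l = dn k \<longleftrightarrow> l = k" "up l \<noteq> dn k" "dn k \<noteq> up l"
proof -
  show "up l = up k \<longleftrightarrow> l = k" using tail_head(1)[of l] tail_head(1)[of k] assms by metis
  show "dn l = dn k \<longleftrightarrow> l = k" using tail_head(4)[of l] tail_head(4)[of k] assms by metis
  have "l = Suc k \<and> Suc l = k" if "up l = dn k"
    using arg_cong[OF that, of "tail D"] arg_cong[OF that, of "head D"] assms by simp
  then show "up l \<noteq> dn k" "dn k \<noteq> up l" by force+
qed

definition string_data :: "nat set => ('b + 'b) set => bool" where
  "string_data W S \<longleftrightarrow> (\<exists>a b. 1 \<le> a \<and> a \<le> b \<and> b \<le> n \<and> W = {a..b} \<and>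
    S \<subseteq> up ` {a..<b} \<union> dn ` {a..<b} \<and> (\<forall>l\<in>{a..<b}. up l \<in> S \<longleftrightarrow> dn l \<notin> S))"

lemma string_data_thin: "string_data W S ==> thin_data W S"
proof -
  assume "string_data W S"
  then obtain a b where ab: "1 \<le> a" "a \<le> b" "b \<le> n" "W = {a..b}" "S \<subseteq> up ` {a..<b} \<union> dn ` {a..<b}"
    "\<forall>l\<in>{a..<b}. up l \<in> S \<longleftrightarrow> dn l \<notin> S" unfolding string_data_def by auto
  have S: "(\<exists>l. a \<le> l \<and> l < b \<and> (c = up l \<or> c = dn l))" if "c \<in> S" for c
  proof -
    have "c \<in> up ` {a..<b} \<union> dn ` {a..<b}" using ab(5) that by blast
    then show ?thesis by auto
  qed
  have "\<not> (up l \<in> S \<and> dn l \<in> S)" if l: "1 \<le> l" "l < n" for l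
  proof
    assume c: "up l \<in> S \<and> dn l \<in> S"
    then obtain k where k: "a \<le> k" "k < b" "up l = up k \<or> up l = dn k" using S by blast
    then have kn: "1 \<le> k" "k < n" using ab by auto
    have "l = k" using k(3) up_dn_inj(1,3)[OF l kn] by blast
    then show False using c ab(6) k by auto
  qed
  then show ?thesis unfolding thin_data_def using ab S by (fastforce dest!: S)
qed

section \<open>Layers are string modules\<close>

lemma regular_left_module: "pmod (regular_module (preproj Q) :: (('b, 'k::field) preproj_elt, _) module)"
proof -
  interpret kalg "preproj Q :: ('k, ('b, 'k) preproj_elt) module" by (rule kalg_preproj)
  interpret abelian_group "regular_module (preproj Q) :: (('b, 'k) preproj_elt, _) module"
    by (rule abelian_group_cong[OF abelian_group_axioms]) (simp_all add: regular_module_def with_smult_def)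
  show ?thesis
    by unfold_locales (simp_all add: regular_module_def with_smult_def l_distr r_distr m_assoc)
qed

lemma depth_submodule:
  assumes "left_stable c"
  shows "submodule (cls ` depth_ideal c) (preproj Q) (regular_module (preproj Q) :: (('b, 'k::field) preproj_elt, _) module)"
proof (rule submodule.intro)
  show "subgroup (cls ` depth_ideal c) (add_monoid (regular_module (preproj Q) :: (('b, 'k) preproj_elt, _) module))"
    using depth_subgroup[of c, where ?'k = 'k] unfolding subgroup_def m_inv_def
    by (simp add: regular_module_def with_smult_def)
  show "submodule_axioms (cls ` depth_ideal c) (preproj Q) (regular_module (preproj Q) :: (('b, 'k) preproj_elt, _) module)"
  proof unfold_locales
    fix a x :: "('b, 'k) preproj_elt" assume "a \<in> carrier (preproj Q)" "x \<in> cls ` depth_ideal c"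
    then obtain f g where f: "a = cls f" "f \<in> carrier PA" and g: "x = cls g" "g \<in> depth_ideal c"
      by (auto simp: carrier_preproj)
    then show "a \<odot>\<^bsub>regular_module (preproj Q)\<^esub> x \<in> cls ` depth_ideal c"
      using depth_ideal_left_mult[OF assms f(2) g(2)]
      by (simp add: regular_module_def with_smult_def cls_hom(1)[OF f(2) depth_idealD(1)[OF g(2)]])
  qed
qed

text \<open>The choice of the representative is immaterial for the coordinates at cells.\<close>

definition ccoord :: "('b, 'k::field) preproj_elt => nat => nat => nat => 'k" where
  "ccoord C = coord (SOME f. f \<in> carrier PA \<and> cls f = C)"

lemma ccoord_cls:
  assumes "f \<in> carrier PA" "cell u p v"
  shows "ccoord (cls f) u p v = coord f u p v"
proof -
  have "\<exists>g. g \<in> carrier PA \<and> cls g = cls f" using assms by auto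
  note g = someI_ex[OF this]
  show ?thesis unfolding ccoord_def
    using iffD1[OF cls_eq_iff(2)[OF conjunct1[OF g] assms(1)] conjunct2[OF g]] assms(2) by blast
qed

text \<open>The arrows that act nontrivially on the layer of \<open>w\<close> and \<open>i\<close>.\<close>

definition ribbon_arrows :: "(nat => nat) => nat => ('b + 'b) set" where
  "ribbon_arrows w i = {up l | l. w i \<le> l \<and> Suc l < w (Suc i) \<and> Suc l \<notin> w ` {1..<i}} \<union>
    {dn l | l. w i \<le> l \<and> Suc l < w (Suc i) \<and> Suc l \<in> w ` {1..<i}}"

lemma ribbon_arrows_iff:
  assumes w: "w permutes {1..Suc n}" and i: "1 \<le> i" "i \<le> n" and l: "1 \<le> l" "l < n"
  shows "up l \<in> ribbon_arrows w i \<longleftrightarrow> w i \<le> l \<and> Suc l < w (Suc i) \<and> Suc l \<notin> w ` {1..<i}"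
    "dn l \<in> ribbon_arrows w i \<longleftrightarrow> w i \<le> l \<and> Suc l < w (Suc i) \<and> Suc l \<in> w ` {1..<i}"
proof -
  have "1 \<le> w i" "w (Suc i) \<le> Suc n" using permutes_in_image[OF w, of i] permutes_in_image[OF w, of "Suc i"] i by auto
  then have b: "1 \<le> k \<and> k < n" if "w i \<le> k" "Suc k < w (Suc i)" for k using that by auto
  show "up l \<in> ribbon_arrows w i \<longleftrightarrow> w i \<le> l \<and> Suc l < w (Suc i) \<and> Suc l \<notin> w ` {1..<i}"
    using up_dn_inj(1,3)[OF l] b unfolding ribbon_arrows_def by blast
  show "dn l \<in> ribbon_arrows w i \<longleftrightarrow> w i \<le> l \<and> Suc l < w (Suc i) \<and> Suc l \<in> w ` {1..<i}"
    using up_dn_inj(2)[OF l] up_dn_inj(4)[OF _ _ l] b unfolding ribbon_arrows_def by blast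
qed

lemma ribbon_string_data:
  assumes w: "w permutes {1..Suc n}" and i: "1 \<le> i" "i \<le> n" "w i < w (Suc i)"
  shows "string_data {w i..<w (Suc i)} (ribbon_arrows w i)"
proof -
  have b: "1 \<le> w i" "w (Suc i) \<le> Suc n" using permutes_in_image[OF w, of i] permutes_in_image[OF w, of "Suc i"] i by auto
  have "ribbon_arrows w i \<subseteq> up ` {w i..<w (Suc i) - 1} \<union> dn ` {w i..<w (Suc i) - 1}"
    by (auto simp: ribbon_arrows_def)
  moreover have "\<forall>l\<in>{w i..<w (Suc i) - 1}. up l \<in> ribbon_arrows w i \<longleftrightarrow> dn l \<notin> ribbon_arrows w i"
    using b by (auto simp: ribbon_arrows_iff[OF w i(1,2)])
  moreover have "{w i..<w (Suc i)} = {w i..w (Suc i) - 1}" using i(3) by auto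
  ultimately show ?thesis unfolding string_data_def using b i(3)
    by (intro exI[of _ "w i"] exI[of _ "w (Suc i) - 1"]) auto
qed

end

context type_A
begin

context
  fixes w :: "nat => nat" and i :: nat
  assumes w: "w permutes {1..Suc n}" and i: "1 \<le> i" "i \<le> n" and ascent: "w i < w (Suc i)"
begin

definition ribbon_depth :: "nat => nat" where
  "ribbon_depth l = card {r \<in> {1..<i}. l < w r}"

lemma ribbon_ends: "1 \<le> w i" "w (Suc i) \<le> Suc n"
  using permutes_in_image[OF w, of i] permutes_in_image[OF w, of "Suc i"] i by auto

lemma w_inj: "w r = w s \<longleftrightarrow> r = s"
  using permutes_inj[OF w] by (auto dest: injD)

lemma depth_of_at: "depth_of w i v = ribbon_depth v + (if v < w i then 1 else 0)"
proof -
  have "{r \<in> {1..i}. v < w r} = {r \<in> {1..<i}. v < w r} \<union> (if v < w i then {i} else {})"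
    using i by (auto simp: le_less)
  then show ?thesis by (simp add: depth_of_def ribbon_depth_def)
qed

lemma depth_of_right_at: "depth_of (w \<circ> simple_refl i) i v = ribbon_depth v + (if v < w (Suc i) then 1 else 0)"
proof -
  have e: "(w \<circ> simple_refl i) r = w r" if "r \<in> {1..<i}" for r
    using that by (simp add: simple_refl_def transpose_def)
  have "{1..i} = insert i {1..<i}" using i by auto
  then have "{r \<in> {1..i}. v < (w \<circ> simple_refl i) r} =
      {r \<in> {1..<i}. v < (w \<circ> simple_refl i) r} \<union> (if v < w (Suc i) then {i} else {})"
    by auto
  also have "{r \<in> {1..<i}. v < (w \<circ> simple_refl i) r} = {r \<in> {1..<i}. v < w r}" using e by (intro Collect_cong) auto
  finally have "{r \<in> {1..i}. v < (w \<circ> simple_refl i) r} = {r \<in> {1..<i}. v < w r} \<union> (if v < w (Suc i) then {i} else {})" .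
  then show ?thesis by (simp add: depth_of_def ribbon_depth_def)
qed

lemma depth_of_right_other:
  assumes "u \<noteq> i"
  shows "depth_of (w \<circ> simple_refl i) u v = depth_of w u v"
proof -
  have m: "simple_refl i r \<in> {1..u} \<longleftrightarrow> r \<in> {1..u}" for r
    using assms i by (auto simp: simple_refl_def transpose_def)
  have "{r \<in> {1..u}. v < (w \<circ> simple_refl i) r} = simple_refl i ` {r \<in> {1..u}. v < w r}"
  proof (rule Set.set_eqI, rule iffI)
    fix r assume "r \<in> {r \<in> {1..u}. v < (w \<circ> simple_refl i) r}"
    then show "r \<in> simple_refl i ` {r \<in> {1..u}. v < w r}"
      using m[of r] by (intro image_eqI[of _ _ "simple_refl i r"]) auto
  next
    fix r assume "r \<in> simple_refl i ` {r \<in> {1..u}. v < w r}"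
    then obtain x where x: "x \<in> {1..u}" "v < w x" "r = simple_refl i x" by blast
    then show "r \<in> {r \<in> {1..u}. v < (w \<circ> simple_refl i) r}" using m[of x] by simp
  qed
  moreover have "inj (simple_refl i)" by (metis injI simple_refl_simps(3))
  ultimately show ?thesis by (simp add: depth_of_def card_image inj_on_subset)
qed

lemma ribbon_depth_step: "ribbon_depth l = ribbon_depth (Suc l) + (if Suc l \<in> w ` {1..<i} then 1 else 0)"
proof (cases "Suc l \<in> w ` {1..<i}")
  case True
  then obtain r where r: "r \<in> {1..<i}" "w r = Suc l" by auto
  have "l < w x \<longleftrightarrow> x = r \<or> Suc l < w x" for x using w_inj[of x r] r(2) by auto
  then have "{r \<in> {1..<i}. l < w r} = insert r {r \<in> {1..<i}. Suc l < w r}" using r(1) by auto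
  then show ?thesis using r True by (simp add: ribbon_depth_def)
next
  case False
  then have "{r \<in> {1..<i}. l < w r} = {r \<in> {1..<i}. Suc l < w r}" by (force simp: Suc_lessI)
  then show ?thesis using False by (simp add: ribbon_depth_def)
qed

lemma ribbon_cell:
  assumes l: "w i \<le> l" "l < w (Suc i)"
  shows "cell i (ribbon_depth l) l"
proof -
  have lt: "ribbon_depth l < i"
  proof -
    have "ribbon_depth l \<le> card {1..<i}" unfolding ribbon_depth_def by (rule card_mono) auto
    then show ?thesis using i by simp
  qed
  have rng: "1 \<le> w r" "w r \<le> Suc n" if "1 \<le> r" "r \<le> Suc n" for r
    using permutes_in_image[OF w, of r] that by auto
  have "card (insert (Suc i) {r \<in> {1..<i}. l < w r}) \<le> card {Suc l..Suc n}"
  proof (rule card_inj_on_le[of w])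
    show "w ` insert (Suc i) {r \<in> {1..<i}. l < w r} \<subseteq> {Suc l..Suc n}"
    proof (rule image_subsetI)
      fix r assume "r \<in> insert (Suc i) {r \<in> {1..<i}. l < w r}"
      then have "1 \<le> r" "r \<le> Suc n" "l < w r" using i l by auto
      then show "w r \<in> {Suc l..Suc n}" using rng[of r] by simp
    qed
  qed (use w_inj in \<open>simp_all add: inj_on_def\<close>)
  then have top: "ribbon_depth l + l \<le> n" using l ribbon_ends by (simp add: ribbon_depth_def)
  have "card (insert i {r \<in> {1..<i}. \<not> l < w r}) \<le> card {1..l}"
  proof (rule card_inj_on_le[of w])
    show "w ` insert i {r \<in> {1..<i}. \<not> l < w r} \<subseteq> {1..l}"
    proof (rule image_subsetI)
      fix r assume "r \<in> insert i {r \<in> {1..<i}. \<not> l < w r}"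
      then have "1 \<le> r" "r \<le> Suc n" "w r \<le> l" using i l by auto
      then show "w r \<in> {1..l}" using rng[of r] by simp
    qed
  qed (use w_inj in \<open>simp_all add: inj_on_def\<close>)
  moreover have "card {1..<i} = ribbon_depth l + card {r \<in> {1..<i}. \<not> l < w r}"
  proof -
    have "{1..<i} = {r \<in> {1..<i}. l < w r} \<union> {r \<in> {1..<i}. \<not> l < w r}" by auto
    moreover have "card ({r \<in> {1..<i}. l < w r} \<union> {r \<in> {1..<i}. \<not> l < w r}) =
        card {r \<in> {1..<i}. l < w r} + card {r \<in> {1..<i}. \<not> l < w r}"
      by (rule card_Un_disjoint) auto
    ultimately show ?thesis unfolding ribbon_depth_def by metis
  qed
  ultimately have "i \<le> ribbon_depth l + l" by simp
  then show ?thesis using lt top i l ribbon_ends by (simp add: cell_def)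
qed

text \<open>These factors absorb the signs with which the descents act on the coordinates.\<close>

definition ribbon_sign :: "nat => 'k::field" where
  "ribbon_sign l = (\<Prod>k\<in>{1..<l}. if Suc k \<in> w ` {1..<i} then eps k else 1)"

lemma ribbon_sign_Suc: "1 \<le> l ==> ribbon_sign (Suc l) = ribbon_sign l * (if Suc l \<in> w ` {1..<i} then eps l else 1 :: 'k::field)"
  by (simp add: ribbon_sign_def atLeastLessThanSuc mult.commute)

lemma ribbon_sign_nonzero: "ribbon_sign l \<noteq> (0 :: 'k::field)"
  by (simp add: ribbon_sign_def eps_def)

text \<open>
  The coordinates of \<open>I(w)\<close> that vanish on \<open>I(w s\<^sub>i)\<close> sit at the start vertex \<open>i\<close>; there is one for each
  vertex between \<open>w i\<close> and \<open>w (i + 1) - 1\<close>.  They fill a ribbon in the rectangle of paths from \<open>i\<close>, hence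
  the layer is a string module.
\<close>

definition ribbon_map :: "('b, 'k::field) preproj_elt => nat => 'k" where
  "ribbon_map C l = (if w i \<le> l \<and> l < w (Suc i) then ribbon_sign l * ccoord C i (ribbon_depth l) l else 0)"

lemma ribbon_map_cls:
  "f \<in> carrier PA ==> ribbon_map (cls f) l =
    (if w i \<le> l \<and> l < w (Suc i) then ribbon_sign l * coord f i (ribbon_depth l) l else 0)"
  by (simp add: ribbon_map_def ccoord_cls[OF _ ribbon_cell])

lemma ribbon_kernel:
  assumes "f \<in> carrier PA"
  shows "f \<in> depth_ideal (depth_of (w \<circ> simple_refl i)) \<longleftrightarrow>
    f \<in> depth_ideal (depth_of w) \<and> (\<forall>l. w i \<le> l \<and> l < w (Suc i) \<longrightarrow> coord f i (ribbon_depth l) l = 0)"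
proof
  assume f: "f \<in> depth_ideal (depth_of (w \<circ> simple_refl i))"
  have le: "depth_of w u v \<le> depth_of (w \<circ> simple_refl i) u v" for u v
    using ascent by (cases "u = i") (simp_all add: depth_of_at depth_of_right_at depth_of_right_other)
  have "coord f u p v = 0" if "cell u p v" "p < depth_of w u v" for u p v
    by (rule depth_idealD(2)[OF f]) (use that le[of u v] in \<open>auto simp: cell_def\<close>)
  then have "f \<in> depth_ideal (depth_of w)" using assms by (simp add: depth_ideal_def)
  moreover have "coord f i (ribbon_depth l) l = 0" if "w i \<le> l" "l < w (Suc i)" for l
    using f ribbon_cell[OF that] that by (auto simp: depth_ideal_def depth_of_right_at)
  ultimately show "f \<in> depth_ideal (depth_of w) \<and> (\<forall>l. w i \<le> l \<and> l < w (Suc i) \<longrightarrow> coord f i (ribbon_depth l) l = 0)" by simp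
next
  assume f: "f \<in> depth_ideal (depth_of w) \<and> (\<forall>l. w i \<le> l \<and> l < w (Suc i) \<longrightarrow> coord f i (ribbon_depth l) l = 0)"
  have "coord f u p v = 0" if c: "cell u p v" "p < depth_of (w \<circ> simple_refl i) u v" for u p v
  proof (cases "u = i \<and> w i \<le> v \<and> v < w (Suc i)")
    case True
    then have "p < ribbon_depth v \<or> p = ribbon_depth v" using c(2) by (auto simp: depth_of_right_at)
    then show ?thesis using f True c(1) by (auto simp: depth_ideal_def depth_of_at)
  next
    case False
    then have "p < depth_of w u v"
      using c(2) ascent by (cases "u = i") (auto simp: depth_of_at depth_of_right_at depth_of_right_other split: if_splits)
    then show ?thesis using f c(1) by (auto simp: depth_ideal_def)
  qed
  then show "f \<in> depth_ideal (depth_of (w \<circ> simple_refl i))" using assms by (simp add: depth_ideal_def)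
qed

lemma ribbon_map_arrow:
  assumes f: "f \<in> depth_ideal (depth_of w)" and b: "b \<in> arcs D"
  shows "ribbon_map (cls (basis_arrow D b \<otimes>\<^bsub>PA\<^esub> f)) v =
    (if b \<in> ribbon_arrows w i \<and> v = head D b then ribbon_map (cls f) (tail D b) else 0 :: 'k::field)"
proof -
  note fc = depth_idealD(1)[OF f]
  have m: "basis_arrow D b \<otimes>\<^bsub>PA\<^esub> f \<in> carrier PA" using b fc by (simp add: D.mult_in_PA)
  have z: "coord f i p l = 0" if "p < depth_of w i l" "p < i" "p + l \<le> n" for p l
    by (rule depth_idealD(2)[OF f]) (use that in auto)
  have rb: "ribbon_depth l < i" "ribbon_depth l + l \<le> n" "1 \<le> l" "l \<le> n" if "w i \<le> l" "l < w (Suc i)" for l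
    using ribbon_cell[OF that] by (auto simp: cell_def)
  from b show ?thesis
  proof (cases rule: arcs_DE)
    case (up l)
    have z1: "coord f i (ribbon_depth (Suc l)) l = 0" if "w i \<le> Suc l" "Suc l < w (Suc i)" "Suc l \<in> w ` {1..<i} \<or> l < w i"
      using that rb[of "Suc l"] ribbon_depth_step[of l] by (intro z) (auto simp: depth_of_at)
    show ?thesis
      using up z1 ribbon_depth_step[of l] ribbon_sign_Suc[of l, where ?'k = 'k]
      by (auto simp: ribbon_map_cls[OF m[unfolded up(3)]] ribbon_map_cls[OF fc] ribbon_arrows_iff[OF w i up(1,2)] coord_up_mult[OF fc])
  next
    case (dn l)
    have z1: "coord f i (ribbon_depth l - 1) (Suc l) = 0"
      if "w i \<le> l" "l < w (Suc i)" "0 < ribbon_depth l" "Suc l \<notin> w ` {1..<i}"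
      using that rb[of l] ribbon_depth_step[of l] by (intro z) (auto simp: depth_of_at)
    have y: "w (Suc i) \<notin> w ` {1..<i}" using w_inj by auto
    have L: "ribbon_map (cls (basis_arrow D b \<otimes>\<^bsub>PA\<^esub> f)) v = (if w i \<le> v \<and> v < w (Suc i)
        then ribbon_sign v * (if v = l \<and> 0 < ribbon_depth v then eps l * coord f i (ribbon_depth v - 1) (Suc l) else 0) else 0)"
      unfolding ribbon_map_cls[OF m] unfolding dn(3) coord_dn_mult[OF fc dn(1,2)] by (rule refl)
    note arrow = ribbon_arrows_iff(2)[OF w i dn(1,2)]
    show ?thesis
    proof (cases "v = l \<and> w i \<le> l \<and> l < w (Suc i)")
      case False
      then show ?thesis unfolding L using dn by (auto simp: arrow)
    next
      case True
      show ?thesis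
      proof (cases "Suc l \<in> w ` {1..<i}")
        case s: True
        then have "Suc l \<noteq> w (Suc i)" using y by metis
        then have "Suc l < w (Suc i)" using True by linarith
        moreover have "ribbon_depth l = Suc (ribbon_depth (Suc l))" "ribbon_sign (Suc l) = (ribbon_sign l * eps l :: 'k)"
          using s ribbon_depth_step[of l] ribbon_sign_Suc[OF dn(1), where ?'k = 'k] by simp_all
        moreover have "dn l \<in> ribbon_arrows w i" using arrow s True \<open>Suc l < w (Suc i)\<close> by blast
        ultimately show ?thesis unfolding L using True dn by (simp add: ribbon_map_cls[OF fc] mult.assoc)
      next
        case s: False
        then have "dn l \<notin> ribbon_arrows w i" using arrow by blast
        then show ?thesis unfolding L using True dn z1 s by simp
      qed
    qed
  qed
qed

lemma layer_iso:
  "mod_iso (preproj Q) (Str {w i..<w (Suc i)} (ribbon_arrows w i))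
    (layer n Q w i :: (('b, 'k::field) preproj_elt, ('b, 'k) preproj_elt set) module)"
proof -
  let ?W = "{w i..<w (Suc i)}" and ?S = "ribbon_arrows w i"
  let ?I = "cls ` depth_ideal (depth_of w) :: ('b, 'k) preproj_elt set"
  let ?R = "regular_module (preproj Q) :: (('b, 'k) preproj_elt, _) module"
  let ?M = "?R\<lparr>carrier := ?I\<rparr>"
  interpret kalg "preproj Q :: ('k, ('b, 'k) preproj_elt) module" by (rule kalg_preproj)
  have d: "thin_data ?W ?S" by (intro string_data_thin ribbon_string_data w i ascent)
  have M: "pmod ?M"
    by (intro submodule_left_module regular_left_module depth_submodule depth_of_left_stable w)
  have N: "pmod (Str ?W ?S :: (('b, 'k) preproj_elt, _) module)" by (rule Str_module[OF d])
  have car: "ribbon_map C \<in> carrier (Str ?W ?S)" for C :: "('b, 'k) preproj_elt"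
    by (auto simp: Str_simps ribbon_map_def)
  have sm: "psm ?M c (cls f) = cls (\<lambda>x. c * f x)" if "f \<in> carrier PA" for c and f :: "('b, 'k) path_elt"
    using that by (simp add: field_smult_def regular_module_def with_smult_def scal_mult_l cls_hom(3)[OF that that])
  have hom: "ribbon_map \<in> mod_hom (preproj Q) ?M (Str ?W ?S)"
  proof (rule mod_homI[OF M N car])
    fix x y assume "x \<in> carrier ?M" "y \<in> carrier ?M"
    then obtain f g where f: "x = cls f" "f \<in> carrier PA" and g: "y = cls g" "g \<in> carrier PA"
      by (auto dest: depth_idealD(1))
    show "ribbon_map (x \<oplus>\<^bsub>?M\<^esub> y) = ribbon_map x \<oplus>\<^bsub>Str ?W ?S\<^esub> ribbon_map y"
      by (simp add: regular_module_def with_smult_def f g cls_hom(2)[OF f(2) g(2)] Str_simps fun_eq_iff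
          ribbon_map_cls[OF f(2)] ribbon_map_cls[OF g(2)] ribbon_map_cls[OF D.add_in_PA[OF f(2) g(2)]]
          coord_add[OF f(2) g(2)] distrib_left)
  next
    fix c x assume "x \<in> carrier ?M"
    then obtain f where f: "x = cls f" "f \<in> carrier PA" by (auto dest: depth_idealD(1))
    show "ribbon_map (psm ?M c x) = psm (Str ?W ?S) c (ribbon_map x)"
      by (simp add: f sm Str_gens(1)[OF d car] fun_eq_iff ribbon_map_cls[OF f(2)]
          ribbon_map_cls[OF D.scal_in_PA[OF f(2)]] coord_scal)
  next
    fix v x assume v: "v \<in> {1..n}" and "x \<in> carrier ?M"
    then obtain f where f: "x = cls f" "f \<in> carrier PA" by (auto dest: depth_idealD(1))
    have m: "basis_path (v, []) \<otimes>\<^bsub>PA\<^esub> f \<in> carrier PA" using f v by (simp add: D.mult_in_PA)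
    have "vertex_act ?M v x = cls (basis_path (v, []) \<otimes>\<^bsub>PA\<^esub> f)"
      using v by (simp add: vertex_act_def regular_module_def with_smult_def f cls_hom(1)[OF basis_vertex_in_PA[OF v] f(2)])
    then show "ribbon_map (vertex_act ?M v x) = vertex_act (Str ?W ?S) v (ribbon_map x)"
      by (auto simp: Str_gens(2)[OF d car v] fun_eq_iff ribbon_map_cls[OF m] coord_vertex_mult(1)[OF f(2) v]
          f(1) ribbon_map_cls[OF f(2)])
  next
    fix b x assume b: "b \<in> arcs D" and "x \<in> carrier ?M"
    then obtain f where f: "x = cls f" "f \<in> depth_ideal (depth_of w)" by auto
    have "arrow_act ?M b x = cls (basis_arrow D b \<otimes>\<^bsub>PA\<^esub> f)"
      using b by (simp add: arrow_act_def regular_module_def with_smult_def f(1) cls_hom(1)[OF D.arrow_in_PA[OF b] depth_idealD(1)[OF f(2)]])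
    then show "ribbon_map (arrow_act ?M b x) = arrow_act (Str ?W ?S) b (ribbon_map x)"
      by (simp add: Str_gens(3)[OF d car b] fun_eq_iff ribbon_map_arrow[OF f(2) b] f(1))
  qed
  have surj: "ribbon_map ` carrier ?M = carrier (Str ?W ?S :: (('b, 'k) preproj_elt, _) module)"
  proof (rule Set.set_eqI, rule iffI)
    fix x assume "x \<in> carrier (Str ?W ?S :: (('b, 'k) preproj_elt, _) module)"
    then have x: "x v = 0" if "\<not> (w i \<le> v \<and> v < w (Suc i))" for v using that by (auto simp: Str_simps)
    define q where "q l = x l / ribbon_sign l" for l
    let ?g = "\<lambda>l y. q l * normal_elt (i, ribbon_depth l, l) y :: 'k"
    let ?f = "\<lambda>y. \<Sum>l\<in>?W. ?g l y"
    have g: "?g l \<in> carrier PA" if "l \<in> ?W" for l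
      by (intro D.scal_in_PA normal_elt_in_PA ribbon_cell) (use that in auto)
    then have fc: "?f \<in> carrier PA" and fl: "lin h ?f = (\<Sum>l\<in>?W. lin h (?g l))" for h
      using lin_sum[of ?W ?g] by auto
    have co: "coord ?f u p v = (if u = i \<and> v \<in> ?W \<and> p = ribbon_depth v then q v else 0)" for u p v
    proof -
      have "coord ?f u p v = (\<Sum>l\<in>?W. coord (?g l) u p v)" unfolding coord_def by (rule fl)
      also have "\<dots> = (\<Sum>l\<in>?W. if l = v then (if u = i \<and> p = ribbon_depth v then q v else 0) else 0)"
        by (intro sum.cong refl) (auto simp: coord_scal coord_normal_elt[OF ribbon_cell])
      finally show ?thesis by (simp add: sum.delta)
    qed
    have "?f \<in> depth_ideal (depth_of w)" using fc by (auto simp: depth_ideal_def co depth_of_at)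
    moreover have "ribbon_map (cls ?f) = x"
    proof
      fix l show "ribbon_map (cls ?f) l = x l"
        unfolding ribbon_map_cls[OF fc] co using x[of l] by (auto simp: q_def ribbon_sign_nonzero)
    qed
    ultimately show "x \<in> ribbon_map ` carrier ?M" by (intro image_eqI[of _ _ "cls ?f"]) auto
  qed (use car in auto)
  have K: "cls ` depth_ideal (depth_of (w \<circ> simple_refl i)) =
      {x \<in> carrier ?M. ribbon_map x = \<zero>\<^bsub>Str ?W ?S\<^esub>}"
  proof -
    have e: "ribbon_map (cls f) = \<zero>\<^bsub>Str ?W ?S\<^esub> \<longleftrightarrow> (\<forall>l. w i \<le> l \<and> l < w (Suc i) \<longrightarrow> coord f i (ribbon_depth l) l = 0)"
      if "f \<in> carrier PA" for f :: "('b, 'k) path_elt"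
      using that ribbon_sign_nonzero[where ?'k = 'k] by (auto simp: Str_simps fun_eq_iff ribbon_map_cls)
    have "cls f \<in> {x \<in> carrier ?M. ribbon_map x = \<zero>\<^bsub>Str ?W ?S\<^esub>} \<longleftrightarrow> cls f \<in> cls ` depth_ideal (depth_of (w \<circ> simple_refl i))"
      if "f \<in> carrier PA" for f :: "('b, 'k) path_elt"
      using that by (simp add: e cls_in_depth_ideal ribbon_kernel)
    then show ?thesis by (auto dest: depth_idealD(1))
  qed
  have p: "(w \<circ> simple_refl i) permutes {1..Suc n}" by (rule permutes_compose[OF simple_refl_permutes[OF i] w])
  show ?thesis
    using first_isomorphism[OF M N hom surj K]
    by (simp add: layer_def weyl_ideal_depth[OF w] weyl_ideal_depth[OF p] sym_group_def)
qed

end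

lemma list_permutation:
  assumes "distinct xs" "set xs = {1..N}"
  obtains w where "w permutes {1..N}" "\<And>r. r < length xs ==> w (Suc r) = xs ! r"
proof -
  let ?w = "\<lambda>r. if r \<in> {1..N} then xs ! (r - 1) else r"
  have N: "length xs = N" using distinct_card[OF assms(1)] assms(2) by simp
  have "bij_betw (\<lambda>r. r - 1) {1..N} {..<N}"
    by (rule bij_betw_byWitness[of _ Suc]) auto
  then have "bij_betw ((!) xs \<circ> (\<lambda>r. r - 1)) {1..N} {1..N}"
    by (rule bij_betw_trans) (use bij_betw_nth[OF assms(1), of "{..<N}" "{1..N}"] N assms(2) in simp)
  then have "bij_betw ?w {1..N} {1..N}" by (rule bij_betw_cong[THEN iffD1, rotated]) auto
  then have "?w permutes {1..N}" by (rule bij_imp_permutes) auto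
  then show ?thesis by (rule that) (simp add: N)
qed

text \<open>
  In one-line notation, \<open>w\<close> lists first the vertices \<open>l + 1\<close> with \<open>dn l\<close> in \<open>S\<close>, then \<open>a\<close> and \<open>b + 1\<close>, then the rest;
  \<open>i\<close> is the place of \<open>a\<close>.
\<close>

lemma string_data_ribbon:
  assumes "string_data W S"
  obtains w i where "w permutes {1..Suc n}" "1 \<le> i" "i \<le> n" "w i < w (Suc i)"
    "W = {w i..<w (Suc i)}" "S = ribbon_arrows w i"
proof -
  obtain a b where ab: "1 \<le> a" "a \<le> b" "b \<le> n" "W = {a..b}" "S \<subseteq> up ` {a..<b} \<union> dn ` {a..<b}"
    "\<forall>l\<in>{a..<b}. up l \<in> S \<longleftrightarrow> dn l \<notin> S" using assms unfolding string_data_def by auto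
  define T where "T = {c. a < c \<and> c \<le> b \<and> dn (c - 1) \<in> S}"
  have T: "finite T" "T \<subseteq> {Suc a..b}" by (auto simp: T_def intro: finite_subset[of _ "{..b}"])
  let ?k = "card T" and ?rest = "{1..Suc n} - T - {a, Suc b}"
  let ?xs = "sorted_list_of_set T @ [a, Suc b] @ sorted_list_of_set ?rest"
  have "distinct ?xs" "set ?xs = {1..Suc n}" using T ab by auto
  then obtain w where w: "w permutes {1..Suc n}" "\<And>r. r < length ?xs ==> w (Suc r) = ?xs ! r"
    using list_permutation[of ?xs "Suc n"] by blast
  have "?k \<le> card {Suc a..b}" by (rule card_mono) (use T in auto)
  then have k: "Suc ?k \<le> n" using ab by simp
  have wi: "w (Suc ?k) = a" "w (Suc (Suc ?k)) = Suc b" using w(2)[of ?k] w(2)[of "Suc ?k"] by (auto simp: nth_append)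
  have "w ` {1..<Suc ?k} = T"
  proof -
    have "{1..<Suc ?k} = Suc ` {..<?k}" by (auto simp: image_iff) (metis Suc_le_D Suc_le_lessD less_Suc_eq_le lessThan_iff)
    then have "w ` {1..<Suc ?k} = (\<lambda>r. sorted_list_of_set T ! r) ` {..<length (sorted_list_of_set T)}"
      using w(2) by (auto simp: image_image nth_append intro!: image_cong)
    also have "\<dots> = set (sorted_list_of_set T)" by (auto simp: set_conv_nth)
    also have "\<dots> = T" using T(1) by simp
    finally show ?thesis .
  qed
  moreover have "S = {up l |l. a \<le> l \<and> l < b \<and> Suc l \<notin> T} \<union> {dn l |l. a \<le> l \<and> l < b \<and> Suc l \<in> T}"
    (is "_ = ?U")
  proof (intro subset_antisym subsetI)
    have T': "Suc l \<in> T \<longleftrightarrow> dn l \<in> S" if "a \<le> l" "l < b" for l using that by (simp add: T_def)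
    {
      fix x assume x: "x \<in> S"
      then have "x \<in> up ` {a..<b} \<union> dn ` {a..<b}" using ab(5) by blast
      then obtain l where l: "a \<le> l" "l < b" "x = up l \<or> x = dn l" by auto
      then show "x \<in> ?U" using x ab(6) T'[OF l(1,2)] by auto
    next
      fix x assume "x \<in> ?U"
      then obtain l where "a \<le> l" "l < b" "x = up l \<and> Suc l \<notin> T \<or> x = dn l \<and> Suc l \<in> T" by blast
      then show "x \<in> S" using ab(6) T'[of l] by auto
    }
  qed
  ultimately have "S = ribbon_arrows w (Suc ?k)" unfolding ribbon_arrows_def wi by auto
  moreover have "W = {w (Suc ?k)..<w (Suc (Suc ?k))}"
    unfolding wi ab(4) by (simp add: atLeastLessThanSuc_atLeastAtMost)
  ultimately show ?thesis using that[of w "Suc ?k"] w(1) k wi ab(2) by simp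
qed

theorem layer_module_iff:
  fixes M :: "(('b, 'k::field) preproj_elt, 'm, 'z) module_scheme"
  assumes M: "fd_module (preproj Q) M"
  shows "layer_module n Q M \<longleftrightarrow> (\<exists>W S. string_data W S \<and> mod_iso (preproj Q) M (Str W S))"
proof
  assume "layer_module n Q M"
  then obtain w i where w: "w permutes {1..Suc n}" and i0: "1 \<le> i" "i \<le> n"
    and len: "weyl_length n (w \<circ> simple_refl i) = weyl_length n w + 1"
    and iso: "mod_iso (preproj Q) M (layer n Q w i)"
    unfolding layer_module_def by (auto simp: sym_group_def)
  have i: "1 \<le> i" "i \<le> n" "w i < w (Suc i)" using i0 iffD1[OF weyl_length_right[OF w i0] len] by auto
  have d: "string_data {w i..<w (Suc i)} (ribbon_arrows w i)" by (rule ribbon_string_data[OF w i])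
  have "mod_iso (preproj Q) (layer n Q w i) (Str {w i..<w (Suc i)} (ribbon_arrows w i) :: (('b, 'k) preproj_elt, _) module)"
    by (rule mod_iso_sym[OF Str_module[OF string_data_thin[OF d]] layer_iso[OF w i]])
  then show "\<exists>W S. string_data W S \<and> mod_iso (preproj Q) M (Str W S)" using mod_iso_trans[OF iso] d by blast
next
  assume "\<exists>W S. string_data W S \<and> mod_iso (preproj Q) M (Str W S)"
  then obtain W S where d: "string_data W S" and iso: "mod_iso (preproj Q) M (Str W S)" by auto
  obtain w i where w: "w permutes {1..Suc n}" and i: "1 \<le> i" "i \<le> n" "w i < w (Suc i)"
    and W: "W = {w i..<w (Suc i)}" "S = ribbon_arrows w i" by (rule string_data_ribbon[OF d])
  have "mod_iso (preproj Q) M (layer n Q w i)"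
    using mod_iso_trans[OF iso] layer_iso[OF w i, where ?'k = 'k] by (simp add: W)
  moreover have "weyl_length n (w \<circ> simple_refl i) = weyl_length n w + 1"
    by (rule iffD2[OF weyl_length_right[OF w i(1,2)] i(3)])
  ultimately show "layer_module n Q M" unfolding layer_module_def using M w i
    by (intro conjI bexI[of _ w] bexI[of _ i]) (auto simp: sym_group_def)
qed

end

section \<open>Indecomposable modules without two-cycles\<close>

lemma zero_submodule:
  assumes "left_module A M"
  shows "submodule {\<zero>\<^bsub>M\<^esub>} A M"
proof (rule submodule.intro)
  interpret left_module A M by fact
  show "subgroup {\<zero>\<^bsub>M\<^esub>} (add_monoid M)" by (rule M.add.subgroupI) auto
  show "submodule_axioms {\<zero>\<^bsub>M\<^esub>} A M" by unfold_locales auto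
qed

lemma kernel_submodule:
  assumes "left_module A M" "left_module A N" "f \<in> mod_hom A M N"
  shows "submodule {x \<in> carrier M. f x = \<zero>\<^bsub>N\<^esub>} A M"
  using submodule_preimage[OF assms(1,2) submodule_carrier[OF assms(1)], of f "{\<zero>\<^bsub>N\<^esub>}"]
    zero_submodule[OF assms(2)] assms(3) by simp

lemma indecomposable_iso:
  assumes M: "left_module A M" and N: "left_module A N" and iso: "mod_iso A M N" and ind: "indecomposable A N"
  shows "indecomposable A M"
proof -
  interpret M: left_module A M by fact
  interpret N: left_module A N by fact
  obtain f where f: "f \<in> mod_hom A M N" "bij_betw f (carrier M) (carrier N)" using iso unfolding mod_iso_def by auto
  let ?g = "inv_into (carrier M) f"
  have g: "?g \<in> mod_hom A N M" by (rule inv_mod_hom[OF M f])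
  have gf: "?g (f x) = x" if "x \<in> carrier M" for x using f(2) that by (simp add: bij_betw_def inv_into_f_f)
  have fg: "f (?g y) = y" if "y \<in> carrier N" for y using f(2) that by (simp add: bij_betw_def f_inv_into_f)
  have f0: "f \<zero>\<^bsub>M\<^esub> = \<zero>\<^bsub>N\<^esub>" by (rule mod_hom_zero[OF f(1) M.abelian_group_axioms N.abelian_group_axioms])
  have g0: "?g \<zero>\<^bsub>N\<^esub> = \<zero>\<^bsub>M\<^esub>" by (rule mod_hom_zero[OF g N.abelian_group_axioms M.abelian_group_axioms])
  have pre: "submodule {y \<in> carrier N. ?g y \<in> U} A N" if "submodule U A M" for U
    using submodule_preimage[OF N M submodule_carrier[OF N], of ?g U] g that by simp
  have zero: "U = {\<zero>\<^bsub>M\<^esub>}" if U: "submodule U A M" and e: "{y \<in> carrier N. ?g y \<in> U} = {\<zero>\<^bsub>N\<^esub>}" for U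
  proof -
    have "x = \<zero>\<^bsub>M\<^esub>" if "x \<in> U" for x
    proof -
      have x: "x \<in> carrier M" by (rule submoduleD(3)[OF U that])
      then have "f x \<in> {y \<in> carrier N. ?g y \<in> U}" using mod_homD(1)[OF f(1) x] gf that by simp
      then have "f x = \<zero>\<^bsub>N\<^esub>" unfolding e by simp
      then show ?thesis using gf[OF x] g0 by simp
    qed
    then show ?thesis using submoduleD(2)[OF U] by blast
  qed
  show ?thesis unfolding indecomposable_def
  proof (intro conjI allI impI)
    show "carrier M \<noteq> {\<zero>\<^bsub>M\<^esub>}"
    proof
      assume c: "carrier M = {\<zero>\<^bsub>M\<^esub>}"
      have "carrier N = f ` carrier M" using f(2) by (simp add: bij_betw_def)
      then show False using ind f0 by (simp add: c indecomposable_def)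
    qed
    fix U V assume "submodule U A M \<and> submodule V A M \<and> U \<inter> V = {\<zero>\<^bsub>M\<^esub>} \<and> U <+>\<^bsub>M\<^esub> V = carrier M"
    then have U: "submodule U A M" and V: "submodule V A M" and i: "U \<inter> V = {\<zero>\<^bsub>M\<^esub>}" and s: "U <+>\<^bsub>M\<^esub> V = carrier M"
      by auto
    let ?U = "{y \<in> carrier N. ?g y \<in> U}" and ?V = "{y \<in> carrier N. ?g y \<in> V}"
    have "?U \<inter> ?V = {\<zero>\<^bsub>N\<^esub>}"
    proof (rule Set.set_eqI, rule iffI)
      fix y assume "y \<in> ?U \<inter> ?V"
      then have "?g y \<in> U \<inter> V" and y: "y \<in> carrier N" by auto
      then have "?g y = \<zero>\<^bsub>M\<^esub>" unfolding i by simp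
      then show "y \<in> {\<zero>\<^bsub>N\<^esub>}" using fg[OF y] f0 by simp
    qed (use g0 submoduleD(2)[OF U] submoduleD(2)[OF V] in auto)
    moreover have "?U <+>\<^bsub>N\<^esub> ?V = carrier N"
    proof (rule Set.set_eqI, rule iffI)
      fix y assume y: "y \<in> carrier N"
      then have "?g y \<in> U <+>\<^bsub>M\<^esub> V" unfolding s by (rule mod_homD(1)[OF g])
      then obtain u v where uv: "u \<in> U" "v \<in> V" "?g y = u \<oplus>\<^bsub>M\<^esub> v" by (auto simp: set_add_defs)
      have c: "u \<in> carrier M" "v \<in> carrier M" by (rule submoduleD(3)[OF U uv(1)] submoduleD(3)[OF V uv(2)])+
      have "y = f u \<oplus>\<^bsub>N\<^esub> f v" using fg[OF y] mod_homD(2)[OF f(1) c] uv(3) by simp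
      moreover have "f u \<in> ?U" "f v \<in> ?V" using mod_homD(1)[OF f(1)] c gf uv by auto
      ultimately show "y \<in> ?U <+>\<^bsub>N\<^esub> ?V" by (auto simp: set_add_defs)
    qed (auto simp: set_add_defs)
    ultimately have "?U = {\<zero>\<^bsub>N\<^esub>} \<or> ?V = {\<zero>\<^bsub>N\<^esub>}"
      using ind pre[OF U] pre[OF V] unfolding indecomposable_def by blast
    then show "U = {\<zero>\<^bsub>M\<^esub>} \<or> V = {\<zero>\<^bsub>M\<^esub>}" using zero U V by blast
  qed
qed

subsection \<open>Linear forms\<close>

context kmod
begin

definition subspace :: "'m set => bool" where
  "subspace W \<longleftrightarrow> W \<subseteq> carrier M \<and> \<zero>\<^bsub>M\<^esub> \<in> W \<and> (\<forall>x\<in>W. \<forall>y\<in>W. x \<oplus>\<^bsub>M\<^esub> y \<in> W) \<and> (\<forall>c. \<forall>x\<in>W. sm c x \<in> W)"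

definition linear_form :: "('m => 'k) => bool" where
  "linear_form \<phi> \<longleftrightarrow> (\<forall>x\<in>carrier M. \<forall>y\<in>carrier M. \<phi> (x \<oplus>\<^bsub>M\<^esub> y) = \<phi> x + \<phi> y) \<and>
    (\<forall>c. \<forall>x\<in>carrier M. \<phi> (sm c x) = c * \<phi> x)"

lemma subspaceD:
  assumes "subspace W"
  shows "x \<in> W ==> x \<in> carrier M" "\<zero>\<^bsub>M\<^esub> \<in> W" "x \<in> W ==> y \<in> W ==> x \<oplus>\<^bsub>M\<^esub> y \<in> W" "x \<in> W ==> sm c x \<in> W"
  using assms by (auto simp: subspace_def)

lemma linear_formD:
  assumes "linear_form \<phi>"
  shows "x \<in> carrier M ==> y \<in> carrier M ==> \<phi> (x \<oplus>\<^bsub>M\<^esub> y) = \<phi> x + \<phi> y"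
    "x \<in> carrier M ==> \<phi> (sm c x) = c * \<phi> x" "\<phi> \<zero>\<^bsub>M\<^esub> = 0"
proof -
  show "x \<in> carrier M ==> y \<in> carrier M ==> \<phi> (x \<oplus>\<^bsub>M\<^esub> y) = \<phi> x + \<phi> y"
    and s: "x \<in> carrier M ==> \<phi> (sm c x) = c * \<phi> x" for x y c
    using assms by (auto simp: linear_form_def)
  show "\<phi> \<zero>\<^bsub>M\<^esub> = 0" using s[of "\<zero>\<^bsub>M\<^esub>" 0] by simp
qed

lemma sm_cancel: "x \<in> carrier M ==> y \<in> carrier M ==> sm (- c) x \<oplus>\<^bsub>M\<^esub> (sm c x \<oplus>\<^bsub>M\<^esub> y) = y"
  using sm_l_distr[of x "- c" c] by (simp flip: M.a_assoc)

lemma fd_span: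
  assumes fd: "fd_module A M"
  obtains S where "finite S" "S \<subseteq> carrier M" "\<And>W. subspace W ==> S \<subseteq> W ==> W = carrier M"
proof -
  obtain S where S: "finite S" "S \<subseteq> carrier M"
    and sp: "\<And>x. x \<in> carrier M ==> \<exists>c. x = (\<Oplus>\<^bsub>M\<^esub>s\<in>S. sm (c s) s)"
    using fd unfolding fd_module_def by auto
  have "x \<in> W" if W: "subspace W" "S \<subseteq> W" and x: "x \<in> carrier M" for W x
  proof -
    obtain c where c: "x = (\<Oplus>\<^bsub>M\<^esub>s\<in>S. sm (c s) s)" using sp[OF x] by auto
    have "(\<Oplus>\<^bsub>M\<^esub>s\<in>T. sm (c s) s) \<in> W" if "finite T" "T \<subseteq> S" for T
      using that
    proof (induction T rule: finite_induct)
      case (insert t T)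
      have "t \<in> W" "t \<in> carrier M" "(\<lambda>s. sm (c s) s) \<in> T \<rightarrow> carrier M" using insert.prems W(2) S(2) by auto
      then show ?case using insert subspaceD[OF W(1)] by simp
    qed (use subspaceD(2)[OF W(1)] in simp)
    then show ?thesis using c S(1) by simp
  qed
  then have "W = carrier M" if "subspace W" "S \<subseteq> W" for W using that subspaceD(1)[OF that(1)] by blast
  then show ?thesis by (rule that[OF S])
qed

text \<open>
  Enlarge \<open>L\<close>, one element of a finite spanning set at a time, without reaching \<open>v\<close>.  In the end it is a
  complement of the line through \<open>v\<close>.
\<close>

lemma separation:
  assumes fd: "fd_module A M" and L: "subspace L" and v: "v \<in> carrier M" "v \<notin> L"
  obtains \<phi> where "linear_form \<phi>" "\<And>x. x \<in> L ==> \<phi> x = 0" "\<phi> v = 1"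
proof -
  obtain S where S: "finite S" "S \<subseteq> carrier M" "\<And>W. subspace W ==> S \<subseteq> W ==> W = carrier M"
    using fd_span[OF fd] by blast
  have "\<exists>H. subspace H \<and> L \<subseteq> H \<and> v \<notin> H \<and> (\<forall>t\<in>T. \<exists>h\<in>H. \<exists>c. t = h \<oplus>\<^bsub>M\<^esub> sm c v)"
    if "finite T" "T \<subseteq> carrier M" for T
    using that
  proof (induction T rule: finite_induct)
    case empty
    then show ?case using L v by auto
  next
    case (insert s T)
    then obtain H where H: "subspace H" "L \<subseteq> H" "v \<notin> H" "\<And>t. t \<in> T ==> \<exists>h\<in>H. \<exists>c. t = h \<oplus>\<^bsub>M\<^esub> sm c v"
      by auto
    have s: "s \<in> carrier M" using insert.prems by simp
    show ?case
    proof (cases "\<exists>h\<in>H. \<exists>c. s = h \<oplus>\<^bsub>M\<^esub> sm c v")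
      case True
      then show ?thesis using H by (intro exI[of _ H]) auto
    next
      case False
      let ?H = "{h \<oplus>\<^bsub>M\<^esub> sm c s | h c. h \<in> H}"
      have in_H: "h \<oplus>\<^bsub>M\<^esub> sm c s \<in> ?H" if "h \<in> H" for h c using that by auto
      have HH: "H \<subseteq> ?H"
      proof
        fix h assume h: "h \<in> H"
        then show "h \<in> ?H" using in_H[OF h, of 0] s subspaceD(1)[OF H(1) h] by simp
      qed
      have "subspace ?H"
        unfolding subspace_def
      proof (intro conjI ballI allI)
        show "?H \<subseteq> carrier M" using subspaceD(1)[OF H(1)] s by auto
        show "\<zero>\<^bsub>M\<^esub> \<in> ?H" using HH subspaceD(2)[OF H(1)] by auto
        fix x y assume "x \<in> ?H" "y \<in> ?H"
        then obtain h c h' c' where x: "x = h \<oplus>\<^bsub>M\<^esub> sm c s" "h \<in> H" and y: "y = h' \<oplus>\<^bsub>M\<^esub> sm c' s" "h' \<in> H" by auto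
        have "x \<oplus>\<^bsub>M\<^esub> y = (h \<oplus>\<^bsub>M\<^esub> h') \<oplus>\<^bsub>M\<^esub> sm (c + c') s"
          using subspaceD(1)[OF H(1)] x y s by (simp add: sm_l_distr M.a_ac)
        then show "x \<oplus>\<^bsub>M\<^esub> y \<in> ?H" using in_H[OF subspaceD(3)[OF H(1) x(2) y(2)], of "c + c'"] by (simp only:)
      next
        fix d x assume "x \<in> ?H"
        then obtain h c where x: "x = h \<oplus>\<^bsub>M\<^esub> sm c s" "h \<in> H" by auto
        have "sm d x = sm d h \<oplus>\<^bsub>M\<^esub> sm (d * c) s"
          using subspaceD(1)[OF H(1)] x s by (simp add: sm_r_distr sm_sm)
        then show "sm d x \<in> ?H" using in_H[OF subspaceD(4)[OF H(1) x(2), of d], of "d * c"] by (simp only:)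
      qed
      moreover have "v \<notin> ?H"
      proof
        assume "v \<in> ?H"
        then obtain h c where h: "v = h \<oplus>\<^bsub>M\<^esub> sm c s" "h \<in> H" by auto
        have hc: "h \<in> carrier M" by (rule subspaceD(1)[OF H(1) h(2)])
        have "c \<noteq> 0"
        proof
          assume "c = 0"
          then have "v = h" using h hc s by simp
          then show False using h(2) H(3) by simp
        qed
        then have "sm (inverse c) v = sm (inverse c) h \<oplus>\<^bsub>M\<^esub> s" using h(1) hc s by (simp add: sm_r_distr sm_sm)
        then have "s = sm (- inverse c) h \<oplus>\<^bsub>M\<^esub> sm (inverse c) v"
          using sm_cancel[of h s "inverse c"] hc s by simp
        then show False using False subspaceD(4)[OF H(1) h(2)] by blast
      qed
      moreover have "\<exists>h\<in>?H. \<exists>c. t = h \<oplus>\<^bsub>M\<^esub> sm c v" if "t \<in> insert s T" for t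
      proof (cases "t = s")
        case True
        have "s = (\<zero>\<^bsub>M\<^esub> \<oplus>\<^bsub>M\<^esub> sm 1 s) \<oplus>\<^bsub>M\<^esub> sm 0 v" using s v by simp
        then show ?thesis using True in_H[OF subspaceD(2)[OF H(1)]] by blast
      next
        case False
        then show ?thesis using H(4)[of t] that HH by blast
      qed
      ultimately show ?thesis using HH H(2) by (intro exI[of _ ?H]) blast
    qed
  qed
  from this[OF S(1,2)] obtain H where H: "subspace H" "L \<subseteq> H" "v \<notin> H"
    "\<And>t. t \<in> S ==> \<exists>h\<in>H. \<exists>c. t = h \<oplus>\<^bsub>M\<^esub> sm c v" by auto
  note hc = subspaceD(1)[OF H(1)]
  let ?A = "{h \<oplus>\<^bsub>M\<^esub> sm c v | h c. h \<in> H}"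
  have add: "(h \<oplus>\<^bsub>M\<^esub> sm c v) \<oplus>\<^bsub>M\<^esub> (h' \<oplus>\<^bsub>M\<^esub> sm c' v) = (h \<oplus>\<^bsub>M\<^esub> h') \<oplus>\<^bsub>M\<^esub> sm (c + c') v"
    if "h \<in> H" "h' \<in> H" for h h' c c'
    using hc that v by (simp add: sm_l_distr M.a_ac)
  have mul: "sm d (h \<oplus>\<^bsub>M\<^esub> sm c v) = sm d h \<oplus>\<^bsub>M\<^esub> sm (d * c) v" if "h \<in> H" for h c d
    using hc that v by (simp add: sm_r_distr sm_sm)
  have "subspace ?A"
    unfolding subspace_def
  proof (intro conjI ballI allI)
    show "?A \<subseteq> carrier M" using hc v by auto
    have "\<zero>\<^bsub>M\<^esub> = \<zero>\<^bsub>M\<^esub> \<oplus>\<^bsub>M\<^esub> sm 0 v" using v by simp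
    then show "\<zero>\<^bsub>M\<^esub> \<in> ?A" using subspaceD(2)[OF H(1)] by blast
    fix x y assume "x \<in> ?A" "y \<in> ?A"
    then show "x \<oplus>\<^bsub>M\<^esub> y \<in> ?A" using add subspaceD(3)[OF H(1)] by blast
  next
    fix d x assume "x \<in> ?A"
    then show "sm d x \<in> ?A" using mul subspaceD(4)[OF H(1)] by blast
  qed
  moreover have "S \<subseteq> ?A" using H(4) by blast
  ultimately have A: "?A = carrier M" by (rule S(3))
  have uniq: "c = c'" if e: "h \<oplus>\<^bsub>M\<^esub> sm c v = h' \<oplus>\<^bsub>M\<^esub> sm c' v" and h: "h \<in> H" "h' \<in> H" for h h' c c'
  proof (rule ccontr)
    assume ne: "c \<noteq> c'"
    have "sm (c - c') v = sm c v \<oplus>\<^bsub>M\<^esub> sm (- c') v" using sm_l_distr[OF v(1), of c "- c'"] by simp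
    also have "sm c v = sm (- 1) h \<oplus>\<^bsub>M\<^esub> (h \<oplus>\<^bsub>M\<^esub> sm c v)" using sm_cancel[of h "sm c v" 1] hc h v by simp
    also have "\<dots> = sm (- 1) h \<oplus>\<^bsub>M\<^esub> (h' \<oplus>\<^bsub>M\<^esub> sm c' v)" by (simp only: e)
    also have "\<dots> \<oplus>\<^bsub>M\<^esub> sm (- c') v = (sm (- 1) h \<oplus>\<^bsub>M\<^esub> h') \<oplus>\<^bsub>M\<^esub> (sm c' v \<oplus>\<^bsub>M\<^esub> sm (- c') v)"
      using hc h v by (simp add: M.a_assoc)
    also have "sm c' v \<oplus>\<^bsub>M\<^esub> sm (- c') v = \<zero>\<^bsub>M\<^esub>" using sm_l_distr[OF v(1), of c' "- c'"] v by simp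
    finally have "sm (c - c') v \<in> H" using subspaceD[OF H(1)] h hc by simp
    then have "sm (inverse (c - c')) (sm (c - c') v) \<in> H" by (rule subspaceD(4)[OF H(1)])
    then show False using ne v H(3) by (simp add: sm_sm)
  qed
  define \<phi> where "\<phi> x = (THE c. \<exists>h\<in>H. x = h \<oplus>\<^bsub>M\<^esub> sm c v)" for x
  have \<phi>: "\<phi> (h \<oplus>\<^bsub>M\<^esub> sm c v) = c" if "h \<in> H" for h c
    unfolding \<phi>_def using that uniq by (intro the_equality) blast+
  have ex: "\<exists>h\<in>H. \<exists>c. x = h \<oplus>\<^bsub>M\<^esub> sm c v" if "x \<in> carrier M" for x using that A by blast
  have "linear_form \<phi>"
    unfolding linear_form_def
  proof (intro conjI ballI allI)
    fix x y assume "x \<in> carrier M" "y \<in> carrier M"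
    then obtain h c h' c' where h: "h \<in> H" "x = h \<oplus>\<^bsub>M\<^esub> sm c v" "h' \<in> H" "y = h' \<oplus>\<^bsub>M\<^esub> sm c' v" using ex by metis
    then show "\<phi> (x \<oplus>\<^bsub>M\<^esub> y) = \<phi> x + \<phi> y" using subspaceD(3)[OF H(1)] by (simp add: add \<phi>)
  next
    fix d x assume "x \<in> carrier M"
    then obtain h c where h: "h \<in> H" "x = h \<oplus>\<^bsub>M\<^esub> sm c v" using ex by metis
    then show "\<phi> (sm d x) = d * \<phi> x" using subspaceD(4)[OF H(1)] by (simp add: mul \<phi>)
  qed
  moreover have "\<phi> x = 0" if "x \<in> L" for x
    using \<phi>[of x 0] that H(2) hc v by auto
  moreover have "\<phi> v = 1" using \<phi>[OF subspaceD(2)[OF H(1)], of 1] v by simp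
  ultimately show ?thesis by (rule that)
qed

end

subsection \<open>Vertex spaces\<close>

locale preproj_module = type_A n Q + kmod "preproj Q" M
  for n and Q :: "(nat, 'b) pre_digraph" and M :: "(('b, 'k::field) preproj_elt, 'm, 'z) module_scheme" (structure)
begin

abbreviation "va \<equiv> vertex_act M"
abbreviation "aa \<equiv> arrow_act M"

lemma pmod_M: "pmod M" by (rule left_module_axioms)

lemma cls_act_closed: "f \<in> carrier PA ==> x \<in> carrier M ==> cls f \<odot> x \<in> carrier M"
  by (rule smult_closed) simp_all

lemma va_closed [simp]: "u \<in> {1..n} ==> x \<in> carrier M ==> va u x \<in> carrier M"
  unfolding vertex_act_def by (rule cls_act_closed) simp_all

lemma aa_closed [simp]: "b \<in> arcs D ==> x \<in> carrier M ==> aa b x \<in> carrier M"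
  unfolding arrow_act_def by (rule cls_act_closed) simp_all

lemma va_linear:
  assumes "u \<in> {1..n}" "x \<in> carrier M"
  shows "y \<in> carrier M ==> va u (x \<oplus> y) = va u x \<oplus> va u y" "va u (sm c x) = sm c (va u x)"
  using assms by (simp_all add: vertex_act_def smult_r_distr sm_comm)

lemma va_zero [simp]: "u \<in> {1..n} ==> va u \<zero> = \<zero>"
  by (simp add: vertex_act_def)

lemma aa_linear:
  assumes "b \<in> arcs D" "x \<in> carrier M"
  shows "y \<in> carrier M ==> aa b (x \<oplus> y) = aa b x \<oplus> aa b y" "aa b (sm c x) = sm c (aa b x)"
  using assms by (simp_all add: arrow_act_def smult_r_distr sm_comm)

lemma aa_zero [simp]: "b \<in> arcs D ==> aa b \<zero> = \<zero>"
  by (simp add: arrow_act_def)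

lemma cls_zero_act: "x \<in> carrier M ==> cls (\<lambda>_. 0) \<odot> x = \<zero>"
  using zero_act by (simp add: cls_zero_one)

lemma va_va:
  assumes "u \<in> {1..n}" "v \<in> {1..n}" "x \<in> carrier M"
  shows "va u (va v x) = (if u = v then va v x else \<zero>)"
  using assms by (auto simp: vertex_act_def cls_hom(1) D.mult_basis cls_zero_act simp flip: smult_assoc1)

lemma va_aa:
  assumes "u \<in> {1..n}" "b \<in> arcs D" "x \<in> carrier M"
  shows "va u (aa b x) = (if u = head D b then aa b x else \<zero>)"
proof -
  have "va u (aa b x) = cls (basis_path (u, []) \<otimes>\<^bsub>PA\<^esub> basis_arrow D b) \<odot> x"
    using assms by (simp add: vertex_act_def arrow_act_def cls_hom(1) flip: smult_assoc1)
  then show ?thesis using assms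
    by (auto simp: basis_arrow_def D.mult_basis cls_zero_act arrow_act_def)
qed

lemma aa_va:
  assumes "u \<in> {1..n}" "b \<in> arcs D" "x \<in> carrier M"
  shows "aa b (va u x) = (if u = tail D b then aa b x else \<zero>)"
proof -
  have "aa b (va u x) = cls (basis_arrow D b \<otimes>\<^bsub>PA\<^esub> basis_path (u, [])) \<odot> x"
    using assms by (simp add: vertex_act_def arrow_act_def cls_hom(1) flip: smult_assoc1)
  then show ?thesis using assms
    by (auto simp: basis_arrow_def D.mult_basis cls_zero_act arrow_act_def)
qed

definition vspace :: "nat => 'm set" where
  "vspace u = {x \<in> carrier M. va u x = x}"

lemma vspaceD: "x \<in> vspace u ==> x \<in> carrier M" "x \<in> vspace u ==> va u x = x"
  by (auto simp: vspace_def)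

lemma vspaceI:
  "u \<in> {1..n} ==> x \<in> carrier M ==> va u x \<in> vspace u"
  "b \<in> arcs D ==> x \<in> carrier M ==> aa b x \<in> vspace (head D b)"
  "u \<in> {1..n} ==> \<zero> \<in> vspace u"
  using D.head_in_verts[of b] by (auto simp: vspace_def va_va va_aa)

lemma subspace_vspace: "u \<in> {1..n} ==> subspace (vspace u)"
  by (auto simp: subspace_def vspace_def va_linear)

lemma va_vspace: "u \<in> {1..n} ==> v \<in> {1..n} ==> x \<in> vspace v ==> va u x = (if u = v then x else \<zero>)"
  using va_va[of u v x] by (auto simp: vspace_def)


lemma vertices_ext_zero:
  assumes x: "x \<in> carrier M" and 0: "\<And>u. u \<in> {1..n} ==> va u x = \<zero>"
  shows "x = \<zero>"
proof -
  have one: "(\<lambda>y. \<Sum>u\<in>A. basis_path (u, []) y :: 'k) \<in> carrier PA \<and> cls (\<lambda>y. \<Sum>u\<in>A. basis_path (u, []) y :: 'k) \<odot> x = \<zero>"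
    if "finite A" "A \<subseteq> {1..n}" for A
    using that
  proof (induction A rule: finite_induct)
    case empty
    then show ?case using x by (simp add: cls_zero_act D.zero_in_PA)
  next
    case (insert u A)
    let ?s = "\<lambda>y. \<Sum>u\<in>A. basis_path (u, []) y :: 'k"
    have u: "basis_path (u, []) \<in> carrier (PA :: ('k, _) module)" using insert.prems by simp
    have s: "?s \<in> carrier PA" "cls ?s \<odot> x = \<zero>" using insert by auto
    have "cls (\<lambda>y. basis_path (u, []) y + ?s y) \<odot> x = va u x \<oplus> cls ?s \<odot> x"
      using x by (simp add: vertex_act_def smult_l_distr u s(1) flip: cls_hom(2)[OF u s(1)])
    then show ?case using insert 0[of u] s x D.add_in_PA[OF u s(1)] by simp
  qed
  from one[of "{1..n}"] have "cls (\<lambda>y. \<Sum>u\<in>{1..n}. basis_path (u, []) y :: 'k) \<odot> x = \<zero>" by simp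
  moreover have "(\<lambda>y. \<Sum>u\<in>{1..n}. basis_path (u, []) y :: 'k) = \<one>\<^bsub>PA\<^esub>"
  proof (rule ext, clarify)
    fix v and p :: "('b + 'b) list"
    have "(\<Sum>u\<in>{1..n}. basis_path (u, []) (v, p) :: 'k) = (\<Sum>u\<in>{1..n}. if u = v then (if p = [] then 1 else 0) else 0)"
      by (rule sum.cong) (auto simp: basis_path_def)
    then show "(\<Sum>u\<in>{1..n}. basis_path (u, []) (v, p) :: 'k) = \<one>\<^bsub>PA\<^esub> (v, p)"
      by (simp add: D.one_PA sum.delta)
  qed
  ultimately show ?thesis using x by (simp flip: cls_zero_one)
qed

lemma vertices_glue:
  assumes "\<And>u. u \<in> {1..n} ==> z u \<in> vspace u"
  obtains m where "m \<in> carrier M" "\<And>u. u \<in> {1..n} ==> va u m = z u"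
proof -
  have "\<exists>m\<in>carrier M. \<forall>u\<in>{1..n}. va u m = (if u \<le> k then z u else \<zero>)" if "k \<le> n" for k
    using that
  proof (induction k)
    case 0
    then show ?case by (intro bexI[of _ "\<zero>"]) auto
  next
    case (Suc k)
    then obtain m where m: "m \<in> carrier M" "\<forall>u\<in>{1..n}. va u m = (if u \<le> k then z u else \<zero>)" by auto
    have z: "z (Suc k) \<in> vspace (Suc k)" "\<And>u. u \<in> {1..n} ==> z u \<in> carrier M" using assms Suc.prems vspaceD by auto
    show ?case
    proof (intro bexI[of _ "m \<oplus> z (Suc k)"] ballI)
      fix u assume u: "u \<in> {1..n}"
      then show "va u (m \<oplus> z (Suc k)) = (if u \<le> Suc k then z u else \<zero>)"
        using m z Suc.prems va_vspace[OF u _ z(1)] by (auto simp: va_linear)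
    qed (use m z Suc.prems in auto)
  qed
  from this[of n] show ?thesis using that by auto
qed

end

context type_A
begin

text \<open>Modules on which every two-cycle vanishes are the modules over the quotient by two-cycles.\<close>

definition killed :: "(('b, 'k::field) preproj_elt, 'm, 'z) module_scheme => bool" where
  "killed M \<longleftrightarrow> (\<forall>l x. 1 \<le> l \<longrightarrow> l < n \<longrightarrow> x \<in> carrier M \<longrightarrow>
    arrow_act M (up l) (arrow_act M (dn l) x) = \<zero>\<^bsub>M\<^esub> \<and> arrow_act M (dn l) (arrow_act M (up l) x) = \<zero>\<^bsub>M\<^esub>)"

end

locale killed_module = preproj_module n Q M
  for n Q and M :: "(('b, 'k::field) preproj_elt, 'm, 'z) module_scheme" (structure) +
  assumes killed: "killed M" and fd: "fd_module (preproj Q) M"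
begin

lemma up_dn: "1 \<le> l ==> l < n ==> x \<in> carrier M ==> aa (up l) (aa (dn l) x) = \<zero>"
  and dn_up: "1 \<le> l ==> l < n ==> x \<in> carrier M ==> aa (dn l) (aa (up l) x) = \<zero>"
  using killed by (auto simp: killed_def)

text \<open>
  Across the edge between \<open>l\<close> and \<open>l + 1\<close>, the vectors \<open>x\<close> behave like the basis of a string module, and
  the linear forms \<open>\<phi>\<close> like the dual basis.
\<close>

definition string_step :: "(nat => 'm) => (nat => 'm => 'k) => ('b + 'b) set => nat => bool" where
  "string_step x \<phi> S l \<longleftrightarrow> (up l \<in> S \<longleftrightarrow> dn l \<notin> S) \<and>
    aa (up l) (x l) = (if up l \<in> S then x (Suc l) else \<zero>) \<and>
    aa (dn l) (x (Suc l)) = (if dn l \<in> S then x l else \<zero>) \<and>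
    (\<forall>y\<in>vspace l. \<phi> (Suc l) (aa (up l) y) = (if up l \<in> S then \<phi> l y else 0)) \<and>
    (\<forall>y\<in>vspace (Suc l). \<phi> l (aa (dn l) y) = (if dn l \<in> S then \<phi> (Suc l) y else 0))"

text \<open>
  A string in \<open>M\<close> on the vertices from \<open>a\<close> to \<open>j\<close> with arrows \<open>S\<close>, together with linear forms that
  split it off to the left of \<open>j\<close>.
\<close>

definition string_at :: "(nat => 'm) => (nat => 'm => 'k) => nat => nat => ('b + 'b) set => bool" where
  "string_at x \<phi> a j S \<longleftrightarrow> 1 \<le> a \<and> a \<le> j \<and> S \<subseteq> up ` {a..<j} \<union> dn ` {a..<j} \<and>
    (\<forall>l\<in>{a..j}. x l \<in> vspace l \<and> linear_form (\<phi> l) \<and> \<phi> l (x l) = 1) \<and>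
    (\<forall>l\<in>{a..<j}. string_step x \<phi> S l) \<and>
    (1 < a \<longrightarrow> aa (dn (a - 1)) (x a) = \<zero> \<and> (\<forall>y\<in>vspace (a - 1). \<phi> a (aa (up (a - 1)) y) = 0))"

lemma string_at_extend:
  assumes s: "string_at x \<phi> a j S" and j: "Suc j \<le> n" and v: "v \<in> vspace (Suc j)" and \<psi>: "linear_form \<psi>" "\<psi> v = 1"
    and b: "b = up j \<or> b = dn j"
    and up: "aa (up j) (x j) = (if b = up j then v else \<zero>)"
    and dn: "aa (dn j) v = (if b = dn j then x j else \<zero>)"
    and up': "\<And>y. y \<in> vspace j ==> \<psi> (aa (up j) y) = (if b = up j then \<phi> j y else 0)"
    and dn': "\<And>y. y \<in> vspace (Suc j) ==> \<phi> j (aa (dn j) y) = (if b = dn j then \<psi> y else 0)"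
  shows "string_at (x(Suc j := v)) (\<phi>(Suc j := \<psi>)) a (Suc j) (insert b S)"
proof -
  have a: "1 \<le> a" "a \<le> j" and S: "S \<subseteq> up ` {a..<j} \<union> dn ` {a..<j}"
    using s unfolding string_at_def by auto
  have in_S: "\<exists>k. a \<le> k \<and> k < j \<and> (c = up k \<or> c = dn k)" if "c \<in> S" for c
    using S that by fastforce
  have inj: "up l = up k \<longleftrightarrow> l = k" "dn l = dn k \<longleftrightarrow> l = k" "up l \<noteq> dn k" "dn k \<noteq> up l"
    if "a \<le> l" "l \<le> j" "a \<le> k" "k \<le> j" for l k using up_dn_inj[of l k] that a j by auto
  have old: "up l \<in> insert b S \<longleftrightarrow> up l \<in> S" "dn l \<in> insert b S \<longleftrightarrow> dn l \<in> S" if "l \<in> {a..<j}" for l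
    using b inj[of l j] inj(3,4)[of j l] that a by auto
  have "up j \<notin> S" "dn j \<notin> S"
    using in_S[of "up j"] in_S[of "dn j"] inj[of j] inj(3,4)[of _ j] a by fastforce+
  then have new: "up j \<in> insert b S \<longleftrightarrow> b = up j" "dn j \<in> insert b S \<longleftrightarrow> b = dn j" "up j \<noteq> dn j"
    using inj(3)[of j j] a by auto
  have set: "{a..<Suc j} = insert j {a..<j}" "{a..Suc j} = insert (Suc j) {a..j}" using a by auto
  show ?thesis
    unfolding string_at_def
  proof (intro conjI)
    show "insert b S \<subseteq> up ` {a..<Suc j} \<union> dn ` {a..<Suc j}" using S b a by auto
    show "\<forall>l\<in>{a..Suc j}. (x(Suc j := v)) l \<in> vspace l \<and> linear_form ((\<phi>(Suc j := \<psi>)) l) \<and> (\<phi>(Suc j := \<psi>)) l ((x(Suc j := v)) l) = 1"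
      using s v \<psi> unfolding string_at_def set by auto
    show "1 < a \<longrightarrow> aa (dn (a - 1)) ((x(Suc j := v)) a) = \<zero> \<and>
        (\<forall>y\<in>vspace (a - 1). (\<phi>(Suc j := \<psi>)) a (aa (up (a - 1)) y) = 0)"
      using s a unfolding string_at_def by auto
    show "\<forall>l\<in>{a..<Suc j}. string_step (x(Suc j := v)) (\<phi>(Suc j := \<psi>)) (insert b S) l"
    proof (intro ballI)
      fix l assume "l \<in> {a..<Suc j}"
      then consider "l = j" | "l \<in> {a..<j}" by force
      then show "string_step (x(Suc j := v)) (\<phi>(Suc j := \<psi>)) (insert b S) l"
      proof cases
        case 1
        then show ?thesis unfolding string_step_def using new up dn up' dn' b by auto
      next
        case 2
        have main: "string_step x \<phi> S l" using s 2 unfolding string_at_def by blast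
        have ne: "l \<noteq> Suc j" "Suc l \<noteq> Suc j" using 2 by auto
        show ?thesis
          unfolding string_step_def old[OF 2] fun_upd_other[OF ne(1)] fun_upd_other[OF ne(2)]
          by (rule main[unfolded string_step_def])
      qed
    qed
  qed (use a in auto)
qed

text \<open>
  An interval between two subspaces of a vertex space is good if each vector in it, with a linear form
  that detects it, is the end of such a string.
\<close>

definition good :: "nat => 'm set => 'm set => bool" where
  "good j L H \<longleftrightarrow> subspace L \<and> subspace H \<and> L \<subseteq> H \<and> H \<subseteq> vspace j \<and>
    (\<forall>v\<in>H. \<forall>\<psi>. linear_form \<psi> \<longrightarrow> (\<forall>y\<in>L. \<psi> y = 0) \<longrightarrow> \<psi> v = 1 \<longrightarrow>
      (\<exists>x \<phi> a S. string_at x \<phi> a j S \<and> x j = v \<and> \<phi> j = \<psi>))"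

lemma good_start:
  assumes j: "1 \<le> j" "j \<le> n" and L: "subspace L" "subspace H" "L \<subseteq> H" "H \<subseteq> vspace j"
    and out: "1 < j ==> (\<forall>x\<in>H. aa (dn (j - 1)) x = \<zero>) \<and> (\<forall>y\<in>vspace (j - 1). aa (up (j - 1)) y \<in> L)"
  shows "good j L H"
  unfolding good_def
proof (intro conjI L ballI allI impI)
  fix v \<psi> assume v: "v \<in> H" "linear_form \<psi>" "\<forall>y\<in>L. \<psi> y = 0" "\<psi> v = 1"
  then have "string_at (\<lambda>_. v) (\<lambda>_. \<psi>) j j {}" using j L out unfolding string_at_def by auto
  then show "\<exists>x \<phi> a S. string_at x \<phi> a j S \<and> x j = v \<and> \<phi> j = \<psi>"
    by (intro exI[of _ "\<lambda>_. v"] exI[of _ "\<lambda>_. \<psi>"] exI) auto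
qed

context
  fixes j assumes j: "1 \<le> j" "Suc j \<le> n"
begin

lemma up_image_subspace:
  assumes L: "subspace L"
  shows "subspace (aa (up j) ` L)" "aa (up j) ` L \<subseteq> vspace (Suc j)"
proof -
  have u: "up j \<in> arcs D" using j by simp
  have Lc: "x \<in> carrier M" if "x \<in> L" for x by (rule subspaceD(1)[OF L that])
  show "aa (up j) ` L \<subseteq> vspace (Suc j)" using vspaceI(2)[OF u] Lc j by auto
  show "subspace (aa (up j) ` L)"
    unfolding subspace_def
  proof (intro conjI ballI allI)
    show "aa (up j) ` L \<subseteq> carrier M" using u Lc by auto
    show "\<zero> \<in> aa (up j) ` L" using u subspaceD(2)[OF L] by (intro image_eqI[of _ _ "\<zero>"]) auto
    fix x y assume "x \<in> aa (up j) ` L" "y \<in> aa (up j) ` L"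
    then obtain x' y' where "x' \<in> L" "y' \<in> L" "x = aa (up j) x'" "y = aa (up j) y'" by auto
    then show "x \<oplus> y \<in> aa (up j) ` L"
      using aa_linear(1)[OF u] Lc subspaceD(3)[OF L] by (intro image_eqI[of _ _ "x' \<oplus> y'"]) auto
  next
    fix c x assume "x \<in> aa (up j) ` L"
    then obtain x' where "x' \<in> L" "x = aa (up j) x'" by auto
    then show "sm c x \<in> aa (up j) ` L"
      using aa_linear(2)[OF u] Lc subspaceD(4)[OF L] by (intro image_eqI[of _ _ "sm c x'"]) auto
  qed
qed

definition dn_preimage :: "'m set => 'm set" where
  "dn_preimage L = {y \<in> vspace (Suc j). aa (dn j) y \<in> L}"

lemma dn_preimage_subspace:
  assumes L: "subspace L"
  shows "subspace (dn_preimage L)" "dn_preimage L \<subseteq> vspace (Suc j)"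
proof -
  have d: "dn j \<in> arcs D" using j by simp
  have V: "subspace (vspace (Suc j))" using j by (intro subspace_vspace) auto
  show "dn_preimage L \<subseteq> vspace (Suc j)" by (auto simp: dn_preimage_def)
  show "subspace (dn_preimage L)"
    unfolding dn_preimage_def subspace_def[of "{y \<in> vspace (Suc j). aa (dn j) y \<in> L}"]
    using d by (auto simp: subspaceD[OF V] subspaceD[OF L] aa_linear[OF d])
qed

text \<open>
  The string continues by \<open>up j\<close>, and the linear form at \<open>j\<close> is the pullback along this arrow.
\<close>

lemma good_up:
  assumes g: "good j L H"
  shows "good (Suc j) (aa (up j) ` L) (aa (up j) ` H)"
  unfolding good_def
proof (intro conjI ballI allI impI)
  have u: "up j \<in> arcs D" and d: "dn j \<in> arcs D" using j by auto
  have L: "subspace L" and H: "subspace H" and LH: "L \<subseteq> H" and HV: "H \<subseteq> vspace j" using g by (auto simp: good_def)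
  show "subspace (aa (up j) ` L)" "subspace (aa (up j) ` H)" "aa (up j) ` H \<subseteq> vspace (Suc j)"
    using up_image_subspace L H by auto
  show "aa (up j) ` L \<subseteq> aa (up j) ` H" using LH by auto
  fix v \<psi> assume v: "v \<in> aa (up j) ` H" and \<psi>: "linear_form \<psi>" and 0: "\<forall>y\<in>aa (up j) ` L. \<psi> y = 0" and 1: "\<psi> v = 1"
  obtain x' where x': "x' \<in> H" "v = aa (up j) x'" using v by auto
  let ?\<psi> = "\<lambda>y. if y \<in> carrier M then \<psi> (aa (up j) y) else 0"
  have x'c: "x' \<in> carrier M" using subspaceD(1)[OF H x'(1)] .
  have "linear_form ?\<psi>"
    using linear_formD[OF \<psi>] aa_linear[OF u] u by (auto simp: linear_form_def)
  moreover have "\<forall>y\<in>L. ?\<psi> y = 0" using 0 by auto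
  moreover have "?\<psi> x' = 1" using 1 x' x'c by simp
  ultimately obtain x \<phi> a S where s: "string_at x \<phi> a j S" "x j = x'" "\<phi> j = ?\<psi>"
    using g x'(1) unfolding good_def by blast
  have "string_at (x(Suc j := v)) (\<phi>(Suc j := \<psi>)) a (Suc j) (insert (up j) S)"
  proof (rule string_at_extend[OF s(1) j(2) _ \<psi> 1])
    have ne: "up j \<noteq> dn j" using up_dn_inj(3)[of j j] j by simp
    show "v \<in> vspace (Suc j)" using vspaceI(2)[OF u x'c] x'(2) j by simp
    show "aa (up j) (x j) = (if up j = up j then v else \<zero>)" using s x' by simp
    show "aa (dn j) v = (if up j = dn j then x j else \<zero>)" using dn_up[of j x'] x' x'c j ne by simp
    show "\<psi> (aa (up j) y) = (if up j = up j then \<phi> j y else 0)" if "y \<in> vspace j" for y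
      using s(3) vspaceD(1)[OF that] by simp
    show "\<phi> j (aa (dn j) y) = (if up j = dn j then \<psi> y else 0)" if "y \<in> vspace (Suc j)" for y
      using s(3) up_dn[of j y] j ne vspaceD(1)[OF that] linear_formD(3)[OF \<psi>] d by simp
  qed simp
  then show "\<exists>x \<phi> a S. string_at x \<phi> a (Suc j) S \<and> x (Suc j) = v \<and> \<phi> (Suc j) = \<psi>"
    by (intro exI[of _ "x(Suc j := v)"] exI[of _ "\<phi>(Suc j := \<psi>)"] exI) auto
qed

text \<open>
  Here the linear form has to be extended from the image of \<open>dn j\<close>; the extension exists because a
  vector is separated from the image of the kernel of the form.
\<close>

lemma good_dn:
  assumes g: "good j L H"
  shows "good (Suc j) (dn_preimage L) (dn_preimage H)"
  unfolding good_def
proof (intro conjI ballI allI impI)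
  have u: "up j \<in> arcs D" and d: "dn j \<in> arcs D" using j by auto
  have L: "subspace L" and H: "subspace H" and LH: "L \<subseteq> H" and HV: "H \<subseteq> vspace j" using g by (auto simp: good_def)
  show "subspace (dn_preimage L)" "subspace (dn_preimage H)" "dn_preimage H \<subseteq> vspace (Suc j)"
    using dn_preimage_subspace L H by auto
  show "dn_preimage L \<subseteq> dn_preimage H" using LH by (auto simp: dn_preimage_def)
  fix v \<psi> assume v: "v \<in> dn_preimage H" and \<psi>: "linear_form \<psi>" and 0: "\<forall>y\<in>dn_preimage L. \<psi> y = 0" and 1: "\<psi> v = 1"
  have V: "subspace (vspace (Suc j))" using j by (intro subspace_vspace) auto
  have vv: "v \<in> vspace (Suc j)" "aa (dn j) v \<in> H" using v by (auto simp: dn_preimage_def)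
  have vc: "v \<in> carrier M" by (rule vspaceD(1)[OF vv(1)])
  let ?K = "{y \<in> vspace (Suc j). \<psi> y = 0}"
  let ?L = "{aa (dn j) y \<oplus> z | y z. y \<in> ?K \<and> z \<in> L}"
  have K: "subspace ?K"
    using subspaceD[OF V] linear_formD[OF \<psi>] by (auto simp: subspace_def)
  have Kc: "y \<in> carrier M" if "y \<in> ?K" for y by (rule subspaceD(1)[OF K that])
  have Lc: "y \<in> carrier M" if "y \<in> L" for y by (rule subspaceD(1)[OF L that])
  have in_L: "aa (dn j) y \<oplus> z \<in> ?L" if "y \<in> ?K" "z \<in> L" for y z using that by blast
  have "subspace ?L"
    unfolding subspace_def[of ?L]
  proof (intro conjI ballI allI)
    show "?L \<subseteq> carrier M" using Kc Lc d by auto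
    have "\<zero> = aa (dn j) \<zero> \<oplus> \<zero>" using d by simp
    then show "\<zero> \<in> ?L" using in_L[OF subspaceD(2)[OF K] subspaceD(2)[OF L]] by simp
    fix x x' assume "x \<in> ?L" "x' \<in> ?L"
    then obtain y z y' z' where y: "x = aa (dn j) y \<oplus> z" "y \<in> ?K" "z \<in> L"
      and y': "x' = aa (dn j) y' \<oplus> z'" "y' \<in> ?K" "z' \<in> L" by blast
    have "x \<oplus> x' = aa (dn j) (y \<oplus> y') \<oplus> (z \<oplus> z')"
      using Kc[OF y(2)] Kc[OF y'(2)] Lc[OF y(3)] Lc[OF y'(3)] d by (simp add: y(1) y'(1) aa_linear M.a_ac)
    then show "x \<oplus> x' \<in> ?L" using in_L[OF subspaceD(3)[OF K y(2) y'(2)] subspaceD(3)[OF L y(3) y'(3)]] by simp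
  next
    fix c x assume "x \<in> ?L"
    then obtain y z where y: "x = aa (dn j) y \<oplus> z" "y \<in> ?K" "z \<in> L" by blast
    have "sm c x = aa (dn j) (sm c y) \<oplus> sm c z"
      using Kc[OF y(2)] Lc[OF y(3)] d by (simp add: y(1) aa_linear sm_r_distr)
    then show "sm c x \<in> ?L" using in_L[OF subspaceD(4)[OF K y(2)] subspaceD(4)[OF L y(3)]] by simp
  qed
  moreover have "aa (dn j) v \<notin> ?L"
  proof
    assume "aa (dn j) v \<in> ?L"
    then obtain y z where y: "aa (dn j) v = aa (dn j) y \<oplus> z" "y \<in> ?K" "z \<in> L" by blast
    let ?d = "sm (- 1) y \<oplus> v"
    have "aa (dn j) ?d = z"
      using Kc[OF y(2)] Lc[OF y(3)] vc d sm_cancel[of "aa (dn j) y" z 1] by (simp add: aa_linear y(1))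
    moreover have dV: "?d \<in> vspace (Suc j)" using y(2) vv(1) by (intro subspaceD(3)[OF V] subspaceD(4)[OF V]) auto
    ultimately have "\<psi> ?d = 0" using 0 y(3) by (auto simp: dn_preimage_def)
    moreover have "\<psi> ?d = 1"
      using linear_formD(1)[OF \<psi>, of "sm (- 1) y" v] linear_formD(2)[OF \<psi>, of y "- 1"] Kc[OF y(2)] vc y(2) 1 by simp
    ultimately show False by simp
  qed
  ultimately obtain \<chi> where \<chi>: "linear_form \<chi>" "\<And>x. x \<in> ?L ==> \<chi> x = 0" "\<chi> (aa (dn j) v) = 1"
    using separation[OF fd, of ?L "aa (dn j) v"] vc d by auto
  have "\<chi> y = 0" if "y \<in> L" for y
  proof -
    have "y = aa (dn j) \<zero> \<oplus> y" using Lc[OF that] d by simp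
    then show ?thesis using \<chi>(2) in_L[OF subspaceD(2)[OF K] that] by simp
  qed
  then obtain x \<phi> a S where s: "string_at x \<phi> a j S" "x j = aa (dn j) v" "\<phi> j = \<chi>"
    using g vv(2) \<chi>(1,3) unfolding good_def by blast
  have \<chi>\<psi>: "\<chi> (aa (dn j) y) = \<psi> y" if y: "y \<in> vspace (Suc j)" for y
  proof -
    have yc: "y \<in> carrier M" by (rule vspaceD(1)[OF y])
    let ?d = "sm (- \<psi> y) v \<oplus> y"
    have "\<psi> ?d = 0"
      using linear_formD(1)[OF \<psi>, of "sm (- \<psi> y) v" y] linear_formD(2)[OF \<psi>, of v "- \<psi> y"] vc yc 1 by simp
    moreover have "?d \<in> vspace (Suc j)" using y vv(1) by (intro subspaceD(3)[OF V] subspaceD(4)[OF V]) auto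
    ultimately have "aa (dn j) ?d \<oplus> \<zero> \<in> ?L" by (intro in_L subspaceD(2)[OF L]) auto
    then have "\<chi> (aa (dn j) ?d) = 0" using \<chi>(2) vc yc d by simp
    moreover have "aa (dn j) ?d = sm (- \<psi> y) (aa (dn j) v) \<oplus> aa (dn j) y" using vc yc d by (simp add: aa_linear)
    ultimately show ?thesis
      using linear_formD(1)[OF \<chi>(1), of "sm (- \<psi> y) (aa (dn j) v)" "aa (dn j) y"]
        linear_formD(2)[OF \<chi>(1), of "aa (dn j) v" "- \<psi> y"] \<chi>(3) vc yc d by simp
  qed
  have "string_at (x(Suc j := v)) (\<phi>(Suc j := \<psi>)) a (Suc j) (insert (dn j) S)"
  proof (rule string_at_extend[OF s(1) j(2) vv(1) \<psi> 1])
    have ne: "dn j \<noteq> up j" using up_dn_inj(4)[of j j] j by simp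
    show "aa (up j) (x j) = (if dn j = up j then v else \<zero>)" using s up_dn[of j v] vc j ne by simp
    show "aa (dn j) v = (if dn j = dn j then x j else \<zero>)" using s by simp
    show "\<psi> (aa (up j) y) = (if dn j = up j then \<phi> j y else 0)" if "y \<in> vspace j" for y
    proof -
      have yc: "y \<in> carrier M" by (rule vspaceD(1)[OF that])
      have "aa (up j) y \<in> dn_preimage L"
        using vspaceI(2)[OF u yc] dn_up[of j y] yc j subspaceD(2)[OF L] by (simp add: dn_preimage_def)
      then show ?thesis using 0 ne by simp
    qed
    show "\<phi> j (aa (dn j) y) = (if dn j = dn j then \<psi> y else 0)" if "y \<in> vspace (Suc j)" for y
      using \<chi>\<psi>[OF that] s(3) by simp
  qed simp
  then show "\<exists>x \<phi> a S. string_at x \<phi> a (Suc j) S \<and> x (Suc j) = v \<and> \<phi> (Suc j) = \<psi>"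
    by (intro exI[of _ "x(Suc j := v)"] exI[of _ "\<phi>(Suc j := \<psi>)"] exI) auto
qed

end

text \<open>
  The good intervals form a chain from zero to the whole vertex space; hence a function that tells the
  two ends apart changes along one of them.
\<close>

lemma good_interval_exists:
  fixes f :: "'m set => 'm set"
  assumes "1 \<le> j" "j \<le> n" "f {\<zero>} \<noteq> f (vspace j)"
  shows "\<exists>L H. good j L H \<and> f L \<noteq> f H"
  using assms
proof (induction j arbitrary: f rule: nat_induct_at_least)
  case base
  have "good 1 {\<zero>} (vspace 1)"
    by (rule good_start) (use base subspace_vspace vspaceI(3)[of 1] in \<open>auto simp: subspace_def\<close>)
  then show ?case using base by auto
next
  case (Suc j)
  have j: "1 \<le> j" "Suc j \<le> n" using Suc by auto
  have u: "up j \<in> arcs D" and d: "dn j \<in> arcs D" using j by auto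
  have V: "subspace (vspace j)" "subspace (vspace (Suc j))" using j by (auto intro!: subspace_vspace)
  have Z: "subspace {\<zero>}" by (auto simp: subspace_def)
  let ?I = "\<lambda>L. aa (up j) ` L" and ?P = "dn_preimage j"
  have ends: "?I {\<zero>} = {\<zero>}" "?P (vspace j) = vspace (Suc j)"
    using u d vspaceI(2)[OF d] vspaceD j by (auto simp: dn_preimage_def[OF j])
  show ?case
  proof (cases "f (?I {\<zero>}) = f (?I (vspace j))")
    case False
    then obtain L H where "good j L H" "f (?I L) \<noteq> f (?I H)" using Suc.IH[of "\<lambda>L. f (?I L)"] j by auto
    then show ?thesis using good_up[OF j] by blast
  next
    case True
    show ?thesis
    proof (cases "f (?P {\<zero>}) = f (?P (vspace j))")
      case False
      then obtain L H where "good j L H" "f (?P L) \<noteq> f (?P H)" using Suc.IH[of "\<lambda>L. f (?P L)"] j by auto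
      then show ?thesis using good_dn[OF j] by blast
    next
      case eq: True
      have "good (Suc j) (?I (vspace j)) (?P {\<zero>})"
      proof (rule good_start[OF _ j(2)])
        show "?I (vspace j) \<subseteq> ?P {\<zero>}"
          using vspaceI(2)[OF u] dn_up[of j] vspaceD(1) j by (auto simp: dn_preimage_def[OF j])
      qed (use up_image_subspace[OF j V(1)] dn_preimage_subspace[OF j Z] in \<open>auto simp: dn_preimage_def[OF j]\<close>)
      moreover have "f (?I (vspace j)) \<noteq> f (?P {\<zero>})" using Suc.prems True eq ends by auto
      ultimately show ?thesis by blast
    qed
  qed
qed

text \<open>
  A nonzero string ends in the last nonzero vertex space.  Its linear forms define a retraction onto it,
  so it is a direct summand.
\<close>

theorem indecomposable_string:
  assumes ind: "indecomposable (preproj Q) M"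
  shows "\<exists>W S. string_data W S \<and> mod_iso (preproj Q) M (Str W S)"
proof -
  have nz: "carrier M \<noteq> {\<zero>}" using ind by (simp add: indecomposable_def)
  let ?supp = "{u \<in> {1..n}. vspace u \<noteq> {\<zero>}}"
  have "?supp \<noteq> {}"
  proof
    assume e: "?supp = {}"
    have "x = \<zero>" if x: "x \<in> carrier M" for x
      by (rule vertices_ext_zero[OF x]) (use e vspaceI(1)[OF _ x] in auto)
    then show False using nz by auto
  qed
  then have m: "Max ?supp \<in> ?supp" by (intro Max_in) auto
  define m where "m = Max ?supp"
  have m1: "1 \<le> m" "m \<le> n" "vspace m \<noteq> {\<zero>}" using m by (auto simp: m_def)
  have top: "x = \<zero>" if "x \<in> vspace u" "m < u" "u \<le> n" for u x
  proof -
    have "u \<notin> ?supp"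
    proof
      assume "u \<in> ?supp"
      then have "u \<le> m" unfolding m_def by (intro Max_ge) auto
      then show False using that by simp
    qed
    then show ?thesis using that m1 by auto
  qed
  obtain L H where g: "good m L H" "L \<noteq> H"
    using good_interval_exists[of m "\<lambda>L. L"] m1 by auto
  then obtain v where v: "v \<in> H" "v \<notin> L" by (auto simp: good_def)
  have LH: "subspace L" "subspace H" using g by (auto simp: good_def)
  obtain \<psi> where "linear_form \<psi>" "\<And>x. x \<in> L ==> \<psi> x = 0" "\<psi> v = 1"
    using separation[OF fd LH(1) subspaceD(1)[OF LH(2) v(1)] v(2)] by blast
  then obtain x \<phi> a S where s: "string_at x \<phi> a m S"
    using g v(1) unfolding good_def by blast
  define W where "W = {a..m}"
  have a: "1 \<le> a" "a \<le> m" and S: "S \<subseteq> up ` {a..<m} \<union> dn ` {a..<m}"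
    and x: "\<And>l. l \<in> W ==> x l \<in> vspace l \<and> linear_form (\<phi> l) \<and> \<phi> l (x l) = 1"
    and ar: "\<And>l. l \<in> {a..<m} ==> (up l \<in> S \<longleftrightarrow> dn l \<notin> S) \<and>
      aa (up l) (x l) = (if up l \<in> S then x (Suc l) else \<zero>) \<and>
      aa (dn l) (x (Suc l)) = (if dn l \<in> S then x l else \<zero>) \<and>
      (\<forall>y\<in>vspace l. \<phi> (Suc l) (aa (up l) y) = (if up l \<in> S then \<phi> l y else 0)) \<and>
      (\<forall>y\<in>vspace (Suc l). \<phi> l (aa (dn l) y) = (if dn l \<in> S then \<phi> (Suc l) y else 0))"
    and lo: "1 < a ==> aa (dn (a - 1)) (x a) = \<zero> \<and> (\<forall>y\<in>vspace (a - 1). \<phi> a (aa (up (a - 1)) y) = 0)"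
    using s unfolding string_at_def string_step_def W_def by auto
  have mW: "m \<in> W" and aW: "a \<in> W" using a by (auto simp: W_def)
  have sd: "string_data W S"
    unfolding string_data_def W_def using a m1 S ar by (intro exI[of _ a] exI[of _ m]) auto
  have td: "thin_data W S" by (rule string_data_thin[OF sd])
  have inS: "k \<in> {a..<m}" if "1 \<le> k" "k < n" "up k \<in> S \<or> dn k \<in> S" for k
  proof -
    have "k \<in> W \<and> Suc k \<in> W" using td that(3) tail_head[OF that(1,2)] unfolding thin_data_def by fastforce
    then show ?thesis by (simp add: W_def)
  qed
  have Wn: "l \<in> {1..n}" if "l \<in> W" for l using a m1 that by (auto simp: W_def)
  have lf: "linear_form (\<phi> l)" and xc: "x l \<in> carrier M" if "l \<in> W" for l using x[OF that] vspaceD by auto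
  have va_c: "va l y \<in> carrier M" if "l \<in> W" "y \<in> carrier M" for l y by (rule va_closed[OF Wn[OF that(1)] that(2)])
  define F where "F y = (\<lambda>l. if l \<in> W then \<phi> l (va l y) else 0)" for y
  have F_add: "\<phi> l (va l (y \<oplus> z)) = \<phi> l (va l y) + \<phi> l (va l z)"
    if "l \<in> W" "y \<in> carrier M" "z \<in> carrier M" for l y z
    using linear_formD(1)[OF lf[OF that(1)] va_c[OF that(1,2)] va_c[OF that(1,3)]]
    by (simp only: va_linear(1)[OF Wn[OF that(1)] that(2,3)])
  have F_scal: "\<phi> l (va l (sm c y)) = c * \<phi> l (va l y)" if "l \<in> W" "y \<in> carrier M" for l c y
    using linear_formD(2)[OF lf[OF that(1)] va_c[OF that]] by (simp only: va_linear(2)[OF Wn[OF that(1)] that(2)])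
  let ?N = "Str W S :: ('b, 'k) coord_module"
  have N: "pmod ?N" by (rule Str_module[OF td])
  have car: "F y \<in> carrier ?N" for y by (auto simp: Str_simps F_def)
  have hom: "F \<in> mod_hom (preproj Q) M ?N"
  proof (rule mod_homI[OF pmod_M N car])
    fix y z assume "y \<in> carrier M" "z \<in> carrier M"
    then show "F (y \<oplus> z) = F y \<oplus>\<^bsub>?N\<^esub> F z" by (auto simp: Str_simps fun_eq_iff F_def F_add)
  next
    fix c y assume "y \<in> carrier M"
    then show "F (sm c y) = psm ?N c (F y)"
      unfolding Str_gens(1)[OF td car] by (auto simp: fun_eq_iff F_def F_scal)
  next
    fix u y assume u: "u \<in> {1..n}" and y: "y \<in> carrier M"
    show "F (va u y) = vertex_act ?N u (F y)"
      unfolding Str_gens(2)[OF td car u]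
    proof
      fix l show "F (va u y) l = (if l = u then F y l else 0)"
        using va_va[OF Wn u y, of l] linear_formD(3)[OF lf, of l] by (auto simp: F_def)
    qed
  next
    fix b y assume b: "b \<in> arcs D" and y: "y \<in> carrier M"
    have t: "tail D b \<in> {1..n}" using D.tail_in_verts[OF b] by simp
    have e: "aa b y = aa b (va (tail D b) y)" using aa_va[OF t b y] by simp
    have yt: "va (tail D b) y \<in> vspace (tail D b)" by (rule vspaceI(1)[OF t y])
    have key: "\<phi> (head D b) (aa b y) = (if b \<in> S then \<phi> (tail D b) (va (tail D b) y) else 0)" if h: "head D b \<in> W"
      using b
    proof (cases rule: arcs_DE)
      case (up k)
      show ?thesis
      proof (cases "k \<in> {a..<m}")
        case True
        then show ?thesis using ar[of k] yt e up by auto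
      next
        case False
        then have "Suc k = a" using h up by (auto simp: W_def)
        moreover have "1 < a" using \<open>Suc k = a\<close> up by auto
        moreover have "up k \<notin> S" using False inS[of k] up by blast
        ultimately show ?thesis using lo yt e up by auto
      qed
    next
      case (dn k)
      show ?thesis
      proof (cases "k \<in> {a..<m}")
        case True
        then show ?thesis using ar[of k] yt e dn by auto
      next
        case False
        then have "k = m" using h dn by (auto simp: W_def)
        then have "va (tail D b) y = \<zero>" using top[of _ "Suc k"] yt dn by auto
        moreover have "dn k \<notin> S" using False inS[of k] dn by blast
        ultimately show ?thesis using e b dn linear_formD(3)[OF lf[OF mW]] \<open>k = m\<close> by auto
      qed
    qed
    have S': "b \<in> S ==> tail D b \<in> W \<and> head D b \<in> W" using td by (auto simp: thin_data_def)
    show "F (aa b y) = arrow_act ?N b (F y)"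
      unfolding Str_gens(3)[OF td car b]
    proof
      fix l
      have "va l (aa b y) = (if l = head D b then aa b y else \<zero>)" if "l \<in> W"
        by (rule va_aa[OF Wn[OF that] b y])
      then show "F (aa b y) l = (if b \<in> S \<and> l = head D b then F y (tail D b) else 0)"
        using key S' linear_formD(3)[OF lf, of l] by (auto simp: F_def)
    qed
  qed
  define e where "e l = (if l \<in> W then x l else \<zero>)" for l
  have e_in: "l \<in> W ==> e l = x l" and e_out: "l \<notin> W ==> e l = \<zero>" for l by (auto simp: e_def)
  have ev: "e l \<in> vspace l" if "l \<in> {1..n}" for l using x[of l] vspaceI(3)[OF that] by (simp add: e_def)
  have ec: "e l \<in> carrier M" if "l \<in> {1..n}" for l by (rule vspaceD(1)[OF ev[OF that]])
  have xa: "\<exists>c. aa b (e (tail D b)) = sm c (e (head D b))" if b: "b \<in> arcs D" for b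
  proof -
    have tc: "e (tail D b) \<in> carrier M" and hc: "e (head D b) \<in> carrier M"
      using ec D.tail_in_verts[OF b] D.head_in_verts[OF b] by simp_all
    have z: ?thesis if "aa b (e (tail D b)) = \<zero>"
      using that hc by (intro exI[of _ 0]) simp
    have o: ?thesis if "aa b (e (tail D b)) = e (head D b)"
      using that hc by (intro exI[of _ 1]) simp
    have eb: "aa b (e (tail D b)) \<in> vspace (head D b)" by (rule vspaceI(2)[OF b tc])
    show ?thesis
    proof (cases "tail D b \<in> W")
      case False
      then show ?thesis using b by (intro z) (simp add: e_out)
    next
      case t: True
      from b show ?thesis
      proof (cases rule: arcs_DE)
        case (up k)
        show ?thesis
        proof (cases "k \<in> {a..<m}")
          case True
          then have "k \<in> W" "Suc k \<in> W" by (auto simp: W_def)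
          then show ?thesis using ar[OF True] up z o by (cases "up k \<in> S") (simp_all add: e_in)
        next
          case False
          then have "k = m" using t up by (auto simp: W_def)
          then show ?thesis using top[OF eb] up by (intro z) auto
        qed
      next
        case (dn k)
        show ?thesis
        proof (cases "k \<in> {a..<m}")
          case True
          then have "k \<in> W" "Suc k \<in> W" by (auto simp: W_def)
          then show ?thesis using ar[OF True] dn z o by (cases "dn k \<in> S") (simp_all add: e_in)
        next
          case False
          then have k: "Suc k = a" using t dn by (auto simp: W_def)
          moreover have "1 < a" using k dn by auto
          ultimately show ?thesis using lo dn e_in[OF aW] by (intro z) auto
        qed
      qed
    qed
  qed
  define X where "X = {y \<in> carrier M. \<forall>l\<in>{1..n}. \<exists>c. va l y = sm c (e l)}"
  have XI: "y \<in> X" if "y \<in> carrier M" "\<And>l. l \<in> {1..n} ==> \<exists>c. va l y = sm c (e l)" for y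
    using that unfolding X_def by blast
  have Xc: "y \<in> carrier M" and XD: "\<And>l. l \<in> {1..n} ==> \<exists>c. va l y = sm c (e l)" if "y \<in> X" for y
    using that unfolding X_def by blast+
  have X: "submodule X (preproj Q) M"
  proof (rule submoduleI[OF pmod_M])
    show "X \<subseteq> carrier M" using Xc by blast
    show "\<zero> \<in> X"
    proof (rule XI)
      fix l assume l: "l \<in> {1..n}"
      then show "\<exists>c. va l \<zero> = sm c (e l)" using ec[OF l] by (intro exI[of _ 0]) simp
    qed simp
    show "y \<oplus> z \<in> X" if y: "y \<in> X" and z: "z \<in> X" for y z
    proof (rule XI)
      fix l assume l: "l \<in> {1..n}"
      obtain c d where "va l y = sm c (e l)" "va l z = sm d (e l)" using XD[OF y l] XD[OF z l] by blast
      then have "va l (y \<oplus> z) = sm (c + d) (e l)"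
        by (simp only: va_linear(1)[OF l Xc[OF y] Xc[OF z]] sm_l_distr[OF ec[OF l]])
      then show "\<exists>c. va l (y \<oplus> z) = sm c (e l)" by blast
    qed (use Xc y z in simp)
    show "sm d y \<in> X" if y: "y \<in> X" for d y
    proof (rule XI)
      fix l assume l: "l \<in> {1..n}"
      obtain c where "va l y = sm c (e l)" using XD[OF y l] by blast
      then have "va l (sm d y) = sm (d * c) (e l)" by (simp only: va_linear(2)[OF l Xc[OF y]] sm_sm[OF ec[OF l]])
      then show "\<exists>c. va l (sm d y) = sm c (e l)" by blast
    qed (use Xc y in simp)
    show "va u y \<in> X" if u: "u \<in> {1..n}" and y: "y \<in> X" for u y
    proof (rule XI)
      fix l assume l: "l \<in> {1..n}"
      show "\<exists>c. va l (va u y) = sm c (e l)"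
      proof (cases "l = u")
        case True
        have "va l (va u y) = va l y" using va_va[OF l u Xc[OF y]] True by simp
        then show ?thesis using XD[OF y l] by simp
      next
        case False
        then have "va l (va u y) = sm 0 (e l)" using ec[OF l] va_va[OF l u Xc[OF y]] by simp
        then show ?thesis by blast
      qed
    qed (rule va_closed[OF u Xc[OF y]])
    show "aa b y \<in> X" if b: "b \<in> arcs D" and y: "y \<in> X" for b y
    proof (rule XI)
      have t: "tail D b \<in> {1..n}" and h: "head D b \<in> {1..n}" using D.tail_in_verts[OF b] D.head_in_verts[OF b] by auto
      obtain c where c: "va (tail D b) y = sm c (e (tail D b))" using XD[OF y t] by blast
      obtain d where d: "aa b (e (tail D b)) = sm d (e (head D b))" using xa[OF b] by blast
      have "aa b y = aa b (va (tail D b) y)" using aa_va[OF t b Xc[OF y]] by simp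
      also have "\<dots> = sm (c * d) (e (head D b))"
        unfolding c aa_linear(2)[OF b ec[OF t]] d by (rule sm_sm[OF ec[OF h]])
      finally have eq: "aa b y = sm (c * d) (e (head D b))" .
      fix l assume l: "l \<in> {1..n}"
      show "\<exists>c. va l (aa b y) = sm c (e l)"
      proof (cases "l = head D b")
        case True
        then show ?thesis using va_aa[OF l b Xc[OF y]] eq by auto
      next
        case False
        then have "va l (aa b y) = sm 0 (e l)" using va_aa[OF l b Xc[OF y]] ec[OF l] by simp
        then show ?thesis by blast
      qed
    qed (rule aa_closed[OF b Xc[OF y]])
  qed
  define K where "K = {y \<in> carrier M. F y = \<zero>\<^bsub>?N\<^esub>}"
  have K: "submodule K (preproj Q) M" unfolding K_def by (rule kernel_submodule[OF pmod_M N hom])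
  have F0: "F \<zero> = (\<lambda>_. 0)"
    using linear_formD(3)[OF lf] va_zero[OF Wn] by (auto simp: F_def fun_eq_iff)
  have glue: "\<exists>y\<in>X. F y = z" if z: "z \<in> carrier ?N" for z
  proof -
    have "sm (z l) (e l) \<in> vspace l" if "l \<in> {1..n}" for l
      by (rule subspaceD(4)[OF subspace_vspace[OF that] ev[OF that]])
    then obtain y where y: "y \<in> carrier M" "\<And>l. l \<in> {1..n} ==> va l y = sm (z l) (e l)"
      using vertices_glue[of "\<lambda>l. sm (z l) (e l)"] by blast
    have "F y = z"
    proof
      fix l show "F y l = z l"
      proof (cases "l \<in> W")
        case True
        then show ?thesis using y(2)[OF Wn[OF True]] linear_formD(2)[OF lf[OF True] xc[OF True]] x[OF True]
          by (simp add: F_def e_in)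
      qed (use z in \<open>auto simp: F_def Str_simps\<close>)
    qed
    moreover have "y \<in> X" using y by (intro XI) auto
    ultimately show ?thesis by blast
  qed
  have XK: "X \<inter> K = {\<zero>}"
  proof (rule Set.set_eqI, rule iffI)
    fix y assume y: "y \<in> X \<inter> K"
    have "va l y = \<zero>" if l: "l \<in> {1..n}" for l
    proof -
      obtain c where c: "va l y = sm c (e l)" using y XD[OF _ l] by blast
      show ?thesis
      proof (cases "l \<in> W")
        case True
        have "F y l = 0" using y by (simp add: K_def Str_simps)
        then have "\<phi> l (sm c (x l)) = 0" using True c by (simp add: F_def e_in)
        then have "c = 0" using x[OF True] linear_formD(2)[OF lf[OF True] xc[OF True]] by simp
        then show ?thesis using c True xc[OF True] by (simp add: e_in)
      qed (use c in \<open>simp add: e_out\<close>)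
    qed
    then show "y \<in> {\<zero>}" using y Xc vertices_ext_zero[of y] by blast
  qed (use submoduleD(2)[OF X] submoduleD(2)[OF K] in blast)
  have sub: "F (sm (- 1) z \<oplus> y) = (\<lambda>l. F y l - F z l)" if "y \<in> carrier M" "z \<in> carrier M" for y z
    using that by (auto simp: F_def fun_eq_iff F_add F_scal)
  have KI: "sm (- 1) z \<oplus> y \<in> K" if "y \<in> carrier M" "z \<in> carrier M" "F y = F z" for y z
    using that sub[OF that(1,2)] by (simp add: K_def Str_simps)
  have split: "y = z \<oplus> (sm (- 1) z \<oplus> y)" if "y \<in> carrier M" "z \<in> carrier M" for y z
    using sm_cancel[of z y "- 1"] that by simp
  have sum: "X <+>\<^bsub>M\<^esub> K = carrier M"
  proof (rule Set.set_eqI, rule iffI)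
    fix y assume "y \<in> X <+>\<^bsub>M\<^esub> K"
    then show "y \<in> carrier M" using Xc by (auto simp: set_add_defs K_def)
  next
    fix y assume y: "y \<in> carrier M"
    obtain z where z: "z \<in> X" "F z = F y" using glue[OF car] by blast
    define k where "k = sm (- 1) z \<oplus> y"
    have "k \<in> K" unfolding k_def by (rule KI[OF y Xc[OF z(1)] z(2)[symmetric]])
    moreover have yk: "y = z \<oplus> k" unfolding k_def by (rule split[OF y Xc[OF z(1)]])
    ultimately show "y \<in> X <+>\<^bsub>M\<^esub> K" using z(1) by (subst yk) (auto simp: set_add_defs)
  qed
  have "X = {\<zero>} \<or> K = {\<zero>}"
    using ind X K XK sum by (simp only: indecomposable_def)
  moreover have "X \<noteq> {\<zero>}"
  proof
    assume e: "X = {\<zero>}"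
    have "(\<lambda>v. if v = m then 1 else 0) \<in> carrier ?N" using mW by (auto simp: Str_simps)
    then obtain y where "y \<in> X" "F y = (\<lambda>v. if v = m then 1 else 0)" using glue by blast
    then have "(\<lambda>v. if v = m then 1 else 0 :: 'k) = (\<lambda>_. 0)" using F0 e by simp
    from fun_cong[OF this, of m] show False by simp
  qed
  ultimately have K0: "K = {\<zero>}" by blast
  have "inj_on F (carrier M)"
  proof (rule inj_onI)
    fix y z assume y: "y \<in> carrier M" and z: "z \<in> carrier M" and e: "F y = F z"
    have "sm (- 1) z \<oplus> y = \<zero>" using KI[OF y z e] K0 by simp
    then show "y = z" using split[OF y z] z by simp
  qed
  moreover have "F ` carrier M = carrier ?N" using glue car Xc by (auto simp: image_iff) metis
  ultimately have "mod_iso (preproj Q) M ?N" using hom unfolding mod_iso_def bij_betw_def by blast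
  then show ?thesis using sd by blast
qed

end

section \<open>Modules over the quotient by the two-cycles\<close>

lemma submodule_iff:
  "submodule U A M \<longleftrightarrow> subgroup U (add_monoid M) \<and> (\<forall>a\<in>carrier A. \<forall>x\<in>U. a \<odot>\<^bsub>M\<^esub> x \<in> U)"
  by (auto simp: submodule_def submodule_axioms_def)

context
  fixes A :: "('k::field, 'r, 'y) module_scheme" and I :: "'r set"
  assumes A: "kalg A" and I: "ideal I A"
begin

lemma submodule_inflate: "submodule U (quot_module A I) N \<longleftrightarrow> submodule U A (inflate A I N)"
  by (auto simp: submodule_iff quot_module_simps subgroup_def m_inv_def)

lemma indecomposable_inflate: "indecomposable (quot_module A I) N \<longleftrightarrow> indecomposable A (inflate A I N)"
  by (simp add: indecomposable_def submodule_inflate set_add_def set_mult_def)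

lemma mod_hom_inflate: "mod_hom (quot_module A I) N N' = mod_hom A (inflate A I N) (inflate A I N')"
  by (auto simp: mod_hom_def quot_module_simps)

lemma mod_iso_inflate: "mod_iso (quot_module A I) N N' \<longleftrightarrow> mod_iso A (inflate A I N) (inflate A I N')"
  by (simp add: mod_iso_def mod_hom_inflate)

lemma field_smult_inflate: "field_smult (quot_module A I) N c x = field_smult A (inflate A I N) c x"
proof -
  interpret kalg A by (rule A)
  show ?thesis by (simp add: field_smult_def quot_module_simps(3) quot_smult[OF I])
qed

lemma fd_module_inflate:
  "left_module (quot_module A I) N ==> fd_module (quot_module A I) N \<longleftrightarrow> fd_module A (inflate A I N)"
  using left_module_inflate[OF A I, of N]
  by (simp add: fd_module_def field_smult_inflate finsum_def finprod_def)

lemma inflate_deflate: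
  assumes M: "left_module A M" and kill: "\<And>a x. a \<in> I ==> x \<in> carrier M ==> a \<odot>\<^bsub>M\<^esub> x = \<zero>\<^bsub>M\<^esub>"
  shows "mod_iso A M (inflate A I (deflate M))"
  unfolding mod_iso_def
  by (rule bexI[of _ "\<lambda>x. x"]) (auto simp: mod_hom_def bij_betw_def deflate_smult[OF A I M kill])

lemma inflate_killed:
  assumes N: "left_module (quot_module A I) N" and a: "a \<in> I" "x \<in> carrier N"
  shows "a \<odot>\<^bsub>inflate A I N\<^esub> x = \<zero>\<^bsub>N\<^esub>"
proof -
  interpret kalg A by (rule A)
  interpret I: ideal I A by (rule I)
  interpret N: left_module "quot_module A I" N by (rule N)
  have "I +>\<^bsub>A\<^esub> a = \<zero>\<^bsub>quot_module A I\<^esub>" using a(1) I.a_rcos_eq_zero_iff I.Icarr by (simp add: quot_module_simps)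
  then show ?thesis using N.zero_act[OF a(2)] by simp
qed

end

lemma hom_finsum:
  assumes M: "left_module A M" and N: "left_module A N" and f: "f \<in> mod_hom A M N"
    and T: "finite T" "\<And>s. s \<in> T ==> g s \<in> carrier M"
  shows "f (\<Oplus>\<^bsub>M\<^esub>s\<in>T. g s) = (\<Oplus>\<^bsub>N\<^esub>s\<in>T. f (g s))"
  using T
proof (induction T rule: finite_induct)
  interpret M: left_module A M by (rule M)
  interpret N: left_module A N by (rule N)
  {
    case empty
    then show ?case using mod_hom_zero[OF f M.abelian_group_axioms N.abelian_group_axioms] by simp
  next
    case (insert t T)
    then have "g \<in> T \<rightarrow> carrier M" "(\<lambda>s. f (g s)) \<in> T \<rightarrow> carrier N" "g t \<in> carrier M" "f (g t) \<in> carrier N"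
      using mod_homD(1)[OF f] by auto
    then show ?case using insert mod_homD(2)[OF f, of "g t" "\<Oplus>\<^bsub>M\<^esub>s\<in>T. g s"] M.M.finsum_closed[of g T] by simp
  }
qed

lemma fd_module_iso:
  assumes A: "kalg A" and M: "fd_module A M" and N: "left_module A N" and iso: "mod_iso A M N"
  shows "fd_module A N"
proof -
  interpret kalg A by fact
  interpret M: kmod A M using M by (intro kmod.intro A) (simp add: fd_module_def)
  interpret N: kmod A N by (intro kmod.intro A N)
  obtain f where f: "f \<in> mod_hom A M N" "bij_betw f (carrier M) (carrier N)" using iso by (auto simp: mod_iso_def)
  obtain S where S: "finite S" "S \<subseteq> carrier M"
    and sp: "\<And>x. x \<in> carrier M ==> \<exists>c. x = (\<Oplus>\<^bsub>M\<^esub>s\<in>S. M.sm (c s) s)"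
    using M unfolding fd_module_def by blast
  have inj: "inj_on f S" using f(2) S(2) by (auto simp: bij_betw_def intro: inj_on_subset)
  have "\<exists>c. y = (\<Oplus>\<^bsub>N\<^esub>s\<in>f ` S. N.sm (c s) s)" if y: "y \<in> carrier N" for y
  proof -
    obtain x where x: "x \<in> carrier M" "f x = y" using f(2) y unfolding bij_betw_def by (metis imageE)
    obtain c where c: "x = (\<Oplus>\<^bsub>M\<^esub>s\<in>S. M.sm (c s) s)" using sp[OF x(1)] by auto
    have Sc: "s \<in> S ==> s \<in> carrier M" for s using S(2) by auto
    have "y = (\<Oplus>\<^bsub>N\<^esub>s\<in>S. f (M.sm (c s) s))"
      unfolding x(2)[symmetric] c by (rule hom_finsum[OF _ N f(1) S(1)]) (use Sc M in \<open>auto simp: fd_module_def\<close>)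
    also have "\<dots> = (\<Oplus>\<^bsub>N\<^esub>s\<in>S. N.sm (c (inv_into S f (f s))) (f s))"
      by (rule N.M.finsum_cong')
        (use Sc inj mod_homD(1)[OF f(1)] in \<open>auto simp: mod_hom_sm[OF A f(1)]\<close>)
    also have "\<dots> = (\<Oplus>\<^bsub>N\<^esub>s\<in>f ` S. N.sm (c (inv_into S f s)) s)"
      by (subst N.M.finsum_reindex) (use inj Sc mod_homD(1)[OF f(1)] in auto)
    finally show ?thesis by (rule exI[of _ "\<lambda>s. c (inv_into S f s)"])
  qed
  moreover have "finite (f ` S)" "f ` S \<subseteq> carrier N" using S mod_homD(1)[OF f(1)] by auto
  ultimately show ?thesis using N unfolding fd_module_def by blast
qed

context type_A
begin

lemma cyc_generators:
  fixes M :: "(('b, 'k::field) preproj_elt, 'm, 'z) module_scheme"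
  assumes M: "pmod M" and b: "b \<in> arcs D" "c \<in> arcs D" "head D b = tail D c" and x: "x \<in> carrier M"
  shows "preproj_path Q (tail D b, [b, c]) \<odot>\<^bsub>M\<^esub> x = arrow_act M c (arrow_act M b x)"
proof -
  interpret preproj_module n Q M by (intro preproj_module.intro type_A_axioms pmod_kmod M)
  have "basis_arrow D c \<otimes>\<^bsub>PA\<^esub> basis_arrow D b = (basis_path (tail D b, [b, c]) :: ('b, 'k) path_elt)"
    using b by (simp add: basis_arrow_def D.mult_basis)
  then have "preproj_path Q (tail D b, [b, c]) = cls (basis_arrow D c) \<otimes>\<^bsub>preproj Q\<^esub> (cls (basis_arrow D b) :: ('b, 'k) preproj_elt)"
    using b by (simp add: preproj_path_eq cls_hom(1))
  then show ?thesis using b x by (simp add: smult_assoc1 arrow_act_def)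
qed

lemma two_cycle_cases:
  assumes "pre_digraph.awalk D u p u" "length p = 2"
  obtains l where "1 \<le> l" "l < n" "u = l" "p = [up l, dn l]" | l where "1 \<le> l" "l < n" "u = Suc l" "p = [dn l, up l]"
proof -
  obtain b c where p: "p = [b, c]" using assms(2) by (auto simp: length_Suc_conv numeral_2_eq_2)
  then have bc: "b \<in> arcs D" "c \<in> arcs D" "u = tail D b" "head D b = tail D c" "head D c = u"
    using assms(1) by (auto simp: D.awalk_simps)
  from bc(1) show ?thesis
  proof (cases rule: arcs_DE)
    case (up l)
    then have "c = dn l" using bc by (intro arc_eqI) auto
    then show ?thesis using that(1)[of l] up bc p by simp
  next
    case (dn l)
    then have "c = up l" using bc by (intro arc_eqI) auto
    then show ?thesis using that(2)[of l] dn bc p by simp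
  qed
qed

lemma cyc_ideal_ideal: "ideal (cyc_ideal Q) (preproj Q :: ('k::field, ('b, 'k) preproj_elt) module)"
proof -
  interpret kalg "preproj Q :: ('k, ('b, 'k) preproj_elt) module" by (rule kalg_preproj)
  show ?thesis unfolding cyc_ideal_def
    by (rule genideal_ideal) (auto simp: preproj_path_eq paths_def intro!: cls_closed D.basis_in_PA)
qed

lemma killed_iff:
  fixes M :: "(('b, 'k::field) preproj_elt, 'm, 'z) module_scheme"
  assumes M: "pmod M"
  shows "killed M \<longleftrightarrow> (\<forall>a\<in>cyc_ideal Q. \<forall>x\<in>carrier M. a \<odot>\<^bsub>M\<^esub> x = \<zero>\<^bsub>M\<^esub>)"
proof
  interpret kalg "preproj Q :: ('k, ('b, 'k) preproj_elt) module" by (rule kalg_preproj)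
  let ?G = "{preproj_path Q (u, p) :: ('b, 'k) preproj_elt | u p. pre_digraph.awalk D u p u \<and> length p = 2}"
  have G: "?G \<subseteq> carrier (preproj Q)"
    by (auto simp: preproj_path_eq paths_def intro!: cls_closed D.basis_in_PA)
  {
    assume k: "killed M"
    have "cyc_ideal Q \<subseteq> {a \<in> carrier (preproj Q). \<forall>x\<in>carrier M. a \<odot>\<^bsub>M\<^esub> x = \<zero>\<^bsub>M\<^esub>}"
      unfolding cyc_ideal_def
    proof (rule genideal_minimal[OF annihilator_ideal[OF M]], rule subsetI)
      fix a :: "('b, 'k) preproj_elt" assume a: "a \<in> ?G"
      then obtain u p where p: "a = preproj_path Q (u, p)" "pre_digraph.awalk D u p u" "length p = 2" by auto
      have "a \<odot>\<^bsub>M\<^esub> x = \<zero>\<^bsub>M\<^esub>" if x: "x \<in> carrier M" for x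
        using p(2,3)
      proof (cases rule: two_cycle_cases)
        case (1 l)
        then show ?thesis using cyc_generators[OF M, of "up l" "dn l" x] k x p(1) by (simp add: killed_def)
      next
        case (2 l)
        then show ?thesis using cyc_generators[OF M, of "dn l" "up l" x] k x p(1) by (simp add: killed_def)
      qed
      then show "a \<in> {a \<in> carrier (preproj Q). \<forall>x\<in>carrier M. a \<odot>\<^bsub>M\<^esub> x = \<zero>\<^bsub>M\<^esub>}" using G a by blast
    qed
    then show "\<forall>a\<in>cyc_ideal Q. \<forall>x\<in>carrier M. a \<odot>\<^bsub>M\<^esub> x = \<zero>\<^bsub>M\<^esub>" by blast
  }
  assume z: "\<forall>a\<in>cyc_ideal Q. \<forall>x\<in>carrier M. a \<odot>\<^bsub>M\<^esub> x = \<zero>\<^bsub>M\<^esub>"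
  have GI: "?G \<subseteq> cyc_ideal Q" unfolding cyc_ideal_def by (rule genideal_self[OF G])
  show "killed M" unfolding killed_def
  proof (intro allI impI conjI)
    fix l x assume l: "1 \<le> l" "l < n" and x: "x \<in> carrier M"
    have w: "pre_digraph.awalk D l [up l, dn l] l" "pre_digraph.awalk D (Suc l) [dn l, up l] (Suc l)"
      using l by (auto simp: D.awalk_simps)
    have "preproj_path Q (l, [up l, dn l]) \<in> ?G"
      by (rule CollectI) (intro exI conjI, rule refl, rule w(1), simp)
    moreover have "preproj_path Q (Suc l, [dn l, up l]) \<in> ?G"
      by (rule CollectI) (intro exI conjI, rule refl, rule w(2), simp)
    ultimately have "preproj_path Q (l, [up l, dn l]) \<in> (cyc_ideal Q :: ('b, 'k) preproj_elt set)"
      "preproj_path Q (Suc l, [dn l, up l]) \<in> (cyc_ideal Q :: ('b, 'k) preproj_elt set)"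
      using GI by blast+
    then show "arrow_act M (up l) (arrow_act M (dn l) x) = \<zero>\<^bsub>M\<^esub>" "arrow_act M (dn l) (arrow_act M (up l) x) = \<zero>\<^bsub>M\<^esub>"
      using z x l cyc_generators[OF M, of "up l" "dn l" x] cyc_generators[OF M, of "dn l" "up l" x] by auto
  qed
qed

lemma Str_killed:
  assumes "thin_data W S"
  shows "killed (Str W S :: ('b, 'k::field) coord_module)"
proof -
  interpret preproj_module n Q "Str W S :: ('b, 'k) coord_module"
    by (intro preproj_module.intro type_A_axioms pmod_kmod Str_module assms)
  show ?thesis unfolding killed_def
  proof (intro allI impI conjI)
    fix l and x :: "nat => 'k" assume l: "1 \<le> l" "l < n" and x: "x \<in> carrier (Str W S)"
    have u: "up l \<in> arcs D" and d: "dn l \<in> arcs D" using l by auto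
    have "\<not> (up l \<in> S \<and> dn l \<in> S)" using assms l by (auto simp: thin_data_def)
    then show "aa (up l) (aa (dn l) x) = \<zero>\<^bsub>Str W S\<^esub>" "aa (dn l) (aa (up l) x) = \<zero>\<^bsub>Str W S\<^esub>"
      unfolding Str_gens(3)[OF assms aa_closed[OF d x] u] Str_gens(3)[OF assms aa_closed[OF u x] d] Str_simps(2)
      unfolding Str_gens(3)[OF assms x u] Str_gens(3)[OF assms x d] using l by auto
  qed
qed

lemma killed_iso:
  assumes M: "pmod M" and N: "pmod N" and iso: "mod_iso (preproj Q) M N" and k: "killed N"
  shows "killed M"
proof -
  obtain f where f: "f \<in> mod_hom (preproj Q) M N" "inj_on f (carrier M)"
    using iso by (auto simp: mod_iso_def bij_betw_def)
  interpret M: left_module "preproj Q" M by (rule M)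
  interpret N: left_module "preproj Q" N by (rule N)
  have "a \<odot>\<^bsub>M\<^esub> x = \<zero>\<^bsub>M\<^esub>" if a: "a \<in> cyc_ideal Q" and x: "x \<in> carrier M" for a x
  proof -
    have ac: "a \<in> carrier (preproj Q)" using a cyc_ideal_ideal ideal.Icarr by metis
    have "f (a \<odot>\<^bsub>M\<^esub> x) = \<zero>\<^bsub>N\<^esub>"
      using mod_homD(3)[OF f(1) ac x] k[unfolded killed_iff[OF N]] a mod_homD(1)[OF f(1) x] by simp
    also have "\<dots> = f \<zero>\<^bsub>M\<^esub>" by (rule mod_hom_zero[OF f(1) M.abelian_group_axioms N.abelian_group_axioms, symmetric])
    finally show ?thesis using inj_onD[OF f(2)] M.smult_closed[OF ac x] by simp
  qed
  then show ?thesis by (simp add: killed_iff[OF M])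
qed

subsection \<open>String modules are indecomposable\<close>

abbreviation unit_vec :: "nat => nat => 'k::field" where
  "unit_vec l \<equiv> (\<lambda>v. if v = l then 1 else 0)"

lemma Str_finsum:
  assumes "thin_data W S" "finite A" "\<And>a. a \<in> A ==> g a \<in> carrier (Str W S)"
  shows "(\<Oplus>\<^bsub>Str W S\<^esub>a\<in>A. g a) = (\<lambda>v. \<Sum>a\<in>A. g a v :: 'k::field)"
proof -
  interpret left_module "preproj Q" "Str W S :: ('b, 'k) coord_module"
    by (rule Str_module[OF assms(1)])
  show ?thesis using assms(2,3)
  proof (induction A rule: finite_induct)
    case (insert a A)
    then have "g \<in> A \<rightarrow> carrier (Str W S)" "g a \<in> carrier (Str W S)" by auto
    then show ?case using insert by (simp add: Str_simps(3))
  qed (simp add: Str_simps(2))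
qed

lemma Str_fd:
  assumes "thin_data W S"
  shows "fd_module (preproj Q) (Str W S :: ('b, 'k::field) coord_module)"
  unfolding fd_module_def
proof (intro conjI exI ballI)
  show "pmod (Str W S :: ('b, 'k) coord_module)" by (rule Str_module[OF assms])
  have fW: "finite W" using assms finite_subset unfolding thin_data_def by blast
  have u: "unit_vec l \<in> carrier (Str W S :: ('b, 'k) coord_module)" if "l \<in> W" for l
    using that by (auto simp: Str_simps)
  show "finite ((unit_vec :: nat => nat => 'k) ` W)" using fW by simp
  show "(unit_vec :: nat => nat => 'k) ` W \<subseteq> carrier (Str W S)" using u by auto
  fix x :: "nat => 'k" assume x: "x \<in> carrier (Str W S)"
  let ?c = "\<lambda>s :: nat => 'k. x (inv_into W unit_vec s)"
  have inj: "inj_on (unit_vec :: nat => nat => 'k) W"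
    by (rule inj_onI) (metis zero_neq_one)
  have sm: "psm (Str W S) (?c s) s = (\<lambda>v. ?c s * s v)" if "s \<in> unit_vec ` W" for s :: "nat => 'k"
    using Str_gens(1)[OF assms, of s] u that by auto
  have "(\<Oplus>\<^bsub>Str W S\<^esub>s\<in>unit_vec ` W. psm (Str W S) (?c s) s) = (\<lambda>v. \<Sum>s\<in>unit_vec ` W. psm (Str W S) (?c s) s v)"
  proof (rule Str_finsum[OF assms])
    fix s :: "nat => 'k" assume s: "s \<in> unit_vec ` W"
    then show "psm (Str W S) (?c s) s \<in> carrier (Str W S)" unfolding sm[OF s] by (auto simp: Str_simps split: if_splits)
  qed (use fW in simp)
  also have "\<dots> = (\<lambda>v. \<Sum>s\<in>unit_vec ` W. ?c s * s v)" using sm by (intro ext sum.cong) auto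
  also have "\<dots> = (\<lambda>v. \<Sum>l\<in>W. ?c (unit_vec l) * unit_vec l v)" by (simp only: sum.reindex[OF inj] o_def)
  also have "\<dots> = (\<lambda>v. \<Sum>l\<in>W. if l = v then x l else 0)"
  proof (intro ext sum.cong refl)
    fix v l assume "l \<in> W"
    then have "?c (unit_vec l) = x l" by (rule arg_cong[OF inv_into_f_f[OF inj]])
    then show "?c (unit_vec l) * unit_vec l v = (if l = v then x l else 0)" by auto
  qed
  also have "\<dots> = x" using x fW by (auto simp: sum.delta' sum.delta Str_simps fun_eq_iff)
  finally show "x = (\<Oplus>\<^bsub>Str W S\<^esub>s\<in>unit_vec ` W. psm (Str W S) (?c s) s)" ..
qed

lemma pmod_submodule_closed:
  assumes M: "pmod M" and U: "submodule U (preproj Q) M" and x: "x \<in> U"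
  shows "psm M c x \<in> U" "v \<in> {1..n} ==> vertex_act M v x \<in> U" "b \<in> arcs D ==> arrow_act M b x \<in> U"
proof -
  interpret kmod "preproj Q" M by (rule pmod_kmod[OF M])
  show "psm M c x \<in> U" "v \<in> {1..n} ==> vertex_act M v x \<in> U" "b \<in> arcs D ==> arrow_act M b x \<in> U"
    using submoduleD(5)[OF U _ x] by (auto simp: field_smult_def vertex_act_def arrow_act_def)
qed

lemma Str_submodule_unit:
  assumes d: "thin_data W S" and U: "submodule U (preproj Q) (Str W S)" and x: "x \<in> U" "x l \<noteq> (0 :: 'k::field)"
  shows "unit_vec l \<in> U"
proof -
  have M: "pmod (Str W S :: ('b, 'k) coord_module)" by (rule Str_module[OF d])
  have xc: "x \<in> carrier (Str W S)" by (rule submoduleD(3)[OF U x(1)])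
  then have l: "l \<in> {1..n}" using x(2) d by (auto simp: Str_simps thin_data_def)
  have v: "vertex_act (Str W S) l x \<in> U" by (rule pmod_submodule_closed(2)[OF M U x(1) l])
  have "psm (Str W S) (inverse (x l)) (vertex_act (Str W S) l x) \<in> U" by (rule pmod_submodule_closed(1)[OF M U v])
  moreover have "psm (Str W S) (inverse (x l)) (vertex_act (Str W S) l x) = unit_vec l"
    unfolding Str_gens(1)[OF d submoduleD(3)[OF U v]] unfolding Str_gens(2)[OF d xc l] using x(2) by (auto simp: fun_eq_iff)
  ultimately show ?thesis by simp
qed

text \<open>
  In a decomposition into two summands each basis vector lies in one of them, and two neighbouring basis
  vectors lie in the same one since an arrow maps one of them to the other.
\<close>

lemma Str_indecomposable:
  assumes sd: "string_data W S"
  shows "indecomposable (preproj Q) (Str W S :: ('b, 'k::field) coord_module)"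
proof -
  let ?M = "Str W S :: ('b, 'k) coord_module"
  have d: "thin_data W S" by (rule string_data_thin[OF sd])
  have M: "pmod ?M" by (rule Str_module[OF d])
  obtain a b where ab: "1 \<le> a" "a \<le> b" "b \<le> n" "W = {a..b}" "\<forall>l\<in>{a..<b}. up l \<in> S \<longleftrightarrow> dn l \<notin> S"
    using sd unfolding string_data_def by auto
  have u: "unit_vec l \<in> carrier ?M" if "l \<in> W" for l using that by (auto simp: Str_simps)
  have arr: "arrow_act ?M c (unit_vec (tail D c)) = unit_vec (head D c)" if "c \<in> S" for c
  proof -
    have c: "c \<in> arcs D" "tail D c \<in> W" using d that by (auto simp: thin_data_def)
    show ?thesis unfolding Str_gens(3)[OF d u[OF c(2)] c(1)] using that by (auto simp: fun_eq_iff)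
  qed
  have step: "unit_vec (head D c) \<in> U" if "c \<in> S" "submodule U (preproj Q) ?M" "unit_vec (tail D c) \<in> U" for c U
    using pmod_submodule_closed(3)[OF M that(2,3), of c] arr[OF that(1)] d that(1) by (auto simp: thin_data_def)
  show ?thesis unfolding indecomposable_def
  proof (intro conjI allI impI)
    have "unit_vec a \<in> carrier ?M" using u ab by auto
    moreover have "unit_vec a \<noteq> (\<lambda>_. 0 :: 'k)" by (metis zero_neq_one)
    ultimately show "carrier ?M \<noteq> {\<zero>\<^bsub>?M\<^esub>}" unfolding Str_simps(2) by blast
    fix U V assume "submodule U (preproj Q) ?M \<and> submodule V (preproj Q) ?M \<and> U \<inter> V = {\<zero>\<^bsub>?M\<^esub>} \<and> U <+>\<^bsub>?M\<^esub> V = carrier ?M"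
    then have U: "submodule U (preproj Q) ?M" and V: "submodule V (preproj Q) ?M"
      and i: "U \<inter> V = {\<zero>\<^bsub>?M\<^esub>}" and s: "U <+>\<^bsub>?M\<^esub> V = carrier ?M" by auto
    have not_both: "\<not> (unit_vec l \<in> U \<and> unit_vec l \<in> V)" for l
    proof
      assume "unit_vec l \<in> U \<and> unit_vec l \<in> V"
      then have "unit_vec l = (\<lambda>_. 0 :: 'k)" using i unfolding Str_simps(2) by blast
      then show False by (metis zero_neq_one)
    qed
    have either: "unit_vec l \<in> U \<or> unit_vec l \<in> V" if l: "l \<in> W" for l
    proof -
      have "unit_vec l \<in> U <+>\<^bsub>?M\<^esub> V" unfolding s by (rule u[OF l])
      then obtain x y where xy: "x \<in> U" "y \<in> V" "unit_vec l = (\<lambda>v. x v + y v)"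
        by (auto simp: set_add_defs Str_simps(3))
      have "x l + y l = 1" using fun_cong[OF xy(3), of l] by simp
      then have "x l \<noteq> 0 \<or> y l \<noteq> 0" by auto
      then show ?thesis using Str_submodule_unit[OF d U xy(1)] Str_submodule_unit[OF d V xy(2)] by blast
    qed
    have same: "unit_vec (Suc l) \<in> U \<longleftrightarrow> unit_vec l \<in> U" if l: "l \<in> {a..<b}" for l
    proof -
      have t: "1 \<le> l" "l < n" "l \<in> W" "Suc l \<in> W" using l ab by auto
      show ?thesis
      proof (cases "up l \<in> S")
        case True
        then show ?thesis using step[OF True U] step[OF True V] either[OF t(3)] either[OF t(4)] not_both t by auto
      next
        case False
        then have D: "dn l \<in> S" using ab(5) l by auto
        then show ?thesis using step[OF D U] step[OF D V] either[OF t(3)] either[OF t(4)] not_both t by auto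
      qed
    qed
    have all: "unit_vec l \<in> U \<longleftrightarrow> unit_vec a \<in> U" if "a \<le> l" "l \<le> b" for l
      using that
    proof (induction l rule: dec_induct)
      case (step l)
      then show ?case using same[of l] by auto
    qed simp
    have zero: "V' = {\<zero>\<^bsub>?M\<^esub>}" if V': "submodule V' (preproj Q) ?M" "\<And>l. l \<in> W ==> unit_vec l \<notin> V'" for V'
    proof -
      have "x = (\<lambda>_. 0)" if "x \<in> V'" for x
      proof
        fix l show "x l = 0"
          using Str_submodule_unit[OF d V'(1) that, of l] V'(2)[of l] submoduleD(3)[OF V'(1) that]
          by (auto simp: Str_simps)
      qed
      then show ?thesis using submoduleD(2)[OF V'(1)] unfolding Str_simps(2) by blast
    qed
    show "U = {\<zero>\<^bsub>?M\<^esub>} \<or> V = {\<zero>\<^bsub>?M\<^esub>}"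
    proof (cases "unit_vec a \<in> U")
      case True
      have "unit_vec l \<notin> V" if "l \<in> W" for l
      proof -
        have "a \<le> l" "l \<le> b" using that by (auto simp: ab(4))
        then have "unit_vec l \<in> U" using all True by blast
        then show ?thesis using not_both by blast
      qed
      then show ?thesis using zero[OF V] by blast
    next
      case False
      have "unit_vec l \<notin> U" if "l \<in> W" for l
      proof -
        have "a \<le> l" "l \<le> b" using that by (auto simp: ab(4))
        then show ?thesis using all False by blast
      qed
      then show ?thesis using zero[OF U] by blast
    qed
  qed
qed

section \<open>Strings as walks\<close>

lemma wf_double: "wf_digraph (double_quiver D)"
proof
  fix e assume "e \<in> arcs (double_quiver D)"
  then obtain b where b: "b \<in> arcs D" "e = Inl b \<or> e = Inr b" by (auto simp: double_quiver_def[of D])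
  then show "tail (double_quiver D) e \<in> verts (double_quiver D)" "head (double_quiver D) e \<in> verts (double_quiver D)"
    using D.tail_in_verts[OF b(1)] D.head_in_verts[OF b(1)] by (auto simp: double_quiver_def[of D])
qed

lemma double_D_simps:
  "verts (double_quiver D) = {1..n}" "Inl b \<in> arcs (double_quiver D) \<longleftrightarrow> b \<in> arcs D"
  "Inr b \<in> arcs (double_quiver D) \<longleftrightarrow> b \<in> arcs D"
  "tail (double_quiver D) (Inl b) = tail D b" "tail (double_quiver D) (Inr b) = head D b"
  "head (double_quiver D) (Inl b) = head D b" "head (double_quiver D) (Inr b) = tail D b"
  using verts_D by (auto simp: double_quiver_def[of D] simp del: verts_D)

lemma walk_Cons:
  "walk_verts D (u, e # p) = insert (tail (double_quiver D) e) (walk_verts D (head (double_quiver D) e, p))"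
  "walk_arrows (u, e # p) = insert (case_sum id id e) (walk_arrows (head (double_quiver D) e, p))"
  by (auto simp: walk_verts_def walk_arrows_def pre_digraph.awalk_verts.simps)

lemma arrow_between:
  assumes "b \<in> arcs D" "tail D b = l" "head D b = Suc l" shows "b = up l"
  using assms by (cases rule: arcs_DE) auto

lemma arrow_between':
  assumes "b \<in> arcs D" "tail D b = Suc l" "head D b = l" shows "b = dn l"
  using assms by (cases rule: arcs_DE) auto

lemma arrow_adjacent:
  assumes "b \<in> arcs D" shows "head D b = Suc (tail D b) \<or> tail D b = Suc (head D b)"
  using assms by (cases rule: arcs_DE) auto

lemma string_data_interval:
  assumes "1 \<le> a" "a \<le> b" "b \<le> n"
  shows "string_data {a..b} S \<longleftrightarrow>
    S \<subseteq> up ` {a..<b} \<union> dn ` {a..<b} \<and> (\<forall>l\<in>{a..<b}. up l \<in> S \<longleftrightarrow> dn l \<notin> S)"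
proof
  assume "string_data {a..b} S"
  then obtain a' b' where ab: "a' \<le> b'" "{a..b} = {a'..b'}" "S \<subseteq> up ` {a'..<b'} \<union> dn ` {a'..<b'}"
    "\<forall>l\<in>{a'..<b'}. up l \<in> S \<longleftrightarrow> dn l \<notin> S" unfolding string_data_def by blast
  then have "a' = a" "b' = b" using assms(2) Icc_eq_Icc[of a b a' b'] by auto
  then show "S \<subseteq> up ` {a..<b} \<union> dn ` {a..<b} \<and> (\<forall>l\<in>{a..<b}. up l \<in> S \<longleftrightarrow> dn l \<notin> S)" using ab by blast
next
  assume "S \<subseteq> up ` {a..<b} \<union> dn ` {a..<b} \<and> (\<forall>l\<in>{a..<b}. up l \<in> S \<longleftrightarrow> dn l \<notin> S)"
  then show "string_data {a..b} S" unfolding string_data_def using assms by blast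
qed

lemma string_data_add_arrow:
  assumes d: "string_data {a..b} S" and ab: "1 \<le> a" "a \<le> b" "b \<le> n"
  shows "b < n ==> string_data (insert (Suc b) {a..b}) (insert (up b) S)"
    "b < n ==> string_data (insert (Suc b) {a..b}) (insert (dn b) S)"
    "1 < a ==> string_data (insert (a - 1) {a..b}) (insert (up (a - 1)) S)"
    "1 < a ==> string_data (insert (a - 1) {a..b}) (insert (dn (a - 1)) S)"
proof -
  have S: "S \<subseteq> up ` {a..<b} \<union> dn ` {a..<b}" "\<And>l. l \<in> {a..<b} ==> up l \<in> S \<longleftrightarrow> dn l \<notin> S"
    using d string_data_interval[OF ab] by auto
  have out: "up l \<notin> S \<and> dn l \<notin> S" if "1 \<le> l" "l < n" "l \<notin> {a..<b}" for l
  proof -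
    have "up l \<noteq> up k \<and> up l \<noteq> dn k \<and> dn l \<noteq> up k \<and> dn l \<noteq> dn k" if "k \<in> {a..<b}" for k
      using up_dn_inj[of l k] up_dn_inj(3)[of k l] that ab \<open>1 \<le> l\<close> \<open>l < n\<close> \<open>l \<notin> {a..<b}\<close> by auto
    then show ?thesis using S(1) by blast
  qed
  have add: "string_data {a'..b'} (insert c S)"
    if ab': "1 \<le> a'" "a' \<le> b'" "b' \<le> n" and iv: "{a'..<b'} = insert l {a..<b}" and l: "1 \<le> l" "l < n" "l \<notin> {a..<b}"
      and c: "c = up l \<or> c = dn l" for a' b' c l
    unfolding string_data_interval[OF ab'] iv
  proof (intro conjI ballI)
    show "insert c S \<subseteq> up ` insert l {a..<b} \<union> dn ` insert l {a..<b}" using S(1) c by blast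
    fix k assume k: "k \<in> insert l {a..<b}"
    show "up k \<in> insert c S \<longleftrightarrow> dn k \<notin> insert c S"
    proof (cases "k = l")
      case True
      then show ?thesis using out[OF l] c up_dn_inj[OF l(1,2,1,2)] by blast
    next
      case False
      then have k': "k \<in> {a..<b}" "1 \<le> k" "k < n" using k ab by auto
      have "c \<noteq> up k" "c \<noteq> dn k" using c up_dn_inj[OF l(1,2) k'(2,3)] up_dn_inj(3)[OF k'(2,3) l(1,2)] False by auto
      then show ?thesis using S(2)[OF k'(1)] by simp
    qed
  qed
  {
    assume b: "b < n"
    have "{a..<Suc b} = insert b {a..<b}" "insert (Suc b) {a..b} = {a..Suc b}" using ab by auto
    then show "string_data (insert (Suc b) {a..b}) (insert (up b) S)" "string_data (insert (Suc b) {a..b}) (insert (dn b) S)"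
      using add[of a "Suc b" b] ab b by auto
  next
    assume a: "1 < a"
    have "{a - 1..<b} = insert (a - 1) {a..<b}" "insert (a - 1) {a..b} = {a - 1..b}" using ab a by auto
    then show "string_data (insert (a - 1) {a..b}) (insert (up (a - 1)) S)" "string_data (insert (a - 1) {a..b}) (insert (dn (a - 1)) S)"
      using add[of "a - 1" b "a - 1"] ab a by auto
  }
qed

lemma simple_string_data: "c \<in> {1..n} ==> string_data {c} {}"
  unfolding string_data_def by (intro exI[of _ c]) auto

text \<open>A string with the vertex at which a walk along it starts.\<close>

definition string_from :: "nat => nat set => ('b + 'b) set => bool" where
  "string_from u W S \<longleftrightarrow>
    (\<exists>a b. 1 \<le> a \<and> a \<le> b \<and> b \<le> n \<and> W = {a..b} \<and> (u = a \<or> u = b) \<and> string_data W S)"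

lemma string_from_extend:
  assumes s: "string_from u' W S" and c: "c \<in> arcs D" and ends: "{tail D c, head D c} = {u, u'}" "u \<noteq> u'" and u: "u \<notin> W"
  shows "string_from u (insert u W) (insert c S)"
proof -
  obtain a b where ab: "1 \<le> a" "a \<le> b" "b \<le> n" and W: "W = {a..b}" "u' = a \<or> u' = b" and d: "string_data {a..b} S"
    using s unfolding string_from_def by auto
  obtain l where l: "1 \<le> l" "l < n" "c = up l \<or> c = dn l" using c by (auto elim: arcs_DE)
  have "u = l \<and> u' = Suc l \<or> u = Suc l \<and> u' = l" using ends l by (auto simp: doubleton_eq_iff)
  then consider "u = l" "l = a - 1" "1 < a" | "u = Suc l" "l = b" using ab W u l by auto
  then show ?thesis
  proof cases
    case 1
    have "insert u W = {a - 1..b}" using 1 ab W by auto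
    moreover have "string_data (insert u W) (insert c S)"
      using string_data_add_arrow(3,4)[OF d ab 1(3)] l(3) 1(1,2) W(1) by auto
    ultimately show ?thesis unfolding string_from_def using 1 ab by (intro exI[of _ "a - 1"] exI[of _ b]) auto
  next
    case 2
    have "insert u W = {a..Suc b}" using 2 ab W by auto
    moreover have "string_data (insert u W) (insert c S)"
      using string_data_add_arrow(1,2)[OF d ab] l(2,3) 2 W(1) by auto
    ultimately show ?thesis unfolding string_from_def using 2 ab l(2) by (intro exI[of _ a] exI[of _ "Suc b"]) auto
  qed
qed

lemma walk_string_data:
  assumes "nonrevisiting_walk D w"
  shows "string_data (walk_verts D w) (walk_arrows w)"
proof -
  interpret DD: wf_digraph "double_quiver D" by (rule wf_double)
  obtain u p where w: "w = (u, p)" by (cases w)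
  then obtain v where v: "DD.apath u p v" using assms by (auto simp: nonrevisiting_walk_def)
  then have "string_from u (walk_verts D (u, p)) (walk_arrows (u, p))"
  proof (induction p arbitrary: u)
    case Nil
    then have u: "u \<in> {1..n}" by (auto simp: DD.apath_Nil_iff double_D_simps(1))
    have "walk_verts D (u, []) = {u}" "walk_arrows (u, []) = ({} :: ('b + 'b) set)"
      by (simp_all add: walk_verts_def walk_arrows_def DD.awalk_verts.simps)
    then show ?case unfolding string_from_def using simple_string_data[OF u] u by (intro exI[of _ u]) auto
  next
    case (Cons e p)
    let ?u' = "head (double_quiver D) e"
    have e: "e \<in> arcs (double_quiver D)" "tail (double_quiver D) e = u" "DD.apath ?u' p v"
      "u \<notin> walk_verts D (?u', p)"
      using Cons.prems by (auto simp: DD.apath_Cons_iff walk_verts_def)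
    let ?c = "case_sum id id e"
    have c: "?c \<in> arcs D" "{tail D ?c, head D ?c} = {u, ?u'}"
      using e(1,2) by (cases e; auto simp: double_D_simps)+
    have "?u' \<in> walk_verts D (?u', p)" using DD.hd_in_awalk_verts(2)[OF e(3)] by (simp add: walk_verts_def)
    then have "u \<noteq> ?u'" using e(4) by auto
    then show ?case unfolding walk_Cons e(2)
      by (rule string_from_extend[OF Cons.IH[OF e(3)] c _ e(4)])
  qed
  then show ?thesis unfolding w string_from_def by blast
qed

lemma string_data_walk:
  assumes "string_data W S"
  obtains w where "nonrevisiting_walk D w" "walk_verts D w = W" "walk_arrows w = S"
proof -
  interpret DD: wf_digraph "double_quiver D" by (rule wf_double)
  obtain a b where ab: "1 \<le> a" "a \<le> b" "b \<le> n" "W = {a..b}" "S \<subseteq> up ` {a..<b} \<union> dn ` {a..<b}"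
    "\<And>l. l \<in> {a..<b} ==> up l \<in> S \<longleftrightarrow> dn l \<notin> S" using assms unfolding string_data_def by auto
  let ?S = "\<lambda>a. {c \<in> S. \<exists>l\<in>{a..<b}. c = up l \<or> c = dn l}"
  have "\<exists>p. DD.apath a p b \<and> walk_verts D (a, p) = {a..b} \<and> walk_arrows (a, p) = ?S a"
    using ab(2,1,6)
  proof (induction a rule: inc_induct)
    case base
    then show ?case using ab(3)
      by (intro exI[of _ "[]"]) (auto simp: DD.apath_Nil_iff double_D_simps(1) walk_verts_def walk_arrows_def DD.awalk_verts.simps)
  next
    case (step a)
    then obtain p where p: "DD.apath (Suc a) p b" "walk_verts D (Suc a, p) = {Suc a..b}" "walk_arrows (Suc a, p) = ?S (Suc a)"
      by auto
    let ?e = "if up a \<in> S then Inl (up a) else Inr (dn a)"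
    have a: "1 \<le> a" "a < n" "a < b" using step ab(3) by auto
    have e: "?e \<in> arcs (double_quiver D)" "tail (double_quiver D) ?e = a" "head (double_quiver D) ?e = Suc a"
      using a by (auto simp: double_D_simps)
    have "DD.apath a (?e # p) b"
      using e p(1,2) by (auto simp: DD.apath_Cons_iff walk_verts_def)
    moreover have "walk_verts D (a, ?e # p) = {a..b}" unfolding walk_Cons e p(2) using a by auto
    moreover have "walk_arrows (a, ?e # p) = ?S a"
    proof -
      have "{a..<b} = insert a {Suc a..<b}" using a by auto
      moreover have "up a \<in> S \<longleftrightarrow> dn a \<notin> S" using step a by auto
      ultimately show ?thesis unfolding walk_Cons e p(3) by auto
    qed
    ultimately show ?case by blast
  qed
  then obtain p where p: "DD.apath a p b" "walk_verts D (a, p) = {a..b}" "walk_arrows (a, p) = ?S a" by blast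
  moreover have "?S a = S" using ab(5) by auto
  ultimately show ?thesis using that[of "(a, p)"] ab(4) by (auto simp: nonrevisiting_walk_def)
qed

abbreviation infl :: "(('b, 'k::field) preproj_bar_elt, 'm, 'z) module_scheme => (('b, 'k) preproj_elt, 'm) module" where
  "infl \<equiv> inflate (preproj Q) (cyc_ideal Q)"

lemma string_module_eq: "string_module Q w = deflate (Str (walk_verts D w) (walk_arrows w))"
  by (simp add: string_module_def Str_def D.string_module_thin)

lemma deflate_bar:
  assumes "pmod M" "killed M"
  shows "left_module (preproj_bar Q) (deflate M)" "mod_iso (preproj Q) M (infl (deflate M))"
proof -
  have k: "a \<in> cyc_ideal Q ==> x \<in> carrier M ==> a \<odot>\<^bsub>M\<^esub> x = \<zero>\<^bsub>M\<^esub>" for a x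
    using assms killed_iff by blast
  show "left_module (preproj_bar Q) (deflate M)"
    unfolding preproj_bar_def by (rule left_module_deflate[OF kalg_preproj cyc_ideal_ideal assms(1) k])
  show "mod_iso (preproj Q) M (infl (deflate M))"
    by (rule inflate_deflate[OF kalg_preproj cyc_ideal_ideal assms(1) k])
qed

lemma inflate_bar:
  assumes "left_module (preproj_bar Q) N"
  shows "pmod (infl N)" "killed (infl N)"
proof -
  note N = assms[unfolded preproj_bar_def]
  show p: "pmod (infl N)" by (rule left_module_inflate[OF kalg_preproj cyc_ideal_ideal N])
  show "killed (infl N)"
    unfolding killed_iff[OF p] using inflate_killed[OF kalg_preproj cyc_ideal_ideal N] by simp
qed

theorem bar_indecomposable_iff:
  fixes N :: "(('b, 'k::field) preproj_bar_elt, 'm, 'z) module_scheme"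
  assumes fd: "fd_module (preproj_bar Q) N"
  shows "indecomposable (preproj_bar Q) N \<longleftrightarrow> (\<exists>W S. string_data W S \<and> mod_iso (preproj Q) (infl N) (Str W S))"
proof -
  have N: "left_module (preproj_bar Q) N" using fd by (simp add: fd_module_def)
  note p = inflate_bar[OF N]
  have ind: "indecomposable (preproj_bar Q) N \<longleftrightarrow> indecomposable (preproj Q) (infl N)"
    unfolding preproj_bar_def by (rule indecomposable_inflate[OF kalg_preproj cyc_ideal_ideal])
  have fd': "fd_module (preproj Q) (infl N)"
    using fd fd_module_inflate[OF kalg_preproj cyc_ideal_ideal N[unfolded preproj_bar_def]] by (simp add: preproj_bar_def)
  show ?thesis unfolding ind
  proof
    assume i: "indecomposable (preproj Q) (infl N)"
    interpret killed_module n Q "infl N"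
      by (intro killed_module.intro preproj_module.intro killed_module_axioms.intro type_A_axioms pmod_kmod p fd')
    show "\<exists>W S. string_data W S \<and> mod_iso (preproj Q) (infl N) (Str W S)" by (rule indecomposable_string[OF i])
  next
    assume "\<exists>W S. string_data W S \<and> mod_iso (preproj Q) (infl N) (Str W S)"
    then obtain W S where WS: "string_data W S" "mod_iso (preproj Q) (infl N) (Str W S)" by auto
    show "indecomposable (preproj Q) (infl N)"
      by (rule indecomposable_iso[OF p(1) Str_module[OF string_data_thin[OF WS(1)]] WS(2) Str_indecomposable[OF WS(1)]])
  qed
qed

theorem bar_indecomposable_iff_string_module:
  fixes N :: "(('b, 'k::field) preproj_bar_elt, 'm) module"
  assumes fd: "fd_module (preproj_bar Q) N"
  shows "indecomposable (preproj_bar Q) N \<longleftrightarrow>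
    (\<exists>w. nonrevisiting_walk D w \<and> mod_iso (preproj_bar Q) N (string_module Q w))"
proof -
  have "mod_iso (preproj_bar Q) N (deflate (Str W S)) \<longleftrightarrow> mod_iso (preproj Q) (infl N) (Str W S)"
    if d: "string_data W S" for W S
  proof -
    note t = string_data_thin[OF d]
    note b = deflate_bar[OF Str_module[OF t] Str_killed[OF t]]
    have "mod_iso (preproj_bar Q) N (deflate (Str W S)) \<longleftrightarrow> mod_iso (preproj Q) (infl N) (infl (deflate (Str W S)))"
      unfolding preproj_bar_def by (rule mod_iso_inflate[OF kalg_preproj cyc_ideal_ideal])
    also have "\<dots> \<longleftrightarrow> mod_iso (preproj Q) (infl N) (Str W S)"
      using mod_iso_trans[OF _ b(2)] mod_iso_trans[OF _ mod_iso_sym[OF Str_module[OF t] b(2)]] by blast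
    finally show ?thesis .
  qed
  then show ?thesis
    unfolding bar_indecomposable_iff[OF fd] string_module_eq
    using walk_string_data string_data_walk by metis
qed

theorem layer_iff_bar_indecomposable:
  fixes M :: "(('b, 'k::field) preproj_elt, 'm) module"
  assumes fd: "fd_module (preproj Q) M"
  shows "layer_module n Q M \<longleftrightarrow> (\<exists>N :: (('b, 'k) preproj_bar_elt, 'm) module.
    fd_module (preproj_bar Q) N \<and> indecomposable (preproj_bar Q) N \<and> mod_iso (preproj Q) M (infl N))"
proof
  have M: "pmod M" using fd by (simp add: fd_module_def)
  assume "layer_module n Q M"
  then obtain W S where WS: "string_data W S" "mod_iso (preproj Q) M (Str W S)" using layer_module_iff[OF fd] by auto
  note t = string_data_thin[OF WS(1)]
  have k: "killed M" by (rule killed_iso[OF M Str_module[OF t] WS(2) Str_killed[OF t]])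
  note b = deflate_bar[OF M k]
  have fdi: "fd_module (preproj Q) (infl (deflate M))"
    by (rule fd_module_iso[OF kalg_preproj fd inflate_bar(1)[OF b(1)] b(2)])
  then have fd': "fd_module (preproj_bar Q) (deflate M)"
    using fd_module_inflate[OF kalg_preproj cyc_ideal_ideal b(1)[unfolded preproj_bar_def]] by (simp add: preproj_bar_def)
  have "mod_iso (preproj Q) (infl (deflate M)) (Str W S)"
    by (rule mod_iso_trans[OF mod_iso_sym[OF M b(2)] WS(2)])
  then have "indecomposable (preproj_bar Q) (deflate M)" using bar_indecomposable_iff[OF fd'] WS(1) by blast
  then show "\<exists>N :: (('b, 'k) preproj_bar_elt, 'm) module.
    fd_module (preproj_bar Q) N \<and> indecomposable (preproj_bar Q) N \<and> mod_iso (preproj Q) M (infl N)"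
    using fd' b(2) by blast
next
  assume "\<exists>N :: (('b, 'k) preproj_bar_elt, 'm) module.
    fd_module (preproj_bar Q) N \<and> indecomposable (preproj_bar Q) N \<and> mod_iso (preproj Q) M (infl N)"
  then obtain N :: "(('b, 'k) preproj_bar_elt, 'm) module" where N: "fd_module (preproj_bar Q) N"
    "indecomposable (preproj_bar Q) N" "mod_iso (preproj Q) M (infl N)" by blast
  then obtain W S where "string_data W S" "mod_iso (preproj Q) (infl N) (Str W S)"
    using bar_indecomposable_iff by blast
  then show "layer_module n Q M" using layer_module_iff[OF fd] mod_iso_trans[OF N(3)] by blast
qed

end

section \<open>Extensions\<close>

lemma one_dimensional_quotI:
  fixes V :: "('k::field, 'v, 'z) module_scheme" (structure)
  assumes V: "abelian_group V" and B: "subgroup B (add_monoid V)"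
    and cl: "\<And>c v. v \<in> carrier V ==> c \<odot> v \<in> carrier V"
    and ad: "\<And>c v w. v \<in> carrier V ==> w \<in> carrier V ==> c \<odot> (v \<oplus> w) = c \<odot> v \<oplus> c \<odot> w"
    and cB: "\<And>c v. v \<in> B ==> c \<odot> v \<in> B"
    and h: "h \<in> carrier V" "h \<notin> B" and gen: "\<And>g. g \<in> carrier V ==> \<exists>c. \<exists>b\<in>B. g = b \<oplus> c \<odot> h"
  shows "one_dimensional (quot_module V B)"
  unfolding one_dimensional_def
proof (rule bexI[of _ "B +> h"], intro conjI ballI)
  interpret abelian_subgroup B V by (intro abelian_subgroupI3 additive_subgroupI V B)
  show "B +> h \<in> carrier (quot_module V B)" using h by (auto simp: quot_module_simps)
  show "B +> h \<noteq> \<zero>\<^bsub>quot_module V B\<^esub>" using h a_rcos_eq_zero_iff by (simp add: quot_module_simps)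
  fix y assume "y \<in> carrier (quot_module V B)"
  then obtain g where g: "g \<in> carrier V" "y = B +> g" by (auto simp: quot_module_simps)
  obtain c b where b: "b \<in> B" "g = b \<oplus> c \<odot> h" using gen[OF g(1)] by auto
  have s: "c \<odot>\<^bsub>quot_module V B\<^esub> (B +> h) = B +> (c \<odot> h)"
    by (rule quot_module_smult[OF abelian_subgroup_axioms h(1)]) (use cl ad cB in auto)
  have "g \<in> B +> (c \<odot> h)" using b by (auto simp: a_r_coset_def')
  then have "y = c \<odot>\<^bsub>quot_module V B\<^esub> (B +> h)" unfolding s g(2) using a_rcos_memE(2) cl[OF h(1)] by blast
  then show "\<exists>c. y = c \<odot>\<^bsub>quot_module V B\<^esub> (B +> h)" ..
qed

subsection \<open>Homomorphism spaces\<close>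

context
  fixes A :: "('k::field, 'r, 'y) module_scheme"
    and M :: "('r, 'm, 'z) module_scheme" and N :: "('r, 'n, 'w) module_scheme"
  assumes A: "kalg A" and M: "left_module A M" and N: "left_module A N"
begin

lemma hom_cong: "f \<in> mod_hom A M N ==> (\<And>x. x \<in> carrier M ==> g x = f x) ==> g \<in> mod_hom A M N"
proof -
  interpret M: left_module A M by (rule M)
  show "f \<in> mod_hom A M N ==> (\<And>x. x \<in> carrier M ==> g x = f x) ==> g \<in> mod_hom A M N"
    by (simp add: mod_hom_def Pi_def M.smult_closed)
qed

lemma hom_add: "f \<in> mod_hom A M N ==> g \<in> mod_hom A M N ==> (\<lambda>x. f x \<oplus>\<^bsub>N\<^esub> g x) \<in> mod_hom A M N"
proof -
  interpret N: left_module A N by (rule N)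
  assume f: "f \<in> mod_hom A M N" and g: "g \<in> mod_hom A M N"
  show ?thesis using mod_homD(1)[OF f] mod_homD(1)[OF g]
    by (auto simp: mod_hom_def mod_homD(2,3)[OF f] mod_homD(2,3)[OF g] N.smult_r_distr N.M.a_ac)
qed

lemma hom_scal: "f \<in> mod_hom A M N ==> (\<lambda>x. field_smult A N c (f x)) \<in> mod_hom A M N"
proof -
  interpret N: kmod A N by (intro kmod.intro A N)
  assume f: "f \<in> mod_hom A M N"
  show ?thesis using mod_homD(1)[OF f]
    by (auto simp: mod_hom_def mod_homD(2,3)[OF f] N.sm_r_distr N.sm_comm)
qed

lemma hom_zero: "(\<lambda>x. \<zero>\<^bsub>N\<^esub>) \<in> mod_hom A M N"
proof -
  interpret N: left_module A N by (rule N)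
  show ?thesis by (auto simp: mod_hom_def)
qed

lemma restrict_hom: "f \<in> mod_hom A M N ==> restrict f (carrier M) \<in> carrier (hom_space A M N)"
  by (auto simp: hom_space_def intro: hom_cong)

lemma hom_space_simps:
  "f \<in> carrier (hom_space A M N) \<longleftrightarrow> f \<in> mod_hom A M N \<and> f \<in> extensional (carrier M)"
  "\<zero>\<^bsub>hom_space A M N\<^esub> = restrict (\<lambda>x. \<zero>\<^bsub>N\<^esub>) (carrier M)"
  "f \<oplus>\<^bsub>hom_space A M N\<^esub> g = restrict (\<lambda>x. f x \<oplus>\<^bsub>N\<^esub> g x) (carrier M)"
  "c \<odot>\<^bsub>hom_space A M N\<^esub> f = restrict (\<lambda>x. field_smult A N c (f x)) (carrier M)"
  by (simp_all add: hom_space_def)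

lemma hom_space_eqI:
  assumes "f \<in> carrier (hom_space A M N)" "g \<in> carrier (hom_space A M N)" "\<And>x. x \<in> carrier M ==> f x = g x"
  shows "f = g"
  using assms by (intro extensionalityI[of _ "carrier M"]) (auto simp: hom_space_simps)

lemma hom_space_closed:
  assumes "f \<in> carrier (hom_space A M N)" "g \<in> carrier (hom_space A M N)"
  shows "f \<oplus>\<^bsub>hom_space A M N\<^esub> g \<in> carrier (hom_space A M N)" "c \<odot>\<^bsub>hom_space A M N\<^esub> f \<in> carrier (hom_space A M N)"
proof -
  have h: "f \<in> mod_hom A M N" "g \<in> mod_hom A M N" using assms by (simp_all add: hom_space_simps(1))
  show "f \<oplus>\<^bsub>hom_space A M N\<^esub> g \<in> carrier (hom_space A M N)"
    unfolding hom_space_simps(3) by (intro restrict_hom hom_add h)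
  show "c \<odot>\<^bsub>hom_space A M N\<^esub> f \<in> carrier (hom_space A M N)"
    unfolding hom_space_simps(4) by (intro restrict_hom hom_scal h)
qed

lemma hom_space_abelian_group: "abelian_group (hom_space A M N)"
proof -
  interpret N: kmod A N by (intro kmod.intro A N)
  let ?H = "hom_space A M N"
  have val: "x \<in> carrier M ==> f \<in> carrier ?H ==> f x \<in> carrier N" for f x
    by (auto simp: hom_space_simps(1) dest: mod_homD(1))
  have zero: "\<zero>\<^bsub>?H\<^esub> \<in> carrier ?H" unfolding hom_space_simps(2) by (intro restrict_hom hom_zero)
  show ?thesis
  proof (rule abelian_groupI)
    fix f g h assume f: "f \<in> carrier ?H" and g: "g \<in> carrier ?H" and h: "h \<in> carrier ?H"
    show "f \<oplus>\<^bsub>?H\<^esub> g \<oplus>\<^bsub>?H\<^esub> h = f \<oplus>\<^bsub>?H\<^esub> (g \<oplus>\<^bsub>?H\<^esub> h)"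
      by (rule hom_space_eqI[OF hom_space_closed(1)[OF hom_space_closed(1)[OF f g] h]
            hom_space_closed(1)[OF f hom_space_closed(1)[OF g h]]])
        (use f g h val in \<open>simp add: hom_space_simps(3) N.M.a_assoc\<close>)
  next
    fix f g assume f: "f \<in> carrier ?H" and g: "g \<in> carrier ?H"
    show "f \<oplus>\<^bsub>?H\<^esub> g \<in> carrier ?H" by (rule hom_space_closed(1)[OF f g])
    show "f \<oplus>\<^bsub>?H\<^esub> g = g \<oplus>\<^bsub>?H\<^esub> f"
      by (rule hom_space_eqI)
        (use f g val hom_space_closed(1) in \<open>auto simp: hom_space_simps(3) N.M.a_comm\<close>)
  next
    fix f assume f: "f \<in> carrier ?H"
    show "\<zero>\<^bsub>?H\<^esub> \<oplus>\<^bsub>?H\<^esub> f = f"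
      by (rule hom_space_eqI[OF hom_space_closed(1)[OF zero f] f])
        (use f val in \<open>simp add: hom_space_simps(2,3)\<close>)
    show "\<exists>g\<in>carrier ?H. g \<oplus>\<^bsub>?H\<^esub> f = \<zero>\<^bsub>?H\<^esub>"
    proof (rule bexI[of _ "(- 1) \<odot>\<^bsub>?H\<^esub> f"])
      have c: "(- 1) \<odot>\<^bsub>?H\<^esub> f \<in> carrier ?H" by (rule hom_space_closed(2)[OF f f])
      show "(- 1) \<odot>\<^bsub>?H\<^esub> f \<oplus>\<^bsub>?H\<^esub> f = \<zero>\<^bsub>?H\<^esub>"
      proof (rule hom_space_eqI[OF hom_space_closed(1)[OF c f] zero])
        fix x assume x: "x \<in> carrier M"
        then show "((- 1) \<odot>\<^bsub>?H\<^esub> f \<oplus>\<^bsub>?H\<^esub> f) x = \<zero>\<^bsub>?H\<^esub> x"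
          using val[OF x f] N.sm_l_distr[of "f x" "- 1" 1] by (simp add: hom_space_simps(2-4))
      qed
      show "(- 1) \<odot>\<^bsub>?H\<^esub> f \<in> carrier ?H" by (rule c)
    qed
  qed (rule zero)
qed

end

lemma act_finsum:
  assumes M: "left_module A M" and r: "r \<in> carrier A" and T: "finite T" "\<And>s. s \<in> T ==> g s \<in> carrier M"
  shows "r \<odot>\<^bsub>M\<^esub> (\<Oplus>\<^bsub>M\<^esub>s\<in>T. g s) = (\<Oplus>\<^bsub>M\<^esub>s\<in>T. r \<odot>\<^bsub>M\<^esub> g s)"
  using T
proof (induction T rule: finite_induct)
  interpret M: left_module A M by (rule M)
  {
    case empty
    then show ?case using r by simp
  next
    case (insert t T)
    then have "g \<in> T \<rightarrow> carrier M" "(\<lambda>s. r \<odot>\<^bsub>M\<^esub> g s) \<in> T \<rightarrow> carrier M" "g t \<in> carrier M" "r \<odot>\<^bsub>M\<^esub> g t \<in> carrier M"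
      using r M.smult_closed by auto
    then show ?case using insert r M.smult_r_distr[OF r, of "g t" "\<Oplus>\<^bsub>M\<^esub>s\<in>T. g s"] M.M.finsum_closed[of g T] by simp
  }
qed

subsection \<open>Free modules\<close>

context kalg
begin

lemma free_module_simps:
  "g \<in> carrier (free_module A C) \<longleftrightarrow> (\<forall>s. g s \<in> carrier A) \<and> (\<forall>s. s \<notin> C \<longrightarrow> g s = \<zero>) \<and> finite {s. g s \<noteq> \<zero>}"
  "\<zero>\<^bsub>free_module A C\<^esub> = (\<lambda>_. \<zero>)"
  "f \<oplus>\<^bsub>free_module A C\<^esub> g = (\<lambda>s. f s \<oplus> g s)"
  "a \<odot>\<^bsub>free_module A C\<^esub> g = (\<lambda>s. a \<otimes> g s)"
  by (auto simp: free_module_def image_subset_iff)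

lemma free_module_left_module: "left_module A (free_module A C)"
proof -
  let ?F = "free_module A C"
  interpret F: abelian_group ?F
  proof (rule abelian_groupI)
    fix f g assume f: "f \<in> carrier ?F" and g: "g \<in> carrier ?F"
    have "{s. f s \<oplus> g s \<noteq> \<zero>} \<subseteq> {s. f s \<noteq> \<zero>} \<union> {s. g s \<noteq> \<zero>}" by auto
    then show "f \<oplus>\<^bsub>?F\<^esub> g \<in> carrier ?F"
      using f g by (auto simp: free_module_simps intro: finite_subset)
  next
    fix f assume f: "f \<in> carrier ?F"
    have "{s. \<ominus> f s \<noteq> \<zero>} \<subseteq> {s. f s \<noteq> \<zero>}" by auto
    then have "(\<lambda>s. \<ominus> f s) \<in> carrier ?F" using f by (auto simp: free_module_simps intro: finite_subset)
    moreover have "(\<lambda>s. \<ominus> f s) \<oplus>\<^bsub>?F\<^esub> f = \<zero>\<^bsub>?F\<^esub>" using f by (simp add: free_module_simps l_neg)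
    ultimately show "\<exists>g\<in>carrier ?F. g \<oplus>\<^bsub>?F\<^esub> f = \<zero>\<^bsub>?F\<^esub>" by blast
  qed (auto simp: free_module_simps a_ac)
  show ?thesis
  proof unfold_locales
    fix a g assume a: "a \<in> carrier A" and g: "g \<in> carrier ?F"
    have "{s. a \<otimes> g s \<noteq> \<zero>} \<subseteq> {s. g s \<noteq> \<zero>}" using a by auto
    then show "a \<odot>\<^bsub>?F\<^esub> g \<in> carrier ?F" using a g by (auto simp: free_module_simps intro: finite_subset)
  qed (auto simp: free_module_simps l_distr r_distr m_assoc)
qed

definition free_unit :: "'s => 's => 'r" where
  "free_unit y = (\<lambda>s. if s = y then \<one> else \<zero>)"

lemma free_unit_closed: "y \<in> C ==> free_unit y \<in> carrier (free_module A C)"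
proof -
  have "{s. free_unit y s \<noteq> \<zero>} \<subseteq> {y}" by (auto simp: free_unit_def)
  then show "y \<in> C ==> free_unit y \<in> carrier (free_module A C)"
    by (auto simp: free_module_simps free_unit_def intro: finite_subset)
qed

definition free_lift :: "('r, 'n, 'w) module_scheme => ('s => 'n) => ('s => 'r) => 'n" where
  "free_lift N t g = (\<Oplus>\<^bsub>N\<^esub>y\<in>{y. g y \<noteq> \<zero>}. g y \<odot>\<^bsub>N\<^esub> t y)"

lemma free_lift_superset:
  assumes N: "left_module A N" and t: "\<And>y. y \<in> C ==> t y \<in> carrier N" and g: "g \<in> carrier (free_module A C)"
    and S: "finite S" "{y. g y \<noteq> \<zero>} \<subseteq> S" "S \<subseteq> C"
  shows "free_lift N t g = (\<Oplus>\<^bsub>N\<^esub>y\<in>S. g y \<odot>\<^bsub>N\<^esub> t y)"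
proof -
  interpret N: left_module A N by (rule N)
  show ?thesis unfolding free_lift_def
    by (rule N.M.add.finprod_mono_neutral_cong_left)
      (use S t g in \<open>auto simp: free_module_simps intro!: N.smult_closed\<close>)
qed

lemma free_lift_hom:
  assumes N: "left_module A N" and t: "\<And>y. y \<in> C ==> t y \<in> carrier N"
  shows "free_lift N t \<in> mod_hom A (free_module A C) N" "y \<in> C ==> free_lift N t (free_unit y) = t y"
proof -
  interpret N: left_module A N by (rule N)
  interpret F: left_module A "free_module A C" by (rule free_module_left_module)
  let ?F = "free_module A C"
  have supp: "finite {y. g y \<noteq> \<zero>}" "{y. g y \<noteq> \<zero>} \<subseteq> C" "\<And>y. g y \<in> carrier A" if "g \<in> carrier ?F" for g
    using that by (auto simp: free_module_simps)
  have tm: "y \<in> C ==> g \<in> carrier ?F ==> g y \<odot>\<^bsub>N\<^esub> t y \<in> carrier N" for g y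
    using t supp(3) by (intro N.smult_closed) auto
  show "free_lift N t \<in> mod_hom A ?F N"
    unfolding mod_hom_def
  proof (intro CollectI conjI ballI funcsetI)
    fix g assume g: "g \<in> carrier ?F"
    show "free_lift N t g \<in> carrier N"
      unfolding free_lift_def using tm[OF _ g] supp(2)[OF g] by (intro N.M.finsum_closed) auto
    fix f assume f: "f \<in> carrier ?F"
    let ?S = "{y. g y \<noteq> \<zero>} \<union> {y. f y \<noteq> \<zero>}"
    have S: "finite ?S" "?S \<subseteq> C" using supp f g by blast+
    have sub: "{y. (g \<oplus>\<^bsub>?F\<^esub> f) y \<noteq> \<zero>} \<subseteq> ?S" by (auto simp: free_module_simps)
    have "free_lift N t (g \<oplus>\<^bsub>?F\<^esub> f) = (\<Oplus>\<^bsub>N\<^esub>y\<in>?S. (g \<oplus>\<^bsub>?F\<^esub> f) y \<odot>\<^bsub>N\<^esub> t y)"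
      by (rule free_lift_superset[OF N t F.M.a_closed[OF g f] S(1) sub S(2)])
    also have "\<dots> = (\<Oplus>\<^bsub>N\<^esub>y\<in>?S. g y \<odot>\<^bsub>N\<^esub> t y \<oplus>\<^bsub>N\<^esub> f y \<odot>\<^bsub>N\<^esub> t y)"
    proof (rule N.M.finsum_cong'[OF refl])
      show "(\<lambda>y. g y \<odot>\<^bsub>N\<^esub> t y \<oplus>\<^bsub>N\<^esub> f y \<odot>\<^bsub>N\<^esub> t y) \<in> ?S \<rightarrow> carrier N"
        using S(2) tm[OF _ g] tm[OF _ f] by auto
      fix y assume "y \<in> ?S"
      then have "t y \<in> carrier N" using S(2) t by auto
      then show "(g \<oplus>\<^bsub>?F\<^esub> f) y \<odot>\<^bsub>N\<^esub> t y = g y \<odot>\<^bsub>N\<^esub> t y \<oplus>\<^bsub>N\<^esub> f y \<odot>\<^bsub>N\<^esub> t y"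
        using supp(3)[OF g] supp(3)[OF f] by (simp add: free_module_simps(3) N.smult_l_distr)
    qed
    also have "\<dots> = (\<Oplus>\<^bsub>N\<^esub>y\<in>?S. g y \<odot>\<^bsub>N\<^esub> t y) \<oplus>\<^bsub>N\<^esub> (\<Oplus>\<^bsub>N\<^esub>y\<in>?S. f y \<odot>\<^bsub>N\<^esub> t y)"
      by (rule N.M.finsum_addf) (use S(2) tm[OF _ g] tm[OF _ f] in auto)
    also have "\<dots> = free_lift N t g \<oplus>\<^bsub>N\<^esub> free_lift N t f"
      using free_lift_superset[OF N t g S(1) _ S(2)] free_lift_superset[OF N t f S(1) _ S(2)] by simp
    finally show "free_lift N t (g \<oplus>\<^bsub>?F\<^esub> f) = free_lift N t g \<oplus>\<^bsub>N\<^esub> free_lift N t f" .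
  next
    fix a g assume a: "a \<in> carrier A" and g: "g \<in> carrier ?F"
    let ?S = "{y. g y \<noteq> \<zero>}"
    have "free_lift N t (a \<odot>\<^bsub>?F\<^esub> g) = (\<Oplus>\<^bsub>N\<^esub>y\<in>?S. (a \<odot>\<^bsub>?F\<^esub> g) y \<odot>\<^bsub>N\<^esub> t y)"
      by (rule free_lift_superset[OF N t F.smult_closed[OF a g] supp(1)[OF g] _ supp(2)[OF g]])
        (use a in \<open>auto simp: free_module_simps\<close>)
    also have "\<dots> = (\<Oplus>\<^bsub>N\<^esub>y\<in>?S. a \<odot>\<^bsub>N\<^esub> (g y \<odot>\<^bsub>N\<^esub> t y))"
    proof (rule N.M.finsum_cong'[OF refl])
      show "(\<lambda>y. a \<odot>\<^bsub>N\<^esub> (g y \<odot>\<^bsub>N\<^esub> t y)) \<in> ?S \<rightarrow> carrier N"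
        using supp(2)[OF g] tm[OF _ g] a N.smult_closed by blast
      fix y assume "y \<in> ?S"
      then have "t y \<in> carrier N" using supp(2)[OF g] t by auto
      then show "(a \<odot>\<^bsub>?F\<^esub> g) y \<odot>\<^bsub>N\<^esub> t y = a \<odot>\<^bsub>N\<^esub> (g y \<odot>\<^bsub>N\<^esub> t y)"
        using supp(3)[OF g] a by (simp add: free_module_simps(4) N.smult_assoc1)
    qed
    also have "\<dots> = a \<odot>\<^bsub>N\<^esub> free_lift N t g"
      unfolding free_lift_def
      by (rule act_finsum[OF N a supp(1)[OF g], symmetric]) (use supp(2)[OF g] tm[OF _ g] in auto)
    finally show "free_lift N t (a \<odot>\<^bsub>?F\<^esub> g) = a \<odot>\<^bsub>N\<^esub> free_lift N t g" .
  qed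
  assume y: "y \<in> C"
  have "free_lift N t (free_unit y) = (\<Oplus>\<^bsub>N\<^esub>z\<in>{y}. free_unit y z \<odot>\<^bsub>N\<^esub> t z)"
    by (rule free_lift_superset[OF N t free_unit_closed[OF y]]) (use y in \<open>auto simp: free_unit_def\<close>)
  then show "free_lift N t (free_unit y) = t y" using t[OF y] by (simp add: free_unit_def)
qed

lemma free_lift_comp:
  assumes N: "left_module A N" and N': "left_module A N'" and p: "p \<in> mod_hom A N N'"
    and t: "\<And>y. y \<in> C ==> t y \<in> carrier N" and g: "g \<in> carrier (free_module A C)"
  shows "p (free_lift N t g) = free_lift N' (\<lambda>y. p (t y)) g"
proof -
  interpret N: left_module A N by (rule N)
  interpret N': left_module A N' by (rule N')
  have c: "y \<in> {y. g y \<noteq> \<zero>} ==> t y \<in> carrier N" "g y \<in> carrier A" for y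
    using g t by (auto simp: free_module_simps)
  have "p (free_lift N t g) = (\<Oplus>\<^bsub>N'\<^esub>y\<in>{y. g y \<noteq> \<zero>}. p (g y \<odot>\<^bsub>N\<^esub> t y))"
    unfolding free_lift_def
    by (rule hom_finsum[OF N N' p]) (use g c N.smult_closed in \<open>auto simp: free_module_simps\<close>)
  also have "\<dots> = free_lift N' (\<lambda>y. p (t y)) g"
    unfolding free_lift_def
    by (rule N'.M.finsum_cong'[OF refl])
      (use c mod_homD(1,3)[OF p] N'.smult_closed in auto)
  finally show ?thesis .
qed

end

subsection \<open>Extensions between adjacent strings\<close>

context type_A
begin

lemma mod_hom_gens:
  assumes "f \<in> mod_hom (preproj Q) M N" "x \<in> carrier M"
  shows "f (psm M c x) = psm N c (f x)" "v \<in> {1..n} ==> f (vertex_act M v x) = vertex_act N v (f x)"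
    "b \<in> arcs D ==> f (arrow_act M b x) = arrow_act N b (f x)"
proof -
  show "f (psm M c x) = psm N c (f x)" by (rule mod_hom_sm[OF kalg_preproj assms])
  show "v \<in> {1..n} ==> f (vertex_act M v x) = vertex_act N v (f x)"
    unfolding vertex_act_def by (rule mod_homD(3)[OF assms(1) _ assms(2)]) simp
  show "b \<in> arcs D ==> f (arrow_act M b x) = arrow_act N b (f x)"
    unfolding arrow_act_def by (rule mod_homD(3)[OF assms(1) _ assms(2)]) simp
qed

text \<open>
  Two strings on disjoint sets of vertices such that a single arrow \<open>\<alpha>\<close> leads from the second, \<open>Y\<close>,
  to the first, \<open>X\<close>.  Adding this arrow gives the extension \<open>E\<close> of \<open>Y\<close> by \<open>X\<close>.
\<close>

context
  fixes WX WY :: "nat set" and SX SY :: "('b + 'b) set" and \<alpha> :: "'b + 'b"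
  assumes dX: "thin_data WX SX" and dY: "thin_data WY SY" and disj: "WX \<inter> WY = {}"
    and dE: "thin_data (WX \<union> WY) (insert \<alpha> (SX \<union> SY))"
    and \<alpha>: "\<alpha> \<in> arcs D" "tail D \<alpha> \<in> WY" "head D \<alpha> \<in> WX"
    and \<alpha>_unique: "\<And>b. b \<in> arcs D ==> tail D b \<in> WY ==> head D b \<in> WX ==> b = \<alpha>"
begin

abbreviation (input) "WE \<equiv> WX \<union> WY"
abbreviation (input) "SE \<equiv> insert \<alpha> (SX \<union> SY)"

lemma W_verts: "v \<in> WX ==> v \<in> {1..n}" "v \<in> WY ==> v \<in> {1..n}"
  using dX dY by (auto simp: thin_data_def)

lemma S_ends: "b \<in> SX ==> tail D b \<in> WX \<and> head D b \<in> WX" "b \<in> SY ==> tail D b \<in> WY \<and> head D b \<in> WY"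
  using dX dY by (auto simp: thin_data_def)

lemma \<alpha>_not: "\<alpha> \<notin> SX" "\<alpha> \<notin> SY"
  using S_ends \<alpha> disj by auto

lemma inclusion_hom: "(\<lambda>x. x) \<in> mod_hom (preproj Q) (Str WX SX :: (('b, 'k::field) preproj_elt, _) module) (Str WE SE)"
proof (rule mod_homI[OF Str_module[OF dX] Str_module[OF dE]])
  fix x :: "nat => 'k" assume x: "x \<in> carrier (Str WX SX)"
  show xE: "x \<in> carrier (Str WE SE)" using x by (auto simp: Str_simps)
  show "psm (Str WX SX) c x = psm (Str WE SE) c x" for c by (simp add: Str_gens(1)[OF dX x] Str_gens(1)[OF dE xE])
  show "vertex_act (Str WX SX) v x = vertex_act (Str WE SE) v x" if "v \<in> {1..n}" for v
    by (simp add: Str_gens(2)[OF dX x that] Str_gens(2)[OF dE xE that])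
  show "arrow_act (Str WX SX) b x = arrow_act (Str WE SE) b x" if b: "b \<in> arcs D" for b
  proof -
    have "x (tail D b) = 0" if "b \<in> SE" "b \<notin> SX"
      using that x S_ends \<alpha> disj by (auto simp: Str_simps)
    then show ?thesis by (auto simp: Str_gens(3)[OF dX x b] Str_gens(3)[OF dE xE b] fun_eq_iff)
  qed
qed (simp_all add: Str_simps)

definition Y_part :: "(nat => 'k::field) => nat => 'k" where
  "Y_part x = (\<lambda>v. if v \<in> WY then x v else 0)"

lemma Y_part_hom: "Y_part \<in> mod_hom (preproj Q) (Str WE SE :: (('b, 'k::field) preproj_elt, _) module) (Str WY SY)"
proof (rule mod_homI[OF Str_module[OF dE] Str_module[OF dY]])
  fix x :: "nat => 'k" assume x: "x \<in> carrier (Str WE SE)"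
  show y: "Y_part x \<in> carrier (Str WY SY)" by (auto simp: Str_simps Y_part_def)
  show "Y_part (psm (Str WE SE) c x) = psm (Str WY SY) c (Y_part x)" for c
    unfolding Str_gens(1)[OF dY y] Str_gens(1)[OF dE x] by (auto simp: Y_part_def fun_eq_iff)
  show "Y_part (vertex_act (Str WE SE) v x) = vertex_act (Str WY SY) v (Y_part x)" if "v \<in> {1..n}" for v
    unfolding Str_gens(2)[OF dY y that] Str_gens(2)[OF dE x that] by (auto simp: Y_part_def fun_eq_iff)
  show "Y_part (arrow_act (Str WE SE) b x) = arrow_act (Str WY SY) b (Y_part x)" if b: "b \<in> arcs D" for b
    unfolding Str_gens(3)[OF dY y b] Str_gens(3)[OF dE x b]
    using S_ends \<alpha> disj by (auto simp: Y_part_def fun_eq_iff)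
qed (auto simp: Str_simps Y_part_def fun_eq_iff)

lemma tail_unit: "unit_vec (tail D \<alpha>) \<in> carrier (Str WY SY :: (('b, 'k::field) preproj_elt, _) module)"
  using \<alpha> by (auto simp: Str_simps)

lemma tail_unit_killed: "arrow_act (Str WY SY) \<alpha> (unit_vec (tail D \<alpha>)) = (\<lambda>_. 0 :: 'k::field)"
  by (simp add: Str_gens(3)[OF dY tail_unit \<alpha>(1)] \<alpha>_not)

text \<open>
  A section would map the basis vector at the tail of \<open>\<alpha>\<close> to a vector that \<open>\<alpha>\<close> does not kill,
  whereas \<open>\<alpha>\<close> kills the basis vector itself in \<open>Y\<close>.
\<close>

lemma string_extension:
  "nonsplit_extension (preproj Q) (Str WX SX) (Str WE SE) (Str WY SY :: ('b, 'k::field) coord_module)"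
  unfolding nonsplit_extension_def
proof (intro bexI[OF _ inclusion_hom] bexI[OF _ Y_part_hom] conjI)
  let ?E = "Str WE SE :: ('b, 'k) coord_module"
  let ?Y = "Str WY SY :: ('b, 'k) coord_module"
  show "Y_part ` carrier ?E = carrier ?Y"
  proof (rule Set.set_eqI, rule iffI)
    fix y assume y: "y \<in> carrier ?Y"
    then have "Y_part y = y" "y \<in> carrier ?E" by (auto simp: Y_part_def Str_simps fun_eq_iff)
    then show "y \<in> Y_part ` carrier ?E" by (metis image_eqI)
  qed (use mod_homD(1)[OF Y_part_hom] in auto)
  show "(\<lambda>x. x) ` carrier (Str WX SX) = {e \<in> carrier ?E. Y_part e = \<zero>\<^bsub>?Y\<^esub>}"
    using disj by (auto simp: Str_simps Y_part_def fun_eq_iff subset_iff)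
  show "\<not> (\<exists>s\<in>mod_hom (preproj Q) ?Y ?E. \<forall>y\<in>carrier ?Y. Y_part (s y) = y)"
  proof
    assume "\<exists>s\<in>mod_hom (preproj Q) ?Y ?E. \<forall>y\<in>carrier ?Y. Y_part (s y) = y"
    then obtain s where s: "s \<in> mod_hom (preproj Q) ?Y ?E" "\<And>y. y \<in> carrier ?Y ==> Y_part (s y) = y" by auto
    interpret Y: left_module "preproj Q" ?Y by (rule Str_module[OF dY])
    interpret E: left_module "preproj Q" ?E by (rule Str_module[OF dE])
    let ?u = "unit_vec (tail D \<alpha>) :: nat => 'k"
    have su: "s ?u \<in> carrier ?E" by (rule mod_homD(1)[OF s(1) tail_unit])
    have s0: "s (\<lambda>_. 0) = (\<lambda>_. 0)"
      using mod_hom_zero[OF s(1) Y.abelian_group_axioms E.abelian_group_axioms] by (simp add: Str_simps)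
    have "arrow_act ?E \<alpha> (s ?u) = (\<lambda>_. 0)"
      using mod_hom_gens(3)[OF s(1) tail_unit \<alpha>(1)] s0 by (simp add: tail_unit_killed)
    then have "arrow_act ?E \<alpha> (s ?u) (head D \<alpha>) = 0" by (rule fun_cong)
    then have "s ?u (tail D \<alpha>) = 0" unfolding Str_gens(3)[OF dE su \<alpha>(1)] by simp
    moreover have "s ?u (tail D \<alpha>) = 1"
      using fun_cong[OF s(2)[OF tail_unit], of "tail D \<alpha>"] \<alpha>(2) by (simp add: Y_part_def)
    ultimately show False by simp
  qed
qed simp

text \<open>
  Conversely, in any extension of \<open>Y\<close> by \<open>X\<close> only the action of \<open>\<alpha>\<close> is not determined, and it is given
  by a scalar.  If the scalar is zero, the extension splits; otherwise it can be rescaled to one.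
\<close>

lemma extension_unique:
  fixes E :: "(('b, 'k::field) preproj_elt, 'm, 'z) module_scheme"
  assumes E: "pmod E" and ext: "nonsplit_extension (preproj Q) (Str WX SX) E (Str WY SY)"
  shows "mod_iso (preproj Q) E (Str WE SE)"
proof -
  interpret preproj_module n Q E by (intro preproj_module.intro type_A_axioms pmod_kmod E)
  let ?X = "Str WX SX :: ('b, 'k) coord_module"
  let ?Y = "Str WY SY :: ('b, 'k) coord_module"
  interpret X: left_module "preproj Q" ?X by (rule Str_module[OF dX])
  interpret Y: left_module "preproj Q" ?Y by (rule Str_module[OF dY])
  obtain f g where f: "f \<in> mod_hom (preproj Q) ?X E" "inj_on f (carrier ?X)"
    and g: "g \<in> mod_hom (preproj Q) E ?Y" "g ` carrier E = carrier ?Y"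
    and ker: "f ` carrier ?X = {e \<in> carrier E. g e = \<zero>\<^bsub>?Y\<^esub>}"
    and nonsplit: "\<not> (\<exists>s\<in>mod_hom (preproj Q) ?Y E. \<forall>y\<in>carrier ?Y. g (s y) = y)"
    using ext unfolding nonsplit_extension_def by blast
  have f0: "f (\<lambda>_. 0) = \<zero>\<^bsub>E\<^esub>"
    using mod_hom_zero[OF f(1) X.abelian_group_axioms M.abelian_group_axioms] by (simp add: Str_simps)
  have gc: "e \<in> carrier E ==> g e \<in> carrier ?Y" for e by (rule mod_homD(1)[OF g(1)])
  let ?fi = "inv_into (carrier ?X) f"
  have fif: "?fi (f x) = x" if "x \<in> carrier ?X" for x using f(2) that by (rule inv_into_f_f)
  have kerE: "\<exists>x\<in>carrier ?X. e = f x" if "e \<in> carrier E" "g e = (\<lambda>_. 0)" for e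
    using that ker by (auto simp: Str_simps)
  have gva: "g (va v e) = (\<lambda>u. if u = v then g e v else 0)" if "v \<in> {1..n}" "e \<in> carrier E" for v e
    using mod_hom_gens(2)[OF g(1) that(2,1)] Str_gens(2)[OF dY gc[OF that(2)] that(1)] by (auto simp: fun_eq_iff)
  have X_part: "\<exists>x\<in>carrier ?X. va v e = f x" if "v \<in> {1..n}" "e \<in> carrier E" "g e v = 0" for v e
  proof (rule kerE)
    show "va v e \<in> carrier E" using that by simp
    show "g (va v e) = (\<lambda>_. 0)" using that by (auto simp: gva fun_eq_iff)
  qed
  have Y_zero: "g e v = 0" if "e \<in> carrier E" "v \<notin> WY" for v e using gc[OF that(1)] that(2) by (auto simp: Str_simps)
  have XW: "v \<in> WX ==> v \<in> {1..n} \<and> v \<notin> WY" for v using W_verts disj by blast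
  define \<kappa> where "\<kappa> v e = ?fi (va v e) v" for v e
  have \<kappa>f: "\<kappa> v (f x) = x v" if "v \<in> {1..n}" "x \<in> carrier ?X" for v x
  proof -
    have "vertex_act ?X v x \<in> carrier ?X" using that(2) by (auto simp: Str_gens(2)[OF dX that(2,1)] Str_simps)
    then have "?fi (va v (f x)) = vertex_act ?X v x"
      using mod_hom_gens(2)[OF f(1) that(2,1)] fif by metis
    then show ?thesis by (simp add: \<kappa>_def Str_gens(2)[OF dX that(2,1)])
  qed
  have \<kappa>va: "\<kappa> v (va v e) = \<kappa> v e" if "v \<in> {1..n}" "e \<in> carrier E" for v e
    using that by (simp add: \<kappa>_def va_va)
  have rep: "\<exists>x\<in>carrier ?X. va v e = f x \<and> \<kappa> v e = x v" if "v \<in> {1..n}" "e \<in> carrier E" "g e v = 0" for v e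
    using X_part[OF that] \<kappa>va[OF that(1,2)] \<kappa>f[OF that(1)] by metis
  have \<kappa>add: "\<kappa> v (e \<oplus>\<^bsub>E\<^esub> e') = \<kappa> v e + \<kappa> v e'"
    if v: "v \<in> {1..n}" and e: "e \<in> carrier E" "g e v = 0" "e' \<in> carrier E" "g e' v = 0" for v e e'
  proof -
    obtain x where x: "x \<in> carrier ?X" "va v e = f x" "\<kappa> v e = x v" using rep[OF v e(1,2)] by auto
    obtain x' where x': "x' \<in> carrier ?X" "va v e' = f x'" "\<kappa> v e' = x' v" using rep[OF v e(3,4)] by auto
    have "va v (e \<oplus>\<^bsub>E\<^esub> e') = f (x \<oplus>\<^bsub>?X\<^esub> x')" using v e x x' by (simp add: va_linear mod_homD(2)[OF f(1)])
    then have "\<kappa> v (e \<oplus>\<^bsub>E\<^esub> e') = (x \<oplus>\<^bsub>?X\<^esub> x') v"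
      using \<kappa>va[OF v, of "e \<oplus>\<^bsub>E\<^esub> e'"] \<kappa>f[OF v X.M.a_closed[OF x(1) x'(1)]] e by simp
    then show ?thesis using x x' by (simp add: Str_simps)
  qed
  have \<kappa>scal: "\<kappa> v (sm c e) = c * \<kappa> v e"
    if v: "v \<in> {1..n}" and e: "e \<in> carrier E" "g e v = 0" for v e c
  proof -
    obtain x where x: "x \<in> carrier ?X" "va v e = f x" "\<kappa> v e = x v" using rep[OF v e(1,2)] by auto
    have sx: "psm ?X c x \<in> carrier ?X" using x(1) by (auto simp: Str_gens(1)[OF dX x(1)] Str_simps)
    have "va v (sm c e) = f (psm ?X c x)" using v e x by (simp add: va_linear mod_hom_gens(1)[OF f(1)])
    then have "\<kappa> v (sm c e) = psm ?X c x v" using \<kappa>va[OF v, of "sm c e"] \<kappa>f[OF v sx] e by simp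
    then show ?thesis using x by (simp add: Str_gens(1)[OF dX x(1)])
  qed
  let ?s = "tail D \<alpha>" and ?t = "head D \<alpha>"
  have st: "?s \<in> {1..n}" "?t \<in> {1..n}" "?t \<notin> WY" "?s \<notin> WX" using \<alpha> W_verts disj by auto
  have aa_X: "\<kappa> (head D b) (aa b e) = (if b \<in> SX then \<kappa> (tail D b) e else 0)"
    if b: "b \<in> arcs D" "head D b \<in> WX" and e: "e \<in> carrier E" "g e (tail D b) = 0" for b e
  proof -
    have t: "tail D b \<in> {1..n}" using D.tail_in_verts[OF b(1)] by simp
    have h: "head D b \<in> {1..n}" using D.head_in_verts[OF b(1)] by simp
    obtain x where x: "x \<in> carrier ?X" "va (tail D b) e = f x" "\<kappa> (tail D b) e = x (tail D b)" using rep[OF t e] by auto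
    have ax: "arrow_act ?X b x \<in> carrier ?X" using b by (auto simp: Str_gens(3)[OF dX x(1) b(1)] Str_simps)
    have "aa b e = f (arrow_act ?X b x)"
      using aa_va[OF t b(1) e(1)] x(2) mod_hom_gens(3)[OF f(1) x(1) b(1)] by simp
    then have "\<kappa> (head D b) (aa b e) = arrow_act ?X b x (head D b)" using \<kappa>f[OF h ax] by simp
    then show ?thesis by (simp add: Str_gens(3)[OF dX x(1) b(1)] x(3))
  qed
  have "unit_vec ?s \<in> g ` carrier E" unfolding g(2) by (rule tail_unit)
  then obtain m where m0: "m \<in> carrier E" "unit_vec ?s = g m" unfolding image_iff by blast
  note m = m0(1) m0(2)[symmetric]
  \<comment> \<open>The scalar by which \<open>\<alpha>\<close> maps the tail vertex of \<open>Y\<close> to the head vertex of \<open>X\<close>.\<close>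
  define c where "c = \<kappa> ?t (aa \<alpha> m)"
  have aa_\<alpha>: "\<kappa> ?t (aa \<alpha> e) = c * g e ?s" if e: "e \<in> carrier E" for e
  proof -
    let ?d = "e \<oplus>\<^bsub>E\<^esub> sm (- g e ?s) m"
    have gt: "g (aa \<alpha> e') ?t = 0" if "e' \<in> carrier E" for e' using Y_zero st(3) \<alpha>(1) that by simp
    have "g ?d ?s = 0"
      using e m mod_homD(2)[OF g(1) e, of "sm (- g e ?s) m"] mod_hom_gens(1)[OF g(1) m(1), of "- g e ?s"]
        Str_gens(1)[OF dY gc[OF m(1)], of "- g e ?s"] by (simp add: Str_simps)
    then have "\<kappa> ?t (aa \<alpha> ?d) = 0" using aa_X[OF \<alpha>(1,3), of ?d] \<alpha>_not e m by simp
    moreover have "aa \<alpha> ?d = aa \<alpha> e \<oplus>\<^bsub>E\<^esub> sm (- g e ?s) (aa \<alpha> m)" using e m \<alpha>(1) by (simp add: aa_linear)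
    moreover have "g (sm (- g e ?s) (aa \<alpha> m)) ?t = 0" using Y_zero st(3) \<alpha>(1) m by simp
    ultimately have "\<kappa> ?t (aa \<alpha> e) + (- g e ?s) * \<kappa> ?t (aa \<alpha> m) = 0"
      using \<kappa>add[OF st(2), of "aa \<alpha> e" "sm (- g e ?s) (aa \<alpha> m)"] \<kappa>scal[OF st(2), of "aa \<alpha> m" "- g e ?s"] gt e m \<alpha>(1) by simp
    then show ?thesis by (simp add: c_def mult.commute)
  qed
  \<comment> \<open>Scaling the \<open>X\<close>-part by \<open>\<gamma> = 1 / c\<close> lets \<open>\<alpha>\<close> act by \<open>1\<close>.  For \<open>c = 0\<close> it does not act, and \<open>E\<close> splits.\<close>
  have main: "\<exists>\<Psi>\<in>mod_hom (preproj Q) E (Str WE S). bij_betw \<Psi> (carrier E) (carrier (Str WE S)) \<and>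
      (\<forall>e\<in>carrier E. \<forall>v\<in>WY. \<Psi> e v = g e v)"
    if dS: "thin_data WE S" and \<gamma>: "\<gamma> \<noteq> 0" and S: "\<And>b. b \<noteq> \<alpha> ==> b \<in> S \<longleftrightarrow> b \<in> SX \<union> SY"
      and S\<alpha>: "\<gamma> * c = (if \<alpha> \<in> S then 1 else 0)" for S \<gamma>
  proof -
    let ?N = "Str WE S :: ('b, 'k) coord_module"
    define \<Psi> where "\<Psi> e = (\<lambda>v. if v \<in> WX then \<gamma> * \<kappa> v e else if v \<in> WY then g e v else 0)" for e
    have car: "\<Psi> e \<in> carrier ?N" for e by (auto simp: \<Psi>_def Str_simps)
    have gX: "g e v = 0" if "e \<in> carrier E" "v \<in> WX" for e v using Y_zero that XW by blast
    have hom: "\<Psi> \<in> mod_hom (preproj Q) E ?N"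
    proof (rule mod_homI[OF E Str_module[OF dS] car])
      fix e e' assume e: "e \<in> carrier E" "e' \<in> carrier E"
      show "\<Psi> (e \<oplus>\<^bsub>E\<^esub> e') = \<Psi> e \<oplus>\<^bsub>?N\<^esub> \<Psi> e'"
        using e gX XW \<kappa>add[of _ e e'] mod_homD(2)[OF g(1) e]
        by (auto simp: \<Psi>_def Str_simps fun_eq_iff distrib_left)
    next
      fix d e assume e: "e \<in> carrier E"
      show "\<Psi> (sm d e) = psm ?N d (\<Psi> e)"
        unfolding Str_gens(1)[OF dS car]
        using e gX XW \<kappa>scal[of _ e d] mod_hom_gens(1)[OF g(1) e, of d] Str_gens(1)[OF dY gc[OF e], of d]
        by (auto simp: \<Psi>_def fun_eq_iff mult.left_commute)
    next
      fix v e assume v: "v \<in> {1..n}" and e: "e \<in> carrier E"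
      have "\<kappa> u (va v e) = (if u = v then \<kappa> v e else 0)" if u: "u \<in> WX" for u
      proof (cases "u = v")
        case False
        then have "va u (va v e) = f (\<lambda>_. 0)" using va_va[OF _ v e, of u] u XW f0 by auto
        moreover have "(\<lambda>_. 0) \<in> carrier ?X" by (simp add: Str_simps)
        ultimately show ?thesis using False fif by (simp add: \<kappa>_def)
      qed (use \<kappa>va v e in simp)
      then show "\<Psi> (va v e) = vertex_act ?N v (\<Psi> e)"
        unfolding Str_gens(2)[OF dS car v] using gva[OF v e] by (auto simp: \<Psi>_def fun_eq_iff)
    next
      fix b e assume b: "b \<in> arcs D" and e: "e \<in> carrier E"
      have k0: "\<kappa> u (aa b e) = 0" if u: "u \<in> WX" "u \<noteq> head D b" for u
      proof -
        have "va u (aa b e) = f (\<lambda>_. 0)" using va_aa[OF _ b e, of u] u XW f0 by auto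
        moreover have "(\<lambda>_. 0) \<in> carrier ?X" by (simp add: Str_simps)
        ultimately show ?thesis using fif by (simp add: \<kappa>_def)
      qed
      have ga: "g (aa b e) = (\<lambda>v. if b \<in> SY \<and> v = head D b then g e (tail D b) else 0)"
        using mod_hom_gens(3)[OF g(1) e b] Str_gens(3)[OF dY gc[OF e] b] by simp
      show "\<Psi> (aa b e) = arrow_act ?N b (\<Psi> e)"
      proof
        fix v
        have N: "arrow_act ?N b (\<Psi> e) v = (if b \<in> S \<and> v = head D b then \<Psi> e (tail D b) else 0)"
          by (simp add: Str_gens(3)[OF dS car b])
        consider "v \<noteq> head D b" | "v = head D b" "v \<in> WX" "tail D b \<in> WY" | "v = head D b" "v \<in> WX" "tail D b \<notin> WY"
          | "v = head D b" "v \<in> WY" | "v = head D b" "v \<notin> WX" "v \<notin> WY" by blast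
        then show "\<Psi> (aa b e) v = arrow_act ?N b (\<Psi> e) v"
        proof cases
          case 1
          then show ?thesis unfolding N using k0[of v] ga by (auto simp: \<Psi>_def)
        next
          case 2
          then have b\<alpha>: "b = \<alpha>" using \<alpha>_unique b by simp
          then have "\<Psi> (aa b e) v = (\<gamma> * c) * g e ?s" using 2 aa_\<alpha>[OF e] by (simp add: \<Psi>_def)
          then show ?thesis unfolding N S\<alpha> using 2 b\<alpha> st \<alpha> by (auto simp: \<Psi>_def)
        next
          case 3
          have "\<Psi> (aa b e) v = \<gamma> * (if b \<in> SX then \<kappa> (tail D b) e else 0)"
            using 3 aa_X[OF b _ e Y_zero[OF e 3(3)]] by (simp add: \<Psi>_def)
          moreover have "b \<in> S \<longleftrightarrow> b \<in> SX" using S[of b] 3 \<alpha> S_ends(2)[of b] by auto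
          moreover have "tail D b \<in> WX" if "b \<in> SX" using S_ends(1)[OF that] by simp
          ultimately show ?thesis unfolding N using 3 by (auto simp: \<Psi>_def)
        next
          case 4
          have v: "v \<notin> WX" using 4 disj by auto
          moreover have "b \<noteq> \<alpha>" using 4 st by auto
          moreover have "b \<in> S \<longleftrightarrow> b \<in> SY" using S[of b] \<open>b \<noteq> \<alpha>\<close> S_ends(1)[of b] 4 v by auto
          moreover have "tail D b \<in> WY \<and> tail D b \<notin> WX" if "b \<in> SY" using S_ends(2)[OF that] disj by auto
          ultimately show ?thesis unfolding N using 4 ga by (auto simp: \<Psi>_def)
        next
          case 5
          then have "b \<notin> S" using dS by (auto simp: thin_data_def)
          then show ?thesis unfolding N using 5 by (simp add: \<Psi>_def)
        qed
      qed
    qed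
    have \<Psi>f: "\<Psi> (f x) v = \<gamma> * x v" if "x \<in> carrier ?X" for x v
    proof -
      have "g (f x) = (\<lambda>_. 0)" using ker that by (auto simp: Str_simps)
      then show ?thesis using that \<kappa>f[OF _ that, of v] XW[of v] by (auto simp: \<Psi>_def Str_simps)
    qed
    have "bij_betw \<Psi> (carrier E) (carrier ?N)"
      unfolding bij_betw_def
    proof
      show "inj_on \<Psi> (carrier E)"
      proof (rule inj_onI)
        fix e e' assume e: "e \<in> carrier E" "e' \<in> carrier E" and eq: "\<Psi> e = \<Psi> e'"
        let ?d = "sm (- 1) e' \<oplus>\<^bsub>E\<^esub> e"
        have dc: "?d \<in> carrier E" using e by simp
        have "\<Psi> ?d = (\<lambda>v. (- 1) * \<Psi> e' v + \<Psi> e v)"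
          using e mod_homD(2)[OF hom, of "sm (- 1) e'" e] mod_hom_gens(1)[OF hom e(2), of "- 1"] Str_gens(1)[OF dS car, of "- 1" e']
          by (simp add: Str_simps)
        then have d0: "\<Psi> ?d v = 0" for v unfolding eq by simp
        have "g ?d v = 0" for v
        proof (cases "v \<in> WY")
          case True
          then have "v \<notin> WX" using disj by auto
          then show ?thesis using d0[of v] True by (simp add: \<Psi>_def)
        qed (use Y_zero[OF dc] in blast)
        then obtain x where x: "x \<in> carrier ?X" "?d = f x" using kerE[OF dc] by auto
        have "x = (\<lambda>_. 0)" using \<Psi>f[OF x(1)] d0 x(2) \<gamma> by auto
        then have "?d = \<zero>\<^bsub>E\<^esub>" using x(2) f0 by simp
        then show "e = e'" using sm_cancel[of e' e "- 1"] e by simp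
      qed
      show "\<Psi> ` carrier E = carrier ?N"
      proof (rule Set.set_eqI, rule iffI)
        fix z assume z: "z \<in> carrier ?N"
        have "Y_part z \<in> carrier ?Y" by (auto simp: Y_part_def Str_simps)
        then obtain e where e: "e \<in> carrier E" "g e = Y_part z" using g(2) by (metis imageE)
        let ?x = "\<lambda>v. if v \<in> WX then inverse \<gamma> * (z v - \<Psi> e v) else 0"
        have x: "?x \<in> carrier ?X" by (auto simp: Str_simps)
        have fx: "f ?x \<in> carrier E" by (rule mod_homD(1)[OF f(1) x])
        have "\<Psi> (e \<oplus>\<^bsub>E\<^esub> f ?x) = (\<lambda>v. \<Psi> e v + \<Psi> (f ?x) v)" using mod_homD(2)[OF hom e(1) fx] by (simp add: Str_simps)
        also have "\<dots> = z"
        proof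
          have iv: "\<gamma> * (inverse \<gamma> * t) = t" for t using \<gamma> by simp
          fix v show "\<Psi> e v + \<Psi> (f ?x) v = z v"
            unfolding \<Psi>f[OF x] using z e(2) disj by (auto simp: Str_simps Y_part_def iv) (auto simp: \<Psi>_def Y_part_def)
        qed
        finally have zz: "\<Psi> (e \<oplus>\<^bsub>E\<^esub> f ?x) = z" .
        have c: "e \<oplus>\<^bsub>E\<^esub> f ?x \<in> carrier E" using e(1) fx by simp
        show "z \<in> \<Psi> ` carrier E" using imageI[OF c, of \<Psi>] by (simp only: zz)
      qed (use car in auto)
    qed
    moreover have "\<forall>e\<in>carrier E. \<forall>v\<in>WY. \<Psi> e v = g e v" using disj by (auto simp: \<Psi>_def)
    ultimately show ?thesis using hom by blast
  qed
  have "c \<noteq> 0"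
  proof
    assume c0: "c = 0"
    have d0: "thin_data WE (SX \<union> SY)" using dE by (auto simp: thin_data_def)
    obtain \<Psi> where \<Psi>: "\<Psi> \<in> mod_hom (preproj Q) E (Str WE (SX \<union> SY))"
      "bij_betw \<Psi> (carrier E) (carrier (Str WE (SX \<union> SY)))" "\<And>e v. e \<in> carrier E ==> v \<in> WY ==> \<Psi> e v = g e v"
      using main[OF d0, of 1] c0 \<alpha>_not by auto
    let ?N = "Str WE (SX \<union> SY) :: ('b, 'k) coord_module"
    have inc: "(\<lambda>y. y) \<in> mod_hom (preproj Q) ?Y ?N"
    proof (rule mod_homI[OF Str_module[OF dY] Str_module[OF d0]])
      fix y :: "nat => 'k" assume y: "y \<in> carrier ?Y"
      show yN: "y \<in> carrier ?N" using y by (auto simp: Str_simps)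
      show "psm ?Y d y = psm ?N d y" for d by (simp add: Str_gens(1)[OF dY y] Str_gens(1)[OF d0 yN])
      show "vertex_act ?Y v y = vertex_act ?N v y" if "v \<in> {1..n}" for v
        by (simp add: Str_gens(2)[OF dY y that] Str_gens(2)[OF d0 yN that])
      show "arrow_act ?Y b y = arrow_act ?N b y" if b: "b \<in> arcs D" for b
      proof -
        have "y (tail D b) = 0" if "b \<in> SX" "b \<notin> SY" using that y S_ends disj by (auto simp: Str_simps)
        then show ?thesis by (auto simp: Str_gens(3)[OF dY y b] Str_gens(3)[OF d0 yN b] fun_eq_iff)
      qed
    qed (simp_all add: Str_simps)
    let ?\<Phi> = "inv_into (carrier E) \<Psi>"
    have \<Phi>: "?\<Phi> \<in> mod_hom (preproj Q) ?N E" by (rule inv_mod_hom[OF E \<Psi>(1,2)])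
    have s: "(\<lambda>y. ?\<Phi> y) \<in> mod_hom (preproj Q) ?Y E" by (rule mod_hom_comp[OF inc \<Phi>])
    have "g (?\<Phi> y) = y" if y: "y \<in> carrier ?Y" for y
    proof
      fix v
      have yN: "y \<in> carrier ?N" by (rule mod_homD(1)[OF inc y])
      have e: "?\<Phi> y \<in> carrier E" by (rule mod_homD(1)[OF \<Phi> yN])
      have "\<Psi> (?\<Phi> y) = y" using \<Psi>(2) yN by (simp add: bij_betw_def f_inv_into_f)
      then show "g (?\<Phi> y) v = y v"
        using \<Psi>(3)[OF e, of v] Y_zero[OF e, of v] y by (cases "v \<in> WY") (auto simp: Str_simps)
    qed
    then show False using nonsplit s by blast
  qed
  then show ?thesis using main[OF dE, of "inverse c"] \<alpha>_not unfolding mod_iso_def by auto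
qed

text \<open>
  A homomorphism \<open>h\<close> from the kernel \<open>K\<close> of the free cover \<open>F \<rightarrow> Y\<close> to \<open>X\<close> is determined, modulo
  restrictions from \<open>F\<close>, by the coordinate of its value on \<open>\<alpha> [y]\<close>, where \<open>y\<close> spans the tail of
  \<open>\<alpha>\<close>.  When this coordinate vanishes, \<open>h\<close> extends to \<open>F\<close>: at a vertex \<open>v\<close> of \<open>X\<close> it extends by the
  rule that the image of \<open>f\<close> has the coordinate of \<open>h (e\<^sub>v f)\<close>, which is defined because \<open>e\<^sub>v f\<close> lies in \<open>K\<close>.
\<close>

lemma Ext1_one_dimensional:
  "one_dimensional (Ext1 (preproj Q) (Str WY SY :: ('b, 'k::field) coord_module)
    (Str WX SX :: ('b, 'k) coord_module))"
proof -
  let ?P = "preproj Q :: ('k, ('b, 'k) preproj_elt) module"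
  let ?X = "Str WX SX :: ('b, 'k) coord_module"
  let ?Y = "Str WY SY :: ('b, 'k) coord_module"
  let ?E = "Str WE SE :: ('b, 'k) coord_module"
  let ?F = "free_module ?P (carrier ?Y)"
  let ?K = "free_cover_kernel ?P ?Y"
  let ?FK = "?F\<lparr>carrier := ?K\<rparr>"
  interpret A: kalg ?P by (rule kalg_preproj)
  have X: "pmod ?X" and Y: "pmod ?Y" and E: "pmod ?E" by (rule Str_module dX dY dE)+
  have F: "pmod ?F" by (rule A.free_module_left_module)
  interpret X: left_module ?P ?X by (rule X)
  interpret Y: left_module ?P ?Y by (rule Y)
  interpret E: left_module ?P ?E by (rule E)
  interpret F: preproj_module n Q ?F by (intro preproj_module.intro type_A_axioms pmod_kmod F)
  let ?\<pi> = "A.free_lift ?Y (\<lambda>y. y) :: ((nat => 'k) => ('b, 'k) preproj_elt) => nat => 'k"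
  have \<pi>: "?\<pi> \<in> mod_hom ?P ?F ?Y" and \<pi>u: "\<And>y. y \<in> carrier ?Y ==> ?\<pi> (A.free_unit y) = y"
    using A.free_lift_hom[OF Y, of "carrier ?Y" "\<lambda>y. y"] by auto
  have K: "?K = {f \<in> carrier ?F. ?\<pi> f = \<zero>\<^bsub>?Y\<^esub>}"
    by (auto simp: free_cover_kernel_def A.free_lift_def)
  have Ksub: "submodule ?K ?P ?F" unfolding K by (rule kernel_submodule[OF F Y \<pi>])
  have FK: "pmod ?FK" by (rule submodule_left_module[OF F Ksub])
  interpret FK: left_module ?P ?FK by (rule FK)
  have FK_gens: "psm ?FK = psm ?F" "vertex_act ?FK = vertex_act ?F" "arrow_act ?FK = arrow_act ?F"
    by (auto simp: field_smult_def vertex_act_def arrow_act_def fun_eq_iff)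
  have KF: "k \<in> ?K ==> k \<in> carrier ?F" for k by (rule submoduleD(3)[OF Ksub])
  have KI: "f \<in> ?K" if "f \<in> carrier ?F" "?\<pi> f = (\<lambda>_. 0)" for f using that by (simp add: K Str_simps)
  let ?s = "tail D \<alpha>" and ?t = "head D \<alpha>"
  let ?u = "A.free_unit (unit_vec ?s) :: (nat => 'k) => ('b, 'k) preproj_elt"
  have st: "?s \<in> {1..n}" "?t \<in> {1..n}" "?t \<notin> WY" "?s \<notin> WX" using \<alpha> W_verts disj by auto
  have u: "?u \<in> carrier ?F" by (rule A.free_unit_closed[OF tail_unit])
  have \<pi>c: "f \<in> carrier ?F ==> ?\<pi> f \<in> carrier ?Y" for f by (rule mod_homD(1)[OF \<pi>])
  have \<pi>va: "?\<pi> (F.va v f) = (\<lambda>w. if w = v then ?\<pi> f v else 0)" if "v \<in> {1..n}" "f \<in> carrier ?F" for v f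
    using mod_hom_gens(2)[OF \<pi> that(2,1)] Str_gens(2)[OF dY \<pi>c[OF that(2)] that(1)] by (auto simp: fun_eq_iff)
  have vaK: "F.va v f \<in> ?K" if "v \<in> {1..n}" "v \<notin> WY" "f \<in> carrier ?F" for v f
  proof (rule KI)
    show "F.va v f \<in> carrier ?F" by (rule F.va_closed[OF that(1,3)])
    have "?\<pi> f v = 0" using \<pi>c[OF that(3)] that(2) unfolding Str_simps(1) by blast
    then show "?\<pi> (F.va v f) = (\<lambda>_. 0)" unfolding \<pi>va[OF that(1,3)] by auto
  qed
  have aaK: "F.aa \<alpha> f \<in> ?K" if "f \<in> carrier ?F" for f
    by (rule KI)
      (use that mod_hom_gens(3)[OF \<pi> that \<alpha>(1)] Str_gens(3)[OF dY \<pi>c[OF that] \<alpha>(1)] \<alpha>(1) \<alpha>_not in auto)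
  have extend: "\<exists>H\<in>mod_hom ?P ?F ?X. \<forall>k\<in>?K. H k = h k"
    if h: "h \<in> mod_hom ?P ?FK ?X" and h0: "h (F.aa \<alpha> ?u) ?t = 0" for h
  proof -
    have hc: "k \<in> ?K ==> h k \<in> carrier ?X" for k using mod_homD(1)[OF h] by simp
    have hadd: "k \<in> ?K ==> k' \<in> ?K ==> h (k \<oplus>\<^bsub>?F\<^esub> k') = (\<lambda>v. h k v + h k' v)" for k k'
      using mod_homD(2)[OF h, of k k'] by (simp add: Str_simps)
    have hsm: "k \<in> ?K ==> h (psm ?F c k) = (\<lambda>v. c * h k v)" for k c
      using mod_hom_gens(1)[OF h, of k c] Str_gens(1)[OF dX hc, of k c] by (simp add: FK_gens)
    have hva: "k \<in> ?K ==> v \<in> {1..n} ==> h (F.va v k) = (\<lambda>w. if w = v then h k w else 0)" for k v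
      using mod_hom_gens(2)[OF h, of k v] Str_gens(2)[OF dX hc, of k v] by (simp add: FK_gens)
    have haa: "k \<in> ?K ==> b \<in> arcs D ==> h (F.aa b k) = (\<lambda>w. if b \<in> SX \<and> w = head D b then h k (tail D b) else 0)" for k b
      using mod_hom_gens(3)[OF h, of k b] Str_gens(3)[OF dX hc, of k b] by (simp add: FK_gens)
    have hz: "h \<zero>\<^bsub>?F\<^esub> = (\<lambda>_. 0)"
      using mod_hom_zero[OF h FK.abelian_group_axioms X.abelian_group_axioms] by (simp add: Str_simps)
    have XW: "v \<in> WX ==> v \<in> {1..n} \<and> v \<notin> WY" for v using W_verts disj by blast
    define H where "H f = (\<lambda>v. if v \<in> WX then h (F.va v f) v else 0)" for f
    have car: "H f \<in> carrier ?X" for f by (auto simp: H_def Str_simps)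
    have "H \<in> mod_hom ?P ?F ?X"
    proof (rule mod_homI[OF F X car])
      fix f f' assume f: "f \<in> carrier ?F" "f' \<in> carrier ?F"
      have "h (F.va v (f \<oplus>\<^bsub>?F\<^esub> f')) v = h (F.va v f) v + h (F.va v f') v" if "v \<in> WX" for v
      proof -
        have v: "v \<in> {1..n}" "v \<notin> WY" using XW[OF that] by auto
        show ?thesis unfolding F.va_linear(1)[OF v(1) f] hadd[OF vaK[OF v f(1)] vaK[OF v f(2)]] by (rule refl)
      qed
      then show "H (f \<oplus>\<^bsub>?F\<^esub> f') = H f \<oplus>\<^bsub>?X\<^esub> H f'" by (auto simp: H_def Str_simps(3) fun_eq_iff)
    next
      fix c f assume f: "f \<in> carrier ?F"
      have "h (F.va v (psm ?F c f)) v = c * h (F.va v f) v" if "v \<in> WX" for v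
      proof -
        have v: "v \<in> {1..n}" "v \<notin> WY" using XW[OF that] by auto
        show ?thesis unfolding F.va_linear(2)[OF v(1) f] hsm[OF vaK[OF v f]] by (rule refl)
      qed
      then show "H (psm ?F c f) = psm ?X c (H f)"
        unfolding Str_gens(1)[OF dX car] by (auto simp: H_def fun_eq_iff)
    next
      fix v f assume v: "v \<in> {1..n}" and f: "f \<in> carrier ?F"
      have "h (F.va w (F.va v f)) w = (if w = v then h (F.va v f) v else 0)" if "w \<in> WX" for w
        using F.va_va[OF conjunct1[OF XW[OF that]] v f] hz by auto
      then show "H (F.va v f) = vertex_act ?X v (H f)"
        unfolding Str_gens(2)[OF dX car v] by (auto simp: H_def fun_eq_iff)
    next
      fix b f assume b: "b \<in> arcs D" and f: "f \<in> carrier ?F"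
      have t: "tail D b \<in> {1..n}" using D.tail_in_verts[OF b] by simp
      have e: "F.aa b f = F.aa b (F.va (tail D b) f)" using F.aa_va[OF t b f] by simp
      have key: "h (F.aa b f) (head D b) = (if b \<in> SX then H f (tail D b) else 0)" if hX: "head D b \<in> WX"
      proof (cases "tail D b \<in> WY")
        case False
        have "h (F.aa b f) (head D b) = (if b \<in> SX then h (F.va (tail D b) f) (tail D b) else 0)"
          unfolding e using haa[OF vaK[OF t False f] b] by simp
        then show ?thesis using S_ends(1)[of b] by (simp add: H_def)
      next
        case True
        then have b\<alpha>: "b = \<alpha>" using \<alpha>_unique b hX by simp
        let ?c = "?\<pi> f ?s"
        \<comment> \<open>Subtracting a multiple of the generator \<open>?u\<close> moves the part of \<open>f\<close> at the tail of \<open>\<alpha>\<close> into the kernel.\<close>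
        let ?d = "F.va ?s f \<oplus>\<^bsub>?F\<^esub> psm ?F (- ?c) (F.va ?s ?u)"
        have uc: "F.va ?s ?u \<in> carrier ?F" and fc: "F.va ?s f \<in> carrier ?F" using st u f by auto
        have \<pi>1: "?\<pi> (F.va ?s f) = (\<lambda>w. if w = ?s then ?c else 0)" by (rule \<pi>va[OF st(1) f])
        have \<pi>2: "?\<pi> (F.va ?s ?u) = unit_vec ?s" using \<pi>va[OF st(1) u] \<pi>u[OF tail_unit] by (auto simp: fun_eq_iff)
        have \<pi>3: "?\<pi> (psm ?F (- ?c) (F.va ?s ?u)) = (\<lambda>w. - ?c * unit_vec ?s w)"
          using mod_hom_gens(1)[OF \<pi> uc, of "- ?c"] Str_gens(1)[OF dY tail_unit, of "- ?c"] by (simp only: \<pi>2)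
        have "?d \<in> ?K"
        proof (rule KI)
          show "?d \<in> carrier ?F" using uc fc by simp
          have "?\<pi> ?d = (\<lambda>w. ?\<pi> (F.va ?s f) w + ?\<pi> (psm ?F (- ?c) (F.va ?s ?u)) w)"
            using mod_homD(2)[OF \<pi> fc F.sm_closed[OF uc, of "- ?c"]] by (simp only: Str_simps(3))
          then show "?\<pi> ?d = (\<lambda>_. 0)" unfolding \<pi>1 \<pi>3 by (auto simp: fun_eq_iff)
        qed
        then have "h (F.aa \<alpha> ?d) ?t = 0" using haa[OF _ \<alpha>(1)] \<alpha>_not by simp
        moreover have "F.aa \<alpha> ?d = F.aa \<alpha> f \<oplus>\<^bsub>?F\<^esub> psm ?F (- ?c) (F.aa \<alpha> ?u)"
          using uc fc \<alpha>(1) F.aa_va[OF st(1) \<alpha>(1) f] F.aa_va[OF st(1) \<alpha>(1) u] by (simp add: F.aa_linear)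
        moreover have "psm ?F (- ?c) (F.aa \<alpha> ?u) \<in> ?K"
          using pmod_submodule_closed(1)[OF F Ksub aaK[OF u]] .
        ultimately have "h (F.aa \<alpha> f) ?t + (- ?c) * h (F.aa \<alpha> ?u) ?t = 0"
          using hadd[OF aaK[OF f], of "psm ?F (- ?c) (F.aa \<alpha> ?u)"] hsm[OF aaK[OF u], of "- ?c"] by simp
        then show ?thesis using h0 b\<alpha> \<alpha>_not by simp
      qed
      show "H (F.aa b f) = arrow_act ?X b (H f)"
      proof
        fix v
        show "H (F.aa b f) v = arrow_act ?X b (H f) v"
        proof (cases "v \<in> WX")
          case True
          then have "F.va v (F.aa b f) = (if v = head D b then F.aa b f else \<zero>\<^bsub>?F\<^esub>)" using F.va_aa[OF _ b f] XW by auto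
          then show ?thesis using True key hz by (auto simp: H_def[of "F.aa b f"] Str_gens(3)[OF dX car b])
        next
          case False
          then show ?thesis using S_ends(1)[of b] by (auto simp: H_def[of "F.aa b f"] Str_gens(3)[OF dX car b])
        qed
      qed
    qed
    moreover have "H k = h k" if k: "k \<in> ?K" for k
    proof
      fix v show "H k v = h k v"
        using hva[OF k] XW[of v] hc[OF k] by (auto simp: H_def Str_simps)
    qed
    ultimately show ?thesis by blast
  qed
  let ?V = "hom_space ?P ?FK ?X"
  let ?B = "(\<lambda>f. restrict f ?K) ` mod_hom ?P ?F ?X"
  let ?l = "A.free_lift ?E (\<lambda>y. y) :: ((nat => 'k) => ('b, 'k) preproj_elt) => nat => 'k"
  have YE: "y \<in> carrier ?Y ==> y \<in> carrier ?E" for y by (auto simp: Str_simps)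
  have l: "?l \<in> mod_hom ?P ?F ?E" and lu: "\<And>y. y \<in> carrier ?Y ==> ?l (A.free_unit y) = y"
    using A.free_lift_hom[OF E, of "carrier ?Y" "\<lambda>y. y"] YE by auto
  have l\<pi>: "Y_part (?l f) = ?\<pi> f" if f: "f \<in> carrier ?F" for f
  proof -
    have "Y_part (?l f) = A.free_lift ?Y (\<lambda>y. Y_part y) f"
      by (rule A.free_lift_comp[OF E Y Y_part_hom YE f])
    also have "\<dots> = ?\<pi> f" unfolding A.free_lift_def
    proof (rule Y.M.finsum_cong'[OF refl])
      have c: "y \<in> carrier ?Y" "f y \<in> carrier ?P" if "y \<in> {y. f y \<noteq> \<zero>\<^bsub>?P\<^esub>}" for y
        using f that by (auto simp: A.free_module_simps)
      show "(\<lambda>y. f y \<odot>\<^bsub>?Y\<^esub> y) \<in> {y. f y \<noteq> \<zero>\<^bsub>?P\<^esub>} \<rightarrow> carrier ?Y" using c Y.smult_closed by auto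
      fix y assume "y \<in> {y. f y \<noteq> \<zero>\<^bsub>?P\<^esub>}"
      then have "Y_part y = y" using c(1)[of y] by (auto simp: Y_part_def Str_simps fun_eq_iff)
      then show "f y \<odot>\<^bsub>?Y\<^esub> Y_part y = f y \<odot>\<^bsub>?Y\<^esub> y" by simp
    qed
    finally show ?thesis .
  qed
  have lX: "?l k \<in> carrier ?X" if k: "k \<in> ?K" for k
  proof -
    have y: "Y_part (?l k) = (\<lambda>_. 0)" using l\<pi>[OF KF[OF k]] k by (simp add: K Str_simps(2))
    have e: "?l k \<in> carrier ?E" by (rule mod_homD(1)[OF l KF[OF k]])
    have "?l k v = 0" if v: "v \<notin> WX" for v
    proof (cases "v \<in> WY")
      case True
      then show ?thesis using fun_cong[OF y, of v] by (simp add: Y_part_def)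
    next
      case False
      then show ?thesis using e v unfolding Str_simps(1) by blast
    qed
    then show ?thesis unfolding Str_simps(1) by blast
  qed
  have lK: "?l \<in> mod_hom ?P ?FK ?X"
    unfolding mod_hom_def
  proof (intro CollectI conjI ballI funcsetI)
    fix k assume "k \<in> carrier ?FK"
    then have k: "k \<in> ?K" by simp
    show "?l k \<in> carrier ?X" by (rule lX[OF k])
    show "?l (k \<oplus>\<^bsub>?FK\<^esub> k') = ?l k \<oplus>\<^bsub>?X\<^esub> ?l k'" if "k' \<in> carrier ?FK" for k'
      using mod_homD(2)[OF l KF[OF k] KF[of k']] that by (simp add: Str_simps(3))
  next
    fix a k assume a: "a \<in> carrier ?P" and "k \<in> carrier ?FK"
    then have k: "k \<in> ?K" by simp
    show "?l (a \<odot>\<^bsub>?FK\<^esub> k) = a \<odot>\<^bsub>?X\<^esub> ?l k"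
      using mod_homD(3)[OF l a KF[OF k]] mod_homD(3)[OF inclusion_hom a lX[OF k]] by simp
  qed
  let ?h = "restrict ?l (carrier ?FK)"
  have h: "?h \<in> carrier ?V" by (rule restrict_hom[OF A.kalg_axioms FK X lK])
  have hu: "?h (F.aa \<alpha> ?u) ?t = 1"
  proof -
    have "?l (F.aa \<alpha> ?u) = arrow_act ?E \<alpha> (unit_vec ?s)" using mod_hom_gens(3)[OF l u \<alpha>(1)] lu[OF tail_unit] by simp
    then show ?thesis using aaK[OF u] Str_gens(3)[OF dE YE[OF tail_unit] \<alpha>(1)] by simp
  qed
  have Fhom: "restrict g ?K \<in> carrier ?V" if g: "g \<in> mod_hom ?P ?F ?X" for g
  proof -
    have "g \<in> mod_hom ?P ?FK ?X" using g KF by (auto simp: mod_hom_def)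
    from restrict_hom[OF A.kalg_axioms FK X this] show ?thesis by simp
  qed
  have Beq: "restrict g ?K \<oplus>\<^bsub>?V\<^esub> restrict g' ?K = restrict (\<lambda>x. g x \<oplus>\<^bsub>?X\<^esub> g' x) ?K"
    "c \<odot>\<^bsub>?V\<^esub> restrict g ?K = restrict (\<lambda>x. psm ?X c (g x)) ?K" for g g' c
    by (auto simp: hom_space_def fun_eq_iff)
  interpret V: abelian_group ?V by (rule hom_space_abelian_group[OF A.kalg_axioms FK X])
  have cB: "c \<odot>\<^bsub>?V\<^esub> g \<in> ?B" if g: "g \<in> ?B" for c g
  proof -
    obtain g' where g': "g' \<in> mod_hom ?P ?F ?X" "g = restrict g' ?K" using g by blast
    show ?thesis unfolding g'(2) Beq using hom_scal[OF A.kalg_axioms F X g'(1), of c] by blast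
  qed
  have aB: "g \<oplus>\<^bsub>?V\<^esub> g' \<in> ?B" if g: "g \<in> ?B" "g' \<in> ?B" for g g'
  proof -
    obtain k k' where k: "k \<in> mod_hom ?P ?F ?X" "g = restrict k ?K" "k' \<in> mod_hom ?P ?F ?X" "g' = restrict k' ?K"
      using g by auto
    show ?thesis unfolding k Beq using hom_add[OF A.kalg_axioms F X k(1,3)] by blast
  qed
  have neg: "\<ominus>\<^bsub>?V\<^esub> g = (- 1) \<odot>\<^bsub>?V\<^esub> g" if g: "g \<in> carrier ?V" for g
  proof (rule V.minus_equality)
    have c: "(- 1) \<odot>\<^bsub>?V\<^esub> g \<in> carrier ?V" by (rule hom_space_closed(2)[OF A.kalg_axioms FK X g g])
    interpret kX: kmod ?P ?X by (rule pmod_kmod[OF X])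
    show "(- 1) \<odot>\<^bsub>?V\<^esub> g \<oplus>\<^bsub>?V\<^esub> g = \<zero>\<^bsub>?V\<^esub>"
    proof (rule hom_space_eqI[OF A.kalg_axioms FK X V.a_closed[OF c g] V.zero_closed])
      fix x assume x: "x \<in> carrier ?FK"
      then have gx: "g x \<in> carrier ?X" using g mod_homD(1)[of g ?P ?FK ?X] by (simp add: hom_space_def)
      show "((- 1) \<odot>\<^bsub>?V\<^esub> g \<oplus>\<^bsub>?V\<^esub> g) x = \<zero>\<^bsub>?V\<^esub> x"
        using x gx kX.sm_l_distr[OF gx, of "- 1" 1] by (simp add: hom_space_def)
    qed
    show "g \<in> carrier ?V" "(- 1) \<odot>\<^bsub>?V\<^esub> g \<in> carrier ?V" by (rule g c)+
  qed
  have Bsub: "subgroup ?B (add_monoid ?V)"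
  proof (rule V.add.subgroupI)
    show "?B \<subseteq> carrier ?V" using Fhom by auto
    show "?B \<noteq> {}" using hom_zero[OF A.kalg_axioms F X] by blast
    show "\<ominus>\<^bsub>?V\<^esub> g \<in> ?B" if "g \<in> ?B" for g using cB[OF that, of "- 1"] neg[of g] Fhom that by auto
    show "g \<oplus>\<^bsub>?V\<^esub> g' \<in> ?B" if "g \<in> ?B" "g' \<in> ?B" for g g' by (rule aB[OF that])
  qed
  have "one_dimensional (quot_module ?V ?B)"
  proof (rule one_dimensional_quotI[OF V.abelian_group_axioms Bsub _ _ cB h])
    show "c \<odot>\<^bsub>?V\<^esub> g \<in> carrier ?V" if "g \<in> carrier ?V" for c g
      by (rule hom_space_closed(2)[OF A.kalg_axioms FK X that that])
    show "c \<odot>\<^bsub>?V\<^esub> (g \<oplus>\<^bsub>?V\<^esub> g') = c \<odot>\<^bsub>?V\<^esub> g \<oplus>\<^bsub>?V\<^esub> c \<odot>\<^bsub>?V\<^esub> g'" if g: "g \<in> carrier ?V" "g' \<in> carrier ?V" for c g g'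
    proof -
      interpret kX: kmod ?P ?X by (rule pmod_kmod[OF X])
      have v: "x \<in> ?K ==> g x \<in> carrier ?X \<and> g' x \<in> carrier ?X" for x
        using g mod_homD(1)[of g ?P ?FK ?X] mod_homD(1)[of g' ?P ?FK ?X] by (simp add: hom_space_def)
      show ?thesis using v by (auto simp: hom_space_def fun_eq_iff kX.sm_r_distr)
    qed
    show "?h \<notin> ?B"
    proof
      assume "?h \<in> ?B"
      then obtain g where g: "g \<in> mod_hom ?P ?F ?X" "?h = restrict g ?K" by auto
      have gu: "g ?u \<in> carrier ?X" by (rule mod_homD(1)[OF g(1) u])
      have "?h (F.aa \<alpha> ?u) = g (F.aa \<alpha> ?u)" unfolding g(2) using aaK[OF u] by simp
      also have "\<dots> = arrow_act ?X \<alpha> (g ?u)" by (rule mod_hom_gens(3)[OF g(1) u \<alpha>(1)])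
      finally have "?h (F.aa \<alpha> ?u) ?t = 0" using Str_gens(3)[OF dX gu \<alpha>(1)] \<alpha>_not by simp
      then show False using hu by simp
    qed
    show "\<exists>c. \<exists>b\<in>?B. g = b \<oplus>\<^bsub>?V\<^esub> c \<odot>\<^bsub>?V\<^esub> ?h" if g: "g \<in> carrier ?V" for g
    proof -
      interpret kX: kmod ?P ?X by (rule pmod_kmod[OF X])
      let ?c = "g (F.aa \<alpha> ?u) ?t"
      have gh: "g \<in> mod_hom ?P ?FK ?X" using g by (simp add: hom_space_def)
      let ?d = "\<lambda>x. g x \<oplus>\<^bsub>?X\<^esub> psm ?X (- ?c) (?l x)"
      have d: "?d \<in> mod_hom ?P ?FK ?X"
        by (rule hom_add[OF A.kalg_axioms FK X gh hom_scal[OF A.kalg_axioms FK X lK]])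
      have "?d (F.aa \<alpha> ?u) ?t = 0"
        using hu aaK[OF u] Str_gens(1)[OF dX lX[OF aaK[OF u]], of "- ?c"] by (simp add: Str_simps(3))
      then obtain H where H: "H \<in> mod_hom ?P ?F ?X" "\<And>k. k \<in> ?K ==> H k = ?d k" using extend[OF d] by blast
      have c: "?c \<odot>\<^bsub>?V\<^esub> ?h \<in> carrier ?V" by (rule hom_space_closed(2)[OF A.kalg_axioms FK X h h])
      have "g = restrict H ?K \<oplus>\<^bsub>?V\<^esub> ?c \<odot>\<^bsub>?V\<^esub> ?h"
      proof (rule hom_space_eqI[OF A.kalg_axioms FK X g V.a_closed[OF Fhom[OF H(1)] c]])
        fix x assume "x \<in> carrier ?FK"
        then have x: "x \<in> ?K" by simp
        have gx: "g x \<in> carrier ?X" using mod_homD(1)[OF gh, of x] x by simp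
        have "(restrict H ?K \<oplus>\<^bsub>?V\<^esub> ?c \<odot>\<^bsub>?V\<^esub> ?h) x = ?d x \<oplus>\<^bsub>?X\<^esub> psm ?X ?c (?l x)"
          using x H(2)[OF x] by (simp add: hom_space_def)
        also have "\<dots> = g x"
          unfolding Str_simps(3) Str_gens(1)[OF dX lX[OF x]] by (simp add: fun_eq_iff)
        finally show "g x = (restrict H ?K \<oplus>\<^bsub>?V\<^esub> ?c \<odot>\<^bsub>?V\<^esub> ?h) x" by simp
      qed
      then show ?thesis using H(1) by blast
    qed
  qed
  then show ?thesis by (simp add: Ext1_def Let_def)
qed

end

end

section \<open>The doubleton extension order\<close>

lemma extension_subfactor:
  assumes A: "left_module A X" "left_module A E" "left_module A Y" and ext: "nonsplit_extension A X E Y"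
  shows "subfactor A X E" "subfactor A Y E"
proof -
  obtain f g where f: "f \<in> mod_hom A X E" "inj_on f (carrier X)" and g: "g \<in> mod_hom A E Y" "g ` carrier E = carrier Y"
    using ext unfolding nonsplit_extension_def by blast
  let ?U = "f ` carrier X"
  interpret X: left_module A X by (rule A)
  interpret E: left_module A E by (rule A)
  have ff: "inv_into (carrier X) f (f x) = x" if "x \<in> carrier X" for x using f(2) that by simp
  have "submodule ?U A E"
  proof (rule submodule.intro)
    show "subgroup ?U (add_monoid E)"
    proof (rule E.M.add.subgroupI)
      show "?U \<subseteq> carrier E" using mod_homD(1)[OF f(1)] by auto
      show "?U \<noteq> {}" using X.M.zero_closed by blast
      fix y assume "y \<in> ?U"
      then obtain x where x: "x \<in> carrier X" "y = f x" by auto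
      have "f (\<ominus>\<^bsub>X\<^esub> x) \<oplus>\<^bsub>E\<^esub> y = \<zero>\<^bsub>E\<^esub>"
        using mod_homD(2)[OF f(1) X.M.a_inv_closed[OF x(1)] x(1)] x
          mod_hom_zero[OF f(1) X.M.abelian_group_axioms E.M.abelian_group_axioms]
        by (simp add: X.M.l_neg)
      then have "\<ominus>\<^bsub>E\<^esub> y = f (\<ominus>\<^bsub>X\<^esub> x)"
        using x mod_homD(1)[OF f(1)] by (intro E.M.minus_equality) auto
      then show "\<ominus>\<^bsub>E\<^esub> y \<in> ?U" using x by simp
      fix z assume "z \<in> ?U"
      then obtain x' where "x' \<in> carrier X" "z = f x'" by auto
      then have "y \<oplus>\<^bsub>E\<^esub> z = f (x \<oplus>\<^bsub>X\<^esub> x')" "x \<oplus>\<^bsub>X\<^esub> x' \<in> carrier X" using mod_homD(2)[OF f(1)] x by auto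
      then show "y \<oplus>\<^bsub>E\<^esub> z \<in> ?U" by blast
    qed
    show "submodule_axioms ?U A E"
    proof unfold_locales
      fix a y assume a: "a \<in> carrier A" and "y \<in> ?U"
      then obtain x where x: "x \<in> carrier X" "y = f x" by auto
      then have "a \<odot>\<^bsub>E\<^esub> y = f (a \<odot>\<^bsub>X\<^esub> x)" using mod_homD(3)[OF f(1) a x(1)] by simp
      then show "a \<odot>\<^bsub>E\<^esub> y \<in> ?U" using X.smult_closed[OF a x(1)] by blast
    qed
  qed
  moreover have "inv_into (carrier X) f \<in> mod_hom A (E\<lparr>carrier := ?U\<rparr>) X"
    by (rule inv_mod_hom[OF A(1)]) (use f in \<open>auto simp: mod_hom_def bij_betw_def\<close>)
  moreover have "inv_into (carrier X) f ` ?U = carrier X" using ff by (auto simp: image_image)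
  ultimately show "subfactor A X E" unfolding subfactor_def by blast
  show "subfactor A Y E" by (rule subfactor_quotient[OF A(2) g])
qed

context type_A
begin

lemma layer_module_pmod: "layer_module n Q M ==> pmod M"
  by (simp add: layer_module_def fd_module_def)

lemma doubleton_gt_subfactor:
  assumes gt: "doubleton_gt n Q A B"
  shows "pmod A" "pmod B" "subfactor (preproj Q) A B"
proof -
  obtain C where C: "doubleton n Q A C"
    and ext: "nonsplit_extension (preproj Q) A B C \<or> nonsplit_extension (preproj Q) C B A"
    using gt unfolding doubleton_gt_def by blast
  show A: "pmod A" using C by (simp add: doubleton_def layer_module_pmod)
  have C': "pmod C" using C by (simp add: doubleton_def layer_module_pmod)
  show B: "pmod B" using gt by (simp add: doubleton_gt_def fd_module_def)
  show "subfactor (preproj Q) A B" using ext extension_subfactor[OF A B C'] extension_subfactor[OF C' B A] by blast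
qed

lemma subfactor_refl: "left_module R M ==> subfactor R M M"
  by (rule subfactor_iso[OF _ mod_iso_refl])

lemma doubleton_chain_subfactor:
  "(doubleton_gt n Q)\<^sup>*\<^sup>* A B ==> pmod A ==> pmod B \<and> subfactor (preproj Q) A B"
proof (induction rule: rtranclp_induct)
  case base
  then show ?case using subfactor_refl by blast
next
  case (step B C)
  note gt = doubleton_gt_subfactor[OF step(2)]
  then show ?case using step subfactor_trans[OF gt(2,1)] by blast
qed

text \<open>
  A submodule of the larger string that maps onto the smaller one contains the basis vectors at the
  vertices of the latter, and maps them to nonzero vectors.  An arrow of the smaller string therefore acts
  nontrivially in the larger one.
\<close>

lemma string_data_mono:
  assumes d: "string_data W S" and d': "string_data W' S'"
    and sub: "subfactor (preproj Q) (Str W S :: (('b, 'k::field) preproj_elt, _) module) (Str W' S')"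
  shows "W \<subseteq> W'" "\<And>l. l \<in> W ==> Suc l \<in> W ==> up l \<in> S \<longleftrightarrow> up l \<in> S'"
proof -
  let ?X = "Str W S :: ('b, 'k) coord_module"
  let ?M = "Str W' S' :: ('b, 'k) coord_module"
  note t = string_data_thin[OF d] and t' = string_data_thin[OF d']
  have M: "pmod ?M" by (rule Str_module[OF t'])
  obtain U f where U: "submodule U (preproj Q) ?M" and f: "f \<in> mod_hom (preproj Q) (?M\<lparr>carrier := U\<rparr>) ?X"
    and surj: "f ` U = carrier ?X" using sub unfolding subfactor_def by blast
  interpret M: left_module "preproj Q" ?M by (rule M)
  interpret U: left_module "preproj Q" "?M\<lparr>carrier := U\<rparr>" by (rule submodule_left_module[OF M U])
  interpret X: left_module "preproj Q" ?X by (rule Str_module[OF t])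
  have Ucar: "x \<in> U ==> x \<in> carrier ?M" for x by (rule submoduleD(3)[OF U])
  have fX: "x \<in> U ==> f x \<in> carrier ?X" for x using mod_homD(1)[OF f, of x] by simp
  have gens: "f (psm ?M c x) = psm ?X c (f x)" "v \<in> {1..n} ==> f (vertex_act ?M v x) = vertex_act ?X v (f x)"
    "b \<in> arcs D ==> f (arrow_act ?M b x) = arrow_act ?X b (f x)" if "x \<in> U" for c v b x
    using mod_hom_gens[OF f, of x] that by (simp_all add: field_smult_def vertex_act_def arrow_act_def)
  have f0: "f (\<lambda>_. 0) = (\<lambda>_. 0)"
    using mod_hom_zero[OF f U.M.abelian_group_axioms X.M.abelian_group_axioms] by (simp add: Str_simps)
  have unit: "unit_vec l \<in> U \<and> f (unit_vec l) l \<noteq> 0 \<and> l \<in> W'" if l: "l \<in> W" for l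
  proof -
    have ln: "l \<in> {1..n}" using l t by (auto simp: thin_data_def)
    have "unit_vec l \<in> carrier ?X" using l by (auto simp: Str_simps)
    then obtain x where x: "x \<in> U" "f x = unit_vec l" using surj by (metis imageE)
    have e: "vertex_act ?M l x = (\<lambda>v. x l * unit_vec l v)" using Str_gens(2)[OF t' Ucar[OF x(1)] ln] by (auto simp: fun_eq_iff)
    have fe: "f (vertex_act ?M l x) = unit_vec l"
      using gens(2)[OF x(1) ln] Str_gens(2)[OF t fX[OF x(1)] ln] by (auto simp: fun_eq_iff x(2))
    have xl: "x l \<noteq> 0"
    proof
      assume "x l = 0"
      then have "unit_vec l = (\<lambda>_. 0 :: 'k)" using fe f0 by (simp add: e)
      then show False by (metis zero_neq_one)
    qed
    have lU: "unit_vec l \<in> U" by (rule Str_submodule_unit[OF t' U x(1) xl])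
    have "(\<lambda>v. x l * unit_vec l v) = psm ?M (x l) (unit_vec l)" using Str_gens(1)[OF t' Ucar[OF lU]] by simp
    then have "f (\<lambda>v. x l * unit_vec l v) = (\<lambda>v. x l * f (unit_vec l) v)"
      using gens(1)[OF lU] Str_gens(1)[OF t fX[OF lU]] by simp
    then have "(\<lambda>v. x l * f (unit_vec l) v) = unit_vec l" using fe by (simp add: e)
    then have "f (unit_vec l) l \<noteq> 0" by (metis mult_zero_right zero_neq_one)
    moreover have "l \<in> W'" using xl Ucar[OF x(1)] by (auto simp: Str_simps)
    ultimately show ?thesis using lU by simp
  qed
  then show WW: "W \<subseteq> W'" by auto
  have arrow: "c \<in> S'" if c: "c \<in> S" for c
  proof (rule ccontr)
    assume n: "c \<notin> S'"
    have ca: "c \<in> arcs D" "tail D c \<in> W" "head D c \<in> W" using t c by (auto simp: thin_data_def)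
    let ?u = "unit_vec (tail D c) :: nat => 'k"
    have u: "?u \<in> U" "f ?u (tail D c) \<noteq> 0" using unit[OF ca(2)] by auto
    have "arrow_act ?M c ?u = (\<lambda>_. 0)" using Str_gens(3)[OF t' Ucar[OF u(1)] ca(1)] n by simp
    then have "arrow_act ?X c (f ?u) = (\<lambda>_. 0)" using gens(3)[OF u(1) ca(1)] f0 by simp
    then have "arrow_act ?X c (f ?u) (head D c) = 0" by simp
    then show False using Str_gens(3)[OF t fX[OF u(1)] ca(1)] c u(2) by simp
  qed
  fix l assume l: "l \<in> W" "Suc l \<in> W"
  obtain a b where ab: "1 \<le> a" "b \<le> n" "W = {a..b}" "\<And>l. l \<in> {a..<b} ==> up l \<in> S \<longleftrightarrow> dn l \<notin> S"
    using d unfolding string_data_def by auto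
  obtain a' b' where ab': "W' = {a'..b'}" "\<And>l. l \<in> {a'..<b'} ==> up l \<in> S' \<longleftrightarrow> dn l \<notin> S'"
    using d' unfolding string_data_def by auto
  have "l \<in> W'" "Suc l \<in> W'" using l WW by auto
  then have "up l \<in> S' \<longleftrightarrow> dn l \<notin> S'" by (intro ab'(2)) (auto simp: ab'(1))
  moreover have "up l \<in> S \<longleftrightarrow> dn l \<notin> S" using l by (intro ab(4)) (auto simp: ab(3))
  ultimately show "up l \<in> S \<longleftrightarrow> up l \<in> S'" using arrow by blast
qed

text \<open>
  A string and the simple module at a vertex adjacent to one of its ends form a doubleton: the two
  arrows between the end and the new vertex give the two extensions.
\<close>

lemma doubleton_gt_step:
  assumes d: "string_data W S" and c: "c \<in> {1..n}" "c \<notin> W"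
    and \<alpha>: "string_data (insert c W) (insert \<alpha> S)" "\<alpha> \<in> arcs D" "tail D \<alpha> \<in> W" "head D \<alpha> = c"
    and \<beta>: "string_data (insert c W) (insert \<beta> S)" "\<beta> \<in> arcs D" "head D \<beta> \<in> W" "tail D \<beta> = c"
    and uniq: "\<And>\<gamma>. \<gamma> \<in> arcs D ==> tail D \<gamma> \<in> W ==> head D \<gamma> = c ==> \<gamma> = \<alpha>"
      "\<And>\<gamma>. \<gamma> \<in> arcs D ==> head D \<gamma> \<in> W ==> tail D \<gamma> = c ==> \<gamma> = \<beta>"
    and T: "T = insert \<alpha> S \<or> T = insert \<beta> S"
  shows "doubleton_gt n Q (Str W S) (Str (insert c W) T :: ('b, 'k::field) coord_module)"
proof -
  let ?A = "Str W S :: ('b, 'k) coord_module" and ?C = "Str {c} {} :: ('b, 'k) coord_module"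
  let ?E = "Str (insert c W) (insert \<alpha> S) :: ('b, 'k) coord_module"
  let ?F = "Str (insert c W) (insert \<beta> S) :: ('b, 'k) coord_module"
  note dC = simple_string_data[OF c(1)]
  note t = string_data_thin[OF d] string_data_thin[OF dC] string_data_thin[OF \<alpha>(1)] string_data_thin[OF \<beta>(1)]
  have layer: "layer_module n Q M" if "fd_module (preproj Q) M" "string_data V R" "mod_iso (preproj Q) M (Str V R)"
    for M :: "('b, 'k) coord_module" and V R
    using layer_module_iff[OF that(1)] that(2,3) by blast
  have e\<alpha>: "{c} \<inter> W = {}" "thin_data ({c} \<union> W) (insert \<alpha> ({} \<union> S))" "tail D \<alpha> \<in> W" "head D \<alpha> \<in> {c}"
    using c \<alpha> t(3) by auto
  have e\<beta>: "W \<inter> {c} = {}" "thin_data (W \<union> {c}) (insert \<beta> (S \<union> {}))" "tail D \<beta> \<in> {c}" "head D \<beta> \<in> W"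
    using c \<beta> t(4) by auto
  have u\<alpha>: "\<And>\<gamma>. \<gamma> \<in> arcs D ==> tail D \<gamma> \<in> W ==> head D \<gamma> \<in> {c} ==> \<gamma> = \<alpha>"
    and u\<beta>: "\<And>\<gamma>. \<gamma> \<in> arcs D ==> tail D \<gamma> \<in> {c} ==> head D \<gamma> \<in> W ==> \<gamma> = \<beta>"
    using uniq by auto
  note a\<alpha> = t(2,1) e\<alpha>(1,2) \<alpha>(2) e\<alpha>(3,4) u\<alpha> and a\<beta> = t(1,2) e\<beta>(1,2) \<beta>(2) e\<beta>(3,4) u\<beta>
  have unions: "{c} \<union> W = insert c W" "W \<union> {c} = insert c W" "{} \<union> S = S" "S \<union> {} = S" by auto
  have E: "nonsplit_extension (preproj Q) ?C ?E ?A"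
    using string_extension[OF a\<alpha>] unfolding unions .
  have F: "nonsplit_extension (preproj Q) ?A ?F ?C"
    using string_extension[OF a\<beta>] unfolding unions .
  have "mod_iso (preproj Q) M ?E" if "pmod M" "nonsplit_extension (preproj Q) ?C M ?A" for M :: "('b, 'k) coord_module"
    using extension_unique[OF a\<alpha> that] unfolding unions .
  moreover have "mod_iso (preproj Q) M ?F" if "pmod M" "nonsplit_extension (preproj Q) ?A M ?C" for M :: "('b, 'k) coord_module"
    using extension_unique[OF a\<beta> that] unfolding unions .
  ultimately have mid: "layer_module n Q M" if "fd_module (preproj Q) M"
      "nonsplit_extension (preproj Q) ?A M ?C \<or> nonsplit_extension (preproj Q) ?C M ?A" for M :: "('b, 'k) coord_module"
    using layer[OF that(1) \<alpha>(1)] layer[OF that(1) \<beta>(1)] that unfolding fd_module_def by blast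
  have "layer_module n Q ?A" "layer_module n Q ?C"
    by (rule layer[OF Str_fd[OF t(1)] d mod_iso_refl] layer[OF Str_fd[OF t(2)] dC mod_iso_refl])+
  then have "doubleton n Q ?A ?C"
    unfolding doubleton_def using Ext1_one_dimensional[OF a\<alpha>] Ext1_one_dimensional[OF a\<beta>] mid by blast
  moreover have "fd_module (preproj Q) ?E" "fd_module (preproj Q) ?F" by (rule Str_fd t)+
  ultimately show ?thesis unfolding doubleton_gt_def using T E F by blast
qed

text \<open>The string on \<open>{a..b}\<close> whose arrows are chosen from those of \<open>S\<close>.\<close>

definition sub_arrows :: "('b + 'b) set => nat => nat => ('b + 'b) set" where
  "sub_arrows S a b = {c \<in> S. \<exists>l\<in>{a..<b}. c = up l \<or> c = dn l}"

lemma sub_arrows_extend: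
  assumes "string_data {a'..b'} S"  and l: "a' \<le> l" "l < b'"
  shows "l < b ==> sub_arrows S l b = insert (if up l \<in> S then up l else dn l) (sub_arrows S (Suc l) b)"
    and "a \<le> l ==> sub_arrows S a (Suc l) = insert (if up l \<in> S then up l else dn l) (sub_arrows S a l)"
proof -
  have "a' \<le> b'" using l by simp
  then have "up l \<in> S \<longleftrightarrow> dn l \<notin> S" using assms unfolding string_data_def by (auto simp: atLeastatMost_subset_iff)
  then have 1: "{c \<in> S. c = up l \<or> c = dn l} = {if up l \<in> S then up l else dn l}" by auto
  show "sub_arrows S l b = insert (if up l \<in> S then up l else dn l) (sub_arrows S (Suc l) b)" if "l < b"
  proof -
    have iv: "{l..<b} = insert l {Suc l..<b}" using that by auto
    have "sub_arrows S l b = {c \<in> S. c = up l \<or> c = dn l} \<union> sub_arrows S (Suc l) b" unfolding sub_arrows_def iv by blast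
    then show ?thesis unfolding 1 by simp
  qed
  show "sub_arrows S a (Suc l) = insert (if up l \<in> S then up l else dn l) (sub_arrows S a l)" if "a \<le> l"
  proof -
    have iv: "{a..<Suc l} = insert l {a..<l}" using that by auto
    have "sub_arrows S a (Suc l) = {c \<in> S. c = up l \<or> c = dn l} \<union> sub_arrows S a l" unfolding sub_arrows_def iv by blast
    then show ?thesis unfolding 1 by simp
  qed
qed

lemma sub_arrows_string_data:
  assumes "string_data {a'..b'} S" "1 \<le> a'" "a' \<le> a" "a \<le> b" "b \<le> b'" "b' \<le> n"
  shows "string_data {a..b} (sub_arrows S a b)"
proof -
  have "\<forall>l\<in>{a'..<b'}. up l \<in> S \<longleftrightarrow> dn l \<notin> S" using assms string_data_interval[of a' b' S] by simp
  then show ?thesis using assms by (subst string_data_interval) (auto simp: sub_arrows_def)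
qed

lemma doubleton_gt_right:
  assumes d: "string_data {a..b} S" and ab: "1 \<le> a" "a \<le> b" "b < n" and T: "T = insert (up b) S \<or> T = insert (dn b) S"
  shows "doubleton_gt n Q (Str {a..b} S) (Str {a..Suc b} T :: ('b, 'k::field) coord_module)"
proof -
  have e: "insert (Suc b) {a..b} = {a..Suc b}" using ab by auto
  have b: "1 \<le> b" "b \<le> n" using ab by auto
  have "doubleton_gt n Q (Str {a..b} S) (Str (insert (Suc b) {a..b}) T :: ('b, 'k) coord_module)"
  proof (rule doubleton_gt_step[OF d _ _ string_data_add_arrow(1)[OF d ab(1,2) b(2) ab(3)] _ _ _
        string_data_add_arrow(2)[OF d ab(1,2) b(2) ab(3)]])
    fix \<gamma> assume g: "\<gamma> \<in> arcs D"
    show "tail D \<gamma> \<in> {a..b} ==> head D \<gamma> = Suc b ==> \<gamma> = up b"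
      using arrow_adjacent[OF g] arrow_between[OF g] by auto
    show "head D \<gamma> \<in> {a..b} ==> tail D \<gamma> = Suc b ==> \<gamma> = dn b"
      using arrow_adjacent[OF g] arrow_between'[OF g] by auto
  qed (use ab b T in auto)
  then show ?thesis unfolding e .
qed

lemma doubleton_gt_left:
  assumes d: "string_data {Suc a..b} S" and ab: "1 \<le> a" "a < b" "b \<le> n" and T: "T = insert (up a) S \<or> T = insert (dn a) S"
  shows "doubleton_gt n Q (Str {Suc a..b} S) (Str {a..b} T :: ('b, 'k::field) coord_module)"
proof -
  have e: "insert a {Suc a..b} = {a..b}" using ab by auto
  have a: "1 \<le> Suc a" "Suc a \<le> b" "1 < Suc a" using ab by auto
  have "doubleton_gt n Q (Str {Suc a..b} S) (Str (insert a {Suc a..b}) T :: ('b, 'k) coord_module)"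
  proof (rule doubleton_gt_step[OF d _ _ string_data_add_arrow(4)[OF d a(1,2) ab(3) a(3), unfolded diff_Suc_1] _ _ _
        string_data_add_arrow(3)[OF d a(1,2) ab(3) a(3), unfolded diff_Suc_1]])
    fix \<gamma> assume g: "\<gamma> \<in> arcs D"
    show "tail D \<gamma> \<in> {Suc a..b} ==> head D \<gamma> = a ==> \<gamma> = dn a"
      using arrow_adjacent[OF g] arrow_between'[OF g] by auto
    show "head D \<gamma> \<in> {Suc a..b} ==> tail D \<gamma> = a ==> \<gamma> = up a"
      using arrow_adjacent[OF g] arrow_between[OF g] by auto
  qed (use ab T in auto)
  then show ?thesis unfolding e .
qed

text \<open>The part of the string grows by one vertex at a time, first at its upper end, then at its lower end.\<close>

lemma doubleton_chain:
  assumes d: "string_data {a'..b'} S" and ab': "1 \<le> a'" "b' \<le> n" and ab: "a' \<le> a" "a \<le> b" "b \<le> b'"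
  shows "(doubleton_gt n Q)\<^sup>*\<^sup>* (Str {a..b} (sub_arrows S a b)) (Str {a'..b'} (sub_arrows S a' b') :: ('b, 'k::field) coord_module)"
proof -
  have right: "(doubleton_gt n Q)\<^sup>*\<^sup>* (Str {a..b} (sub_arrows S a b)) (Str {a..b'} (sub_arrows S a b') :: ('b, 'k) coord_module)"
    using ab(3)
  proof (induction b' rule: dec_induct)
    case (step m)
    have "doubleton_gt n Q (Str {a..m} (sub_arrows S a m)) (Str {a..Suc m} (sub_arrows S a (Suc m)) :: ('b, 'k) coord_module)"
      by (rule doubleton_gt_right[OF sub_arrows_string_data[OF d]])
        (use step(1,2) ab' ab sub_arrows_extend(2)[OF d, of m a] in auto)
    then show ?case using step(3) by (rule rtranclp.rtrancl_into_rtrancl[rotated])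
  qed simp
  have "(doubleton_gt n Q)\<^sup>*\<^sup>* (Str {a..b'} (sub_arrows S a b')) (Str {a'..b'} (sub_arrows S a' b') :: ('b, 'k) coord_module)"
    using ab(1)
  proof (induction a' rule: inc_induct)
    case (step m)
    have "doubleton_gt n Q (Str {Suc m..b'} (sub_arrows S (Suc m) b')) (Str {m..b'} (sub_arrows S m b') :: ('b, 'k) coord_module)"
      by (rule doubleton_gt_left[OF sub_arrows_string_data[OF d]])
        (use step(1,2) ab' ab sub_arrows_extend(1)[OF d, of m b'] in auto)
    then show ?case using step(3) by (rule rtranclp.rtrancl_into_rtrancl[rotated])
  qed simp
  with right show ?thesis by (rule rtranclp_trans)
qed

theorem doubleton_ge_iff_subfactor:
  fixes A :: "(('b, 'k::field) preproj_elt, 'x) module" and B :: "(('b, 'k) preproj_elt, 'y) module"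
  assumes A: "layer_module n Q A" and B: "layer_module n Q B"
  shows "doubleton_ge n Q A B \<longleftrightarrow> iso_to_subfactor (preproj Q) A B"
proof -
  have pA: "pmod A" and pB: "pmod B" using A B layer_module_pmod by blast+
  have fA: "fd_module (preproj Q) A" and fB: "fd_module (preproj Q) B" using A B by (auto simp: layer_module_def)
  show ?thesis unfolding iso_to_subfactor_iff[OF pB pA]
  proof
    assume "doubleton_ge n Q A B"
    then obtain A' B' :: "('b, 'k) coord_module" where fd: "fd_module (preproj Q) A'" "fd_module (preproj Q) B'"
      and iso: "mod_iso (preproj Q) A A'" "mod_iso (preproj Q) B B'" and ch: "(doubleton_gt n Q)\<^sup>*\<^sup>* A' B'"
      unfolding doubleton_ge_def by blast
    have p: "pmod A'" "pmod B'" using fd by (auto simp: fd_module_def)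
    have "subfactor (preproj Q) A' B'" using doubleton_chain_subfactor[OF ch p(1)] by simp
    moreover have "subfactor (preproj Q) A A'" by (rule subfactor_iso[OF p(1) mod_iso_sym[OF pA iso(1)]])
    moreover have "subfactor (preproj Q) B' B" by (rule subfactor_iso[OF pB iso(2)])
    ultimately show "subfactor (preproj Q) A B"
      using subfactor_trans[OF p(2,1)] subfactor_trans[OF pB p(2)] by blast
  next
    assume sub: "subfactor (preproj Q) A B"
    obtain W S where d: "string_data W S" and isoA: "mod_iso (preproj Q) A (Str W S)"
      using layer_module_iff[OF fA] A by blast
    obtain W' S' where d': "string_data W' S'" and isoB: "mod_iso (preproj Q) B (Str W' S')"
      using layer_module_iff[OF fB] B by blast
    let ?A = "Str W S :: ('b, 'k) coord_module" and ?B = "Str W' S' :: ('b, 'k) coord_module"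
    note t = string_data_thin[OF d] string_data_thin[OF d']
    have p: "pmod ?A" "pmod ?B" by (rule Str_module t)+
    have "subfactor (preproj Q) ?A A" by (rule subfactor_iso[OF pA isoA])
    moreover have "subfactor (preproj Q) B ?B" by (rule subfactor_iso[OF p(2) mod_iso_sym[OF pB isoB]])
    ultimately have "subfactor (preproj Q) ?A ?B"
      using sub subfactor_trans[OF pB pA] subfactor_trans[OF p(2) pB] by blast
    note mono = string_data_mono[OF d d' this]
    obtain a b where ab: "1 \<le> a" "a \<le> b" "b \<le> n" "W = {a..b}" using d unfolding string_data_def by blast
    obtain a' b' where ab': "1 \<le> a'" "a' \<le> b'" "b' \<le> n" "W' = {a'..b'}" using d' unfolding string_data_def by blast
    have le: "a' \<le> a" "b \<le> b'" using mono(1) ab ab' by (auto simp: atLeastatMost_subset_iff)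
    have S: "S \<subseteq> up ` {a..<b} \<union> dn ` {a..<b}" "\<And>l. l \<in> {a..<b} ==> up l \<in> S \<longleftrightarrow> dn l \<notin> S"
      using d string_data_interval[OF ab(1-3), of S] ab(4) by auto
    have S': "S' \<subseteq> up ` {a'..<b'} \<union> dn ` {a'..<b'}" "\<And>l. l \<in> {a'..<b'} ==> up l \<in> S' \<longleftrightarrow> dn l \<notin> S'"
      using d' string_data_interval[OF ab'(1-3), of S'] ab'(4) by auto
    have same: "(up l \<in> S \<longleftrightarrow> up l \<in> S') \<and> (dn l \<in> S \<longleftrightarrow> dn l \<in> S')" if l: "l \<in> {a..<b}" for l
    proof -
      have "l \<in> {a'..<b'}" using l le by auto
      then show ?thesis using mono(2)[of l] S(2)[OF l] S'(2)[of l] l by (auto simp: ab(4))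
    qed
    have "S = sub_arrows S' a b"
    proof (rule Set.set_eqI)
      fix c show "c \<in> S \<longleftrightarrow> c \<in> sub_arrows S' a b"
        using S(1) same unfolding sub_arrows_def by blast
    qed
    moreover have "S' = sub_arrows S' a' b'" using S'(1) unfolding sub_arrows_def by blast
    ultimately have "(doubleton_gt n Q)\<^sup>*\<^sup>* ?A ?B"
      using doubleton_chain[OF d'[unfolded ab'(4)] ab'(1,3) le(1) ab(2) le(2), where ?'k = 'k] by (simp add: ab(4) ab'(4))
    then show "doubleton_ge n Q A B" unfolding doubleton_ge_def using Str_fd[OF t(1)] Str_fd[OF t(2)] isoA isoB by blast
  qed
qed

end

theorem theorem5p5:
  fixes n :: nat and Q :: "(nat, 'b) pre_digraph"
  assumes "n \<ge> 1" and "A_orientation n Q"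
  shows
    "(\<forall>M :: (('b, 'k::field) preproj_elt, 'm) module. fd_module (preproj Q) M \<longrightarrow>
       (layer_module n Q M \<longleftrightarrow>
         (\<exists>N :: (('b, 'k) preproj_bar_elt, 'm) module.
            fd_module (preproj_bar Q) N \<and> indecomposable (preproj_bar Q) N \<and>
            mod_iso (preproj Q) M (inflate (preproj Q) (cyc_ideal Q) N)))) \<and>
     (\<forall>N :: (('b, 'k) preproj_bar_elt, 'l) module. fd_module (preproj_bar Q) N \<longrightarrow>
       (indecomposable (preproj_bar Q) N \<longleftrightarrow>
         (\<exists>w. nonrevisiting_walk (double_quiver Q) w \<and>
            mod_iso (preproj_bar Q) N (string_module Q w)))) \<and>
     (\<forall>(A :: (('b, 'k) preproj_elt, 'x) module) (B :: (('b, 'k) preproj_elt, 'y) module).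
       layer_module n Q A \<and> layer_module n Q B \<longrightarrow>
       (doubleton_ge n Q A B \<longleftrightarrow> iso_to_subfactor (preproj Q) A B))"
proof -
  interpret type_A n Q by unfold_locales (use assms in auto)
  show ?thesis
    using layer_iff_bar_indecomposable bar_indecomposable_iff_string_module doubleton_ge_iff_subfactor by blast
qed

end
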